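(* Assume that $\lim_{n\to+\infty}m_\Phi(\Delta^n)=0$, where for $n\ge 2$ $$m_\Phi(\Delta^n):=\int_0^T\int_0^{v_1}\cdots\int_0^{v_{n-1}}\prod_{i=2}^{n}\Phi(v_{i-1}-v_i)\,dv_n\cdots dv_1 .$$ Then, with the loss processes $L,K$, the bounded function $h:\mathbb R_+\to\mathbb R_+$, the claim variables, the shifted Hawkes processes $H^{v_n,\ldots,v_1}$ and the times $\hat\tau_i^{v_n,\ldots,v_1}$ as in the context, $$\begin{aligned} &\mathbb E[K_Th(L_T)]\\ &=\mu\int_0^Te^{-\kappa(T-v_1)}\,\mathbb E\left[g(\bar\eta_1,\bar\vartheta_1)\,\mathbb E\left[h\left(e^{-\kappa(T-v_1)}f(\bar\eta_1)+\sum_{i=1}^{H_T^{v_1}-1}e^{-\kappa(T-\hat\tau_i^{v_1})}f(\eta_i)\right)\Big|\,\bar\eta_1\right]\right]dv_1\\ &\quad+\mu\sum_{n=2}^{+\infty}\int_0^T\int_0^{v_1}\cdots\int_0^{v_{n-1}}e^{-\kappa(T-v_1)}\prod_{i=2}^n\Phi(v_{i-1}-v_i)\\ &\qquad\times\mathbb E\left[g(\bar\eta_1,\bar\vartheta_1)\,\mathbb E\left[h\left(\sum_{k=1}^ne^{-\kappa(T-v_k)}f(\bar\eta_k)+\sum_{i=1}^{H_T^{v_n,\ldots,v_1}-n}e^{-\kappa(T-\hat\tau_i^{v_n,\ldots,v_1})}f(\eta_i)\right)\Big|\,\bar\eta_1\right]\right]dv_n\cdots dv_1 . \end{aligned}$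$
   Context: Fix $T>0$, $\mu>0$, $\kappa\ge0$ and a bounded (measurable) function $\Phi:[0,T]\to\mathbb R_+$ with $\|\Phi\|_1=\int_0^T\Phi(s)ds<1$. Let $N$ be a Poisson random measure on $[0,T]\times\mathbb R_+$ with intensity $dt\otimes d\theta$, the canonical process on its configuration space $(\Omega^N,\mathcal F_T^N,\mathbb P^N)$, with natural filtration $\mathbb F^N$. $(H,\Lambda)$ is the unique $\mathbb F^N$-adapted solution of $$H_t=\int_{(0,t]}\int_{\mathbb R_+}\mathbf 1_{\{\theta\le\Lambda_s\}}N(ds,d\theta),\qquad\Lambda_t=\mu+\int_{(0,t)}\Phi(t-u)\,dH_u,\quad t\in[0,T],$$ a standard Hawkes process; $(\tau_i^H)_{i\ge1}$ are its jump times. Claims: on another probability space $(\Omega^C,\mathcal F^C,\mathbb P^C)$, let $(\eta_1,\vartheta_1)$ be an $\mathbb R_+^2$-valued random variable and let $(\eta_i,\vartheta_i)_{i\ge2}$ and $(\bar\eta_i,\bar\vartheta_i)_{i\ge1}$ be independent copies of $(\eta_1,\vartheta_1)$ (all these pairs are mutually independent). Work on the product space with $\mathbb P=\mathbb P^N\otimes\mathbb P^C$, so $N$ (hence $H$) is independent of all claim variables. Loss processes: $f:\mathbb R_+\to\mathbb R_+$, $g:\mathbb R_+^2\to\mathbb R_+$, $h:\mathbb R_+\to\mathbb R_+$ are bounded (measurable) deterministic functions and $$L_t=\sum_{i=1}^{H_t}e^{-\kappa(t-\tau_i^H)}f(\eta_i),\qquad K_t=\sum_{i=1}^{H_t}e^{-\kappa(t-\tau_i^H)}g(\eta_i,\vartheta_i),\qquad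 t\in[0,T].$$ Multi-shifted Hawkes process: for $n\ge1$ and $0<v_n<\cdots<v_1<T$, put $v_0:=T$ (and, for $i=1$, read the intervals $[v_1,v_0)$ and $(v_1,v_0]$ below as $[v_1,T]$ and $(v_1,T]$). Writing $H^{*}=H^{v_n,\ldots,v_1}$, $\Lambda^{*}=\Lambda^{v_n,\ldots,v_1}$, $$H^{*}_t=\mathbf 1_{[0,v_n)}(t)H_t+\sum_{i=1}^n\mathbf 1_{[v_i,v_{i-1})}(t)\Big(H^{*}_{v_i-}+1+\int_{(v_i,t]}\int_{\mathbb R_+}\mathbf 1_{\{\theta\le\Lambda^{*}_s\}}N(ds,d\theta)\Big),$$ $$\Lambda^{*}_t=\mathbf 1_{(0,v_n]}(t)\Lambda_t+\sum_{i=1}^n\mathbf 1_{(v_i,v_{i-1}]}(t)\Big(\mu+\int_{(0,v_i]}\Phi(t-u)\,dH^{*}_u+\int_{(v_i,t)}\Phi(t-u)\,dH^{*}_u\Big).$$ Thus $H^{v_n,\ldots,v_1}$ has deterministic unit jumps at $v_n,\ldots,v_1$. Almost surely it has exactly $H_T^{v_n,\ldots,v_1}-n$ jump times in $[0,T]$ different from $v_1,\ldots,v_n$; these are enumerated in increasing order as $\hat\tau_1^{v_n,\ldots,v_1}<\hat\tau_2^{v_n,\ldots,v_1}<\cdots$. *)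

theory Defs
  imports "HOL-Probability.Probability"
begin

section \<open>Poisson random measures and the canonical space\<close>

definition poisson_random_measure ::
  "'w measure \<Rightarrow> ('w \<Rightarrow> 'x measure) \<Rightarrow> 'x measure \<Rightarrow> bool" where
  "poisson_random_measure P N \<nu> \<longleftrightarrow>
     prob_space P \<and>
     (\<forall>\<omega>\<in>space P. sets (N \<omega>) = sets \<nu>) \<and>
     (\<forall>A\<in>sets \<nu>. (\<lambda>\<omega>. emeasure (N \<omega>) A) \<in> borel_measurable P) \<and>
     (\<forall>A\<in>sets \<nu>. emeasure \<nu> A < \<infinity> \<longrightarrow>
        (\<forall>k::nat. measure P {\<omega>\<in>space P. emeasure (N \<omega>) A = of_nat k} =
           measure \<nu> A ^ k / fact k * exp (- measure \<nu> A))) \<and>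
     (\<forall>(I::nat set) A. finite I \<and> A ` I \<subseteq> sets \<nu> \<and> disjoint_family_on A I \<longrightarrow>
        prob_space.indep_vars P (\<lambda>_. borel) (\<lambda>i \<omega>. emeasure (N \<omega>) (A i)) I)"

definition intensity :: "real \<Rightarrow> (real \<times> real) measure" where
  "intensity T = restrict_space lborel {0..T} \<Otimes>\<^sub>M restrict_space lborel {0..}"

text \<open>A configuration is a locally finite set of points \<open>(t, \<theta>)\<close>; it stands for the sum of the
  Dirac masses at its points.\<close>

definition configurations :: "real \<Rightarrow> (real \<times> real) set set" where
  "configurations T =
     {\<omega>. \<omega> \<subseteq> {0..T} \<times> {0..} \<and> (\<forall>b. finite (\<omega> \<inter> {0..T} \<times> {0..b}))}"

definition canonical_process :: "real \<Rightarrow> (real \<times> real) set \<Rightarrow> (real \<times> real) measure" where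
  "canonical_process T \<omega> = distr (count_space \<omega>) (intensity T) (\<lambda>z. z)"

definition natural_filtration :: "real \<Rightarrow> real \<Rightarrow> (real \<times> real) set measure" where
  "natural_filtration T t = sigma (configurations T)
     {{\<omega>\<in>configurations T. emeasure (canonical_process T \<omega>) A \<in> B} | A B.
        A \<in> sets (intensity T) \<and> A \<subseteq> {0..t} \<times> {0..} \<and> B \<in> sets borel}"

definition canonical_poisson_space :: "real \<Rightarrow> (real \<times> real) set measure \<Rightarrow> bool" where
  "canonical_poisson_space T P \<longleftrightarrow>
     space P = configurations T \<and> sets P = sets (natural_filtration T T) \<and>
     poisson_random_measure P (canonical_process T) (intensity T)"

definition adapted ::
  "real \<Rightarrow> 'b measure \<Rightarrow> (real \<Rightarrow> (real \<times> real) set \<Rightarrow> 'b) \<Rightarrow> bool" where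
  "adapted T B X \<longleftrightarrow> (\<forall>t\<in>{0..T}. X t \<in> measurable (natural_filtration T t) B)"


section \<open>Paths\<close>

text \<open>The Lebesgue--Stieltjes measure of a counting path on \<open>[0,T]\<close>; since \<open>interval_measure\<close>
  expects a function on the whole line, the path is extended constantly outside \<open>[0,T]\<close>.\<close>

definition path_measure :: "real \<Rightarrow> (real \<Rightarrow> nat) \<Rightarrow> real measure" where
  "path_measure T x = interval_measure (\<lambda>u. real (x (max 0 (min T u))))"

definition left_limit :: "(real \<Rightarrow> nat) \<Rightarrow> real \<Rightarrow> nat" where
  "left_limit x t = Lim (at_left t) x"

definition jumps :: "real \<Rightarrow> (real \<Rightarrow> nat) \<Rightarrow> real set" where
  "jumps T x = {t\<in>{0<..T}. left_limit x t \<noteq> x t}"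

text \<open>The \<open>i\<close>-th element (\<open>i \<ge> 1\<close>), in increasing order, of the jump times of \<open>x\<close> that are not
  in \<open>V\<close>.\<close>

definition jump_time :: "real \<Rightarrow> (real \<Rightarrow> nat) \<Rightarrow> real set \<Rightarrow> nat \<Rightarrow> real" where
  "jump_time T x V i = sorted_list_of_set (jumps T x - V) ! (i - 1)"

text \<open>The number \<open>\<integral>\<^bsub>(a,t]\<^esub> \<integral> 1(\<theta> \<le> l s) N(ds,d\<theta>)\<close> of accepted points.\<close>

definition thinned_count ::
  "real \<Rightarrow> (real \<times> real) set \<Rightarrow> (real \<Rightarrow> real) \<Rightarrow> real \<Rightarrow> real \<Rightarrow> ennreal" where
  "thinned_count T \<omega> l a t =
     (\<integral>\<^sup>+ z. indicator {(s, \<theta>). s \<in> {a<..t} \<and> \<theta> \<le> l s} z \<partial>canonical_process T \<omega>)"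


section \<open>Hawkes processes and their shifted versions\<close>

definition hawkes_equations ::
  "real \<Rightarrow> real \<Rightarrow> (real \<Rightarrow> real) \<Rightarrow> (real \<times> real) set \<Rightarrow> (real \<Rightarrow> nat) \<Rightarrow> (real \<Rightarrow> real) \<Rightarrow> bool"
where
  "hawkes_equations T \<mu> \<Phi> \<omega> x l \<longleftrightarrow> (\<forall>t\<in>{0..T}.
     of_nat (x t) = thinned_count T \<omega> l 0 t \<and>
     l t = \<mu> + (LINT u:{0<..<t}|path_measure T x. \<Phi> (t - u)))"

definition hawkes_process ::
  "real \<Rightarrow> real \<Rightarrow> (real \<Rightarrow> real) \<Rightarrow> (real \<times> real) set measure \<Rightarrow>
   (real \<Rightarrow> (real \<times> real) set \<Rightarrow> nat) \<Rightarrow> (real \<Rightarrow> (real \<times> real) set \<Rightarrow> real) \<Rightarrow> bool" where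
  "hawkes_process T \<mu> \<Phi> P H \<Lambda> \<longleftrightarrow>
     adapted T (count_space UNIV) H \<and> adapted T borel \<Lambda> \<and>
     (AE \<omega> in P. hawkes_equations T \<mu> \<Phi> \<omega> (\<lambda>t. H t \<omega>) (\<lambda>t. \<Lambda> t \<omega>))"

text \<open>Shift times \<open>0 < v\<^sub>n < \<dots> < v\<^sub>1 < T\<close> are given as the list \<open>vs = [v\<^sub>1, \<dots>, v\<^sub>n]\<close>; with
  \<open>v\<^sub>0 = T\<close>, the time \<open>v\<^sub>i\<close> is \<open>(T # vs) ! i\<close> for \<open>0 \<le> i \<le> n\<close>.\<close>

definition shift_times :: "real \<Rightarrow> real list \<Rightarrow> bool" where
  "shift_times T vs \<longleftrightarrow> vs \<noteq> [] \<and> sorted_wrt (>) vs \<and> set vs \<subseteq> {0<..<T}"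

text \<open>In the equations below \<open>(x, l)\<close> is the path of \<open>(H, \<Lambda>)\<close> and \<open>(y, m)\<close> that of the shifted
  pair. The interval \<open>[v\<^sub>1, v\<^sub>0)\<close> is read as \<open>[v\<^sub>1, T]\<close>.\<close>

definition shifted_hawkes_equations ::
  "real \<Rightarrow> real \<Rightarrow> (real \<Rightarrow> real) \<Rightarrow> real list \<Rightarrow> (real \<times> real) set \<Rightarrow>
   (real \<Rightarrow> nat) \<Rightarrow> (real \<Rightarrow> real) \<Rightarrow> (real \<Rightarrow> nat) \<Rightarrow> (real \<Rightarrow> real) \<Rightarrow> bool" where
  "shifted_hawkes_equations T \<mu> \<Phi> vs \<omega> x l y m \<longleftrightarrow>
    (let n = length vs; v = (\<lambda>i. (T # vs) ! i) in
     \<forall>t\<in>{0..T}.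
       of_nat (y t) =
         indicator {0..<v n} t * of_nat (x t) +
         (\<Sum>i=1..n. indicator (if i = 1 then {v 1..T} else {v i..<v (i - 1)}) t *
            (of_nat (left_limit y (v i)) + 1 + thinned_count T \<omega> m (v i) t)) \<and>
       m t =
         indicator {0<..v n} t * l t +
         (\<Sum>i=1..n. indicator {v i<..v (i - 1)} t *
            (\<mu> + (LINT u:{0<..v i}|path_measure T y. \<Phi> (t - u))
               + (LINT u:{v i<..<t}|path_measure T y. \<Phi> (t - u)))))"

definition shifted_hawkes_process ::
  "real \<Rightarrow> real \<Rightarrow> (real \<Rightarrow> real) \<Rightarrow> (real \<times> real) set measure \<Rightarrow>
   (real \<Rightarrow> (real \<times> real) set \<Rightarrow> nat) \<Rightarrow> (real \<Rightarrow> (real \<times> real) set \<Rightarrow> real) \<Rightarrow> real list \<Rightarrow>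
   (real \<Rightarrow> (real \<times> real) set \<Rightarrow> nat) \<Rightarrow> (real \<Rightarrow> (real \<times> real) set \<Rightarrow> real) \<Rightarrow> bool" where
  "shifted_hawkes_process T \<mu> \<Phi> P H \<Lambda> vs Hv \<Lambda>v \<longleftrightarrow>
     adapted T (count_space UNIV) Hv \<and> adapted T borel \<Lambda>v \<and>
     (AE \<omega> in P. shifted_hawkes_equations T \<mu> \<Phi> vs \<omega>
        (\<lambda>t. H t \<omega>) (\<lambda>t. \<Lambda> t \<omega>) (\<lambda>t. Hv t \<omega>) (\<lambda>t. \<Lambda>v t \<omega>))"


section \<open>Claims and losses\<close>

definition bounded_nonneg_measurable :: "'x::topological_space set \<Rightarrow> ('x \<Rightarrow> real) \<Rightarrow> bool" where
  "bounded_nonneg_measurable A f \<longleftrightarrow>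
     f \<in> borel_measurable (restrict_space borel A) \<and> bounded (f ` A) \<and> f ` A \<subseteq> {0..}"

text \<open>The pairs \<open>(\<eta> i, \<theta> i)\<close> and \<open>(\<eta>' i, \<theta>' i)\<close>, \<open>i \<ge> 1\<close>, are i.i.d. with values in the
  nonnegative quadrant; the primed variables are usually written with a bar.\<close>

definition iid_claims ::
  "'c measure \<Rightarrow> (nat \<Rightarrow> 'c \<Rightarrow> real) \<Rightarrow> (nat \<Rightarrow> 'c \<Rightarrow> real) \<Rightarrow>
   (nat \<Rightarrow> 'c \<Rightarrow> real) \<Rightarrow> (nat \<Rightarrow> 'c \<Rightarrow> real) \<Rightarrow> bool" where
  "iid_claims P \<eta> \<theta> \<eta>' \<theta>' \<longleftrightarrow>
    (let X = (\<lambda>k c. case k of Inl i \<Rightarrow> (\<eta> i c, \<theta> i c) | Inr i \<Rightarrow> (\<eta>' i c, \<theta>' i c));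
         I = {1..} <+> {1..} in
     prob_space.indep_vars P (\<lambda>_. borel) X I \<and>
     (\<forall>k\<in>I. distr P borel (X k) = distr P borel (X (Inl 1))) \<and>
     (\<forall>k\<in>I. \<forall>c\<in>space P. X k c \<in> {0..} \<times> {0..}))"

text \<open>Solutions of the Hawkes equations, hence jump times, are determined up to null sets only;
  therefore expectations are taken with respect to the completion of the product measure.\<close>

definition joint_space :: "'w measure \<Rightarrow> 'c measure \<Rightarrow> ('w \<times> 'c) measure" where
  "joint_space P Q = completion (P \<Otimes>\<^sub>M Q)"

definition loss_L ::
  "real \<Rightarrow> real \<Rightarrow> (real \<Rightarrow> real) \<Rightarrow> (real \<Rightarrow> 'w \<Rightarrow> nat) \<Rightarrow> (nat \<Rightarrow> 'c \<Rightarrow> real) \<Rightarrow>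
   real \<Rightarrow> 'w \<times> 'c \<Rightarrow> real" where
  "loss_L T \<kappa> f H \<eta> t = (\<lambda>(\<omega>, c).
     \<Sum>i=1..H t \<omega>. exp (- \<kappa> * (t - jump_time T (\<lambda>s. H s \<omega>) {} i)) * f (\<eta> i c))"

definition loss_K ::
  "real \<Rightarrow> real \<Rightarrow> (real \<times> real \<Rightarrow> real) \<Rightarrow> (real \<Rightarrow> 'w \<Rightarrow> nat) \<Rightarrow>
   (nat \<Rightarrow> 'c \<Rightarrow> real) \<Rightarrow> (nat \<Rightarrow> 'c \<Rightarrow> real) \<Rightarrow> real \<Rightarrow> 'w \<times> 'c \<Rightarrow> real" where
  "loss_K T \<kappa> g H \<eta> \<theta> t = (\<lambda>(\<omega>, c).
     \<Sum>i=1..H t \<omega>. exp (- \<kappa> * (t - jump_time T (\<lambda>s. H s \<omega>) {} i)) * g (\<eta> i c, \<theta> i c))"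

definition shifted_loss ::
  "real \<Rightarrow> real \<Rightarrow> (real \<Rightarrow> real) \<Rightarrow> (nat \<Rightarrow> 'c \<Rightarrow> real) \<Rightarrow> (nat \<Rightarrow> 'c \<Rightarrow> real) \<Rightarrow>
   real list \<Rightarrow> (real \<Rightarrow> 'w \<Rightarrow> nat) \<Rightarrow> 'w \<times> 'c \<Rightarrow> real" where
  "shifted_loss T \<kappa> f \<eta> \<eta>' vs Hv = (\<lambda>(\<omega>, c).
     (\<Sum>k=1..length vs. exp (- \<kappa> * (T - (T # vs) ! k)) * f (\<eta>' k c)) +
     (\<Sum>i=1..Hv T \<omega> - length vs.
        exp (- \<kappa> * (T - jump_time T (\<lambda>s. Hv s \<omega>) (set vs) i)) * f (\<eta> i c)))"


section \<open>Iterated integrals over the simplex\<close>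

text \<open>\<open>iterated_integral n b F\<close> is
  \<open>\<integral>\<^sub>0\<^sup>b \<integral>\<^sub>0\<^bsup>v\<^sub>1\<^esup> \<dots> \<integral>\<^sub>0\<^bsup>v\<^sub>n\<^sub>-\<^sub>1\<^esup> F [v\<^sub>1, \<dots>, v\<^sub>n] dv\<^sub>n \<dots> dv\<^sub>1\<close>.\<close>

primrec iterated_integral :: "nat \<Rightarrow> real \<Rightarrow> (real list \<Rightarrow> real) \<Rightarrow> real" where
  "iterated_integral 0 b F = F []"
| "iterated_integral (Suc n) b F = (LBINT v=0..b. iterated_integral n v (\<lambda>vs. F (v # vs)))"

definition kernel_product :: "(real \<Rightarrow> real) \<Rightarrow> real list \<Rightarrow> real" where
  "kernel_product \<Phi> vs = (\<Prod>i=2..length vs. \<Phi> (vs ! (i - 2) - vs ! (i - 1)))"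

definition m_simplex :: "real \<Rightarrow> (real \<Rightarrow> real) \<Rightarrow> nat \<Rightarrow> real" where
  "m_simplex T \<Phi> n = iterated_integral n T (kernel_product \<Phi>)"

end

theory Submission
  imports Defs
begin

text \<open>
  By Mecke's formula, the expectation of a sum over the accepted points of the Poisson measure equals
  an integral over time in which the point at time \<open>v\<close> is weighted by the intensity at \<open>v\<close> and
  the remaining points are those of the process shifted at \<open>v\<close>. Applied to \<open>K\<^sub>T h(L\<^sub>T)\<close> this yields
  \<open>\<integral> e\<^sup>-\<^sup>\<kappa>\<^sup>(\<^sup>T\<^sup>-\<^sup>v\<^sup>) E[\<Lambda>\<^sub>v g h(L\<^sup>v)] dv\<close>. The constant part \<open>\<mu>\<close> of the intensity gives the first term of the
  series; its integral part is again a sum over accepted points, to which the same formula applies, and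
  so on. As \<open>E \<Lambda>\<close> is bounded by \<open>\<mu> / (1 - \<parallel>\<Phi>\<parallel>\<^sub>1)\<close>, the remainder after \<open>n\<close> steps is of order
  \<open>\<parallel>\<Phi>\<parallel>\<^sub>1\<^sup>n\<close>. The claims are exchangeable, so the claim of the removed point may be taken to be one of
  the barred ones.
\<close>

section \<open>The Mecke formula\<close>

text \<open>Removing a point must be an operation on configurations, not on the given processes:
  \<open>Hs vs\<close> is fixed only up to a null set that depends on \<open>vs\<close>, and nothing
  makes it measurable jointly in the shift times, over which Mecke's formula and the iterated
  integrals integrate. All computations are therefore made with a version defined on every
  configuration, the set of points accepted by a least fixed point. It is jointly measurable, and
  trading an accepted point \<open>z\<close> for a shift at \<open>fst z\<close> leaves the rest of
  it unchanged as an identity of sets. The given processes are compared with it only at the end, one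
  list \<open>vs\<close> at a time, through pathwise uniqueness. The intensity is predictable: its
  value at \<open>v\<close> ignores a point or a shift at \<open>v\<close>. Hence a point does not
  affect its own acceptance, and the intensity factor at \<open>v\<close> survives the exchange and
  can be expanded again. Everything is computed in \<open>ennreal\<close>, where interchanging sums,
  limits and integrals needs no integrability; the bound on the mean intensity supplies the
  finiteness for the return to real integrals.\<close>

abbreviation strip :: "real \<Rightarrow> real \<Rightarrow> (real \<times> real) set" where
  "strip T b \<equiv> {0..T} \<times> {0..b}"

section \<open>Intensity measure, strips of bounded marks and locally finite configurations\<close>

lemma space_intensity: "space (intensity T) = {0..T} \<times> {0..}"
  by (simp add: intensity_def space_pair_measure space_restrict_space)

lemma measurable_fst_intensity [measurable]: "fst \<in> intensity T \<rightarrow>\<^sub>M borel"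
  and measurable_snd_intensity [measurable]: "snd \<in> intensity T \<rightarrow>\<^sub>M borel"
proof -
  have "fst \<in> intensity T \<rightarrow>\<^sub>M restrict_space lborel {0..T}"
    and "snd \<in> intensity T \<rightarrow>\<^sub>M restrict_space lborel {0..}"
    unfolding intensity_def by (rule measurable_fst, rule measurable_snd)
  then show "fst \<in> intensity T \<rightarrow>\<^sub>M borel" "snd \<in> intensity T \<rightarrow>\<^sub>M borel"
    by (simp_all add: measurable_restrict_space2_iff)
qed

lemma measurable_id_intensity: "(\<lambda>z. z) \<in> intensity T \<rightarrow>\<^sub>M (borel :: (real \<times> real) measure)"
proof -
  have "(\<lambda>z. (fst z, snd z)) \<in> intensity T \<rightarrow>\<^sub>M borel \<Otimes>\<^sub>M borel" by measurable
  then show ?thesis by (simp add: borel_prod)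
qed

lemma sets_intensityI: "A \<in> sets borel \<Longrightarrow> A \<subseteq> {0..T} \<times> {0..} \<Longrightarrow> A \<in> sets (intensity T)"
  using measurable_sets[OF measurable_id_intensity, of A T]
  by (simp add: space_intensity Int_absorb2)

lemma strip_sets [measurable]: "strip T b \<in> sets (intensity T)"
  by (intro sets_intensityI borel_Times) auto

lemma sigma_finite_intensity: "sigma_finite_measure (intensity T)"
  and nn_integral_intensity:
    "F \<in> borel_measurable (intensity T) \<Longrightarrow>
     (\<integral>\<^sup>+z. F z \<partial>intensity T) = (\<integral>\<^sup>+s\<in>{0..T}. (\<integral>\<^sup>+\<theta>\<in>{0..}. F (s, \<theta>) \<partial>lborel) \<partial>lborel)"
proof -
  interpret a: sigma_finite_measure "restrict_space lborel {0..T}"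
    by (rule sigma_finite_measure_restrict_space) (auto intro: lborel.sigma_finite_measure_axioms)
  interpret b: sigma_finite_measure "restrict_space lborel {0::real..}"
    by (rule sigma_finite_measure_restrict_space) (auto intro: lborel.sigma_finite_measure_axioms)
  interpret p: pair_sigma_finite "restrict_space lborel {0..T}" "restrict_space lborel {0::real..}" ..
  show "sigma_finite_measure (intensity T)"
    unfolding intensity_def by (rule p.sigma_finite_measure_axioms)
  assume F: "F \<in> borel_measurable (intensity T)"
  show "(\<integral>\<^sup>+z. F z \<partial>intensity T) = (\<integral>\<^sup>+s\<in>{0..T}. (\<integral>\<^sup>+\<theta>\<in>{0..}. F (s, \<theta>) \<partial>lborel) \<partial>lborel)"
    unfolding intensity_def
    by (subst b.nn_integral_fst[symmetric])
       (use F in \<open>auto simp: intensity_def nn_integral_restrict_space\<close>)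
qed

lemma emeasure_strip_finite: "emeasure (intensity T) (strip T b) < \<infinity>"
proof -
  interpret b: sigma_finite_measure "restrict_space lborel {0::real..}"
    by (rule sigma_finite_measure_restrict_space) (auto intro: lborel.sigma_finite_measure_axioms)
  have "emeasure (intensity T) (strip T b) =
      emeasure (restrict_space lborel {0..T}) {0..T} * emeasure (restrict_space lborel {0..}) {0..b}"
    unfolding intensity_def
    by (rule b.emeasure_pair_measure_Times) (auto simp: sets_restrict_space_iff)
  then show ?thesis
    by (auto simp: emeasure_restrict_space emeasure_lborel_Icc_eq ennreal_mult_less_top)
qed

lemma finite_strip: "\<omega> \<in> configurations T \<Longrightarrow> finite (\<omega> \<inter> strip T b)"
  by (simp add: configurations_def)

lemma configurations_subset: "\<omega> \<in> configurations T \<Longrightarrow> \<omega> \<subseteq> {0..T} \<times> {0..}"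
  by (simp add: configurations_def)

lemma configurations_remove: "\<omega> \<in> configurations T \<Longrightarrow> \<omega> - A \<in> configurations T"
  unfolding configurations_def by (blast intro: finite_subset[rotated])

lemma UN_strip: "(\<Union>n::nat. strip T (real n)) = {0..T} \<times> {0..}"
  by (auto intro: real_arch_simple)

lemma configurations_countable:
  assumes "\<omega> \<in> configurations T" shows "countable \<omega>"
proof -
  have "\<omega> = (\<Union>n::nat. \<omega> \<inter> strip T (real n))"
    using configurations_subset[OF assms]
    by (simp only: Int_UN_distrib[symmetric] UN_strip) (simp add: Int_absorb2)
  moreover have "countable (\<Union>n::nat. \<omega> \<inter> strip T (real n))"
    using finite_strip[OF assms] by (intro countable_UN) (auto intro: countable_finite)
  ultimately show ?thesis by simp
qed

lemma measurable_canonical_id: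
  "\<omega> \<in> configurations T \<Longrightarrow> (\<lambda>z. z) \<in> count_space \<omega> \<rightarrow>\<^sub>M intensity T"
  unfolding measurable_count_space_eq1 space_intensity using configurations_subset by blast

lemma sets_canonical_process [simp]: "sets (canonical_process T \<omega>) = sets (intensity T)"
  and space_canonical_process [simp]: "space (canonical_process T \<omega>) = space (intensity T)"
  by (simp_all add: canonical_process_def)

lemma measurable_canonical_process [simp]:
  "measurable (canonical_process T \<omega>) M = measurable (intensity T) M"
  by (rule measurable_cong_sets) simp_all

lemma emeasure_canonical_process:
  "\<omega> \<in> configurations T \<Longrightarrow> A \<in> sets (intensity T) \<Longrightarrow>
    emeasure (canonical_process T \<omega>) A = emeasure (count_space \<omega>) (A \<inter> \<omega>)"
  unfolding canonical_process_def
  by (subst emeasure_distr[OF measurable_canonical_id]) auto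

text \<open>Over \<open>count_space \<omega>\<close> every integrand is measurable, so sums over the
  points can be cut, reindexed and split freely. Measurability on \<open>intensity T\<close> is
  called for only at the passage to the canonical process.\<close>

lemma nn_integral_canonical_process:
  "\<omega> \<in> configurations T \<Longrightarrow> F \<in> borel_measurable (intensity T) \<Longrightarrow>
    (\<integral>\<^sup>+z. F z \<partial>canonical_process T \<omega>) = (\<integral>\<^sup>+z. F z \<partial>count_space \<omega>)"
  unfolding canonical_process_def
  by (subst nn_integral_distr[OF measurable_canonical_id]) auto

lemma emeasure_canonical_strip:
  assumes "\<omega> \<in> configurations T" "A \<in> sets (intensity T)" "A \<subseteq> strip T b"
  shows "emeasure (canonical_process T \<omega>) A = of_nat (card (A \<inter> \<omega>))" "finite (A \<inter> \<omega>)"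
proof -
  show *: "finite (A \<inter> \<omega>)"
    by (rule finite_subset[OF _ finite_strip[OF assms(1), of b]]) (use assms(3) in auto)
  then show "emeasure (canonical_process T \<omega>) A = of_nat (card (A \<inter> \<omega>))"
    by (simp add: emeasure_canonical_process[OF assms(1,2)])
qed

lemma nn_integral_count_space_indicator_canonical:
  assumes "\<omega> \<in> configurations T" "A \<in> sets (intensity T)"
  shows "(\<integral>\<^sup>+z. indicator A z \<partial>count_space \<omega>) = emeasure (canonical_process T \<omega>) A"
  using assms(2) by (subst nn_integral_canonical_process[OF assms(1), symmetric]) simp_all

lemma nn_integral_remove_point:
  assumes "z \<in> \<omega>"
  shows "(\<integral>\<^sup>+x. F x \<partial>count_space \<omega>) = F z + (\<integral>\<^sup>+x. F x \<partial>count_space (\<omega> - {z}))"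
proof -
  have "(\<integral>\<^sup>+x. F x \<partial>count_space \<omega>) =
      (\<integral>\<^sup>+x. F x * indicator {z} x + F x * indicator (\<omega> - {z}) x \<partial>count_space \<omega>)"
    by (intro nn_integral_cong) (auto split: split_indicator)
  also have "\<dots> = (\<integral>\<^sup>+x. F x * indicator {z} x \<partial>count_space \<omega>)
      + (\<integral>\<^sup>+x. F x * indicator (\<omega> - {z}) x \<partial>count_space \<omega>)"
    by (rule nn_integral_add) auto
  also have "(\<integral>\<^sup>+x. F x * indicator {z} x \<partial>count_space \<omega>) = F z"
    using assms by (subst nn_integral_count_space'[where A = "{z}"]) auto
  also have "(\<integral>\<^sup>+x. F x * indicator (\<omega> - {z}) x \<partial>count_space \<omega>) = (\<integral>\<^sup>+x. F x \<partial>count_space (\<omega> - {z}))"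
    by (simp add: nn_integral_count_space_indicator mult.assoc indicator_inter_arith[symmetric]
        Int_absorb2)
  finally show ?thesis .
qed

text \<open>A configuration is exhausted by its finite parts with marks at most \<open>n\<close>.
  Point counts and the intensity are both finite on a strip, so arguments that need finiteness are
  made there and extended by monotone convergence.\<close>

lemma nn_integral_SUP_strip:
  assumes "\<omega> \<in> configurations T"
  shows "(\<integral>\<^sup>+z. F z \<partial>count_space \<omega>) =
    (SUP n::nat. \<integral>\<^sup>+z. F z * indicator (strip T (real n)) z \<partial>count_space \<omega>)"
proof -
  have "(\<integral>\<^sup>+z. F z \<partial>count_space \<omega>) =
      (\<integral>\<^sup>+z. (SUP n::nat. F z * indicator (strip T (real n)) z) \<partial>count_space \<omega>)"
  proof (rule nn_integral_cong)
    fix z assume "z \<in> space (count_space \<omega>)"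
    then have "z \<in> {0..T} \<times> {0..}" using configurations_subset[OF assms] by auto
    then obtain n :: nat where "z \<in> strip T (real n)" using UN_strip[of T] by blast
    then have "F z \<le> (SUP n::nat. F z * indicator (strip T (real n)) z)"
      by (intro SUP_upper2[of n]) auto
    moreover have "(SUP n::nat. F z * indicator (strip T (real n)) z) \<le> F z"
      by (intro SUP_least) (auto split: split_indicator)
    ultimately show "F z = (SUP n::nat. F z * indicator (strip T (real n)) z)" by (rule antisym)
  qed
  also have "\<dots> = (SUP n::nat. \<integral>\<^sup>+z. F z * indicator (strip T (real n)) z \<partial>count_space \<omega>)"
  proof (rule nn_integral_monotone_convergence_SUP)
    show "incseq (\<lambda>n z. F z * indicator (strip T (real n)) z)"
      by (auto simp: incseq_def le_fun_def split: split_indicator)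
  qed auto
  finally show ?thesis .
qed

section \<open>Measurable structure of the configuration space\<close>

locale canonical_poisson =
  fixes T :: real and P :: "(real \<times> real) set measure"
  assumes T_pos: "T > 0" and canonical: "canonical_poisson_space T P"
begin

abbreviation N :: "(real \<times> real) set \<Rightarrow> (real \<times> real) set \<Rightarrow> ennreal" where
  "N \<omega> A \<equiv> emeasure (canonical_process T \<omega>) A"

lemma prm: "poisson_random_measure P (canonical_process T) (intensity T)"
  using canonical by (simp add: canonical_poisson_space_def)

sublocale prob_space P
  using prm by (simp add: poisson_random_measure_def)

lemma space_P [simp]: "space P = configurations T"
  using canonical by (simp add: canonical_poisson_space_def)

definition gens :: "(real \<times> real) set set set" where
  "gens = {{\<omega>\<in>configurations T. N \<omega> A \<in> B} | A B. A \<in> sets (intensity T) \<and> B \<in> sets borel}"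

lemma sets_P: "sets P = sigma_sets (configurations T) gens"
proof -
  have "sets P = sets (natural_filtration T T)"
    using canonical by (simp add: canonical_poisson_space_def)
  also have "{{\<omega>\<in>configurations T. N \<omega> A \<in> B} | A B.
        A \<in> sets (intensity T) \<and> A \<subseteq> {0..T} \<times> {0..} \<and> B \<in> sets borel} = gens"
  proof -
    have "A \<subseteq> {0..T} \<times> {0..}" if "A \<in> sets (intensity T)" for A
      using sets.sets_into_space[OF that] by (simp add: space_intensity)
    then show ?thesis unfolding gens_def by blast
  qed
  then have "sets (natural_filtration T T) = sigma_sets (configurations T) gens"
    unfolding natural_filtration_def
    by (subst sets_measure_of) (auto simp: gens_def)
  finally show ?thesis .
qed

lemma measurable_N [measurable]: "A \<in> sets (intensity T) \<Longrightarrow> (\<lambda>\<omega>. N \<omega> A) \<in> borel_measurable P"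
  using prm by (simp add: poisson_random_measure_def)

lemma measurable_into_P:
  assumes "f \<in> space W \<rightarrow> configurations T"
    and "\<And>A. A \<in> sets (intensity T) \<Longrightarrow> (\<lambda>w. N (f w) A) \<in> borel_measurable W"
  shows "f \<in> W \<rightarrow>\<^sub>M P"
proof (rule measurable_sigma_sets[OF sets_P])
  show "gens \<subseteq> Pow (configurations T)" by (auto simp: gens_def)
  show "f \<in> space W \<rightarrow> configurations T" by fact
  fix y assume "y \<in> gens"
  then obtain A B where y: "y = {\<omega>\<in>configurations T. N \<omega> A \<in> B}"
    and A: "A \<in> sets (intensity T)" and B: "B \<in> sets borel"
    by (auto simp: gens_def)
  have "f -` y \<inter> space W = (\<lambda>w. N (f w) A) -` B \<inter> space W"
    unfolding y using assms(1) by blast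
  also have "\<dots> \<in> sets W"
    by (rule measurable_sets[OF assms(2)[OF A] B])
  finally show "f -` y \<inter> space W \<in> sets W" .
qed

text \<open>On a strip the configuration is a counting measure of finite but unbounded mass.
  Dividing by one plus its number of points makes it a subprobability kernel in \<open>w\<close>,
  for which integrals of parameter-dependent integrands are measurable. Multiplying back and
  exhausting by strips gives the full sum.\<close>

lemma measurable_campbell:
  assumes f [measurable]: "f \<in> W \<rightarrow>\<^sub>M P"
    and F [measurable]: "(\<lambda>(w, z). F w z) \<in> borel_measurable (W \<Otimes>\<^sub>M intensity T)"
  shows "(\<lambda>w. \<integral>\<^sup>+z. F w z \<partial>count_space (f w)) \<in> borel_measurable W"
proof -
  have fw: "f w \<in> configurations T" if "w \<in> space W" for w
    using measurable_space[OF f that] by simp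
  have fin: "N (f w) (strip T b) < \<top>" if "w \<in> space W" for w b
    using emeasure_canonical_strip(1)[OF fw[OF that] strip_sets order_refl] by (simp add: of_nat_less_top)
  define L where "L b w = scale_measure (1 / (1 + N (f w) (strip T b)))
      (density (canonical_process T (f w)) (indicator (strip T b)))" for b w
  have emL: "emeasure (L b w) A = 1 / (1 + N (f w) (strip T b)) * N (f w) (A \<inter> strip T b)"
    if "A \<in> sets (intensity T)" for b w A
  proof -
    have "emeasure (density (canonical_process T (f w)) (indicator (strip T b))) A
        = (\<integral>\<^sup>+z. indicator (strip T b) z * indicator A z \<partial>canonical_process T (f w))"
      using that by (subst emeasure_density) auto
    also have "\<dots> = (\<integral>\<^sup>+z. indicator (A \<inter> strip T b) z \<partial>canonical_process T (f w))"
      by (intro nn_integral_cong) (auto split: split_indicator)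
    also have "\<dots> = N (f w) (A \<inter> strip T b)"
      using that by (subst nn_integral_indicator) auto
    finally show ?thesis by (simp add: L_def)
  qed
  have meas_L: "L b \<in> W \<rightarrow>\<^sub>M subprob_algebra (intensity T)" for b
  proof (rule measurable_subprob_algebra)
    fix w assume w: "w \<in> space W"
    show "sets (L b w) = sets (intensity T)" by (simp add: L_def)
    then have sp: "space (L b w) = space (intensity T)" by (rule sets_eq_imp_space_eq)
    have "N (f w) (space (intensity T) \<inter> strip T b) = N (f w) (strip T b)"
      using sets.sets_into_space[OF strip_sets[of T b]] by (simp add: Int_absorb1)
    then have "emeasure (L b w) (space (L b w)) =
        1 / (1 + N (f w) (strip T b)) * N (f w) (strip T b)"
      unfolding sp by (subst emL) auto
    also have "\<dots> \<le> 1"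
    proof -
      have "1 / (1 + x) * x \<le> 1" if "x < \<top>" for x :: ennreal
      proof -
        have "1 / (1 + x) * x = x / (1 + x)" by (simp add: ennreal_times_divide mult.commute)
        also have "\<dots> \<le> (1 + x) / (1 + x)" by (intro divide_right_mono_ennreal) simp
        also have "\<dots> \<le> 1" using that by (intro divide_le_posI_ennreal) (auto simp: add_pos_nonneg)
        finally show ?thesis .
      qed
      from this[OF fin[OF w]] show ?thesis .
    qed
    finally have le: "emeasure (L b w) (space (L b w)) \<le> 1" .
    show "subprob_space (L b w)"
    proof
      show "emeasure (L b w) (space (L b w)) \<le> 1" by fact
      show "space (L b w) \<noteq> {}" using T_pos by (simp add: sp space_intensity)
    qed
  next
    fix A assume [measurable]: "A \<in> sets (intensity T)"
    have [measurable]: "(\<lambda>w. N (f w) A) \<in> borel_measurable W" if "A \<in> sets (intensity T)" for A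
      using measurable_compose[OF f measurable_N[OF that]] .
    show "(\<lambda>w. emeasure (L b w) A) \<in> borel_measurable W"
      by (subst emL) measurable
  qed
  have conv: "(\<integral>\<^sup>+z. F w z * indicator (strip T b) z \<partial>count_space (f w)) =
      (1 + N (f w) (strip T b)) * (\<integral>\<^sup>+z. F w z \<partial>L b w)" if w: "w \<in> space W" for b w
  proof -
    have Fw [measurable]: "F w \<in> borel_measurable (intensity T)"
      using measurable_Pair2[OF F w] by simp
    have "(\<integral>\<^sup>+z. F w z \<partial>L b w) = 1 / (1 + N (f w) (strip T b)) *
        (\<integral>\<^sup>+z. indicator (strip T b) z * F w z \<partial>canonical_process T (f w))"
      unfolding L_def
      by (subst nn_integral_scale_measure) (simp_all add: nn_integral_density)
    moreover have "(1 + x) * (1 / (1 + x)) = 1" if "x < \<top>" for x :: ennreal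
      using that by (subst ennreal_times_divide) (auto intro!: ennreal_divide_self simp: add_pos_nonneg)
    ultimately have "(1 + N (f w) (strip T b)) * (\<integral>\<^sup>+z. F w z \<partial>L b w) =
        (\<integral>\<^sup>+z. indicator (strip T b) z * F w z \<partial>canonical_process T (f w))"
      using fin[OF w] by (simp add: mult.assoc[symmetric])
    then show ?thesis
      by (subst nn_integral_canonical_process[OF fw[OF w], symmetric]) (auto simp: mult.commute)
  qed
  have [measurable]: "(\<lambda>w. N (f w) (strip T b)) \<in> borel_measurable W" for b
    using measurable_compose[OF f measurable_N[OF strip_sets]] .
  have meas_b: "(\<lambda>w. \<integral>\<^sup>+z. F w z * indicator (strip T b) z \<partial>count_space (f w)) \<in> borel_measurable W" for b
  proof -
    have [measurable]: "(\<lambda>w. \<integral>\<^sup>+z. F w z \<partial>L b w) \<in> borel_measurable W"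
      by (rule nn_integral_measurable_subprob_algebra2[OF F meas_L])
    have "(\<lambda>w. (1 + N (f w) (strip T b)) * (\<integral>\<^sup>+z. F w z \<partial>L b w)) \<in> borel_measurable W"
      by measurable
    then show ?thesis by (subst measurable_cong[OF conv])
  qed
  have "(\<lambda>w. SUP n. \<integral>\<^sup>+z. F w z * indicator (strip T (real n)) z \<partial>count_space (f w)) \<in> borel_measurable W"
    by (intro borel_measurable_SUP meas_b) auto
  then show ?thesis
    by (subst measurable_cong[OF nn_integral_SUP_strip[OF fw]])
qed

text \<open>A moving point lies in a moving configuration exactly when the indicator of the diagonal
  has a nonzero sum over that configuration, and such sums are measurable.\<close>

lemma measurable_mem_configuration [measurable (raw)]:
  assumes f: "f \<in> W \<rightarrow>\<^sub>M P" and g: "g \<in> W \<rightarrow>\<^sub>M borel"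
  shows "Measurable.pred W (\<lambda>w. g w \<in> f w)"
proof -
  have "(\<lambda>x. (g (fst x), snd x)) \<in> W \<Otimes>\<^sub>M intensity T \<rightarrow>\<^sub>M borel \<Otimes>\<^sub>M borel"
    using g measurable_id_intensity by measurable
  then have "(\<lambda>x. g (fst x) = snd x) \<in> measurable (W \<Otimes>\<^sub>M intensity T) (count_space UNIV)"
    by measurable
  then have "(\<lambda>x. if g (fst x) = snd x then 1 else 0 :: ennreal) \<in> borel_measurable (W \<Otimes>\<^sub>M intensity T)"
    by measurable
  moreover have "(\<lambda>x. if g (fst x) = snd x then 1 else 0 :: ennreal) = (\<lambda>(w, z). indicator {g w} z)"
    by (auto simp: fun_eq_iff)
  ultimately have [measurable]: "(\<lambda>(w, z). indicator {g w} z :: ennreal) \<in> borel_measurable (W \<Otimes>\<^sub>M intensity T)"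
    by simp
  have *: "(\<lambda>w. \<integral>\<^sup>+z. indicator {g w} z \<partial>count_space (f w)) \<in> borel_measurable W"
    by (rule measurable_campbell[OF f]) measurable
  have "g w \<in> f w \<longleftrightarrow> (\<integral>\<^sup>+z. indicator {g w} z \<partial>count_space (f w)) \<noteq> 0" for w
    by (cases "g w \<in> f w") (auto simp: nn_integral_0_iff_AE AE_count_space split: split_indicator)
  with * show ?thesis by simp
qed

text \<open>Measurability into \<open>P\<close> is tested on counts, and a count after the removal
  is a sum over the original configuration in which the removed point is given the value
  zero.\<close>

lemma measurable_remove_point:
  assumes f: "f \<in> W \<rightarrow>\<^sub>M P" and g: "g \<in> W \<rightarrow>\<^sub>M borel"
  shows "(\<lambda>w. f w - {g w}) \<in> W \<rightarrow>\<^sub>M P"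
proof (rule measurable_into_P)
  have fw: "f w \<in> configurations T" if "w \<in> space W" for w
    using measurable_space[OF f that] by simp
  show "(\<lambda>w. f w - {g w}) \<in> space W \<rightarrow> configurations T"
    using fw configurations_remove by blast
  fix A assume A: "A \<in> sets (intensity T)"
  have m: "(\<lambda>x. g (fst x) \<noteq> snd x) \<in> measurable (W \<Otimes>\<^sub>M intensity T) (count_space UNIV)"
  proof -
    have "(\<lambda>x. (g (fst x), snd x)) \<in> W \<Otimes>\<^sub>M intensity T \<rightarrow>\<^sub>M borel \<Otimes>\<^sub>M borel"
      using g measurable_id_intensity by measurable
    then show ?thesis by measurable
  qed
  have "(\<lambda>x. indicator A (snd x) * (if g (fst x) \<noteq> snd x then 1 else 0 :: ennreal))
      \<in> borel_measurable (W \<Otimes>\<^sub>M intensity T)"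
    using m A by measurable
  then have *: "(\<lambda>w. \<integral>\<^sup>+z. indicator A z * (if g w \<noteq> z then 1 else 0) \<partial>count_space (f w)) \<in> borel_measurable W"
    by (intro measurable_campbell[OF f]) (simp add: case_prod_beta)
  have "N (f w - {g w}) A = (\<integral>\<^sup>+z. indicator A z * (if g w \<noteq> z then 1 else 0) \<partial>count_space (f w))"
    if "w \<in> space W" for w
  proof -
    have "N (f w - {g w}) A = (\<integral>\<^sup>+z. indicator A z \<partial>count_space (f w - {g w}))"
      by (rule nn_integral_count_space_indicator_canonical[symmetric, OF configurations_remove[OF fw[OF that]] A])
    also have "\<dots> = (\<integral>\<^sup>+z. indicator A z * (if g w \<noteq> z then 1 else 0) \<partial>count_space (f w - {g w}))"
      by (rule nn_integral_cong) auto
    also have "\<dots> = (\<integral>\<^sup>+z. indicator A z * (if g w \<noteq> z then 1 else 0) \<partial>count_space (f w))"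
      by (rule nn_integral_count_space_eq) auto
    finally show ?thesis .
  qed
  then show "(\<lambda>w. N (f w - {g w}) A) \<in> borel_measurable W"
    using * by (subst measurable_cong) auto
qed

lemma measurable_removal [measurable]:
  "(\<lambda>(\<omega>, z). \<omega> - {z}) \<in> P \<Otimes>\<^sub>M intensity T \<rightarrow>\<^sub>M P"
proof -
  have "(\<lambda>x. fst x - {snd x}) \<in> P \<Otimes>\<^sub>M intensity T \<rightarrow>\<^sub>M P"
    by (rule measurable_remove_point[OF measurable_fst measurable_compose[OF measurable_snd measurable_id_intensity]])
  then show ?thesis by (simp add: case_prod_beta)
qed

section \<open>Mecke's identity for counts in disjoint cells\<close>

lemma nn_integral_N:
  assumes A: "A \<in> sets (intensity T)" "A \<subseteq> strip T b" and u: "u \<in> borel_measurable borel"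
  shows "(\<integral>\<^sup>+\<omega>. N \<omega> A * u (N \<omega> A - 1) \<partial>P) = emeasure (intensity T) A * (\<integral>\<^sup>+\<omega>. u (N \<omega> A) \<partial>P)"
proof -
  note u[measurable] A(1)[measurable]
  let ?c = "measure (intensity T) A"
  have fin: "emeasure (intensity T) A < \<infinity>"
    using emeasure_mono[OF A(2) strip_sets] emeasure_strip_finite[of T b] by (rule le_less_trans)
  have c: "emeasure (intensity T) A = ennreal ?c"
    using fin by (simp add: emeasure_eq_ennreal_measure less_top)
  define p where "p k = emeasure P {\<omega>\<in>space P. N \<omega> A = of_nat k}" for k
  have p: "p k = ennreal (?c ^ k / fact k * exp (- ?c))" for k
    using prm A(1) fin unfolding p_def
    by (simp add: poisson_random_measure_def emeasure_eq_measure)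
  have [measurable]: "{\<omega>\<in>configurations T. N \<omega> A = of_nat k} \<in> sets P" for k
  proof -
    have "{\<omega>\<in>space P. N \<omega> A = of_nat k} \<in> sets P" by measurable
    then show ?thesis by simp
  qed
  have expand: "(\<integral>\<^sup>+\<omega>. v (N \<omega> A) \<partial>P) = (\<Sum>k. v (of_nat k) * p k)" if [measurable]: "v \<in> borel_measurable borel" for v
  proof -
    have "(\<integral>\<^sup>+\<omega>. v (N \<omega> A) \<partial>P) =
        (\<integral>\<^sup>+\<omega>. (\<Sum>k. v (of_nat k) * indicator {\<omega>\<in>space P. N \<omega> A = of_nat k} \<omega>) \<partial>P)"
    proof (rule nn_integral_cong)
      fix \<omega> assume "\<omega> \<in> space P"
      define j where "j = card (A \<inter> \<omega>)"
      have j: "N \<omega> A = of_nat j"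
        unfolding j_def
        by (rule emeasure_canonical_strip(1)[OF _ A(1) A(2)]) (use \<open>\<omega> \<in> space P\<close> in simp)
      have "(\<Sum>k. v (of_nat k) * indicator {\<omega>\<in>space P. N \<omega> A = of_nat k} \<omega>) =
          (\<Sum>k\<in>{j}. v (of_nat k) * indicator {\<omega>\<in>space P. N \<omega> A = of_nat k} \<omega>)"
        by (rule suminf_finite) (auto simp: j)
      also have "\<dots> = v (of_nat j) * indicator {\<omega>\<in>space P. N \<omega> A = of_nat j} \<omega>"
        by (subst sum.insert[OF finite.emptyI]) (simp_all only: empty_iff not_False_eq_True sum.empty add_0_right)
      also have "\<dots> = v (N \<omega> A)"
        using \<open>\<omega> \<in> space P\<close> j by (simp only: indicator_simps mem_Collect_eq simp_thms mult_1_right)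
      finally show "v (N \<omega> A) = (\<Sum>k. v (of_nat k) * indicator {\<omega>\<in>space P. N \<omega> A = of_nat k} \<omega>)"
        by (rule sym)
    qed
    also have "\<dots> = (\<Sum>k. \<integral>\<^sup>+\<omega>. v (of_nat k) * indicator {\<omega>\<in>space P. N \<omega> A = of_nat k} \<omega> \<partial>P)"
      by (rule nn_integral_suminf) measurable
    also have "\<dots> = (\<Sum>k. v (of_nat k) * p k)"
      by (intro suminf_cong) (simp add: nn_integral_cmult_indicator p_def)
    finally show ?thesis .
  qed
  have "(\<integral>\<^sup>+\<omega>. N \<omega> A * u (N \<omega> A - 1) \<partial>P) = (\<Sum>k. of_nat k * u (of_nat k - 1) * p k)"
    by (rule expand) measurable
  \<comment> \<open>The term with \<open>k = 0\<close> carries the factor zero, so the truncated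
    value of \<open>0 - 1\<close> has no effect, and the index can be shifted by one.\<close>
  also have "\<dots> = (\<Sum>k. of_nat (k + 1) * u (of_nat (k + 1) - 1) * p (k + 1))
      + (\<Sum>k<1. of_nat k * u (of_nat k - 1) * p k)"
    by (rule suminf_offset) (rule summableI)
  also have "\<dots> = (\<Sum>k. ennreal ?c * (u (of_nat k) * p k))"
  proof -
    \<comment> \<open>The recursion of the Poisson weights: the factor \<open>k + 1\<close> is
      traded for the mean \<open>?c\<close>, and the weight moves from \<open>k + 1\<close> to
      \<open>k\<close>.\<close>
    have "of_nat (Suc k) * p (Suc k) = ennreal ?c * p k" for k
    proof -
      have "of_nat (Suc k) * p (Suc k) = ennreal (real (Suc k) * (?c ^ Suc k / fact (Suc k) * exp (- ?c)))"
        unfolding p ennreal_of_nat_eq_real_of_nat by (rule ennreal_mult[symmetric]) auto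
      also have "real (Suc k) * (?c ^ Suc k / fact (Suc k) * exp (- ?c)) = ?c * (?c ^ k / fact k * exp (- ?c))"
        by (simp add: divide_simps)
      also have "ennreal \<dots> = ennreal ?c * p k"
        unfolding p by (rule ennreal_mult) auto
      finally show ?thesis .
    qed
    then have "of_nat (Suc k) * u (of_nat k) * p (Suc k) = ennreal ?c * (u (of_nat k) * p k)" for k
      by (metis (no_types) mult.assoc mult.commute)
    moreover have "of_nat (Suc k) - 1 = (of_nat k :: ennreal)" for k
      by (simp add: ennreal_of_nat_eq_real_of_nat ennreal_minus[symmetric] flip: ennreal_1)
    ultimately show ?thesis by simp
  qed
  also have "\<dots> = emeasure (intensity T) A * (\<integral>\<^sup>+\<omega>. u (N \<omega> A) \<partial>P)"
    unfolding c expand[OF u] by (rule ennreal_suminf_cmult)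
  finally show ?thesis .
qed

lemma indep_N:
  "finite (I :: nat set) \<Longrightarrow> (\<And>i. i \<in> I \<Longrightarrow> C i \<in> sets (intensity T)) \<Longrightarrow> disjoint_family_on C I \<Longrightarrow>
    indep_vars (\<lambda>_. borel) (\<lambda>i \<omega>. N \<omega> (C i)) I"
proof -
  assume I: "finite I" and C: "\<And>i. i \<in> I \<Longrightarrow> C i \<in> sets (intensity T)" and d: "disjoint_family_on C I"
  have "\<forall>(I::nat set) A. finite I \<and> A ` I \<subseteq> sets (intensity T) \<and> disjoint_family_on A I \<longrightarrow>
        indep_vars (\<lambda>_. borel) (\<lambda>i \<omega>. N \<omega> (A i)) I"
    using prm unfolding poisson_random_measure_def by (elim conjE)
  from this[rule_format, of I C] show ?thesis using I C d by auto
qed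

text \<open>By independence this reduces to \<open>E (X u (X - 1)) = c E (u X)\<close> for a Poisson variable \<open>X\<close> with mean \<open>c\<close>.\<close>

lemma nn_integral_N_disjoint:
  assumes I: "finite (I :: nat set)" "j \<in> I" and C: "\<And>i. i \<in> I \<Longrightarrow> C i \<in> sets (intensity T)"
    and disj: "disjoint_family_on C I" and Cj: "C j \<subseteq> strip T b"
    and \<psi>[measurable]: "\<psi> \<in> borel_measurable (\<Pi>\<^sub>M i\<in>I. (borel :: ennreal measure))"
  shows "(\<integral>\<^sup>+\<omega>. N \<omega> (C j) * \<psi> ((\<lambda>i\<in>I. N \<omega> (C i))(j := N \<omega> (C j) - 1)) \<partial>P) =
    emeasure (intensity T) (C j) * (\<integral>\<^sup>+\<omega>. \<psi> (\<lambda>i\<in>I. N \<omega> (C i)) \<partial>P)"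
proof -
  define X where "X \<omega> = (\<lambda>i\<in>I. N \<omega> (C i))" for \<omega>
  define \<rho> where "\<rho> i = distr P (borel :: ennreal measure) (\<lambda>\<omega>. N \<omega> (C i))" for i
  define J where "J = I - {j}"
  have IJ: "I = insert j J" "finite J" "j \<notin> J" using I by (auto simp: J_def)
  have mN [measurable]: "i \<in> I \<Longrightarrow> (\<lambda>\<omega>. N \<omega> (C i)) \<in> borel_measurable P" for i
    using measurable_N[OF C] .
  \<comment> \<open>Outside \<open>I\<close> a Dirac mass is inserted, because the product locale
    wants a probability measure at every index.\<close>
  define \<rho>' where "\<rho>' i = (if i \<in> I then \<rho> i else return borel 0)" for i
  have ps: "prob_space (\<rho>' i)" for i
    using mN by (auto simp: \<rho>'_def \<rho>_def intro!: prob_space_distr prob_space_return)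
  interpret psf: product_prob_space \<rho>' UNIV
    by (rule product_prob_spaceI) (rule ps)
  have sets_\<rho>: "sets (\<rho>' i) = sets borel" for i by (simp add: \<rho>'_def \<rho>_def)
  have PiM_sets: "sets (Pi\<^sub>M K \<rho>') = sets (\<Pi>\<^sub>M i\<in>K. borel)" for K
    by (rule sets_PiM_cong) (simp_all add: sets_\<rho>)
  have PiM_meas: "measurable (Pi\<^sub>M K \<rho>') M = measurable (\<Pi>\<^sub>M i\<in>K. borel) M" for K M
    by (rule measurable_cong_sets) (simp_all add: PiM_sets)
  have X [measurable]: "X \<in> P \<rightarrow>\<^sub>M (\<Pi>\<^sub>M i\<in>I. borel)"
    unfolding X_def by (rule measurable_restrict) (rule mN)
  have law: "distr P (\<Pi>\<^sub>M i\<in>I. borel) X = Pi\<^sub>M I \<rho>'"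
  proof -
    have "distr P (\<Pi>\<^sub>M i\<in>I. borel) X = Pi\<^sub>M I \<rho>"
      unfolding X_def \<rho>_def
      by (rule indep_vars_iff_distr_eq_PiM'[THEN iffD1, OF _ _ indep_N[OF I(1) C disj]])
         (use I(2) in \<open>auto intro: mN\<close>)
    also have "\<dots> = Pi\<^sub>M I \<rho>'" by (rule PiM_cong) (simp_all add: \<rho>'_def)
    finally show ?thesis .
  qed
  have restr: "(\<lambda>x. restrict x J) \<in> (\<Pi>\<^sub>M i\<in>insert j J. borel) \<rightarrow>\<^sub>M (\<Pi>\<^sub>M i\<in>J. (borel :: ennreal measure))"
    by (rule measurable_restrict_subset) auto
  have upd [measurable]: "(\<lambda>x. x(j := x j - 1)) \<in> (\<Pi>\<^sub>M i\<in>I. borel) \<rightarrow>\<^sub>M (\<Pi>\<^sub>M i\<in>I. (borel :: ennreal measure))"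
  proof -
    have "(\<lambda>x. (restrict x J)(j := x j - 1)) \<in> (\<Pi>\<^sub>M i\<in>insert j J. borel) \<rightarrow>\<^sub>M (\<Pi>\<^sub>M i\<in>insert j J. (borel :: ennreal measure))"
      by (rule measurable_fun_upd[where J = J, OF _ restr]) auto
    moreover have "(restrict x J)(j := x j - 1) = x(j := x j - 1)"
      if "x \<in> space (\<Pi>\<^sub>M i\<in>insert j J. (borel :: ennreal measure))" for x
      using that by (auto simp: fun_eq_iff space_PiM PiE_def extensional_def)
    ultimately have "(\<lambda>x. x(j := x j - 1)) \<in> (\<Pi>\<^sub>M i\<in>insert j J. borel) \<rightarrow>\<^sub>M (\<Pi>\<^sub>M i\<in>insert j J. (borel :: ennreal measure))"
      by (subst (asm) measurable_cong) auto
    then show ?thesis by (simp add: IJ(1)[symmetric])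
  qed
  define \<psi>' where "\<psi>' x = x j * \<psi> (x(j := x j - 1))" for x
  have \<psi>' [measurable]: "\<psi>' \<in> borel_measurable (\<Pi>\<^sub>M i\<in>I. borel)"
    unfolding \<psi>'_def using I(2) by measurable
  have "(\<integral>\<^sup>+\<omega>. N \<omega> (C j) * \<psi> ((\<lambda>i\<in>I. N \<omega> (C i))(j := N \<omega> (C j) - 1)) \<partial>P) = (\<integral>\<^sup>+\<omega>. \<psi>' (X \<omega>) \<partial>P)"
    using I(2) by (simp add: \<psi>'_def X_def)
  also have "\<dots> = (\<integral>\<^sup>+x. \<psi>' x \<partial>distr P (\<Pi>\<^sub>M i\<in>I. borel) X)"
    by (rule nn_integral_distr[symmetric]) measurable
  also have "\<dots> = (\<integral>\<^sup>+x. \<psi>' x \<partial>Pi\<^sub>M (insert j J) \<rho>')"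
    by (simp only: law flip: IJ(1))
  also have "\<dots> = (\<integral>\<^sup>+x. (\<integral>\<^sup>+y. \<psi>' (x(j := y)) \<partial>\<rho>' j) \<partial>Pi\<^sub>M J \<rho>')"
    by (rule psf.product_nn_integral_insert) (use IJ \<psi>' in \<open>simp_all add: PiM_meas flip: IJ(1)\<close>)
  also have "\<dots> = (\<integral>\<^sup>+x. emeasure (intensity T) (C j) * (\<integral>\<^sup>+y. \<psi> (x(j := y)) \<partial>\<rho>' j) \<partial>Pi\<^sub>M J \<rho>')"
  proof (rule nn_integral_cong)
    fix x assume "x \<in> space (Pi\<^sub>M J \<rho>')"
    then have x: "x \<in> space (\<Pi>\<^sub>M i\<in>J. borel :: ennreal measure)"
      using sets_eq_imp_space_eq[OF PiM_sets] by simp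
    have "(\<lambda>y. x(j := y)) \<in> borel \<rightarrow>\<^sub>M (\<Pi>\<^sub>M i\<in>insert j J. (borel :: ennreal measure))"
      by (rule measurable_fun_upd[where J = J]) (use x in auto)
    then have [measurable]: "(\<lambda>y. \<psi> (x(j := y))) \<in> borel_measurable borel"
      using \<psi> by (auto simp: IJ(1)[symmetric])
    have "(\<integral>\<^sup>+y. \<psi>' (x(j := y)) \<partial>\<rho>' j) = (\<integral>\<^sup>+\<omega>. N \<omega> (C j) * \<psi> (x(j := N \<omega> (C j) - 1)) \<partial>P)"
      using I(2) mN[OF I(2)]
      by (simp add: \<rho>'_def \<rho>_def nn_integral_distr \<psi>'_def)
    also have "\<dots> = emeasure (intensity T) (C j) * (\<integral>\<^sup>+\<omega>. \<psi> (x(j := N \<omega> (C j))) \<partial>P)"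
      by (rule nn_integral_N[OF C[OF I(2)] Cj]) measurable
    also have "(\<integral>\<^sup>+\<omega>. \<psi> (x(j := N \<omega> (C j))) \<partial>P) = (\<integral>\<^sup>+y. \<psi> (x(j := y)) \<partial>\<rho>' j)"
      using I(2) mN[OF I(2)] by (simp add: \<rho>'_def \<rho>_def nn_integral_distr)
    finally show "(\<integral>\<^sup>+y. \<psi>' (x(j := y)) \<partial>\<rho>' j) = emeasure (intensity T) (C j) * (\<integral>\<^sup>+y. \<psi> (x(j := y)) \<partial>\<rho>' j)" .
  qed
  also have "\<dots> = emeasure (intensity T) (C j) * (\<integral>\<^sup>+x. (\<integral>\<^sup>+y. \<psi> (x(j := y)) \<partial>\<rho>' j) \<partial>Pi\<^sub>M J \<rho>')"
  proof (rule nn_integral_cmult)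
    have "(\<lambda>p. (fst p)(j := snd p)) \<in> (\<Pi>\<^sub>M i\<in>J. borel) \<Otimes>\<^sub>M borel \<rightarrow>\<^sub>M (\<Pi>\<^sub>M i\<in>insert j J. (borel :: ennreal measure))"
      by (rule measurable_fun_upd[where J = J]) auto
    then have "(\<lambda>p. \<psi> ((fst p)(j := snd p))) \<in> borel_measurable ((\<Pi>\<^sub>M i\<in>J. borel) \<Otimes>\<^sub>M borel)"
      using \<psi> by (auto simp: IJ(1)[symmetric])
    also have "borel_measurable ((\<Pi>\<^sub>M i\<in>J. borel) \<Otimes>\<^sub>M (borel :: ennreal measure)) = borel_measurable (Pi\<^sub>M J \<rho>' \<Otimes>\<^sub>M \<rho>' j)"
      by (rule measurable_cong_sets) (auto intro!: sets_pair_measure_cong simp: PiM_sets sets_\<rho>)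
    finally show "(\<lambda>x. \<integral>\<^sup>+y. \<psi> (x(j := y)) \<partial>\<rho>' j) \<in> borel_measurable (Pi\<^sub>M J \<rho>')"
      by (intro sigma_finite_measure.borel_measurable_nn_integral[OF psf.sigma_finite_measures])
         (simp only: split_beta')
  qed
  also have "(\<integral>\<^sup>+x. (\<integral>\<^sup>+y. \<psi> (x(j := y)) \<partial>\<rho>' j) \<partial>Pi\<^sub>M J \<rho>') = (\<integral>\<^sup>+x. \<psi> x \<partial>Pi\<^sub>M (insert j J) \<rho>')"
    by (rule psf.product_nn_integral_insert[symmetric]) (use IJ \<psi> in \<open>simp_all add: PiM_meas flip: IJ(1)\<close>)
  also have "\<dots> = (\<integral>\<^sup>+x. \<psi> x \<partial>distr P (\<Pi>\<^sub>M i\<in>I. borel) X)"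
    by (simp only: law flip: IJ(1))
  also have "\<dots> = (\<integral>\<^sup>+\<omega>. \<psi> (X \<omega>) \<partial>P)"
    by (rule nn_integral_distr) measurable
  finally show ?thesis by (simp only: X_def)
qed

section \<open>Extension from cylinder events to all measurable integrands\<close>

definition cylinders :: "(real \<times> real) set set set" where
  "cylinders = {{\<omega>\<in>configurations T. \<forall>i<m. N \<omega> (A i) \<in> B i} | (m::nat) A B.
     (\<forall>i<m. A i \<in> sets (intensity T) \<and> B i \<in> sets borel)}"

lemma cylindersI:
  fixes m :: nat
  assumes "x = {\<omega>\<in>configurations T. \<forall>i<m. N \<omega> (A i) \<in> B i}"
    and "\<And>i. i < m \<Longrightarrow> A i \<in> sets (intensity T)" "\<And>i. i < m \<Longrightarrow> B i \<in> sets borel"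
  shows "x \<in> cylinders"
  unfolding cylinders_def
  by (rule CollectI, rule exI[of _ m], rule exI[of _ A], rule exI[of _ B]) (use assms in simp)

lemma cylindersE:
  assumes "x \<in> cylinders"
  obtains m :: nat and A B where
    "x = {\<omega>\<in>configurations T. \<forall>i<m. N \<omega> (A i) \<in> B i}"
    "\<forall>i<m. A i \<in> sets (intensity T) \<and> B i \<in> sets borel"
  using assms unfolding cylinders_def by (elim CollectE exE conjE) (rule that)

text \<open>Concatenating the two finite lists of conditions describes the intersection. This
  closure is what Dynkin's argument asks of the generator, hence cylinders with arbitrarily many
  conditions instead of events for a single count.\<close>

lemma Int_stable_cylinders: "Int_stable cylinders"
proof (rule Int_stableI)
  fix a b assume "a \<in> cylinders" "b \<in> cylinders"
  from \<open>a \<in> cylinders\<close> obtain m :: nat and A B where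
    a: "a = {\<omega>\<in>configurations T. \<forall>i<m. N \<omega> (A i) \<in> B i}"
       "\<forall>i<m. A i \<in> sets (intensity T) \<and> B i \<in> sets borel" by (rule cylindersE)
  from \<open>b \<in> cylinders\<close> obtain m' :: nat and A' B' where
    b: "b = {\<omega>\<in>configurations T. \<forall>i<m'. N \<omega> (A' i) \<in> B' i}"
       "\<forall>i<m'. A' i \<in> sets (intensity T) \<and> B' i \<in> sets borel" by (rule cylindersE)
  define A'' where "A'' i = (if i < m then A i else A' (i - m))" for i
  define B'' where "B'' i = (if i < m then B i else B' (i - m))" for i
  have split: "(\<forall>i<m + m'. Q i) \<longleftrightarrow> (\<forall>i<m. Q i) \<and> (\<forall>i<m'. Q (m + i))" for Q
  proof safe
    fix i assume *: "\<forall>i<m. Q i" "\<forall>i<m'. Q (m + i)" "i < m + m'"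
    show "Q i"
    proof (cases "i < m")
      case False
      then have "i = m + (i - m)" "i - m < m'" using *(3) by auto
      then show ?thesis using *(2) by metis
    qed (use * in auto)
  qed auto
  have "a \<inter> b = {\<omega>\<in>configurations T. \<forall>i<m + m'. N \<omega> (A'' i) \<in> B'' i}"
    unfolding split a(1) b(1) by (auto simp: A''_def B''_def)
  moreover have "\<forall>i<m + m'. A'' i \<in> sets (intensity T) \<and> B'' i \<in> sets borel"
    unfolding split using a(2) b(2) by (auto simp: A''_def B''_def)
  ultimately show "a \<inter> b \<in> cylinders" by (intro cylindersI) auto
qed

lemma cylinders_subset: "cylinders \<subseteq> Pow (configurations T)"
  by (auto simp: cylinders_def)

lemma sets_P_cylinders: "sets P = sigma_sets (configurations T) cylinders"
proof
  have "gens \<subseteq> cylinders"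
  proof
    fix x assume "x \<in> gens"
    then obtain A B where x: "x = {\<omega>\<in>configurations T. N \<omega> A \<in> B}"
      and AB: "A \<in> sets (intensity T)" "B \<in> sets borel"
      unfolding gens_def by (elim CollectE exE conjE)
    show "x \<in> cylinders"
      by (rule cylindersI[of _ 1 "\<lambda>_. A" "\<lambda>_. B"]) (use AB in \<open>simp_all only: x less_one simp_thms\<close>)
  qed
  then show "sets P \<subseteq> sigma_sets (configurations T) cylinders"
    unfolding sets_P by (rule sigma_sets_mono')
  have "cylinders \<subseteq> sets P"
  proof
    fix x assume "x \<in> cylinders"
    then obtain m :: nat and A B where x: "x = {\<omega>\<in>configurations T. \<forall>i<m. N \<omega> (A i) \<in> B i}"
       and *: "\<forall>i<m. A i \<in> sets (intensity T) \<and> B i \<in> sets borel"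
      by (rule cylindersE)
    have "{\<omega>\<in>space P. \<forall>i\<in>{..<m}. N \<omega> (A i) \<in> B i} \<in> sets P"
    proof (rule sets.sets_Collect_finite_All)
      fix i assume "i \<in> {..<m}"
      then have "A i \<in> sets (intensity T)" "B i \<in> sets borel" using * by auto
      then show "{\<omega>\<in>space P. N \<omega> (A i) \<in> B i} \<in> sets P"
        using measurable_sets[OF measurable_N[of "A i"], of "B i"]
        by (simp add: vimage_def Int_def conj_commute)
    qed simp
    then show "x \<in> sets P" unfolding x by (simp only: space_P Ball_def lessThan_iff)
  qed
  then show "sigma_sets (configurations T) cylinders \<subseteq> sets P"
    using sets.sigma_sets_subset[of cylinders P] by simp
qed

text \<open>These are the atoms of the finite algebra generated by the \<open>A i\<close>: a point
  is classified by the set of indices \<open>i\<close> for which it lies in \<open>A i\<close>. The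
  classes are numbered by \<open>set_encode\<close>, since the independence of counts is stated for
  families indexed by natural numbers.\<close>

lemma cylinder_atoms:
  fixes A :: "nat \<Rightarrow> (real \<times> real) set"
  assumes A: "\<And>i. i \<le> m \<Longrightarrow> A i \<in> sets (intensity T)"
  obtains C :: "nat \<Rightarrow> (real \<times> real) set" and I J where
    "finite I" "\<And>j. C j \<in> sets (intensity T)" "disjoint_family_on C I"
    "\<And>i. i \<le> m \<Longrightarrow> J i \<subseteq> I" "\<And>i. i \<le> m \<Longrightarrow> A i = (\<Union>j\<in>J i. C j)"
proof -
  define code where "code z = set_encode {i. i \<le> m \<and> z \<in> A i}" for z
  define C where "C j = {z\<in>space (intensity T). code z = j}" for j
  define I where "I = set_encode ` Pow {..m}"
  define J where "J i = {j\<in>I. i \<in> set_decode j}" for i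
  have fin: "finite {i. i \<le> m \<and> z \<in> A i}" for z by (rule finite_subset[of _ "{..m}"]) auto
  have dec: "set_decode (code z) = {i. i \<le> m \<and> z \<in> A i}" for z
    unfolding code_def by (rule set_encode_inverse) (rule fin)
  have codeI: "code z \<in> I" for z
    unfolding code_def I_def by (rule imageI) auto
  show thesis
  proof (rule that[of I C J])
    show "finite I" by (simp add: I_def)
    show "C j \<in> sets (intensity T)" for j
    proof (cases "\<exists>S\<subseteq>{..m}. j = set_encode S")
      case True
      then obtain S where S: "S \<subseteq> {..m}" "j = set_encode S" by blast
      have "code z = j \<longleftrightarrow> (\<forall>i\<in>{..m}. z \<in> A i \<longleftrightarrow> i \<in> S)" for z
      proof -
        have "finite S" using S(1) by (rule finite_subset) simp
        then have "code z = j \<longleftrightarrow> {i. i \<le> m \<and> z \<in> A i} = S"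
          unfolding code_def S(2) using fin by (subst set_encode_eq) auto
        also have "\<dots> \<longleftrightarrow> (\<forall>i\<in>{..m}. z \<in> A i \<longleftrightarrow> i \<in> S)" using S(1) by auto
        finally show ?thesis .
      qed
      then have "C j = {z\<in>space (intensity T). \<forall>i\<in>{..m}. z \<in> A i \<longleftrightarrow> i \<in> S}"
        by (simp add: C_def)
      also have "\<dots> \<in> sets (intensity T)"
      proof (rule sets.sets_Collect_finite_All)
        fix i assume "i \<in> {..m}"
        then have "A i \<in> sets (intensity T)" using A by simp
        then have "{z\<in>space (intensity T). z \<in> A i} \<in> sets (intensity T)"
          using sets.Int_space_eq2 by (simp add: Int_def[symmetric] conj_commute Collect_conj_eq)
        then show "{z\<in>space (intensity T). z \<in> A i \<longleftrightarrow> i \<in> S} \<in> sets (intensity T)"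
          by (cases "i \<in> S") (auto intro: sets.sets_Collect_neg)
      qed simp
      finally show ?thesis .
    next
      case False
      have "code z \<noteq> j" for z
      proof
        assume "code z = j"
        moreover have "{i. i \<le> m \<and> z \<in> A i} \<subseteq> {..m}" by auto
        ultimately show False using False unfolding code_def by metis
      qed
      then show ?thesis by (simp add: C_def)
    qed
    show "disjoint_family_on C I" by (auto simp: disjoint_family_on_def C_def)
    show "J i \<subseteq> I" for i by (auto simp: J_def)
    fix i assume i: "i \<le> m"
    have "A i \<subseteq> space (intensity T)" using A[OF i] by (rule sets.sets_into_space)
    then show "A i = (\<Union>j\<in>J i. C j)"
      using i codeI by (auto simp: J_def C_def dec)
  qed
qed

lemma nn_integral_count_space_UN_atoms:
  assumes J: "finite J" and disj: "disjoint_family_on C J"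
  shows "(\<integral>\<^sup>+z. indicator (\<Union>j\<in>J. C j) z * F z \<partial>count_space \<omega>) =
    (\<Sum>j\<in>J. \<integral>\<^sup>+z. indicator (C j) z * F z \<partial>count_space \<omega>)"
proof -
  have "(\<integral>\<^sup>+z. indicator (\<Union>j\<in>J. C j) z * F z \<partial>count_space \<omega>) =
      (\<integral>\<^sup>+z. (\<Sum>j\<in>J. indicator (C j) z * F z) \<partial>count_space \<omega>)"
    by (intro nn_integral_cong)
       (simp add: indicator_UN_disjoint[OF J disj] sum_distrib_right)
  also have "\<dots> = (\<Sum>j\<in>J. \<integral>\<^sup>+z. indicator (C j) z * F z \<partial>count_space \<omega>)"
    by (rule nn_integral_sum) simp
  finally show ?thesis .
qed

text \<open>On atoms the counts are independent, and removing a point of \<open>C j\<close> lowers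
  the count of \<open>C j\<close> by one and leaves the others alone. The event seen after the
  removal is therefore the same for all points of an atom, and the identity for disjoint cells can
  be summed over the atoms contained in \<open>A0\<close>.\<close>

lemma mecke_cylinder:
  assumes A0: "A0 \<in> sets (intensity T)" "A0 \<subseteq> strip T b" and \<Gamma>: "\<Gamma> \<in> cylinders"
  shows "(\<integral>\<^sup>+\<omega>. (\<integral>\<^sup>+z. indicator A0 z * indicator \<Gamma> (\<omega> - {z}) \<partial>count_space \<omega>) \<partial>P) =
    emeasure (intensity T) A0 * emeasure P \<Gamma>"
proof -
  obtain m :: nat and A B where \<Gamma>_eq: "\<Gamma> = {\<omega>\<in>configurations T. \<forall>i<m. N \<omega> (A i) \<in> B i}"
    and AB: "\<forall>i<m. A i \<in> sets (intensity T) \<and> B i \<in> sets borel"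
    using \<Gamma> by (rule cylindersE)
  \<comment> \<open>\<open>A0\<close> is appended as the set with index \<open>m\<close>, so that
    the atoms refine it too.\<close>
  define A' where "A' i = (if i < m then A i else A0)" for i
  have "A' i \<in> sets (intensity T)" for i using AB A0 by (simp add: A'_def)
  then obtain C :: "nat \<Rightarrow> (real \<times> real) set" and I J where
    I: "finite I" and C: "\<And>j. C j \<in> sets (intensity T)" and disj: "disjoint_family_on C I"
    and J: "\<And>i. i \<le> m \<Longrightarrow> J i \<subseteq> I" and A': "\<And>i. i \<le> m \<Longrightarrow> A' i = (\<Union>j\<in>J i. C j)"
    using cylinder_atoms[of m A'] by metis
  have finJ: "finite (J i)" if "i \<le> m" for i using J[OF that] I by (rule finite_subset)
  have disjJ: "disjoint_family_on C (J i)" if "i \<le> m" for i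
    using J[OF that] disj by (auto simp: disjoint_family_on_def)
  have NA: "N \<omega> (A i) = (\<Sum>j\<in>J i. N \<omega> (C j))" if "i < m" for i \<omega>
  proof -
    have "A i = (\<Union>j\<in>J i. C j)" using A'[of i] that by (simp add: A'_def)
    then show ?thesis
      using that by (simp only:) (intro sum_emeasure[symmetric] finJ disjJ; use C in auto)
  qed
  define \<psi> :: "(nat \<Rightarrow> ennreal) \<Rightarrow> ennreal" where
    "\<psi> y = (\<Prod>i<m. indicator (B i) (\<Sum>j\<in>J i. y j))" for y
  have \<psi>: "\<psi> \<in> borel_measurable (\<Pi>\<^sub>M i\<in>I. (borel :: ennreal measure))"
    unfolding \<psi>_def
  proof (rule borel_measurable_prod_ennreal)
    fix i assume i: "i \<in> {..<m}"
    have "(\<lambda>y. \<Sum>j\<in>J i. y j) \<in> borel_measurable (\<Pi>\<^sub>M i\<in>I. (borel :: ennreal measure))"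
      by (rule borel_measurable_sum, rule measurable_component_singleton) (use J[of i] i in auto)
    then show "(\<lambda>y. indicator (B i) (\<Sum>j\<in>J i. y j)) \<in> borel_measurable (\<Pi>\<^sub>M i\<in>I. borel)"
      using AB i by (intro measurable_compose[OF _ borel_measurable_indicator]) auto
  qed
  have ind: "indicator \<Gamma> \<omega> = \<psi> (\<lambda>i\<in>I. N \<omega> (C i))" if "\<omega> \<in> configurations T" for \<omega>
  proof -
    have "(\<Sum>j\<in>J i. (\<lambda>i\<in>I. N \<omega> (C i)) j) = N \<omega> (A i)" if "i < m" for i
      unfolding NA[OF that] using J[of i] that by (intro sum.cong) auto
    then have "\<psi> (\<lambda>i\<in>I. N \<omega> (C i)) = (\<Prod>i<m. indicator (B i) (N \<omega> (A i)))"
      unfolding \<psi>_def by (intro prod.cong) auto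
    also have "\<dots> = (if \<forall>i<m. N \<omega> (A i) \<in> B i then 1 else 0)"
      by (auto intro!: prod.neutral simp: prod_zero_iff indicator_def)
    finally show ?thesis using that by (simp add: \<Gamma>_eq)
  qed
  have A0_eq: "A0 = (\<Union>j\<in>J m. C j)" using A'[of m] by (simp add: A'_def)
  have inner: "(\<integral>\<^sup>+z. indicator A0 z * indicator \<Gamma> (\<omega> - {z}) \<partial>count_space \<omega>) =
      (\<Sum>j\<in>J m. N \<omega> (C j) * \<psi> ((\<lambda>i\<in>I. N \<omega> (C i))(j := N \<omega> (C j) - 1)))"
    if \<omega>: "\<omega> \<in> configurations T" for \<omega>
  proof -
    have "(\<integral>\<^sup>+z. indicator A0 z * indicator \<Gamma> (\<omega> - {z}) \<partial>count_space \<omega>) =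
        (\<Sum>j\<in>J m. \<integral>\<^sup>+z. indicator (C j) z * indicator \<Gamma> (\<omega> - {z}) \<partial>count_space \<omega>)"
      unfolding A0_eq by (rule nn_integral_count_space_UN_atoms[OF finJ disjJ]) simp_all
    also have "\<dots> = (\<Sum>j\<in>J m. N \<omega> (C j) * \<psi> ((\<lambda>i\<in>I. N \<omega> (C i))(j := N \<omega> (C j) - 1)))"
    proof (rule sum.cong[OF refl])
      fix j assume j: "j \<in> J m"
      then have jI: "j \<in> I" using J[of m] by auto
      let ?c = "\<psi> ((\<lambda>i\<in>I. N \<omega> (C i))(j := N \<omega> (C j) - 1))"
      have pt: "indicator \<Gamma> (\<omega> - {z}) = ?c" if z: "z \<in> \<omega>" "z \<in> C j" for z
      proof -
        have NC: "N \<omega> (C i) = indicator (C i) z + N (\<omega> - {z}) (C i)" for i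
        proof -
          have "N \<omega> (C i) = (\<integral>\<^sup>+x. indicator (C i) x \<partial>count_space \<omega>)"
            by (rule nn_integral_count_space_indicator_canonical[symmetric, OF \<omega> C])
          also have "\<dots> = indicator (C i) z + (\<integral>\<^sup>+x. indicator (C i) x \<partial>count_space (\<omega> - {z}))"
            by (rule nn_integral_remove_point[OF z(1)])
          also have "(\<integral>\<^sup>+x. indicator (C i) x \<partial>count_space (\<omega> - {z})) = N (\<omega> - {z}) (C i)"
            by (rule nn_integral_count_space_indicator_canonical[OF configurations_remove[OF \<omega>] C])
          finally show ?thesis .
        qed
        have "(\<lambda>i\<in>I. N (\<omega> - {z}) (C i)) = (\<lambda>i\<in>I. N \<omega> (C i))(j := N \<omega> (C j) - 1)"
        proof
          fix i
          show "(\<lambda>i\<in>I. N (\<omega> - {z}) (C i)) i = ((\<lambda>i\<in>I. N \<omega> (C i))(j := N \<omega> (C j) - 1)) i"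
          proof (cases "i = j")
            case True
            then show ?thesis using jI z(2) NC[of j] by simp
          next
            case False
            then have "i \<in> I \<Longrightarrow> z \<notin> C i"
              using disj jI z(2) unfolding disjoint_family_on_def by auto
            then show ?thesis using False NC[of i] by (auto simp: restrict_def)
          qed
        qed
        then show ?thesis using ind[OF configurations_remove[OF \<omega>], of "{z}"] by simp
      qed
      have "(\<integral>\<^sup>+z. indicator (C j) z * indicator \<Gamma> (\<omega> - {z}) \<partial>count_space \<omega>) =
          (\<integral>\<^sup>+z. indicator (C j) z * ?c \<partial>count_space \<omega>)"
        by (rule nn_integral_cong) (use pt in \<open>auto split: split_indicator\<close>)
      also have "\<dots> = (\<integral>\<^sup>+z. indicator (C j) z \<partial>count_space \<omega>) * ?c"
        by (rule nn_integral_multc) simp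
      also have "(\<integral>\<^sup>+z. indicator (C j) z \<partial>count_space \<omega>) = N \<omega> (C j)"
        by (rule nn_integral_count_space_indicator_canonical[OF \<omega> C])
      finally show "(\<integral>\<^sup>+z. indicator (C j) z * indicator \<Gamma> (\<omega> - {z}) \<partial>count_space \<omega>) = N \<omega> (C j) * ?c" .
    qed
    finally show ?thesis .
  qed
  have "(\<integral>\<^sup>+\<omega>. (\<integral>\<^sup>+z. indicator A0 z * indicator \<Gamma> (\<omega> - {z}) \<partial>count_space \<omega>) \<partial>P) =
      (\<integral>\<^sup>+\<omega>. (\<Sum>j\<in>J m. N \<omega> (C j) * \<psi> ((\<lambda>i\<in>I. N \<omega> (C i))(j := N \<omega> (C j) - 1))) \<partial>P)"
    by (rule nn_integral_cong) (simp only: inner space_P)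
  also have "\<dots> = (\<Sum>j\<in>J m. \<integral>\<^sup>+\<omega>. N \<omega> (C j) * \<psi> ((\<lambda>i\<in>I. N \<omega> (C i))(j := N \<omega> (C j) - 1)) \<partial>P)"
  proof (rule nn_integral_sum)
    fix j assume j: "j \<in> J m"
    then have jI: "I = insert j (I - {j})" using J[of m] by auto
    have "(\<lambda>\<omega>. (\<lambda>i\<in>I - {j}. N \<omega> (C i))(j := N \<omega> (C j) - 1)) \<in> P \<rightarrow>\<^sub>M (\<Pi>\<^sub>M i\<in>I. borel)"
      by (rule measurable_fun_upd[where J = "I - {j}"])
         (use jI C measurable_N in \<open>auto intro!: measurable_restrict\<close>)
    also have "(\<lambda>\<omega>. (\<lambda>i\<in>I - {j}. N \<omega> (C i))(j := N \<omega> (C j) - 1)) =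
        (\<lambda>\<omega>. (\<lambda>i\<in>I. N \<omega> (C i))(j := N \<omega> (C j) - 1))"
      by (auto simp: fun_eq_iff restrict_def)
    finally have mX: "(\<lambda>\<omega>. (\<lambda>i\<in>I. N \<omega> (C i))(j := N \<omega> (C j) - 1)) \<in> P \<rightarrow>\<^sub>M (\<Pi>\<^sub>M i\<in>I. borel)" .
    show "(\<lambda>\<omega>. N \<omega> (C j) * \<psi> ((\<lambda>i\<in>I. N \<omega> (C i))(j := N \<omega> (C j) - 1))) \<in> borel_measurable P"
      by (rule borel_measurable_times_ennreal[OF measurable_N[OF C] measurable_compose[OF mX \<psi>]])
  qed
  also have "\<dots> = (\<Sum>j\<in>J m. emeasure (intensity T) (C j) * (\<integral>\<^sup>+\<omega>. \<psi> (\<lambda>i\<in>I. N \<omega> (C i)) \<partial>P))"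
  proof (rule sum.cong[OF refl])
    fix j assume j: "j \<in> J m"
    show "(\<integral>\<^sup>+\<omega>. N \<omega> (C j) * \<psi> ((\<lambda>i\<in>I. N \<omega> (C i))(j := N \<omega> (C j) - 1)) \<partial>P) =
       emeasure (intensity T) (C j) * (\<integral>\<^sup>+\<omega>. \<psi> (\<lambda>i\<in>I. N \<omega> (C i)) \<partial>P)"
      by (rule nn_integral_N_disjoint[OF I _ C disj _ \<psi>, where b = b])
         (use j J[of m] A0_eq A0(2) in auto)
  qed
  also have "\<dots> = emeasure (intensity T) A0 * (\<integral>\<^sup>+\<omega>. \<psi> (\<lambda>i\<in>I. N \<omega> (C i)) \<partial>P)"
    unfolding sum_distrib_right[symmetric] A0_eq
    by (subst sum_emeasure) (use finJ[of m] disjJ[of m] C in auto)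
  also have "(\<integral>\<^sup>+\<omega>. \<psi> (\<lambda>i\<in>I. N \<omega> (C i)) \<partial>P) = (\<integral>\<^sup>+\<omega>. indicator \<Gamma> \<omega> \<partial>P)"
    by (rule nn_integral_cong) (simp only: ind space_P)
  also have "\<dots> = emeasure P \<Gamma>"
    using \<Gamma> by (intro nn_integral_indicator) (auto simp: sets_P_cylinders)
  finally show ?thesis .
qed

text \<open>Dynkin's argument in the event for the remaining configuration. For a complement, the
  identities for \<open>\<Gamma>\<close> and its complement add up to the mean count of
  \<open>A0\<close>, which is finite because \<open>A0\<close> lies in a strip, so one of them can
  be cancelled.\<close>

lemma mecke_bounded_set:
  assumes A0: "A0 \<in> sets (intensity T)" "A0 \<subseteq> strip T b" and \<Gamma>: "\<Gamma> \<in> sets P"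
  shows "(\<integral>\<^sup>+\<omega>. (\<integral>\<^sup>+z. indicator A0 z * indicator \<Gamma> (\<omega> - {z}) \<partial>count_space \<omega>) \<partial>P) =
    emeasure (intensity T) A0 * emeasure P \<Gamma>"
proof -
  let ?Q = "\<lambda>\<Gamma> \<omega>. \<integral>\<^sup>+z. indicator A0 z * indicator \<Gamma> (\<omega> - {z}) \<partial>count_space \<omega>"
  note A0(1)[measurable]
  have meas: "?Q \<Gamma> \<in> borel_measurable P" if [measurable]: "\<Gamma> \<in> sets P" for \<Gamma>
  proof (rule measurable_campbell)
    have "(\<lambda>x. (\<lambda>(\<omega>, z). \<omega> - {z}) x \<in> \<Gamma>) \<in> measurable (P \<Otimes>\<^sub>M intensity T) (count_space UNIV)"
      by measurable
    then have "(\<lambda>x. indicator A0 (snd x) * indicator \<Gamma> ((\<lambda>(\<omega>, z). \<omega> - {z}) x) :: ennreal)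
        \<in> borel_measurable (P \<Otimes>\<^sub>M intensity T)"
      by measurable
    then show "(\<lambda>(\<omega>, z). indicator A0 z * indicator \<Gamma> (\<omega> - {z}) :: ennreal) \<in> borel_measurable (P \<Otimes>\<^sub>M intensity T)"
      by (simp add: split_beta')
  qed simp
  have total: "?Q \<Gamma> \<omega> + ?Q (configurations T - \<Gamma>) \<omega> = N \<omega> A0" if \<omega>: "\<omega> \<in> configurations T" for \<Gamma> \<omega>
  proof -
    have "?Q \<Gamma> \<omega> + ?Q (configurations T - \<Gamma>) \<omega> =
      (\<integral>\<^sup>+z. indicator A0 z * indicator \<Gamma> (\<omega> - {z}) + indicator A0 z * indicator (configurations T - \<Gamma>) (\<omega> - {z}) \<partial>count_space \<omega>)"
      by (rule nn_integral_add[symmetric]) auto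
    also have "\<dots> = (\<integral>\<^sup>+z. indicator A0 z \<partial>count_space \<omega>)"
      using configurations_remove[OF \<omega>] by (intro nn_integral_cong) (auto split: split_indicator)
    also have "\<dots> = N \<omega> A0" by (rule nn_integral_count_space_indicator_canonical[OF \<omega> A0(1)])
    finally show ?thesis .
  qed
  have fin: "emeasure (intensity T) A0 < \<infinity>"
    using emeasure_mono[OF A0(2) strip_sets] emeasure_strip_finite[of T b] by (rule le_less_trans)
  have NA0: "(\<integral>\<^sup>+\<omega>. N \<omega> A0 \<partial>P) = emeasure (intensity T) A0"
  proof -
    have "(\<integral>\<^sup>+\<omega>. N \<omega> A0 * 1 \<partial>P) = emeasure (intensity T) A0 * (\<integral>\<^sup>+\<omega>. 1 \<partial>P)"
      by (rule nn_integral_N[OF A0]) simp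
    then show ?thesis using emeasure_space_1 by simp
  qed
  show ?thesis
    using Int_stable_cylinders cylinders_subset \<Gamma>[unfolded sets_P_cylinders]
  proof (induction rule: sigma_sets_induct_disjoint)
    case (basic \<Gamma>)
    then show ?case by (rule mecke_cylinder[OF A0])
  next
    case empty
    then show ?case by simp
  next
    case (compl \<Gamma>)
    then have \<Gamma>: "\<Gamma> \<in> sets P" "configurations T - \<Gamma> \<in> sets P"
      using sets.compl_sets[of \<Gamma> P] by (simp_all add: sets_P_cylinders)
    have "emeasure (intensity T) A0 * emeasure P \<Gamma> + (\<integral>\<^sup>+\<omega>. ?Q (configurations T - \<Gamma>) \<omega> \<partial>P) =
        (\<integral>\<^sup>+\<omega>. ?Q \<Gamma> \<omega> + ?Q (configurations T - \<Gamma>) \<omega> \<partial>P)"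
      unfolding compl.IH[symmetric] by (rule nn_integral_add[symmetric]; rule meas) (rule \<Gamma>)+
    also have "\<dots> = (\<integral>\<^sup>+\<omega>. N \<omega> A0 \<partial>P)"
      by (rule nn_integral_cong) (simp only: space_P total)
    also have "\<dots> = emeasure (intensity T) A0 * (emeasure P \<Gamma> + emeasure P (configurations T - \<Gamma>))"
      using emeasure_compl[OF \<Gamma>(1)] emeasure_space_1 NA0 emeasure_finite[of \<Gamma>]
      by (subst plus_emeasure) (use \<Gamma> sets.sets_into_space[OF \<Gamma>(1)] in \<open>auto simp: Un_absorb1\<close>)
    also have "\<dots> = emeasure (intensity T) A0 * emeasure P \<Gamma> + emeasure (intensity T) A0 * emeasure P (configurations T - \<Gamma>)"
      by (rule distrib_left)
    finally show ?case
      using fin emeasure_finite[of \<Gamma>]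
      by (subst (asm) ennreal_add_left_cancel) (auto simp: ennreal_mult_eq_top_iff)
  next
    case (union \<Gamma>)
    then have \<Gamma>: "range \<Gamma> \<subseteq> sets P" by (simp add: sets_P_cylinders)
    have "?Q (\<Union>i. \<Gamma> i) \<omega> = (\<Sum>i. ?Q (\<Gamma> i) \<omega>)" for \<omega>
    proof -
      have "?Q (\<Union>i. \<Gamma> i) \<omega> = (\<integral>\<^sup>+z. (\<Sum>i. indicator A0 z * indicator (\<Gamma> i) (\<omega> - {z})) \<partial>count_space \<omega>)"
        by (intro nn_integral_cong) (simp add: suminf_indicator[OF union(1), symmetric])
      also have "\<dots> = (\<Sum>i. ?Q (\<Gamma> i) \<omega>)" by (rule nn_integral_suminf) simp
      finally show ?thesis .
    qed
    then have "(\<integral>\<^sup>+\<omega>. ?Q (\<Union>i. \<Gamma> i) \<omega> \<partial>P) = (\<Sum>i. \<integral>\<^sup>+\<omega>. ?Q (\<Gamma> i) \<omega> \<partial>P)"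
      using \<Gamma> by (simp only:) (rule nn_integral_suminf, rule meas, auto)
    also have "\<dots> = emeasure (intensity T) A0 * (\<Sum>i. emeasure P (\<Gamma> i))"
      by (simp only: union.IH ennreal_suminf_cmult)
    also have "(\<Sum>i. emeasure P (\<Gamma> i)) = emeasure P (\<Union>i. \<Gamma> i)"
      by (rule suminf_emeasure[OF \<Gamma> union(1)])
    finally show ?case .
  qed
qed

text \<open>The integrand sees the configuration without the point, so on the right it is evaluated
  at the unchanged configuration. After truncation to a strip both sides are additive, continuous
  along increasing sequences and finite on indicators. They agree on rectangles, hence on measurable
  sets, hence on functions, and monotone convergence removes the truncation.\<close>

theorem mecke:
  assumes F: "(\<lambda>(\<omega>, z). F \<omega> z) \<in> borel_measurable (P \<Otimes>\<^sub>M intensity T)"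
  shows "(\<integral>\<^sup>+\<omega>. (\<integral>\<^sup>+z. F (\<omega> - {z}) z \<partial>count_space \<omega>) \<partial>P) =
    (\<integral>\<^sup>+\<omega>. (\<integral>\<^sup>+z. F \<omega> z \<partial>intensity T) \<partial>P)"
proof -
  interpret I: sigma_finite_measure "intensity T" by (rule sigma_finite_intensity)
  note F[measurable]
  have meas: "(\<lambda>\<omega>. \<integral>\<^sup>+z. H (\<omega> - {z}, z) \<partial>count_space \<omega>) \<in> borel_measurable P"
    if [measurable]: "H \<in> borel_measurable (P \<Otimes>\<^sub>M intensity T)" for H :: "(real \<times> real) set \<times> real \<times> real \<Rightarrow> ennreal"
  proof (rule measurable_campbell)
    have "(\<lambda>x. ((\<lambda>(\<omega>, z). \<omega> - {z}) x, snd x)) \<in> P \<Otimes>\<^sub>M intensity T \<rightarrow>\<^sub>M P \<Otimes>\<^sub>M intensity T"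
      by measurable
    from measurable_compose[OF this that]
    show "(\<lambda>(\<omega>, z). H (\<omega> - {z}, z)) \<in> borel_measurable (P \<Otimes>\<^sub>M intensity T)"
      by (simp add: split_beta')
  qed simp
  define L where "L n H = (\<integral>\<^sup>+\<omega>. (\<integral>\<^sup>+z. H (\<omega> - {z}, z) * indicator (strip T (real n)) z \<partial>count_space \<omega>) \<partial>P)"
    for n :: nat and H :: "(real \<times> real) set \<times> real \<times> real \<Rightarrow> ennreal"
  define R where "R n H = (\<integral>\<^sup>+\<omega>. (\<integral>\<^sup>+z. H (\<omega>, z) * indicator (strip T (real n)) z \<partial>intensity T) \<partial>P)"
    for n :: nat and H :: "(real \<times> real) set \<times> real \<times> real \<Rightarrow> ennreal"
  have measL: "(\<lambda>\<omega>. \<integral>\<^sup>+z. H (\<omega> - {z}, z) * indicator (strip T (real n)) z \<partial>count_space \<omega>) \<in> borel_measurable P"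
    if [measurable]: "H \<in> borel_measurable (P \<Otimes>\<^sub>M intensity T)" for H n
    using meas[of "\<lambda>x. H x * indicator (strip T (real n)) (snd x)"] by simp
  have measR: "(\<lambda>\<omega>. \<integral>\<^sup>+z. H (\<omega>, z) * indicator (strip T (real n)) z \<partial>intensity T) \<in> borel_measurable P"
    if [measurable]: "H \<in> borel_measurable (P \<Otimes>\<^sub>M intensity T)" for H n
    by measurable
  have measR': "(\<lambda>z. H (\<omega>, z) * indicator (strip T (real n)) z) \<in> borel_measurable (intensity T)"
    if "H \<in> borel_measurable (P \<Otimes>\<^sub>M intensity T)" "\<omega> \<in> space P"
    for H :: "_ \<Rightarrow> ennreal" and n \<omega>
  proof -
    have [measurable]: "(\<lambda>z. H (\<omega>, z)) \<in> borel_measurable (intensity T)"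
      by (rule measurable_Pair2[OF that])
    show ?thesis by (rule borel_measurable_times_ennreal) auto
  qed
  have addL: "L n (\<lambda>x. H x + H' x) = L n H + L n H'"
    if "H \<in> borel_measurable (P \<Otimes>\<^sub>M intensity T)" "H' \<in> borel_measurable (P \<Otimes>\<^sub>M intensity T)" for H H' n
    unfolding L_def using measL[OF that(1)] measL[OF that(2)]
    by (simp add: distrib_right nn_integral_add)
  have addR: "R n (\<lambda>x. H x + H' x) = R n H + R n H'"
    if "H \<in> borel_measurable (P \<Otimes>\<^sub>M intensity T)" "H' \<in> borel_measurable (P \<Otimes>\<^sub>M intensity T)" for H H' n
    unfolding R_def nn_integral_add[OF measR[OF that(1)] measR[OF that(2)], symmetric] distrib_right
    by (intro nn_integral_cong nn_integral_add measR'[OF that(1)] measR'[OF that(2)])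
  have supL: "L n (\<lambda>x. SUP i. U i x) = (SUP i. L n (U i))"
    if U: "\<And>i. U i \<in> borel_measurable (P \<Otimes>\<^sub>M intensity T)" "incseq U" for U :: "nat \<Rightarrow> _ \<Rightarrow> ennreal" and n
  proof -
    have i: "incseq (\<lambda>i. U i x * c)" for x c
      by (rule incseq_SucI) (rule mult_right_mono[OF le_funD[OF incseq_SucD[OF U(2)]]], simp)
    have "L n (\<lambda>x. SUP i. U i x) = (\<integral>\<^sup>+\<omega>. (SUP i. \<integral>\<^sup>+z. U i (\<omega> - {z}, z) * indicator (strip T (real n)) z \<partial>count_space \<omega>) \<partial>P)"
      unfolding L_def SUP_mult_right_ennreal
      by (subst nn_integral_monotone_convergence_SUP) (use i in \<open>auto simp: incseq_def le_fun_def\<close>)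
    also have "\<dots> = (SUP i. L n (U i))"
      unfolding L_def
      by (rule nn_integral_monotone_convergence_SUP[OF _ measL[OF U(1)]])
         (use i in \<open>auto simp: incseq_def le_fun_def intro!: nn_integral_mono\<close>)
    finally show ?thesis .
  qed
  have supR: "R n (\<lambda>x. SUP i. U i x) = (SUP i. R n (U i))"
    if U: "\<And>i. U i \<in> borel_measurable (P \<Otimes>\<^sub>M intensity T)" "incseq U" for U :: "nat \<Rightarrow> _ \<Rightarrow> ennreal" and n
  proof -
    have i: "incseq (\<lambda>i. U i x * c)" for x c
      by (rule incseq_SucI) (rule mult_right_mono[OF le_funD[OF incseq_SucD[OF U(2)]]], simp)
    have "R n (\<lambda>x. SUP i. U i x) = (\<integral>\<^sup>+\<omega>. (SUP i. \<integral>\<^sup>+z. U i (\<omega>, z) * indicator (strip T (real n)) z \<partial>intensity T) \<partial>P)"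
      unfolding R_def SUP_mult_right_ennreal
      by (intro nn_integral_cong nn_integral_monotone_convergence_SUP measR'[OF U(1)])
         (use i in \<open>auto simp: incseq_def le_fun_def\<close>)
    also have "\<dots> = (SUP i. R n (U i))"
      unfolding R_def
      by (rule nn_integral_monotone_convergence_SUP[OF _ measR[OF U(1)]])
         (use i in \<open>auto simp: incseq_def le_fun_def intro!: nn_integral_mono\<close>)
    finally show ?thesis .
  qed
  have rect: "L n (indicator (\<Gamma> \<times> A)) = emeasure P \<Gamma> * emeasure (intensity T) (A \<inter> strip T (real n))"
    "R n (indicator (\<Gamma> \<times> A)) = emeasure P \<Gamma> * emeasure (intensity T) (A \<inter> strip T (real n))"
    if [measurable]: "\<Gamma> \<in> sets P" "A \<in> sets (intensity T)" for \<Gamma> A n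
  proof -
    have "L n (indicator (\<Gamma> \<times> A)) =
        (\<integral>\<^sup>+\<omega>. (\<integral>\<^sup>+z. indicator (A \<inter> strip T (real n)) z * indicator \<Gamma> (\<omega> - {z}) \<partial>count_space \<omega>) \<partial>P)"
      unfolding L_def by (intro nn_integral_cong) (auto split: split_indicator)
    also have "\<dots> = emeasure (intensity T) (A \<inter> strip T (real n)) * emeasure P \<Gamma>"
      by (rule mecke_bounded_set[where b = "real n"]) auto
    finally show "L n (indicator (\<Gamma> \<times> A)) = emeasure P \<Gamma> * emeasure (intensity T) (A \<inter> strip T (real n))"
      by (simp add: mult.commute)
    have "R n (indicator (\<Gamma> \<times> A)) =
        (\<integral>\<^sup>+\<omega>. indicator \<Gamma> \<omega> * (\<integral>\<^sup>+z. indicator (A \<inter> strip T (real n)) z \<partial>intensity T) \<partial>P)"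
      unfolding R_def by (subst nn_integral_cmult[symmetric])
        (auto split: split_indicator intro!: nn_integral_cong)
    also have "\<dots> = emeasure P \<Gamma> * emeasure (intensity T) (A \<inter> strip T (real n))"
      by (subst nn_integral_multc) auto
    finally show "R n (indicator (\<Gamma> \<times> A)) = emeasure P \<Gamma> * emeasure (intensity T) (A \<inter> strip T (real n))" .
  qed
  let ?\<Omega> = "space P \<times> space (intensity T)"
  have \<Omega>: "space (P \<Otimes>\<^sub>M intensity T) = ?\<Omega>" by (simp add: space_pair_measure)
  have eq_set: "L n (indicator Q) = R n (indicator Q)" if "Q \<in> sets (P \<Otimes>\<^sub>M intensity T)" for Q n
    using Int_stable_pair_measure_generator[of P "intensity T"]
      pair_measure_closed[of P "intensity T"] that[unfolded sets_pair_measure]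
  proof (induction rule: sigma_sets_induct_disjoint)
    case (basic Q)
    then show ?case using rect by auto
  next
    case empty
    then show ?case by (simp add: L_def R_def)
  next
    case (compl Q)
    then have Q[measurable]: "Q \<in> sets (P \<Otimes>\<^sub>M intensity T)" by (simp add: sets_pair_measure)
    have sub: "Q \<subseteq> ?\<Omega>" using sets.sets_into_space[OF Q] by (simp add: \<Omega>)
    have Q': "?\<Omega> - Q \<in> sets (P \<Otimes>\<^sub>M intensity T)" using sets.compl_sets[OF Q] by (simp add: \<Omega>)
    have spl: "(\<lambda>x. indicator Q x + indicator (?\<Omega> - Q) x :: ennreal) = indicator (space P \<times> space (intensity T))"
      using sub by (auto simp: fun_eq_iff split: split_indicator)
    have le: "L n (indicator Q) \<le> L n (indicator (space P \<times> space (intensity T)))"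
      unfolding L_def using sub by (intro nn_integral_mono mult_right_mono) (auto split: split_indicator)
    also have "\<dots> < \<top>"
      using rect(1)[OF sets.top sets.top, of n] emeasure_strip_finite[of T "real n"]
        emeasure_mono[of "space (intensity T) \<inter> strip T (real n)" "strip T (real n)" "intensity T"]
      by (auto simp: emeasure_space_1 simp del: space_P intro: le_less_trans)
    finally have fin: "L n (indicator Q) < \<top>" .
    have "L n (indicator Q) + L n (indicator (?\<Omega> - Q)) = L n (indicator (space P \<times> space (intensity T)))"
      unfolding spl[symmetric] using Q Q' by (intro addL[symmetric]) auto
    also have "\<dots> = R n (indicator (space P \<times> space (intensity T)))"
      using rect[OF sets.top sets.top, of n] by simp
    also have "\<dots> = R n (indicator Q) + R n (indicator (?\<Omega> - Q))"
      unfolding spl[symmetric] using Q Q' by (intro addR) auto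
    finally show ?case
      unfolding compl.IH[symmetric] using fin by (auto simp: ennreal_add_left_cancel)
  next
    case (union Q)
    then have Q: "Q i \<in> sets (P \<Otimes>\<^sub>M intensity T)" for i by (auto simp: sets_pair_measure)
    \<comment> \<open>Partial sums turn the disjoint union into an increasing limit, so that
      additivity and continuity along increasing sequences are enough.\<close>
    define U :: "nat \<Rightarrow> _ \<Rightarrow> ennreal" where "U m x = (\<Sum>i<m. indicator (Q i) x)" for m x
    have Um [measurable]: "U m \<in> borel_measurable (P \<Otimes>\<^sub>M intensity T)" for m
      unfolding U_def using Q by measurable
    have inc: "incseq U"
      unfolding U_def by (auto simp: incseq_def le_fun_def intro!: sum_mono2)
    have "indicator (\<Union>i. Q i) = (\<lambda>x. SUP m. U m x)"
    proof
      fix x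
      show "indicator (\<Union>i. Q i) x = (SUP m. U m x)"
        unfolding U_def suminf_indicator[OF union(1), symmetric] by (rule suminf_eq_SUP)
    qed
    moreover have "L n (U m) = R n (U m)" for m
    proof (induction m)
      case 0
      then show ?case by (simp add: U_def L_def R_def)
    next
      case (Suc m)
      have "U (Suc m) = (\<lambda>x. U m x + indicator (Q m) x)" unfolding U_def by (rule ext) simp
      then show ?case using Q[of m] by (simp add: addL addR Suc union.IH)
    qed
    ultimately show ?case by (simp add: supL[OF Um inc] supR[OF Um inc])
  qed
  have eq: "L n H = R n H" if "H \<in> borel_measurable (P \<Otimes>\<^sub>M intensity T)" for H n
    using that
  proof (induction rule: borel_measurable_induct)
    case (cong f g)
    have "f (\<omega> - {z}, z) = g (\<omega> - {z}, z)" if "\<omega> \<in> space P" "z \<in> space (count_space \<omega>)" for \<omega> z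
    proof (rule cong(3))
      have "z \<in> space (intensity T)"
        using that configurations_subset[of \<omega> T] unfolding space_intensity by auto
      then show "(\<omega> - {z}, z) \<in> space (P \<Otimes>\<^sub>M intensity T)"
        using that configurations_remove[of \<omega> T "{z}"] unfolding \<Omega> by simp
    qed
    then have "L n f = L n g"
      unfolding L_def by (intro nn_integral_cong) (simp only:)
    moreover have "f (\<omega>, z) = g (\<omega>, z)" if "\<omega> \<in> space P" "z \<in> space (intensity T)" for \<omega> z
      by (rule cong(3)) (use that in \<open>simp add: \<Omega>\<close>)
    then have "R n f = R n g"
      unfolding R_def by (intro nn_integral_cong) (simp only:)
    ultimately have "L n f = L n g" "R n f = R n g" .
    then show ?case using cong by simp
  next
    case (set A)
    then show ?case by (rule eq_set)
  next
    case (mult u c)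
    have "L n (\<lambda>x. c * u x) = c * L n u"
      unfolding L_def using measL[OF mult(2)] by (simp add: mult.assoc nn_integral_cmult)
    moreover have "R n (\<lambda>x. c * u x) = c * R n u"
      unfolding R_def nn_integral_cmult[OF measR[OF mult(2)], symmetric] mult.assoc
      by (intro nn_integral_cong nn_integral_cmult measR'[OF mult(2)])
    ultimately show ?case by (simp add: mult.IH)
  next
    case (add u v)
    then show ?case by (simp add: addL addR)
  next
    case (seq U)
    have "(SUP i. U i) = (\<lambda>x. SUP i. U i x)" by (rule ext) (rule SUP_apply)
    then show ?case using supL[OF seq(1,3)] supR[OF seq(1,3)] seq by simp
  qed
  let ?F = "\<lambda>x. F (fst x) (snd x)"
  have mF: "?F \<in> borel_measurable (P \<Otimes>\<^sub>M intensity T)" using F by (simp add: split_beta')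
  have "(\<integral>\<^sup>+\<omega>. (\<integral>\<^sup>+z. F (\<omega> - {z}) z \<partial>count_space \<omega>) \<partial>P) =
      (\<integral>\<^sup>+\<omega>. (SUP n::nat. \<integral>\<^sup>+z. F (\<omega> - {z}) z * indicator (strip T (real n)) z \<partial>count_space \<omega>) \<partial>P)"
    by (intro nn_integral_cong nn_integral_SUP_strip) simp
  also have "\<dots> = (SUP n. L n ?F)"
    unfolding L_def fst_conv snd_conv
    by (rule nn_integral_monotone_convergence_SUP)
       (use measL[OF mF] in \<open>auto simp: incseq_def le_fun_def intro!: nn_integral_mono split: split_indicator\<close>)
  also have "\<dots> = (SUP n. R n ?F)" by (simp add: eq[OF mF])
  also have "\<dots> = (\<integral>\<^sup>+\<omega>. (SUP n::nat. \<integral>\<^sup>+z. F \<omega> z * indicator (strip T (real n)) z \<partial>intensity T) \<partial>P)"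
    unfolding R_def fst_conv snd_conv
    by (rule nn_integral_monotone_convergence_SUP[symmetric])
       (use measR[OF mF] in \<open>auto simp: incseq_def le_fun_def intro!: nn_integral_mono split: split_indicator\<close>)
  also have "\<dots> = (\<integral>\<^sup>+\<omega>. (\<integral>\<^sup>+z. F \<omega> z \<partial>intensity T) \<partial>P)"
  proof (rule nn_integral_cong)
    fix \<omega> assume \<omega>: "\<omega> \<in> space P"
    have "(SUP n::nat. \<integral>\<^sup>+z. F \<omega> z * indicator (strip T (real n)) z \<partial>intensity T) =
        (\<integral>\<^sup>+z. (SUP n::nat. F \<omega> z * indicator (strip T (real n)) z) \<partial>intensity T)"
      by (rule nn_integral_monotone_convergence_SUP[symmetric])
         (use measR'[OF mF \<omega>] in \<open>auto simp: incseq_def le_fun_def split: split_indicator\<close>)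
    also have "\<dots> = (\<integral>\<^sup>+z. F \<omega> z \<partial>intensity T)"
    proof (rule nn_integral_cong)
      fix z assume "z \<in> space (intensity T)"
      then obtain n :: nat where n: "z \<in> strip T (real n)"
        using UN_strip[of T] unfolding space_intensity by blast
      show "(SUP n::nat. F \<omega> z * indicator (strip T (real n)) z) = F \<omega> z"
      proof (rule antisym)
        show "F \<omega> z \<le> (SUP n::nat. F \<omega> z * indicator (strip T (real n)) z)"
          using n by (intro SUP_upper2[of n]) auto
      qed (auto intro!: SUP_least split: split_indicator)
    qed
    finally show "(SUP n::nat. \<integral>\<^sup>+z. F \<omega> z * indicator (strip T (real n)) z \<partial>intensity T) =
      (\<integral>\<^sup>+z. F \<omega> z \<partial>intensity T)" .
  qed
  finally show ?thesis .
qed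

end

section \<open>The thinned process as a least fixed point\<close>

text \<open>As \<open>\<phi> \<ge> 0\<close>, acceptance of points is a monotone operator. The following are its iterates from
  below, whose limit is the minimal solution; it needs no ordering of the points by time.\<close>

primrec rate_approx :: "(real \<Rightarrow> ennreal) \<Rightarrow> ennreal \<Rightarrow> nat \<Rightarrow> real list \<Rightarrow> (real \<times> real) set \<Rightarrow> real \<Rightarrow> ennreal" where
  "rate_approx \<phi> m 0 vs \<omega> t = 0"
| "rate_approx \<phi> m (Suc k) vs \<omega> t = m + (\<Sum>v\<leftarrow>vs. if v < t then \<phi> (t - v) else 0) +
     (\<integral>\<^sup>+z. (if fst z < t \<and> ennreal (snd z) \<le> rate_approx \<phi> m k vs \<omega> (fst z) then \<phi> (t - fst z) else 0)
        \<partial>count_space \<omega>)"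

definition rate_limit :: "(real \<Rightarrow> ennreal) \<Rightarrow> ennreal \<Rightarrow> real list \<Rightarrow> (real \<times> real) set \<Rightarrow> real \<Rightarrow> ennreal" where
  "rate_limit \<phi> m vs \<omega> t = (SUP k. rate_approx \<phi> m k vs \<omega> t)"

text \<open>Acceptance is demanded at a finite stage and not in the limit: the indicators of the
  stages then increase to the indicator of this set, as monotone convergence requires. A mark that
  merely equals an unattained supremum is left out.\<close>

definition accepted_points :: "(real \<Rightarrow> ennreal) \<Rightarrow> ennreal \<Rightarrow> real list \<Rightarrow> (real \<times> real) set \<Rightarrow> (real \<times> real) set" where
  "accepted_points \<phi> m vs \<omega> = {z\<in>\<omega>. \<exists>k. ennreal (snd z) \<le> rate_approx \<phi> m k vs \<omega> (fst z)}"

section \<open>Monotonicity, predictability and the exchange of a point for a shift\<close>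

lemma accepted_points_subset: "accepted_points \<phi> m vs \<omega> \<subseteq> \<omega>"
  by (auto simp: accepted_points_def)

lemma rate_approx_Suc_mono: "rate_approx \<phi> m k vs \<omega> t \<le> rate_approx \<phi> m (Suc k) vs \<omega> t"
proof (induction k arbitrary: t)
  case (Suc k)
  have "(\<integral>\<^sup>+z. (if fst z < t \<and> ennreal (snd z) \<le> rate_approx \<phi> m k vs \<omega> (fst z) then \<phi> (t - fst z) else 0) \<partial>count_space \<omega>)
     \<le> (\<integral>\<^sup>+z. (if fst z < t \<and> ennreal (snd z) \<le> rate_approx \<phi> m (Suc k) vs \<omega> (fst z) then \<phi> (t - fst z) else 0) \<partial>count_space \<omega>)"
    by (rule nn_integral_mono) (use order_trans[OF _ Suc] in \<open>simp del: rate_approx.simps\<close>)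
  then show ?case unfolding rate_approx.simps(2)[of \<phi> m k] rate_approx.simps(2)[of \<phi> m "Suc k"] by (rule add_left_mono)
qed simp

lemma incseq_rate_approx: "incseq (\<lambda>k. rate_approx \<phi> m k vs \<omega> t)"
  by (rule incseq_SucI) (rule rate_approx_Suc_mono)

lemma rate_approx_mono: "k \<le> k' \<Longrightarrow> rate_approx \<phi> m k vs \<omega> t \<le> rate_approx \<phi> m k' vs \<omega> t"
  using incseq_rate_approx by (rule incseqD)

text \<open>Stage \<open>k + 1\<close> at time \<open>t\<close> consults only points and shifts
  strictly before \<open>t\<close>, and stage \<open>k\<close> only at the times of such points.
  This allows both the removal of the point under test and the addition of a shift at the time of
  evaluation.\<close>

lemma rate_approx_predictable:
  assumes "\<omega> \<inter> {z. fst z < t} = \<omega>' \<inter> {z. fst z < t}"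
    and "filter (\<lambda>v. v < t) vs = filter (\<lambda>v. v < t) vs'"
  shows "rate_approx \<phi> m k vs \<omega> t = rate_approx \<phi> m k vs' \<omega>' t"
  using assms
proof (induction k arbitrary: t)
  case (Suc k)
  have 1: "(\<Sum>v\<leftarrow>us. if v < t then \<phi> (t - v) else 0) = (\<Sum>v\<leftarrow>filter (\<lambda>v. v < t) us. \<phi> (t - v))" for us
    by (induction us) auto
  have IH: "rate_approx \<phi> m k vs \<omega> s = rate_approx \<phi> m k vs' \<omega>' s" if "s < t" for s
  proof (rule Suc.IH)
    show "\<omega> \<inter> {z. fst z < s} = \<omega>' \<inter> {z. fst z < s}"
    proof -
      have "w \<inter> {z. fst z < s} = w \<inter> {z. fst z < t} \<inter> {z. fst z < s}" for w :: "(real \<times> real) set"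
        using that by auto
      then show ?thesis using Suc.prems(1) by metis
    qed
    have "filter (\<lambda>v. v < s) us = filter (\<lambda>v. v < s) (filter (\<lambda>v. v < t) us)" for us
      using that by (auto intro!: filter_cong)
    then show "filter (\<lambda>v. v < s) vs = filter (\<lambda>v. v < s) vs'"
      using Suc.prems(2) by metis
  qed
  let ?f = "\<lambda>us \<omega> z. if fst z < t \<and> ennreal (snd z) \<le> rate_approx \<phi> m k us \<omega> (fst z) then \<phi> (t - fst z) else 0"
  have "(\<integral>\<^sup>+z. ?f vs \<omega> z \<partial>count_space \<omega>) = (\<integral>\<^sup>+z. ?f vs \<omega> z \<partial>count_space (\<omega> \<inter> {z. fst z < t}))"
    by (rule nn_integral_count_space_eq) auto
  also have "\<dots> = (\<integral>\<^sup>+z. ?f vs' \<omega>' z \<partial>count_space (\<omega>' \<inter> {z. fst z < t}))"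
    unfolding Suc.prems(1) by (rule nn_integral_cong) (simp add: IH)
  also have "\<dots> = (\<integral>\<^sup>+z. ?f vs' \<omega>' z \<partial>count_space \<omega>')"
    by (rule nn_integral_count_space_eq) auto
  finally show ?case by (simp only: rate_approx.simps(2) 1 Suc.prems(2))
qed simp

lemma rate_approx_append_shift: "t \<le> s \<Longrightarrow> rate_approx \<phi> m k (vs @ [s]) \<omega> t = rate_approx \<phi> m k vs \<omega> t"
  by (rule rate_approx_predictable) auto

lemma rate_approx_remove_point: "t \<le> fst z \<Longrightarrow> rate_approx \<phi> m k vs (\<omega> - {z}) t = rate_approx \<phi> m k vs \<omega> t"
  by (rule rate_approx_predictable) auto

lemma rate_limit_append_shift: "t \<le> s \<Longrightarrow> rate_limit \<phi> m (vs @ [s]) \<omega> t = rate_limit \<phi> m vs \<omega> t"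
  by (simp add: rate_limit_def rate_approx_append_shift)

lemma rate_limit_before_shifts:
  assumes "\<And>v. v \<in> set vs \<Longrightarrow> t \<le> v"
  shows "rate_limit \<phi> m vs \<omega> t = rate_limit \<phi> m [] \<omega> t"
proof -
  have "filter (\<lambda>v. v < t) vs = []" using assms by (auto simp: filter_empty_conv not_less)
  then have "rate_approx \<phi> m k vs \<omega> t = rate_approx \<phi> m k [] \<omega> t" for k by (intro rate_approx_predictable) auto
  then show ?thesis by (simp add: rate_limit_def)
qed

text \<open>Monotone convergence passes to the limit in the iteration, so the limit solves the
  intensity equation whose jumps are the accepted points.\<close>

lemma rate_limit_eq:
  "rate_limit \<phi> m vs \<omega> t = m + (\<Sum>v\<leftarrow>vs. if v < t then \<phi> (t - v) else 0) +
     (\<integral>\<^sup>+z. (if fst z < t \<and> z \<in> accepted_points \<phi> m vs \<omega> then \<phi> (t - fst z) else 0) \<partial>count_space \<omega>)"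
proof -
  let ?f = "\<lambda>k z. if fst z < t \<and> ennreal (snd z) \<le> rate_approx \<phi> m k vs \<omega> (fst z) then \<phi> (t - fst z) else 0"
  have inc: "incseq ?f"
    by (rule incseq_SucI) (use order_trans[OF _ rate_approx_Suc_mono] in \<open>simp add: le_fun_def del: rate_approx.simps\<close>)
  have sup: "(SUP k. ?f k z) = (if fst z < t \<and> z \<in> accepted_points \<phi> m vs \<omega> then \<phi> (t - fst z) else 0)"
    if "z \<in> space (count_space \<omega>)" for z
  proof (cases "fst z < t \<and> z \<in> accepted_points \<phi> m vs \<omega>")
    case True
    then obtain k where "ennreal (snd z) \<le> rate_approx \<phi> m k vs \<omega> (fst z)" by (auto simp: accepted_points_def)
    with True have "\<phi> (t - fst z) \<le> (SUP k. ?f k z)" by (intro SUP_upper2[of k]) auto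
    moreover have "(SUP k. ?f k z) \<le> \<phi> (t - fst z)" by (rule SUP_least) auto
    ultimately show ?thesis using True by auto
  next
    case False
    then have "?f k z = 0" for k using that by (auto simp: accepted_points_def)
    then have "(SUP k. ?f k z) = (SUP k::nat. 0)" by (simp only:)
    then show ?thesis unfolding if_not_P[OF False] by simp
  qed
  have "rate_limit \<phi> m vs \<omega> t = (SUP k. rate_approx \<phi> m (Suc k) vs \<omega> t)"
    unfolding rate_limit_def
    by (rule antisym) (auto intro!: SUP_mono intro: rate_approx_Suc_mono simp del: rate_approx.simps)
  also have "\<dots> = m + (\<Sum>v\<leftarrow>vs. if v < t then \<phi> (t - v) else 0) + (SUP k. \<integral>\<^sup>+z. ?f k z \<partial>count_space \<omega>)"
    unfolding rate_approx.simps(2) by (rule ennreal_SUP_add_right[symmetric]) simp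
  also have "(SUP k. \<integral>\<^sup>+z. ?f k z \<partial>count_space \<omega>) = (\<integral>\<^sup>+z. (SUP k. ?f k z) \<partial>count_space \<omega>)"
    by (rule nn_integral_monotone_convergence_SUP[OF inc, symmetric]) simp
  also have "\<dots> = (\<integral>\<^sup>+z. (if fst z < t \<and> z \<in> accepted_points \<phi> m vs \<omega> then \<phi> (t - fst z) else 0) \<partial>count_space \<omega>)"
    by (rule nn_integral_cong) (rule sup)
  finally show ?thesis .
qed

text \<open>After its time an accepted point adds \<open>\<phi> (t - fst z)\<close> to the
  intensity, just as a shift at \<open>fst z\<close> does. The two iterations differ only by a
  delay: the shift contributes from the first stage on, the point once some stage \<open>k0\<close>
  has accepted it. The unions over all stages therefore coincide.\<close>

lemma accepted_points_remove_point:
  assumes z: "z \<in> accepted_points \<phi> m vs \<omega>"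
  shows "accepted_points \<phi> m (vs @ [fst z]) (\<omega> - {z}) = accepted_points \<phi> m vs \<omega> - {z}"
proof -
  have z\<omega>: "z \<in> \<omega>" using z by (simp add: accepted_points_def)
  obtain k0 where k0: "ennreal (snd z) \<le> rate_approx \<phi> m k0 vs \<omega> (fst z)" using z by (auto simp: accepted_points_def)
  let ?vs = "vs @ [fst z]" and ?\<omega> = "\<omega> - {z}"
  let ?S = "\<lambda>t. \<Sum>v\<leftarrow>vs. if v < t then \<phi> (t - v) else 0"
  have up: "rate_approx \<phi> m k vs \<omega> t \<le> rate_approx \<phi> m k ?vs ?\<omega> t" for k t
  proof (induction k arbitrary: t)
    case (Suc k)
    let ?f = "\<lambda>us \<omega> x. if fst x < t \<and> ennreal (snd x) \<le> rate_approx \<phi> m k us \<omega> (fst x) then \<phi> (t - fst x) else 0"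
    have "rate_approx \<phi> m (Suc k) vs \<omega> t = m + ?S t + (?f vs \<omega> z + (\<integral>\<^sup>+x. ?f vs \<omega> x \<partial>count_space ?\<omega>))"
      unfolding rate_approx.simps(2) by (subst nn_integral_remove_point[OF z\<omega>]) (rule refl)
    also have "\<dots> \<le> m + ?S t + ((if fst z < t then \<phi> (t - fst z) else 0) + (\<integral>\<^sup>+x. ?f ?vs ?\<omega> x \<partial>count_space ?\<omega>))"
      by (intro add_left_mono add_mono nn_integral_mono)
         (use order_trans[OF _ Suc.IH] in \<open>simp_all del: rate_approx.simps\<close>)
    also have "\<dots> = rate_approx \<phi> m (Suc k) ?vs ?\<omega> t" by (simp add: ac_simps)
    finally show ?case .
  qed simp
  have down: "rate_approx \<phi> m k ?vs ?\<omega> t \<le> rate_approx \<phi> m (k + k0) vs \<omega> t" for k t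
  proof (induction k arbitrary: t)
    case (Suc k)
    let ?f = "\<lambda>k us \<omega> x. if fst x < t \<and> ennreal (snd x) \<le> rate_approx \<phi> m k us \<omega> (fst x) then \<phi> (t - fst x) else 0"
    have "rate_approx \<phi> m (Suc k) ?vs ?\<omega> t = m + ?S t + ((if fst z < t then \<phi> (t - fst z) else 0) + (\<integral>\<^sup>+x. ?f k ?vs ?\<omega> x \<partial>count_space ?\<omega>))"
      by (simp add: ac_simps)
    also have "\<dots> \<le> m + ?S t + (?f (k + k0) vs \<omega> z + (\<integral>\<^sup>+x. ?f (k + k0) vs \<omega> x \<partial>count_space ?\<omega>))"
      by (intro add_left_mono add_mono nn_integral_mono)
         (use order_trans[OF _ Suc.IH] order_trans[OF k0 rate_approx_mono[of k0 "k + k0"]] in \<open>simp_all del: rate_approx.simps\<close>)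
    also have "\<dots> = rate_approx \<phi> m (Suc k + k0) vs \<omega> t"
      by (simp only: add_Suc rate_approx.simps(2) nn_integral_remove_point[OF z\<omega>, of "?f (k + k0) vs \<omega>"])
    finally show ?case .
  qed simp
  show ?thesis
  proof (intro equalityI subsetI)
    fix x assume "x \<in> accepted_points \<phi> m ?vs ?\<omega>"
    then obtain k where "x \<in> ?\<omega>" "ennreal (snd x) \<le> rate_approx \<phi> m k ?vs ?\<omega> (fst x)" by (auto simp: accepted_points_def)
    then show "x \<in> accepted_points \<phi> m vs \<omega> - {z}" using order_trans[OF _ down] by (auto simp: accepted_points_def)
  next
    fix x assume "x \<in> accepted_points \<phi> m vs \<omega> - {z}"
    then obtain k where "x \<in> ?\<omega>" "ennreal (snd x) \<le> rate_approx \<phi> m k vs \<omega> (fst x)" by (auto simp: accepted_points_def)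
    then show "x \<in> accepted_points \<phi> m ?vs ?\<omega>" using order_trans[OF _ up] by (auto simp: accepted_points_def)
  qed
qed

section \<open>Joint measurability and the thinning formula\<close>

abbreviation vecs :: "(nat \<Rightarrow> real) measure" where
  "vecs \<equiv> \<Pi>\<^sub>M i\<in>UNIV. borel"

locale hawkes_kernel = canonical_poisson +
  fixes \<phi> :: "real \<Rightarrow> ennreal" and m :: ennreal
  assumes measurable_\<phi> [measurable]: "\<phi> \<in> borel_measurable borel"
begin

abbreviation "\<Lambda> \<equiv> rate_approx \<phi> m"
abbreviation "\<Lambda>' \<equiv> rate_limit \<phi> m"
abbreviation "S \<equiv> accepted_points \<phi> m"

text \<open>Shift times, configuration and evaluation time have to vary together: in the recursion
  the time of a removed point becomes a shift time and then an integration variable. The first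
  \<open>n\<close> coordinates of a sequence serve as the list.\<close>

lemma measurable_rate_approx_joint:
  "(\<lambda>w. \<Lambda> k (map (fst w) [0..<n]) (fst (snd w)) (snd (snd w))) \<in> borel_measurable (vecs \<Otimes>\<^sub>M P \<Otimes>\<^sub>M borel)"
proof (induction k)
  case (Suc k)
  let ?W = "vecs \<Otimes>\<^sub>M P \<Otimes>\<^sub>M borel"
  have c: "(\<lambda>w. fst w i) \<in> borel_measurable ?W" for i
    by (rule measurable_compose[OF measurable_fst]) (rule measurable_component_singleton, simp)
  have sum: "(\<lambda>w. \<Sum>v\<leftarrow>map (fst w) is. if v < snd (snd w) then \<phi> (snd (snd w) - v) else 0) \<in> borel_measurable ?W" for "is"
    using c by (induction "is") auto
  have "(\<lambda>x. (fst (fst x), fst (snd (fst x)), fst (snd x))) \<in> ?W \<Otimes>\<^sub>M intensity T \<rightarrow>\<^sub>M ?W"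
    by measurable
  from measurable_compose[OF this Suc.IH]
  have [measurable]: "(\<lambda>x. \<Lambda> k (map (fst (fst x)) [0..<n]) (fst (snd (fst x))) (fst (snd x))) \<in> borel_measurable (?W \<Otimes>\<^sub>M intensity T)"
    by simp
  have "(\<lambda>x. if fst (snd x) < snd (snd (fst x)) \<and>
        ennreal (snd (snd x)) \<le> \<Lambda> k (map (fst (fst x)) [0..<n]) (fst (snd (fst x))) (fst (snd x))
      then \<phi> (snd (snd (fst x)) - fst (snd x)) else 0) \<in> borel_measurable (?W \<Otimes>\<^sub>M intensity T)"
    by measurable
  then have "(\<lambda>(w, z). if fst z < snd (snd w) \<and> ennreal (snd z) \<le> \<Lambda> k (map (fst w) [0..<n]) (fst (snd w)) (fst z)
      then \<phi> (snd (snd w) - fst z) else 0) \<in> borel_measurable (?W \<Otimes>\<^sub>M intensity T)"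
    by (simp add: split_beta')
  from measurable_campbell[OF _ this, of "\<lambda>w. fst (snd w)"]
  have "(\<lambda>w. \<integral>\<^sup>+z. (if fst z < snd (snd w) \<and> ennreal (snd z) \<le> \<Lambda> k (map (fst w) [0..<n]) (fst (snd w)) (fst z)
      then \<phi> (snd (snd w) - fst z) else 0) \<partial>count_space (fst (snd w))) \<in> borel_measurable ?W"
    by measurable
  then show ?case unfolding rate_approx.simps(2) using sum by (intro borel_measurable_add) auto
qed simp

lemma measurable_rate_approx:
  assumes "\<And>i. i < n \<Longrightarrow> X i \<in> borel_measurable W" "f \<in> W \<rightarrow>\<^sub>M P" "t \<in> borel_measurable W"
  shows "(\<lambda>w. \<Lambda> k (map (\<lambda>i. X i w) [0..<n]) (f w) (t w)) \<in> borel_measurable W"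
proof -
  have "(\<lambda>w. ((\<lambda>i. if i < n then X i w else 0), f w, t w)) \<in> W \<rightarrow>\<^sub>M vecs \<Otimes>\<^sub>M P \<Otimes>\<^sub>M borel"
  proof (intro measurable_Pair measurable_PiM_single' assms(2,3))
    show "(\<lambda>w. if i < n then X i w else 0) \<in> borel_measurable W" for i
      using assms(1) by (cases "i < n") auto
  qed (simp add: extensional_def)
  from measurable_compose[OF this measurable_rate_approx_joint[of k n]]
  have "(\<lambda>w. \<Lambda> k (map (\<lambda>i. if i < n then X i w else 0) [0..<n]) (f w) (t w)) \<in> borel_measurable W"
    by simp
  moreover have "map (\<lambda>i. if i < n then X i w else 0) [0..<n] = map (\<lambda>i. X i w) [0..<n]" for w
    by (rule map_cong) auto
  ultimately show ?thesis by (simp only:)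
qed

lemma measurable_rate_limit:
  assumes "\<And>i. i < n \<Longrightarrow> X i \<in> borel_measurable W" "f \<in> W \<rightarrow>\<^sub>M P" "t \<in> borel_measurable W"
  shows "(\<lambda>w. \<Lambda>' (map (\<lambda>i. X i w) [0..<n]) (f w) (t w)) \<in> borel_measurable W"
  unfolding rate_limit_def using measurable_rate_approx[OF assms] by (intro borel_measurable_SUP) auto

lemma measurable_accepted_points:
  assumes "\<And>i. i < n \<Longrightarrow> X i \<in> borel_measurable W" and f: "f \<in> W \<rightarrow>\<^sub>M P" and z: "z \<in> borel_measurable W"
  shows "Measurable.pred W (\<lambda>w. z w \<in> S (map (\<lambda>i. X i w) [0..<n]) (f w))"
proof -
  have [measurable]: "(\<lambda>w. fst (z w)) \<in> borel_measurable W" "(\<lambda>w. snd (z w)) \<in> borel_measurable W"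
    using measurable_compose[OF z, of fst borel] measurable_compose[OF z, of snd borel]
    by (simp_all add: borel_prod[symmetric])
  note measurable_rate_approx[OF assms(1) f, measurable]
  note measurable_mem_configuration[OF f z, measurable]
  show ?thesis unfolding accepted_points_def mem_Collect_eq by measurable
qed

lemma nn_integral_below: "(\<integral>\<^sup>+\<theta>\<in>{0..}. (if ennreal \<theta> \<le> c then 1 else 0) \<partial>lborel) = c"
proof (cases c)
  case (real r)
  have "(\<integral>\<^sup>+\<theta>\<in>{0..}. (if ennreal \<theta> \<le> c then 1 else 0) \<partial>lborel) = (\<integral>\<^sup>+\<theta>. indicator {0..r} \<theta> \<partial>lborel)"
    using real by (intro nn_integral_cong) (auto split: split_indicator)
  then show ?thesis using real by simp
next
  case top
  have "emeasure lborel {0::real..} = \<top>"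
  proof -
    have "of_nat n \<le> emeasure lborel {0::real..}" for n :: nat
    proof -
      have "of_nat n = emeasure lborel {0..real n}" by (simp add: ennreal_of_nat_eq_real_of_nat)
      also have "\<dots> \<le> emeasure lborel {0::real..}" by (rule emeasure_mono) auto
      finally show ?thesis .
    qed
    then show ?thesis
      by (metis ennreal_Ex_less_of_nat less_top not_le)
  qed
  then show ?thesis using top by simp
qed

lemma nn_integral_rate:
  assumes G[measurable]: "G \<in> borel_measurable borel" and c[measurable]: "c \<in> borel_measurable borel"
  shows "(\<integral>\<^sup>+z. (if ennreal (snd z) \<le> c (fst z) then G (fst z) else 0) \<partial>intensity T) =
    (\<integral>\<^sup>+s\<in>{0..T}. c s * G s \<partial>lborel)"
proof -
  have "(\<integral>\<^sup>+z. (if ennreal (snd z) \<le> c (fst z) then G (fst z) else 0) \<partial>intensity T) =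
    (\<integral>\<^sup>+s\<in>{0..T}. (\<integral>\<^sup>+\<theta>\<in>{0..}. (if ennreal \<theta> \<le> c s then G s else 0) \<partial>lborel) \<partial>lborel)"
    by (subst nn_integral_intensity) (measurable, simp only: fst_conv snd_conv)
  also have "\<dots> = (\<integral>\<^sup>+s\<in>{0..T}. c s * G s \<partial>lborel)"
  proof (intro nn_integral_cong arg_cong2[where f = "(*)"] refl)
    fix s
    have "(\<integral>\<^sup>+\<theta>\<in>{0..}. (if ennreal \<theta> \<le> c s then G s else 0) \<partial>lborel) =
        (\<integral>\<^sup>+\<theta>. G s * ((if ennreal \<theta> \<le> c s then 1 else 0) * indicator {0..} \<theta>) \<partial>lborel)"
      by (intro nn_integral_cong) (auto split: split_indicator)
    also have "\<dots> = G s * (\<integral>\<^sup>+\<theta>\<in>{0..}. (if ennreal \<theta> \<le> c s then 1 else 0) \<partial>lborel)"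
      by (rule nn_integral_cmult) measurable
    also have "\<dots> = c s * G s" unfolding nn_integral_below by (rule mult.commute)
    finally show "(\<integral>\<^sup>+\<theta>\<in>{0..}. (if ennreal \<theta> \<le> c s then G s else 0) \<partial>lborel) = c s * G s" .
  qed
  finally show ?thesis .
qed

lemma measurable_rate_approx_const:
  "(\<lambda>(\<omega>, s). \<Lambda> k vs \<omega> s) \<in> borel_measurable (P \<Otimes>\<^sub>M borel)"
  "(\<lambda>(\<omega>, s). \<Lambda>' vs \<omega> s) \<in> borel_measurable (P \<Otimes>\<^sub>M borel)"
proof -
  have "map (\<lambda>i. vs ! i) [0..<length vs] = vs" by (rule map_nth)
  then show "(\<lambda>(\<omega>, s). \<Lambda> k vs \<omega> s) \<in> borel_measurable (P \<Otimes>\<^sub>M borel)"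
    "(\<lambda>(\<omega>, s). \<Lambda>' vs \<omega> s) \<in> borel_measurable (P \<Otimes>\<^sub>M borel)"
    using measurable_rate_approx[of "length vs" "\<lambda>i w. vs ! i" "P \<Otimes>\<^sub>M borel" fst snd k]
      measurable_rate_limit[of "length vs" "\<lambda>i w. vs ! i" "P \<Otimes>\<^sub>M borel" fst snd]
    by (simp_all add: split_beta')
qed

text \<open>Mecke's formula integrates out the mark, leaving the intensity.\<close>

lemma thinning_formula_approx:
  assumes G: "(\<lambda>(\<omega>, s). G \<omega> s) \<in> borel_measurable (P \<Otimes>\<^sub>M borel)"
  shows "(\<integral>\<^sup>+\<omega>. (\<integral>\<^sup>+z. (if ennreal (snd z) \<le> \<Lambda> k vs \<omega> (fst z) then G (\<omega> - {z}) (fst z) else 0) \<partial>count_space \<omega>) \<partial>P) =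
    (\<integral>\<^sup>+s\<in>{0..T}. (\<integral>\<^sup>+\<omega>. \<Lambda> k vs \<omega> s * G \<omega> s \<partial>P) \<partial>lborel)"
proof -
  have "(\<lambda>x. (fst x, fst (snd x))) \<in> P \<Otimes>\<^sub>M intensity T \<rightarrow>\<^sub>M P \<Otimes>\<^sub>M borel" by measurable
  from measurable_compose[OF this G] measurable_compose[OF this measurable_rate_approx_const(1)[of k vs]]
  have [measurable]: "(\<lambda>x. G (fst x) (fst (snd x))) \<in> borel_measurable (P \<Otimes>\<^sub>M intensity T)"
    "(\<lambda>x. \<Lambda> k vs (fst x) (fst (snd x))) \<in> borel_measurable (P \<Otimes>\<^sub>M intensity T)"
    by simp_all
  have sec [measurable]: "(\<lambda>s. G \<omega> s) \<in> borel_measurable borel" "(\<lambda>s. \<Lambda> k vs \<omega> s) \<in> borel_measurable borel"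
    if "\<omega> \<in> space P" for \<omega>
    using measurable_Pair2[OF G that] measurable_Pair2[OF measurable_rate_approx_const(1)[of k vs] that] by simp_all
  \<comment> \<open>The test for \<open>z\<close> depends only on what lies strictly before
    \<open>fst z\<close>, so it may be evaluated without \<open>z\<close>. This is the form to which
    Mecke's formula applies.\<close>
  have "(\<integral>\<^sup>+\<omega>. (\<integral>\<^sup>+z. (if ennreal (snd z) \<le> \<Lambda> k vs \<omega> (fst z) then G (\<omega> - {z}) (fst z) else 0) \<partial>count_space \<omega>) \<partial>P) =
     (\<integral>\<^sup>+\<omega>. (\<integral>\<^sup>+z. (if ennreal (snd z) \<le> \<Lambda> k vs (\<omega> - {z}) (fst z) then G (\<omega> - {z}) (fst z) else 0) \<partial>count_space \<omega>) \<partial>P)"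
    by (simp add: rate_approx_remove_point)
  also have "\<dots> = (\<integral>\<^sup>+\<omega>. (\<integral>\<^sup>+z. (if ennreal (snd z) \<le> \<Lambda> k vs \<omega> (fst z) then G \<omega> (fst z) else 0) \<partial>intensity T) \<partial>P)"
  proof (rule mecke)
    have "(\<lambda>x. if ennreal (snd (snd x)) \<le> \<Lambda> k vs (fst x) (fst (snd x)) then G (fst x) (fst (snd x)) else 0)
        \<in> borel_measurable (P \<Otimes>\<^sub>M intensity T)"
      by measurable
    then show "(\<lambda>(\<omega>, z). if ennreal (snd z) \<le> \<Lambda> k vs \<omega> (fst z) then G \<omega> (fst z) else 0)
        \<in> borel_measurable (P \<Otimes>\<^sub>M intensity T)"
      by (simp add: split_beta')
  qed
  also have "\<dots> = (\<integral>\<^sup>+\<omega>. (\<integral>\<^sup>+s\<in>{0..T}. \<Lambda> k vs \<omega> s * G \<omega> s \<partial>lborel) \<partial>P)"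
    by (intro nn_integral_cong nn_integral_rate sec)
  also have "\<dots> = (\<integral>\<^sup>+s. (\<integral>\<^sup>+\<omega>. \<Lambda> k vs \<omega> s * G \<omega> s * indicator {0..T} s \<partial>P) \<partial>lborel)"
  proof (rule pair_sigma_finite.Fubini'[symmetric])
    show "pair_sigma_finite P lborel"
      by (rule pair_sigma_finite.intro[OF sigma_finite_measure_axioms lborel.sigma_finite_measure_axioms])
    have "(\<lambda>x. \<Lambda> k vs (fst x) (snd x) * G (fst x) (snd x) * indicator {0..T} (snd x)) \<in> borel_measurable (P \<Otimes>\<^sub>M lborel)"
      using G measurable_rate_approx_const(1)[of k vs] by (simp add: split_beta')
    then show "(\<lambda>(\<omega>, s). \<Lambda> k vs \<omega> s * G \<omega> s * indicator {0..T} s) \<in> borel_measurable (P \<Otimes>\<^sub>M lborel)"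
      by (simp add: split_beta')
  qed
  also have "\<dots> = (\<integral>\<^sup>+s\<in>{0..T}. (\<integral>\<^sup>+\<omega>. \<Lambda> k vs \<omega> s * G \<omega> s \<partial>P) \<partial>lborel)"
    by (intro nn_integral_cong) (simp split: split_indicator)
  finally show ?thesis .
qed

text \<open>The formula holds at every stage of the iteration, and both sides increase with the
  stage to the expressions for the limit.\<close>

lemma thinning_formula:
  assumes G: "(\<lambda>(\<omega>, s). G \<omega> s) \<in> borel_measurable (P \<Otimes>\<^sub>M borel)"
  shows "(\<integral>\<^sup>+\<omega>. (\<integral>\<^sup>+z. (if z \<in> S vs \<omega> then G (\<omega> - {z}) (fst z) else 0) \<partial>count_space \<omega>) \<partial>P) =
    (\<integral>\<^sup>+s\<in>{0..T}. (\<integral>\<^sup>+\<omega>. \<Lambda>' vs \<omega> s * G \<omega> s \<partial>P) \<partial>lborel)"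
proof -
  have measL: "(\<lambda>\<omega>. \<integral>\<^sup>+z. (if ennreal (snd z) \<le> \<Lambda> k vs \<omega> (fst z) then G (\<omega> - {z}) (fst z) else 0) \<partial>count_space \<omega>)
      \<in> borel_measurable P" for k
  proof (rule measurable_campbell)
    have "(\<lambda>x. ((\<lambda>(\<omega>, z). \<omega> - {z}) x, fst (snd x))) \<in> P \<Otimes>\<^sub>M intensity T \<rightarrow>\<^sub>M P \<Otimes>\<^sub>M borel" by measurable
    from measurable_compose[OF this G]
    have [measurable]: "(\<lambda>x. G (fst x - {snd x}) (fst (snd x))) \<in> borel_measurable (P \<Otimes>\<^sub>M intensity T)"
      by (simp add: split_beta')
    have "(\<lambda>x. (fst x, fst (snd x))) \<in> P \<Otimes>\<^sub>M intensity T \<rightarrow>\<^sub>M P \<Otimes>\<^sub>M borel" by measurable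
    from measurable_compose[OF this measurable_rate_approx_const(1)[of k vs]]
    have [measurable]: "(\<lambda>x. \<Lambda> k vs (fst x) (fst (snd x))) \<in> borel_measurable (P \<Otimes>\<^sub>M intensity T)"
      by simp
    have "(\<lambda>x. if ennreal (snd (snd x)) \<le> \<Lambda> k vs (fst x) (fst (snd x)) then G (fst x - {snd x}) (fst (snd x)) else 0)
        \<in> borel_measurable (P \<Otimes>\<^sub>M intensity T)"
      by measurable
    then show "(\<lambda>(\<omega>, z). if ennreal (snd z) \<le> \<Lambda> k vs \<omega> (fst z) then G (\<omega> - {z}) (fst z) else 0)
        \<in> borel_measurable (P \<Otimes>\<^sub>M intensity T)"
      by (simp add: split_beta')
  qed simp
  have measR: "(\<lambda>x. \<Lambda> k vs (fst x) (snd x) * G (fst x) (snd x)) \<in> borel_measurable (P \<Otimes>\<^sub>M borel)" for k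
    using G measurable_rate_approx_const(1)[of k vs] by (simp add: split_beta')
  have measR1: "(\<lambda>\<omega>. \<Lambda> k vs \<omega> s * G \<omega> s) \<in> borel_measurable P" for k s
    using measurable_Pair1[OF measR, of s] by simp
  have measR2: "(\<lambda>s. \<integral>\<^sup>+\<omega>. \<Lambda> k vs \<omega> s * G \<omega> s \<partial>P) \<in> borel_measurable borel" for k
  proof (rule borel_measurable_nn_integral)
    have "(\<lambda>x. (snd x, fst x)) \<in> borel \<Otimes>\<^sub>M P \<rightarrow>\<^sub>M P \<Otimes>\<^sub>M borel" by measurable
    from measurable_compose[OF this measR[of k]]
    show "(\<lambda>(s, \<omega>). \<Lambda> k vs \<omega> s * G \<omega> s) \<in> borel_measurable (borel \<Otimes>\<^sub>M P)"
      by (simp add: split_beta')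
  qed
  have inc: "incseq (\<lambda>k. if ennreal (snd z) \<le> \<Lambda> k vs \<omega> (fst z) then c else 0)" for \<omega> z and c :: ennreal
    by (rule incseq_SucI) (use order_trans[OF _ rate_approx_Suc_mono] in \<open>simp del: rate_approx.simps\<close>)
  have sup: "(SUP k. if ennreal (snd z) \<le> \<Lambda> k vs \<omega> (fst z) then c else 0) = (if z \<in> S vs \<omega> then c else 0)"
    if "z \<in> \<omega>" for \<omega> z and c :: ennreal
  proof (cases "z \<in> S vs \<omega>")
    case True
    then obtain k where "ennreal (snd z) \<le> \<Lambda> k vs \<omega> (fst z)" by (auto simp: accepted_points_def)
    then have "c \<le> (SUP k. if ennreal (snd z) \<le> \<Lambda> k vs \<omega> (fst z) then c else 0)"
      by (intro SUP_upper2[of k]) auto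
    moreover have "(SUP k. if ennreal (snd z) \<le> \<Lambda> k vs \<omega> (fst z) then c else 0) \<le> c"
      by (rule SUP_least) auto
    ultimately show ?thesis using True by auto
  next
    case False
    then have "(if ennreal (snd z) \<le> \<Lambda> k vs \<omega> (fst z) then c else 0) = 0" for k
      using that by (auto simp: accepted_points_def)
    then have "(SUP k. if ennreal (snd z) \<le> \<Lambda> k vs \<omega> (fst z) then c else 0) = (SUP k::nat. 0)" by (simp only:)
    then show ?thesis unfolding if_not_P[OF False] by simp
  qed
  have "(\<integral>\<^sup>+\<omega>. (\<integral>\<^sup>+z. (if z \<in> S vs \<omega> then G (\<omega> - {z}) (fst z) else 0) \<partial>count_space \<omega>) \<partial>P) =
     (\<integral>\<^sup>+\<omega>. (\<integral>\<^sup>+z. (SUP k. if ennreal (snd z) \<le> \<Lambda> k vs \<omega> (fst z) then G (\<omega> - {z}) (fst z) else 0) \<partial>count_space \<omega>) \<partial>P)"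
    by (intro nn_integral_cong sup[symmetric]) simp
  also have "\<dots> = (\<integral>\<^sup>+\<omega>. (SUP k. \<integral>\<^sup>+z. (if ennreal (snd z) \<le> \<Lambda> k vs \<omega> (fst z) then G (\<omega> - {z}) (fst z) else 0) \<partial>count_space \<omega>) \<partial>P)"
    by (intro nn_integral_cong nn_integral_monotone_convergence_SUP incseq_SucI le_funI incseq_SucD[OF inc]) simp
  also have "\<dots> = (SUP k. \<integral>\<^sup>+\<omega>. (\<integral>\<^sup>+z. (if ennreal (snd z) \<le> \<Lambda> k vs \<omega> (fst z) then G (\<omega> - {z}) (fst z) else 0) \<partial>count_space \<omega>) \<partial>P)"
    by (intro nn_integral_monotone_convergence_SUP incseq_SucI le_funI nn_integral_mono incseq_SucD[OF inc] measL)
  also have "\<dots> = (SUP k. \<integral>\<^sup>+s\<in>{0..T}. (\<integral>\<^sup>+\<omega>. \<Lambda> k vs \<omega> s * G \<omega> s \<partial>P) \<partial>lborel)"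
    by (simp only: thinning_formula_approx[OF G])
  also have "\<dots> = (\<integral>\<^sup>+s. (SUP k. (\<integral>\<^sup>+\<omega>. \<Lambda> k vs \<omega> s * G \<omega> s \<partial>P) * indicator {0..T} s) \<partial>lborel)"
  proof (rule nn_integral_monotone_convergence_SUP[symmetric])
    show "(\<lambda>s. (\<integral>\<^sup>+\<omega>. \<Lambda> k vs \<omega> s * G \<omega> s \<partial>P) * indicator {0..T} s) \<in> borel_measurable lborel" for k
      using measR2[of k] by measurable
  qed (intro incseq_SucI le_funI mult_right_mono nn_integral_mono rate_approx_Suc_mono, simp_all)
  also have "\<dots> = (\<integral>\<^sup>+s\<in>{0..T}. (SUP k. \<integral>\<^sup>+\<omega>. \<Lambda> k vs \<omega> s * G \<omega> s \<partial>P) \<partial>lborel)"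
    by (simp only: SUP_mult_right_ennreal)
  also have "\<dots> = (\<integral>\<^sup>+s\<in>{0..T}. (\<integral>\<^sup>+\<omega>. (SUP k. \<Lambda> k vs \<omega> s * G \<omega> s) \<partial>P) \<partial>lborel)"
    by (intro nn_integral_cong arg_cong2[where f = "(*)"] refl nn_integral_monotone_convergence_SUP[symmetric]
        measR1 incseq_SucI le_funI mult_right_mono rate_approx_Suc_mono) simp
  also have "\<dots> = (\<integral>\<^sup>+s\<in>{0..T}. (\<integral>\<^sup>+\<omega>. \<Lambda>' vs \<omega> s * G \<omega> s \<partial>P) \<partial>lborel)"
    by (simp only: SUP_mult_right_ennreal rate_limit_def)
  finally show ?thesis .
qed

section \<open>Almost sure properties of the point times\<close>

lemma AE_intensity_time: "AE z in intensity T. fst z \<noteq> c"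
proof -
  have meas: "(\<lambda>z. if fst z = c then 1 else 0 :: ennreal) \<in> borel_measurable (intensity T)"
    by measurable
  have "(\<integral>\<^sup>+z. (if fst z = c then 1 else 0) \<partial>intensity T) =
      (\<integral>\<^sup>+s\<in>{0..T}. (\<integral>\<^sup>+\<theta>\<in>{0::real..}. (if s = c then 1 else 0) \<partial>lborel) \<partial>lborel)"
    by (subst nn_integral_intensity[OF meas]) (simp only: fst_conv snd_conv)
  also have "\<dots> = (\<integral>\<^sup>+s. 0 \<partial>(lborel :: real measure))"
  proof (rule nn_integral_cong_AE)
    have "AE s in lborel. s \<noteq> c" by (rule AE_lborel_singleton)
    then show "AE s in lborel. (\<integral>\<^sup>+\<theta>\<in>{0::real..}. (if s = c then 1 else 0) \<partial>lborel) * indicator {0..T} s = 0"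
      by eventually_elim simp
  qed
  finally have "AE z in intensity T. (if fst z = c then 1 else 0 :: ennreal) = 0"
    using nn_integral_0_iff_AE[OF meas] by simp
  then show "AE z in intensity T. fst z \<noteq> c" by eventually_elim (simp split: if_splits)
qed

text \<open>Mecke's formula is applied to the number of other points that share the time of a given
  point. On its right-hand side, for a fixed configuration, the integral runs over points whose time
  belongs to a countable set, and this is null for the intensity.\<close>

lemma AE_distinct_times: "AE \<omega> in P. inj_on fst \<omega>"
proof -
  let ?F = "\<lambda>\<omega> (z :: real \<times> real). \<integral>\<^sup>+x. (if fst x = fst z then 1 else 0 :: ennreal) \<partial>count_space \<omega>"
  have meas: "(\<lambda>(\<omega>, z). ?F \<omega> z) \<in> borel_measurable (P \<Otimes>\<^sub>M intensity T)"
  proof -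
    have "(\<lambda>w. ?F (fst w) (snd w)) \<in> borel_measurable (P \<Otimes>\<^sub>M intensity T)"
    proof (rule measurable_campbell)
      have "(\<lambda>w. if fst (snd w) = fst (snd (fst w)) then 1 else 0 :: ennreal)
          \<in> borel_measurable ((P \<Otimes>\<^sub>M intensity T) \<Otimes>\<^sub>M intensity T)" by measurable
      then show "(\<lambda>(w, z). if fst z = fst (snd w) then 1 else 0 :: ennreal)
          \<in> borel_measurable ((P \<Otimes>\<^sub>M intensity T) \<Otimes>\<^sub>M intensity T)"
        by (simp add: split_beta')
    qed simp
    then show ?thesis by (simp add: split_beta')
  qed
  have "(\<integral>\<^sup>+z. ?F \<omega> z \<partial>intensity T) = 0" if \<omega>: "\<omega> \<in> configurations T" for \<omega>
  proof -
    have "countable (fst ` \<omega>)" using configurations_countable[OF \<omega>] by (rule countable_image)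
    then have "AE z in intensity T. \<forall>c\<in>fst ` \<omega>. fst z \<noteq> c"
      by (intro AE_ball_countable' AE_intensity_time)
    then have "AE z in intensity T. ?F \<omega> z = 0"
    proof eventually_elim
      case (elim z)
      have "?F \<omega> z = (\<integral>\<^sup>+x. 0 \<partial>count_space \<omega>)"
        using elim by (intro nn_integral_cong) (metis imageI space_count_space)
      then show ?case by simp
    qed
    then have "(\<integral>\<^sup>+z. ?F \<omega> z \<partial>intensity T) = (\<integral>\<^sup>+z. 0 \<partial>intensity T)" by (rule nn_integral_cong_AE)
    then show ?thesis by simp
  qed
  then have "(\<integral>\<^sup>+\<omega>. (\<integral>\<^sup>+z. ?F (\<omega> - {z}) z \<partial>count_space \<omega>) \<partial>P) = 0"
    unfolding mecke[OF meas] by (subst nn_integral_cong[where v = "\<lambda>_. 0"]) simp_all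
  moreover have "(\<lambda>\<omega>. \<integral>\<^sup>+z. ?F (\<omega> - {z}) z \<partial>count_space \<omega>) \<in> borel_measurable P"
  proof (rule measurable_campbell)
    have "(\<lambda>x. ((\<lambda>(\<omega>, z). \<omega> - {z}) x, snd x)) \<in> P \<Otimes>\<^sub>M intensity T \<rightarrow>\<^sub>M P \<Otimes>\<^sub>M intensity T" by measurable
    from measurable_compose[OF this meas]
    show "(\<lambda>(\<omega>, z). ?F (\<omega> - {z}) z) \<in> borel_measurable (P \<Otimes>\<^sub>M intensity T)" by (simp add: split_beta')
  qed simp
  ultimately have "AE \<omega> in P. (\<integral>\<^sup>+z. ?F (\<omega> - {z}) z \<partial>count_space \<omega>) = 0"
    by (subst (asm) nn_integral_0_iff_AE)
  then show ?thesis
  proof eventually_elim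
    case (elim \<omega>)
    have 0: "?F (\<omega> - {z}) z = 0" if "z \<in> \<omega>" for z
      using elim that by (auto simp: nn_integral_0_iff_AE AE_count_space)
    show ?case
    proof (rule inj_onI)
      fix x y assume xy: "x \<in> \<omega>" "y \<in> \<omega>" "fst x = fst y"
      show "x = y"
      proof (rule ccontr)
        assume "x \<noteq> y"
        then have "y \<in> \<omega> - {x}" using xy by auto
        then have "(if fst y = fst x then 1 else 0 :: ennreal) = 0"
          using 0[OF xy(1)] by (auto simp: nn_integral_0_iff_AE AE_count_space)
        then show False using xy(3) by simp
      qed
    qed
  qed
qed

lemma AE_no_point_at: "AE \<omega> in P. c \<notin> fst ` \<omega>"
proof -
  have meas: "(\<lambda>(\<omega>, z). if fst z = c then 1 else 0 :: ennreal) \<in> borel_measurable (P \<Otimes>\<^sub>M intensity T)"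
  proof -
    have "(\<lambda>x. if fst (snd x) = c then 1 else 0 :: ennreal) \<in> borel_measurable (P \<Otimes>\<^sub>M intensity T)" by measurable
    then show ?thesis by (simp add: split_beta')
  qed
  have "(\<integral>\<^sup>+z. (if fst z = c then 1 else 0 :: ennreal) \<partial>intensity T) = (\<integral>\<^sup>+z. 0 \<partial>intensity T)"
  proof (rule nn_integral_cong_AE)
    show "AE z in intensity T. (if fst z = c then 1 else 0 :: ennreal) = 0"
      using AE_intensity_time[of c] by eventually_elim simp
  qed
  then have "(\<integral>\<^sup>+\<omega>. (\<integral>\<^sup>+z. (if fst z = c then 1 else 0) \<partial>count_space \<omega>) \<partial>P) = 0"
    using mecke[OF meas] by simp
  moreover have "(\<lambda>\<omega>. \<integral>\<^sup>+z. (if fst z = c then 1 else 0) \<partial>count_space \<omega>) \<in> borel_measurable P"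
    by (rule measurable_campbell[OF _ meas]) simp
  ultimately have "AE \<omega> in P. (\<integral>\<^sup>+z. (if fst z = c then 1 else 0) \<partial>count_space \<omega>) = 0"
    by (subst (asm) nn_integral_0_iff_AE)
  then show ?thesis
    by eventually_elim (auto simp: nn_integral_0_iff_AE AE_count_space split: if_splits)
qed

end

section \<open>Mean intensity of a subcritical kernel\<close>

locale stable_kernel = hawkes_kernel +
  fixes q b :: real
  assumes \<phi>_bound: "\<phi> t \<le> ennreal b"
    and \<phi>_integral: "(\<integral>\<^sup>+s. \<phi> s \<partial>lborel) \<le> ennreal q"
    and q: "0 \<le> q" "q < 1" and m_finite: "m < \<top>"
begin

text \<open>The solution \<open>r\<close> of \<open>r = m + n b + q r\<close>: each of the
  \<open>n\<close> shifts adds at most \<open>b\<close> to the intensity, and the accepted points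
  add at most \<open>q\<close> times the largest mean intensity.\<close>

definition rate_bound :: "real list \<Rightarrow> ennreal" where
  "rate_bound vs = (m + of_nat (length vs) * ennreal b) * ennreal (1 / (1 - q))"

lemma rate_bound_finite: "rate_bound vs < \<top>"
  using m_finite by (simp add: rate_bound_def ennreal_mult_less_top of_nat_less_top)

lemma nn_integral_\<phi>_shift: "(\<integral>\<^sup>+s. \<phi> (t - s) \<partial>lborel) \<le> ennreal q"
  using \<phi>_integral nn_integral_real_affine[of \<phi> "-1" t] by simp

text \<open>By the thinning formula the accepted points contribute the convolution of the previous
  mean intensity with \<open>\<phi>\<close>, which is at most \<open>q\<close> times its bound.
  \<open>rate_bound\<close> is a fixed point of this estimate, so it is passed on from stage to
  stage, uniformly in time.\<close>

lemma expectation_rate_approx_le: "(\<integral>\<^sup>+\<omega>. \<Lambda> k vs \<omega> t \<partial>P) \<le> rate_bound vs"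
proof (induction k arbitrary: t)
  case (Suc k)
  let ?c = "\<Sum>v\<leftarrow>vs. if v < t then \<phi> (t - v) else 0"
  let ?G = "\<lambda>\<omega> s. if s < t then \<phi> (t - s) else 0"
  have c: "?c \<le> of_nat (length vs) * ennreal b"
  proof (induction vs)
    case (Cons v vs)
    have "(if v < t then \<phi> (t - v) else 0) \<le> ennreal b" using \<phi>_bound by simp
    from add_mono[OF this Cons] show ?case by (simp add: distrib_right)
  qed simp
  have G: "(\<lambda>(\<omega>, s). ?G \<omega> s) \<in> borel_measurable (P \<Otimes>\<^sub>M borel)"
    by measurable
  have int: "(\<integral>\<^sup>+\<omega>. (\<integral>\<^sup>+z. (if fst z < t \<and> ennreal (snd z) \<le> \<Lambda> k vs \<omega> (fst z) then \<phi> (t - fst z) else 0) \<partial>count_space \<omega>) \<partial>P)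
      \<le> rate_bound vs * ennreal q"
  proof -
    have "(\<integral>\<^sup>+\<omega>. (\<integral>\<^sup>+z. (if fst z < t \<and> ennreal (snd z) \<le> \<Lambda> k vs \<omega> (fst z) then \<phi> (t - fst z) else 0) \<partial>count_space \<omega>) \<partial>P) =
      (\<integral>\<^sup>+\<omega>. (\<integral>\<^sup>+z. (if ennreal (snd z) \<le> \<Lambda> k vs \<omega> (fst z) then ?G (\<omega> - {z}) (fst z) else 0) \<partial>count_space \<omega>) \<partial>P)"
      by (intro nn_integral_cong) simp
    also have "\<dots> = (\<integral>\<^sup>+s\<in>{0..T}. (\<integral>\<^sup>+\<omega>. \<Lambda> k vs \<omega> s * ?G \<omega> s \<partial>P) \<partial>lborel)"
      by (rule thinning_formula_approx[OF G])
    also have "\<dots> \<le> (\<integral>\<^sup>+s. rate_bound vs * \<phi> (t - s) \<partial>lborel)"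
    proof (rule nn_integral_mono)
      fix s
      have ms: "(\<lambda>\<omega>. \<Lambda> k vs \<omega> s) \<in> borel_measurable P"
        using measurable_Pair1[OF measurable_rate_approx_const(1)[of k vs], of s] by simp
      \<comment> \<open>The weight is constant in the configuration, so an arbitrary value fills
        that argument when the weight leaves the integral.\<close>
      have "(\<integral>\<^sup>+\<omega>. \<Lambda> k vs \<omega> s * ?G \<omega> s \<partial>P) = (\<integral>\<^sup>+\<omega>. \<Lambda> k vs \<omega> s \<partial>P) * ?G undefined s"
        by (rule nn_integral_multc[OF ms])
      also have "\<dots> \<le> rate_bound vs * \<phi> (t - s)"
        by (intro mult_mono Suc.IH) auto
      finally show "(\<integral>\<^sup>+\<omega>. \<Lambda> k vs \<omega> s * ?G \<omega> s \<partial>P) * indicator {0..T} s \<le> rate_bound vs * \<phi> (t - s)"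
        by (auto split: split_indicator)
    qed
    also have "\<dots> = rate_bound vs * (\<integral>\<^sup>+s. \<phi> (t - s) \<partial>lborel)"
      by (rule nn_integral_cmult) measurable
    also have "\<dots> \<le> rate_bound vs * ennreal q" by (intro mult_left_mono nn_integral_\<phi>_shift) simp
    finally show ?thesis .
  qed
  have ms: "(\<lambda>\<omega>. \<integral>\<^sup>+z. (if fst z < t \<and> ennreal (snd z) \<le> \<Lambda> k vs \<omega> (fst z) then \<phi> (t - fst z) else 0) \<partial>count_space \<omega>) \<in> borel_measurable P"
  proof (rule measurable_campbell)
    have "(\<lambda>x. (fst x, fst (snd x))) \<in> P \<Otimes>\<^sub>M intensity T \<rightarrow>\<^sub>M P \<Otimes>\<^sub>M borel" by measurable
    from measurable_compose[OF this measurable_rate_approx_const(1)[of k vs]]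
    have [measurable]: "(\<lambda>x. \<Lambda> k vs (fst x) (fst (snd x))) \<in> borel_measurable (P \<Otimes>\<^sub>M intensity T)"
      by simp
    have "(\<lambda>x. if fst (snd x) < t \<and> ennreal (snd (snd x)) \<le> \<Lambda> k vs (fst x) (fst (snd x)) then \<phi> (t - fst (snd x)) else 0)
        \<in> borel_measurable (P \<Otimes>\<^sub>M intensity T)" by measurable
    then show "(\<lambda>(\<omega>, z). if fst z < t \<and> ennreal (snd z) \<le> \<Lambda> k vs \<omega> (fst z) then \<phi> (t - fst z) else 0)
        \<in> borel_measurable (P \<Otimes>\<^sub>M intensity T)" by (simp add: split_beta')
  qed simp
  have "(\<integral>\<^sup>+\<omega>. \<Lambda> (Suc k) vs \<omega> t \<partial>P) = m + ?c +
      (\<integral>\<^sup>+\<omega>. (\<integral>\<^sup>+z. (if fst z < t \<and> ennreal (snd z) \<le> \<Lambda> k vs \<omega> (fst z) then \<phi> (t - fst z) else 0) \<partial>count_space \<omega>) \<partial>P)"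
    unfolding rate_approx.simps(2) by (subst nn_integral_add[OF _ ms]) (simp_all add: emeasure_space_1[unfolded space_P])
  also have "\<dots> \<le> (m + of_nat (length vs) * ennreal b) + rate_bound vs * ennreal q"
    by (intro add_mono c int order_refl)
  also have "\<dots> = rate_bound vs"
  proof -
    have "1 + 1 / (1 - q) * q = 1 / (1 - q)" using q by (simp add: field_simps)
    then have "1 + ennreal (1 / (1 - q)) * ennreal q = ennreal (1 / (1 - q))"
      using q by (simp flip: ennreal_mult ennreal_plus ennreal_1)
    then show ?thesis
      unfolding rate_bound_def by (metis (no_types) distrib_left mult.assoc mult.right_neutral)
  qed
  finally show ?case .
qed simp

lemma measurable_rate_limit_at: "(\<lambda>\<omega>. \<Lambda>' vs \<omega> t) \<in> borel_measurable P"
  using measurable_Pair1[OF measurable_rate_approx_const(2)[of vs], of t] by simp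

lemma expectation_rate_limit_le: "(\<integral>\<^sup>+\<omega>. \<Lambda>' vs \<omega> t \<partial>P) \<le> rate_bound vs"
proof -
  have "(\<lambda>\<omega>. \<Lambda> k vs \<omega> t) \<in> borel_measurable P" for k
    using measurable_Pair1[OF measurable_rate_approx_const(1)[of k vs], of t] by simp
  then have "(\<integral>\<^sup>+\<omega>. \<Lambda>' vs \<omega> t \<partial>P) = (SUP k. \<integral>\<^sup>+\<omega>. \<Lambda> k vs \<omega> t \<partial>P)"
    unfolding rate_limit_def
    by (intro nn_integral_monotone_convergence_SUP incseq_SucI le_funI rate_approx_Suc_mono)
  also have "\<dots> \<le> rate_bound vs" by (rule SUP_least) (rule expectation_rate_approx_le)
  finally show ?thesis .
qed

text \<open>With weight one the thinning formula gives the mean number of accepted points as the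
  time integral of the mean intensity, which is at most \<open>T\<close> times the bound.\<close>

lemma AE_finite_accepted_points: "AE \<omega> in P. finite (S vs \<omega>)"
proof -
  let ?c = "\<lambda>\<omega>. \<integral>\<^sup>+z. (if z \<in> S vs \<omega> then 1 else 0) \<partial>count_space \<omega>"
  have "(\<integral>\<^sup>+\<omega>. ?c \<omega> \<partial>P) = (\<integral>\<^sup>+s\<in>{0..T}. (\<integral>\<^sup>+\<omega>. \<Lambda>' vs \<omega> s * 1 \<partial>P) \<partial>lborel)"
    by (rule thinning_formula) measurable
  also have "\<dots> \<le> (\<integral>\<^sup>+s\<in>{0..T}. rate_bound vs \<partial>lborel)"
    by (intro nn_integral_mono mult_right_mono) (simp_all add: expectation_rate_limit_le)
  also have "\<dots> = rate_bound vs * ennreal T" using T_pos by (subst nn_integral_cmult) simp_all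
  also have "\<dots> < \<infinity>" using rate_bound_finite by (simp add: ennreal_mult_less_top)
  finally have fin: "(\<integral>\<^sup>+\<omega>. ?c \<omega> \<partial>P) \<noteq> \<infinity>" by simp
  have meas: "?c \<in> borel_measurable P"
  proof (rule measurable_campbell)
    have "Measurable.pred (P \<Otimes>\<^sub>M intensity T) (\<lambda>w. snd w \<in> S (map (\<lambda>i. vs ! i) [0..<length vs]) (fst w))"
      using measurable_compose[OF measurable_snd measurable_id_intensity]
      by (intro measurable_accepted_points[where X = "\<lambda>i w. vs ! i"]) simp_all
    then have [measurable]: "Measurable.pred (P \<Otimes>\<^sub>M intensity T) (\<lambda>w. snd w \<in> S vs (fst w))"
      unfolding map_nth .
    have "(\<lambda>w. if snd w \<in> S vs (fst w) then 1 else 0 :: ennreal) \<in> borel_measurable (P \<Otimes>\<^sub>M intensity T)"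
      by measurable
    then show "(\<lambda>(\<omega>, z). if z \<in> S vs \<omega> then 1 else 0 :: ennreal) \<in> borel_measurable (P \<Otimes>\<^sub>M intensity T)"
      by (simp add: split_beta')
  qed simp
  have "AE \<omega> in P. ?c \<omega> \<noteq> \<infinity>" by (rule nn_integral_PInf_AE[OF meas fin])
  then show ?thesis
  proof eventually_elim
    case (elim \<omega>)
    have "?c \<omega> = (\<integral>\<^sup>+z. (if z \<in> S vs \<omega> then 1 else 0) \<partial>count_space (S vs \<omega>))"
      using accepted_points_subset[of \<phi> m vs \<omega>] by (intro nn_integral_count_space_eq) auto
    also have "\<dots> = (\<integral>\<^sup>+z. 1 \<partial>count_space (S vs \<omega>))" by (intro nn_integral_cong) simp
    also have "\<dots> = emeasure (count_space (S vs \<omega>)) (S vs \<omega>)" by simp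
    finally show ?case using elim by (auto simp: emeasure_count_space split: if_splits)
  qed
qed

end

section \<open>Claims\<close>

definition claim_indices :: "(nat + nat) set" where
  "claim_indices = {1..} <+> {1..}"

lemma claim_indices_iff [simp]:
  "Inl i \<in> claim_indices \<longleftrightarrow> 0 < i" "Inr i \<in> claim_indices \<longleftrightarrow> 0 < i"
  by (auto simp: claim_indices_def)

text \<open>\<open>Inl i\<close> indexes the \<open>i\<close>-th ordinary pair and
  \<open>Inr i\<close> the \<open>i\<close>-th barred pair. Moving a claim from one family to the
  other is then a relabelling inside a single i.i.d. family.\<close>

locale claims_model = stable_kernel +
  fixes C :: "'c measure" and X :: "nat + nat \<Rightarrow> 'c \<Rightarrow> real \<times> real" and \<nu> :: "(real \<times> real) measure"
    and \<kappa> :: real and f :: "real \<Rightarrow> real" and g :: "real \<times> real \<Rightarrow> ennreal" and h :: "real \<Rightarrow> ennreal" and gb hb :: real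
  assumes prob_C: "prob_space C"
    and X_measurable [measurable]: "\<And>k. X k \<in> borel_measurable C"
    and X_indep: "prob_space.indep_vars C (\<lambda>_. borel) X claim_indices"
    and X_law: "\<And>k. k \<in> claim_indices \<Longrightarrow> distr C borel (X k) = \<nu>"
    and f_measurable [measurable]: "f \<in> borel_measurable borel"
    and g_measurable [measurable]: "g \<in> borel_measurable borel"
    and h_measurable [measurable]: "h \<in> borel_measurable borel"
    and f_nonneg: "\<And>x. 0 \<le> f x"
    and g_le: "\<And>x. g x \<le> ennreal gb" and h_le: "\<And>x. h x \<le> ennreal hb"
begin

interpretation C: prob_space C by (rule prob_C)

lemma sets_\<nu> [simp]: "sets \<nu> = sets borel" "space \<nu> = UNIV"
  and prob_\<nu>: "prob_space \<nu>"
proof -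
  have k: "Inl 1 \<in> claim_indices" by simp
  have "prob_space (distr C borel (X (Inl 1)))" by (rule C.prob_space_distr) simp
  then show "prob_space \<nu>" unfolding X_law[OF k] .
  show "sets \<nu> = sets borel" "space \<nu> = UNIV"
    unfolding X_law[OF k, symmetric] by simp_all
qed

lemma measurable_\<nu> [simp]: "measurable \<nu> M = measurable borel M"
  by (rule measurable_cong_sets) simp_all

text \<open>Exchangeability in the form in which it is used: the right-hand side does not see the
  injection \<rho>, since selecting and reindexing coordinates of a product of equal factors gives
  the same product again.\<close>

lemma claims_law:
  assumes \<rho>: "inj_on \<rho> J" "\<rho> ` J \<subseteq> claim_indices"
  shows "distr C (\<Pi>\<^sub>M j\<in>J. borel) (\<lambda>c. \<lambda>j\<in>J. X (\<rho> j) c) = (\<Pi>\<^sub>M j\<in>J. \<nu>)"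
proof -
  let ?I = claim_indices
  have "Inl 1 \<in> ?I" by simp
  then have ne: "?I \<noteq> {}" by (rule ex_in_conv[THEN iffD1, OF exI])
  have "distr C (\<Pi>\<^sub>M i\<in>?I. borel) (\<lambda>c. \<lambda>i\<in>?I. X i c) = (\<Pi>\<^sub>M i\<in>?I. distr C borel (X i))"
    by (rule C.indep_vars_iff_distr_eq_PiM'[THEN iffD1, OF ne _ X_indep]) simp
  also have "\<dots> = (\<Pi>\<^sub>M i\<in>?I. \<nu>)" by (rule PiM_cong) (simp_all add: X_law)
  finally have law: "distr C (\<Pi>\<^sub>M i\<in>?I. borel) (\<lambda>c. \<lambda>i\<in>?I. X i c) = (\<Pi>\<^sub>M i\<in>?I. \<nu>)" .
  have r: "(\<lambda>\<omega>. \<lambda>n\<in>J. \<omega> (\<rho> n)) \<in> (\<Pi>\<^sub>M i\<in>?I. borel) \<rightarrow>\<^sub>M (\<Pi>\<^sub>M j\<in>J. (borel :: (real \<times> real) measure))"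
    using \<rho>(2) by (intro measurable_restrict measurable_component_singleton) auto
  have sets_J: "sets (\<Pi>\<^sub>M j\<in>J. \<nu>) = sets (\<Pi>\<^sub>M j\<in>J. (borel :: (real \<times> real) measure))"
    by (rule sets_PiM_cong) simp_all
  have "(\<Pi>\<^sub>M j\<in>J. \<nu>) = distr (\<Pi>\<^sub>M i\<in>?I. \<nu>) (\<Pi>\<^sub>M j\<in>J. \<nu>) (\<lambda>\<omega>. \<lambda>n\<in>J. \<omega> (\<rho> n))"
    by (rule distr_PiM_reindex[symmetric]) (use \<rho> prob_\<nu> in auto)
  also have "\<dots> = distr (\<Pi>\<^sub>M i\<in>?I. \<nu>) (\<Pi>\<^sub>M j\<in>J. borel) (\<lambda>\<omega>. \<lambda>n\<in>J. \<omega> (\<rho> n))"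
    by (rule distr_cong) (simp_all add: sets_J)
  also have "\<dots> = distr C (\<Pi>\<^sub>M j\<in>J. borel) ((\<lambda>\<omega>. \<lambda>n\<in>J. \<omega> (\<rho> n)) \<circ> (\<lambda>c. \<lambda>i\<in>?I. X i c))"
    unfolding law[symmetric] by (rule distr_distr[OF r]) (intro measurable_restrict, simp)
  also have "(\<lambda>\<omega>. \<lambda>n\<in>J. \<omega> (\<rho> n)) \<circ> (\<lambda>c. \<lambda>i\<in>?I. X i c) = (\<lambda>c. \<lambda>j\<in>J. X (\<rho> j) c)"
    using \<rho>(2) by (auto simp: fun_eq_iff restrict_def)
  finally show ?thesis by (rule sym)
qed

lemma nn_integral_claims:
  assumes \<rho>: "inj_on \<rho> J" "\<rho> ` J \<subseteq> claim_indices"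
    and \<Psi>: "\<Psi> \<in> borel_measurable (\<Pi>\<^sub>M j\<in>J. borel)"
  shows "(\<integral>\<^sup>+c. \<Psi> (\<lambda>j\<in>J. X (\<rho> j) c) \<partial>C) = (\<integral>\<^sup>+x. \<Psi> x \<partial>(\<Pi>\<^sub>M j\<in>J. \<nu>))"
proof -
  have m: "(\<lambda>c. \<lambda>j\<in>J. X (\<rho> j) c) \<in> C \<rightarrow>\<^sub>M (\<Pi>\<^sub>M j\<in>J. borel)" by (intro measurable_restrict) simp
  show ?thesis
    unfolding claims_law[OF \<rho>, symmetric]
    by (rule nn_integral_distr[symmetric, OF m]) (simp add: \<Psi>)
qed

lemma labelled_measurable:
  assumes "finite J"
  shows "(\<lambda>x. \<Sum>j\<in>J. w j * f (fst (x j))) \<in> borel_measurable (\<Pi>\<^sub>M j\<in>J. (borel :: (real \<times> real) measure))"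
proof (rule borel_measurable_sum)
  fix j assume j: "j \<in> J"
  have "(\<lambda>x. x j) \<in> (\<Pi>\<^sub>M j\<in>J. (borel :: (real \<times> real) measure)) \<rightarrow>\<^sub>M borel \<Otimes>\<^sub>M borel"
    using j by (simp add: borel_prod)
  from measurable_compose[OF measurable_compose[OF this measurable_fst] f_measurable]
  show "(\<lambda>x. w j * f (fst (x j))) \<in> borel_measurable (\<Pi>\<^sub>M j\<in>J. (borel :: (real \<times> real) measure))"
    by measurable
qed

lemma relabel:
  fixes J :: "'j set"
  assumes J: "finite J" "j0 \<in> J"
    and \<rho>: "inj_on \<rho> J" "\<rho> ` J \<subseteq> claim_indices" and \<rho>': "inj_on \<rho>' J" "\<rho>' ` J \<subseteq> claim_indices"
  shows "(\<integral>\<^sup>+c. g (X (\<rho> j0) c) * h (\<Sum>j\<in>J. w j * f (fst (X (\<rho> j) c))) \<partial>C) =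
    (\<integral>\<^sup>+c. g (X (\<rho>' j0) c) * h (\<Sum>j\<in>J. w j * f (fst (X (\<rho>' j) c))) \<partial>C)"
proof -
  let ?\<Psi> = "\<lambda>x :: 'j \<Rightarrow> real \<times> real. g (x j0) * h (\<Sum>j\<in>J. w j * f (fst (x j)))"
  have "(\<lambda>x. x j0) \<in> (\<Pi>\<^sub>M j\<in>J. (borel :: (real \<times> real) measure)) \<rightarrow>\<^sub>M borel"
    by (rule measurable_component_singleton) (rule J)
  from measurable_compose[OF this g_measurable]
  have 1: "(\<lambda>x. g (x j0)) \<in> borel_measurable (\<Pi>\<^sub>M j\<in>J. borel)" .
  have 2: "(\<lambda>x. h (\<Sum>j\<in>J. w j * f (fst (x j)))) \<in> borel_measurable (\<Pi>\<^sub>M j\<in>J. (borel :: (real \<times> real) measure))"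
    by (rule measurable_compose[OF labelled_measurable[OF J(1)] h_measurable])
  have \<Psi>: "?\<Psi> \<in> borel_measurable (\<Pi>\<^sub>M j\<in>J. borel)"
    using 1 2 by (rule borel_measurable_times_ennreal)
  have eq: "g (X (r j0) c) * h (\<Sum>j\<in>J. w j * f (fst (X (r j) c))) = ?\<Psi> (\<lambda>j\<in>J. X (r j) c)" for r c
    using J(2) by simp
  show ?thesis unfolding eq nn_integral_claims[OF \<rho> \<Psi>] nn_integral_claims[OF \<rho>' \<Psi>] ..
qed

text \<open>Under the product law Fubini's theorem integrates the distinguished claim last. The
  remaining claims, still labelled injectively, keep their own product law, so the inner integral is
  the conditional mean given the distinguished claim.\<close>

lemma factor_claim:
  fixes J :: "'j set"
  assumes J: "finite J" "j0 \<notin> J"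
    and \<rho>: "inj_on \<rho> (insert j0 J)" "\<rho> ` (insert j0 J) \<subseteq> claim_indices"
    and k[measurable]: "k \<in> borel_measurable borel"
  shows "(\<integral>\<^sup>+c. k (X (\<rho> j0) c) * h (a * f (fst (X (\<rho> j0) c)) + (\<Sum>j\<in>J. w j * f (fst (X (\<rho> j) c)))) \<partial>C) =
    (\<integral>\<^sup>+x. k x * (\<integral>\<^sup>+c. h (a * f (fst x) + (\<Sum>j\<in>J. w j * f (fst (X (\<rho> j) c)))) \<partial>C) \<partial>\<nu>)"
proof -
  interpret \<nu>: prob_space \<nu> by (rule prob_\<nu>)
  interpret psf: product_sigma_finite "\<lambda>_::'j. \<nu>" ..
  let ?I = "insert j0 J"
  let ?u = "\<lambda>(x :: real \<times> real) (y :: 'j \<Rightarrow> real \<times> real). h (a * f (fst x) + (\<Sum>j\<in>J. w j * f (fst (y j))))"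
  let ?\<Psi> = "\<lambda>y :: 'j \<Rightarrow> real \<times> real. k (y j0) * ?u (y j0) y"
  have sets_PiM: "sets (\<Pi>\<^sub>M j\<in>K. \<nu>) = sets (\<Pi>\<^sub>M j\<in>K. (borel :: (real \<times> real) measure))" for K :: "'j set"
    by (rule sets_PiM_cong) simp_all
  have meas_PiM: "measurable (\<Pi>\<^sub>M j\<in>K. \<nu>) M = measurable (\<Pi>\<^sub>M j\<in>K. (borel :: (real \<times> real) measure)) M" for K :: "'j set" and M :: "ennreal measure"
    by (rule measurable_cong_sets) (simp_all add: sets_PiM)
  have fst_meas [measurable]: "(\<lambda>x. f (fst x)) \<in> borel_measurable (borel :: (real \<times> real) measure)"
    using measurable_compose[OF measurable_fst f_measurable] by (simp add: borel_prod[symmetric])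
  have sumI: "(\<lambda>y. \<Sum>j\<in>J. w j * f (fst (y j))) \<in> borel_measurable (\<Pi>\<^sub>M j\<in>K. (borel :: (real \<times> real) measure))" if "J \<subseteq> K" for K
  proof (rule borel_measurable_sum)
    fix j assume "j \<in> J"
    then have [measurable]: "(\<lambda>y. y j) \<in> (\<Pi>\<^sub>M j\<in>K. (borel :: (real \<times> real) measure)) \<rightarrow>\<^sub>M borel"
      using that by (intro measurable_component_singleton) auto
    have "(\<lambda>y. f (fst (y j))) \<in> borel_measurable (\<Pi>\<^sub>M j\<in>K. (borel :: (real \<times> real) measure))"
      by (rule measurable_compose[OF _ fst_meas]) measurable
    then show "(\<lambda>y. w j * f (fst (y j))) \<in> borel_measurable (\<Pi>\<^sub>M j\<in>K. (borel :: (real \<times> real) measure))"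
      by measurable
  qed
  have \<Psi>: "?\<Psi> \<in> borel_measurable (\<Pi>\<^sub>M j\<in>?I. borel)"
  proof -
    have [measurable]: "(\<lambda>y. y j0) \<in> (\<Pi>\<^sub>M j\<in>?I. (borel :: (real \<times> real) measure)) \<rightarrow>\<^sub>M borel"
      by (intro measurable_component_singleton) auto
    have [measurable]: "(\<lambda>y. f (fst (y j0))) \<in> borel_measurable (\<Pi>\<^sub>M j\<in>?I. (borel :: (real \<times> real) measure))"
      by (rule measurable_compose[OF _ fst_meas]) measurable
    note sumI[of ?I, measurable]
    show ?thesis by measurable
  qed
  have ux: "?u x \<in> borel_measurable (\<Pi>\<^sub>M j\<in>J. borel)" for x
    using sumI[OF order_refl] by measurable
  have inj: "inj_on \<rho> J" "\<rho> ` J \<subseteq> claim_indices" using \<rho> by (auto intro: inj_on_subset)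
  have "(\<integral>\<^sup>+c. k (X (\<rho> j0) c) * h (a * f (fst (X (\<rho> j0) c)) + (\<Sum>j\<in>J. w j * f (fst (X (\<rho> j) c)))) \<partial>C) =
      (\<integral>\<^sup>+c. ?\<Psi> (\<lambda>j\<in>?I. X (\<rho> j) c) \<partial>C)"
    by (intro nn_integral_cong) simp
  also have "\<dots> = (\<integral>\<^sup>+y. ?\<Psi> y \<partial>(\<Pi>\<^sub>M j\<in>?I. \<nu>))" by (rule nn_integral_claims[OF \<rho> \<Psi>])
  also have "\<dots> = (\<integral>\<^sup>+x. (\<integral>\<^sup>+y. ?\<Psi> (y(j0 := x)) \<partial>(\<Pi>\<^sub>M j\<in>J. \<nu>)) \<partial>\<nu>)"
    by (rule psf.product_nn_integral_insert_rev[OF J]) (use \<Psi> in \<open>simp add: meas_PiM\<close>)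
  also have "\<dots> = (\<integral>\<^sup>+x. k x * (\<integral>\<^sup>+c. h (a * f (fst x) + (\<Sum>j\<in>J. w j * f (fst (X (\<rho> j) c)))) \<partial>C) \<partial>\<nu>)"
  proof (rule nn_integral_cong)
    fix x
    have "(\<Sum>j\<in>J. w j * f (fst ((y(j0 := x)) j))) = (\<Sum>j\<in>J. w j * f (fst (y j)))" for y :: "'j \<Rightarrow> real \<times> real"
      using J(2) by (intro sum.cong) auto
    then have "(\<integral>\<^sup>+y. ?\<Psi> (y(j0 := x)) \<partial>(\<Pi>\<^sub>M j\<in>J. \<nu>)) = (\<integral>\<^sup>+y. k x * ?u x y \<partial>(\<Pi>\<^sub>M j\<in>J. \<nu>))" by simp
    also have "\<dots> = k x * (\<integral>\<^sup>+y. ?u x y \<partial>(\<Pi>\<^sub>M j\<in>J. \<nu>))"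
      by (rule nn_integral_cmult) (use ux in \<open>simp add: meas_PiM\<close>)
    also have "(\<integral>\<^sup>+y. ?u x y \<partial>(\<Pi>\<^sub>M j\<in>J. \<nu>)) = (\<integral>\<^sup>+c. ?u x (\<lambda>j\<in>J. X (\<rho> j) c) \<partial>C)"
      by (rule nn_integral_claims[OF inj ux, symmetric])
    also have "\<dots> = (\<integral>\<^sup>+c. h (a * f (fst x) + (\<Sum>j\<in>J. w j * f (fst (X (\<rho> j) c)))) \<partial>C)" by simp
    finally show "(\<integral>\<^sup>+y. ?\<Psi> (y(j0 := x)) \<partial>(\<Pi>\<^sub>M j\<in>J. \<nu>)) =
      k x * (\<integral>\<^sup>+c. h (a * f (fst x) + (\<Sum>j\<in>J. w j * f (fst (X (\<rho> j) c)))) \<partial>C)" .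
  qed
  finally show ?thesis .
qed

section \<open>Loss of a configuration and the exchange of claims\<close>

definition disc :: "real \<Rightarrow> real" where "disc t = exp (- \<kappa> * (T - t))"

lemma disc_pos: "0 < disc t" by (simp add: disc_def)

lemma disc_measurable [measurable]: "disc \<in> borel_measurable borel"
  unfolding disc_def by measurable

text \<open>The position of \<open>z\<close> in time order among the accepted points, and thereby
  the index of its claim. It is written as a sum over the configuration, for which measurability is
  available; when finitely many points are accepted it is a cardinality.\<close>

definition claim_rank :: "real list \<Rightarrow> (real \<times> real) set \<Rightarrow> real \<times> real \<Rightarrow> nat" where
  "claim_rank vs \<omega> z = nat \<lfloor>enn2real (\<integral>\<^sup>+x. (if x \<in> S vs \<omega> \<and> fst x \<le> fst z then 1 else 0) \<partial>count_space \<omega>)\<rfloor>"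

definition random_part :: "real list \<Rightarrow> (real \<times> real) set \<Rightarrow> 'c \<Rightarrow> real" where
  "random_part vs \<omega> c = enn2real (\<integral>\<^sup>+z. (if z \<in> S vs \<omega>
     then ennreal (disc (fst z) * f (fst (X (Inl (claim_rank vs \<omega> z)) c))) else 0) \<partial>count_space \<omega>)"

definition loss :: "real list \<Rightarrow> (real \<times> real) set \<Rightarrow> 'c \<Rightarrow> real" where
  "loss vs \<omega> c = (\<Sum>k<length vs. disc (vs ! k) * f (fst (X (Inr (Suc k)) c))) + random_part vs \<omega> c"

text \<open>Under this almost sure condition ranks are genuine positions and distinct points have
  distinct ranks, so no claim is used twice.\<close>

definition regular :: "real list \<Rightarrow> (real \<times> real) set \<Rightarrow> bool" where
  "regular vs \<omega> \<longleftrightarrow> finite (S vs \<omega>) \<and> inj_on fst \<omega>"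

lemma AE_regular: "AE \<omega> in P. regular vs \<omega>"
  unfolding regular_def using AE_finite_accepted_points AE_distinct_times by eventually_elim simp

lemma nn_integral_accepted_points:
  assumes "finite (S vs \<omega>)"
  shows "(\<integral>\<^sup>+z. (if z \<in> S vs \<omega> then F z else 0) \<partial>count_space \<omega>) = (\<Sum>z\<in>S vs \<omega>. F z)"
proof -
  have "(\<integral>\<^sup>+z. (if z \<in> S vs \<omega> then F z else 0) \<partial>count_space \<omega>) = (\<Sum>z\<in>S vs \<omega>. if z \<in> S vs \<omega> then F z else 0)"
    by (rule nn_integral_count_space'[OF assms]) (use accepted_points_subset in auto)
  then show ?thesis by simp
qed

lemma claim_rank_eq:
  assumes "finite (S vs \<omega>)"
  shows "claim_rank vs \<omega> z = card {x \<in> S vs \<omega>. fst x \<le> fst z}"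
proof -
  have "(\<integral>\<^sup>+x. (if x \<in> S vs \<omega> \<and> fst x \<le> fst z then 1 else 0) \<partial>count_space \<omega>) =
      (\<integral>\<^sup>+x. (if x \<in> S vs \<omega> then (if fst x \<le> fst z then 1 else 0) else 0) \<partial>count_space \<omega>)"
    by (intro nn_integral_cong) auto
  also have "\<dots> = (\<Sum>x\<in>S vs \<omega>. if fst x \<le> fst z then 1 else 0)" by (rule nn_integral_accepted_points[OF assms])
  also have "\<dots> = of_nat (card {x \<in> S vs \<omega>. fst x \<le> fst z})"
    using assms by (simp add: sum.If_cases Int_def)
  finally show ?thesis by (simp add: claim_rank_def ennreal_of_nat_eq_real_of_nat)
qed

lemma claim_rank_pos: "finite (S vs \<omega>) \<Longrightarrow> z \<in> S vs \<omega> \<Longrightarrow> 1 \<le> claim_rank vs \<omega> z"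
proof -
  assume fin: "finite (S vs \<omega>)" and z: "z \<in> S vs \<omega>"
  have "card {z} \<le> card {x \<in> S vs \<omega>. fst x \<le> fst z}" by (intro card_mono) (use fin z in auto)
  then show "1 \<le> claim_rank vs \<omega> z" by (simp add: claim_rank_eq[OF fin])
qed

lemma claim_rank_inj:
  assumes "regular vs \<omega>"
  shows "inj_on (claim_rank vs \<omega>) (S vs \<omega>)"
proof -
  have fin: "finite (S vs \<omega>)" and inj: "inj_on fst \<omega>" using assms by (auto simp: regular_def)
  have less: "claim_rank vs \<omega> x < claim_rank vs \<omega> y" if "x \<in> S vs \<omega>" "y \<in> S vs \<omega>" "fst x < fst y" for x y
    unfolding claim_rank_eq[OF fin]
  proof (intro psubset_card_mono psubsetI)
    have "y \<in> {z \<in> S vs \<omega>. fst z \<le> fst y}" "y \<notin> {z \<in> S vs \<omega>. fst z \<le> fst x}" using that by auto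
    then show "{z \<in> S vs \<omega>. fst z \<le> fst x} \<noteq> {z \<in> S vs \<omega>. fst z \<le> fst y}" by blast
  qed (use fin that in auto)
  show ?thesis
  proof (rule inj_onI)
    fix x y assume xy: "x \<in> S vs \<omega>" "y \<in> S vs \<omega>" "claim_rank vs \<omega> x = claim_rank vs \<omega> y"
    then have "fst x = fst y" using less[of x y] less[of y x] by (cases "fst x" "fst y" rule: linorder_cases) auto
    then show "x = y" by (rule inj_onD[OF inj]) (rule subsetD[OF accepted_points_subset], rule xy)+
  qed
qed

lemma random_part_eq:
  assumes "finite (S vs \<omega>)"
  shows "random_part vs \<omega> c = (\<Sum>z\<in>S vs \<omega>. disc (fst z) * f (fst (X (Inl (claim_rank vs \<omega> z)) c)))"
proof -
  have nn: "0 \<le> disc (fst z) * f (fst (X (Inl (claim_rank vs \<omega> z)) c))" for z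
    using disc_pos[of "fst z"] f_nonneg by simp
  have "(\<integral>\<^sup>+z. (if z \<in> S vs \<omega> then ennreal (disc (fst z) * f (fst (X (Inl (claim_rank vs \<omega> z)) c))) else 0) \<partial>count_space \<omega>)
      = (\<Sum>z\<in>S vs \<omega>. ennreal (disc (fst z) * f (fst (X (Inl (claim_rank vs \<omega> z)) c))))"
    by (rule nn_integral_accepted_points[OF assms])
  also have "\<dots> = ennreal (\<Sum>z\<in>S vs \<omega>. disc (fst z) * f (fst (X (Inl (claim_rank vs \<omega> z)) c)))"
    by (rule sum_ennreal) (rule nn)
  finally show ?thesis by (simp add: random_part_def sum_nonneg nn)
qed

lemma loss_nonneg: "0 \<le> loss vs \<omega> c"
  unfolding loss_def random_part_def
  by (intro add_nonneg_nonneg sum_nonneg mult_nonneg_nonneg f_nonneg less_imp_le[OF disc_pos]) simp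

text \<open>The events behind a loss are the shifts, given by their position \<open>Inl k\<close>
  counted from zero, and the accepted points \<open>Inr z\<close>. With a time and a claim label for
  every event the loss is one sum over events, and exchanging claims amounts to changing labels.
  Barred claims are counted from one, hence \<open>Suc k\<close>.\<close>

definition claim_label :: "real list \<Rightarrow> (real \<times> real) set \<Rightarrow> nat + real \<times> real \<Rightarrow> nat + nat" where
  "claim_label vs \<omega> j = (case j of Inl k \<Rightarrow> Inr (Suc k) | Inr z \<Rightarrow> Inl (claim_rank vs \<omega> z))"

definition event_time :: "real list \<Rightarrow> nat + real \<times> real \<Rightarrow> real" where
  "event_time vs j = (case j of Inl k \<Rightarrow> vs ! k | Inr z \<Rightarrow> fst z)"

lemma loss_labelled:
  assumes "finite (S vs \<omega>)"
  shows "loss vs \<omega> c = (\<Sum>j\<in>{..<length vs} <+> S vs \<omega>. disc (event_time vs j) * f (fst (X (claim_label vs \<omega> j) c)))"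
  unfolding loss_def random_part_eq[OF assms] using assms
  by (subst sum.Plus) (simp_all add: claim_label_def event_time_def)

lemma claim_label_inj:
  assumes "regular vs \<omega>"
  shows "inj_on (claim_label vs \<omega>) ({..<n} <+> S vs \<omega>)"
    "claim_label vs \<omega> ` ({..<n} <+> S vs \<omega>) \<subseteq> claim_indices"
proof -
  have fin: "finite (S vs \<omega>)" using assms by (simp add: regular_def)
  show "inj_on (claim_label vs \<omega>) ({..<n} <+> S vs \<omega>)"
  proof (rule inj_onI)
    fix i j assume "i \<in> {..<n} <+> S vs \<omega>" "j \<in> {..<n} <+> S vs \<omega>" "claim_label vs \<omega> i = claim_label vs \<omega> j"
    then show "i = j"
      using inj_onD[OF claim_rank_inj[OF assms]] by (cases i; cases j) (auto simp: claim_label_def)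
  qed
  show "claim_label vs \<omega> ` ({..<n} <+> S vs \<omega>) \<subseteq> claim_indices"
  proof (rule image_subsetI)
    fix j assume "j \<in> {..<n} <+> S vs \<omega>"
    then show "claim_label vs \<omega> j \<in> claim_indices"
      using claim_rank_pos[OF fin] by (cases j) (auto simp: claim_label_def Suc_le_eq)
  qed
qed

text \<open>Removing \<open>z\<close> and shifting at \<open>fst z\<close> keeps the events and
  their times and changes only the labels: \<open>z\<close> receives the next barred claim, and the
  points after \<open>z\<close> move down by one rank. Both labellings are injective, so the claims
  have the same joint law under either. The marked event \<open>j0\<close> is the removed point at
  the first exchange and the first shift at all later ones; its new label is \<open>Inr 1\<close> in
  both cases.\<close>

lemma exchange:
  assumes reg: "regular vs \<omega>" and z: "z \<in> S vs \<omega>"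
    and j0: "(if vs = [] then j0 = Inr z else j0 = Inl 0)"
  shows "(\<integral>\<^sup>+c. g (X (claim_label vs \<omega> j0) c) * h (loss vs \<omega> c) \<partial>C) =
    (\<integral>\<^sup>+c. g (X (Inr 1) c) * h (loss (vs @ [fst z]) (\<omega> - {z}) c) \<partial>C)"
proof -
  let ?n = "length vs" and ?vs = "vs @ [fst z]" and ?\<omega> = "\<omega> - {z}"
  let ?J = "{..<?n} <+> S vs \<omega>"
  have fin: "finite (S vs \<omega>)" using reg by (simp add: regular_def)
  have S': "S ?vs ?\<omega> = S vs \<omega> - {z}" by (rule accepted_points_remove_point[OF z])
  have reg': "regular ?vs ?\<omega>" using reg by (auto simp: regular_def S' intro: inj_on_subset)
  have fin': "finite (S ?vs ?\<omega>)" using fin S' by simp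
  define \<rho>' where "\<rho>' j = (if j = Inr z then Inr (Suc ?n) else claim_label ?vs ?\<omega> j)" for j
  \<comment> \<open>The bijection between old and new events: the removed point becomes the shift at
    position \<open>?n\<close>, the end of the extended list.\<close>
  define \<sigma> where "\<sigma> j = (if j = Inr z then Inl ?n else j)" for j :: "nat + real \<times> real"
  have \<rho>'_\<sigma>: "\<rho>' j = claim_label ?vs ?\<omega> (\<sigma> j)" for j by (simp add: \<rho>'_def \<sigma>_def claim_label_def)
  have \<sigma>: "bij_betw \<sigma> ?J ({..<Suc ?n} <+> S ?vs ?\<omega>)"
    unfolding bij_betw_def
  proof
    show "inj_on \<sigma> ?J" by (auto simp: inj_on_def \<sigma>_def)
    show "\<sigma> ` ?J = {..<Suc ?n} <+> S ?vs ?\<omega>"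
      unfolding S'
    proof (intro equalityI subsetI)
      fix j assume "j \<in> {..<Suc ?n} <+> (S vs \<omega> - {z})"
      then consider k where "j = Inl k" "k < ?n" | "j = Inl ?n" | x where "j = Inr x" "x \<in> S vs \<omega>" "x \<noteq> z"
        by (auto simp: less_Suc_eq)
      then show "j \<in> \<sigma> ` ?J"
      proof cases
        case 1 then show ?thesis by (intro image_eqI[of _ _ "Inl k"]) (auto simp: \<sigma>_def)
      next
        case 2 then show ?thesis using z by (intro image_eqI[of _ _ "Inr z"]) (auto simp: \<sigma>_def)
      next
        case 3 then show ?thesis by (intro image_eqI[of _ _ "Inr x"]) (auto simp: \<sigma>_def)
      qed
    qed (auto simp: \<sigma>_def split: if_splits)
  qed
  note lab = claim_label_inj[OF reg', of "Suc ?n"]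
  have \<rho>': "inj_on \<rho>' ?J" "\<rho>' ` ?J \<subseteq> claim_indices"
  proof -
    have eq: "\<rho>' = claim_label ?vs ?\<omega> \<circ> \<sigma>" by (simp add: fun_eq_iff \<rho>'_\<sigma>)
    show "inj_on \<rho>' ?J" unfolding eq using \<sigma> lab(1) by (auto simp: bij_betw_def intro: comp_inj_on)
    show "\<rho>' ` ?J \<subseteq> claim_indices"
      unfolding eq image_comp[symmetric] using \<sigma> lab(2) by (simp add: bij_betw_def)
  qed
  have loss': "loss ?vs ?\<omega> c = (\<Sum>j\<in>?J. disc (event_time vs j) * f (fst (X (\<rho>' j) c)))" for c
  proof -
    have "loss ?vs ?\<omega> c = (\<Sum>j\<in>{..<Suc ?n} <+> S ?vs ?\<omega>. disc (event_time ?vs j) * f (fst (X (claim_label ?vs ?\<omega> j) c)))"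
      using loss_labelled[OF fin'] by simp
    also have "\<dots> = (\<Sum>j\<in>?J. disc (event_time ?vs (\<sigma> j)) * f (fst (X (claim_label ?vs ?\<omega> (\<sigma> j)) c)))"
      by (rule sum.reindex_bij_betw[OF \<sigma>, symmetric])
    also have "\<dots> = (\<Sum>j\<in>?J. disc (event_time vs j) * f (fst (X (\<rho>' j) c)))"
    proof (intro sum.cong refl)
      fix j assume "j \<in> ?J"
      then have "event_time ?vs (\<sigma> j) = event_time vs j" by (auto simp: \<sigma>_def event_time_def nth_append)
      then show "disc (event_time ?vs (\<sigma> j)) * f (fst (X (claim_label ?vs ?\<omega> (\<sigma> j)) c)) =
          disc (event_time vs j) * f (fst (X (\<rho>' j) c))"
        by (simp only: \<rho>'_\<sigma>)
    qed
    finally show ?thesis .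
  qed
  have j0J: "j0 \<in> ?J" using j0 z by (auto split: if_splits)
  have "\<rho>' j0 = Inr 1" using j0 by (auto simp: \<rho>'_def claim_label_def split: if_splits)
  moreover have "(\<integral>\<^sup>+c. g (X (claim_label vs \<omega> j0) c) * h (\<Sum>j\<in>?J. disc (event_time vs j) * f (fst (X (claim_label vs \<omega> j) c))) \<partial>C) =
    (\<integral>\<^sup>+c. g (X (\<rho>' j0) c) * h (\<Sum>j\<in>?J. disc (event_time vs j) * f (fst (X (\<rho>' j) c))) \<partial>C)"
    using fin by (intro relabel j0J claim_label_inj[OF reg] \<rho>') simp
  ultimately show ?thesis by (simp only: loss_labelled[OF fin] loss')
qed

section \<open>Averages over the claims and the recursion\<close>

definition loss_mean :: "real list \<Rightarrow> (real \<times> real) set \<Rightarrow> ennreal" where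
  "loss_mean vs \<omega> = (\<integral>\<^sup>+c. g (X (Inr 1) c) * h (loss vs \<omega> c) \<partial>C)"

lemma loss_mean_exchange:
  assumes "regular vs \<omega>" "z \<in> S vs \<omega>" "vs \<noteq> []"
  shows "loss_mean vs \<omega> = loss_mean (vs @ [fst z]) (\<omega> - {z})"
  unfolding loss_mean_def using exchange[OF assms(1,2), of "Inl 0"] assms(3) by (simp add: claim_label_def)

lemma measurable_claim_rank:
  assumes X: "\<And>i. i < n \<Longrightarrow> Y i \<in> borel_measurable W" and F: "F \<in> W \<rightarrow>\<^sub>M P" and z: "z \<in> borel_measurable W"
  shows "(\<lambda>w. claim_rank (map (\<lambda>i. Y i w) [0..<n]) (F w) (z w)) \<in> W \<rightarrow>\<^sub>M count_space UNIV"
proof -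
  have "(\<lambda>w. \<integral>\<^sup>+x. (if x \<in> S (map (\<lambda>i. Y i w) [0..<n]) (F w) \<and> fst x \<le> fst (z w) then 1 else 0) \<partial>count_space (F w))
      \<in> borel_measurable W"
  proof (rule measurable_campbell[OF F])
    have [measurable]: "(\<lambda>u. fst (z (fst u))) \<in> borel_measurable (W \<Otimes>\<^sub>M intensity T)"
    proof -
      have "(\<lambda>w. z w) \<in> W \<rightarrow>\<^sub>M borel \<Otimes>\<^sub>M borel" using z by (simp add: borel_prod)
      then show ?thesis by measurable
    qed
    have [measurable]: "Measurable.pred (W \<Otimes>\<^sub>M intensity T) (\<lambda>u. snd u \<in> S (map (\<lambda>i. Y i (fst u)) [0..<n]) (F (fst u)))"
      by (rule measurable_accepted_points)
         (use measurable_compose[OF measurable_fst X] measurable_compose[OF measurable_fst F]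
            measurable_compose[OF measurable_snd measurable_id_intensity] in auto)
    have "(\<lambda>u. if snd u \<in> S (map (\<lambda>i. Y i (fst u)) [0..<n]) (F (fst u)) \<and> fst (snd u) \<le> fst (z (fst u)) then 1 else 0 :: ennreal)
        \<in> borel_measurable (W \<Otimes>\<^sub>M intensity T)" by measurable
    then show "(\<lambda>(w, x). if x \<in> S (map (\<lambda>i. Y i w) [0..<n]) (F w) \<and> fst x \<le> fst (z w) then 1 else 0 :: ennreal)
        \<in> borel_measurable (W \<Otimes>\<^sub>M intensity T)" by (simp add: split_beta')
  qed
  then show ?thesis unfolding claim_rank_def by measurable
qed

lemma measurable_claim_label:
  assumes "r \<in> W \<rightarrow>\<^sub>M count_space UNIV" and c: "c \<in> W \<rightarrow>\<^sub>M C"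
  shows "(\<lambda>w. X (Inl (r w)) (c w)) \<in> borel_measurable W"
  by (rule measurable_compose_countable[OF _ assms(1)]) (rule measurable_compose[OF c X_measurable])

lemma measurable_random_part:
  assumes Y: "\<And>i. i < n \<Longrightarrow> Y i \<in> borel_measurable W" and F: "F \<in> W \<rightarrow>\<^sub>M P" and c: "c \<in> W \<rightarrow>\<^sub>M C"
  shows "(\<lambda>w. random_part (map (\<lambda>i. Y i w) [0..<n]) (F w) (c w)) \<in> borel_measurable W"
proof -
  have "(\<lambda>w. \<integral>\<^sup>+z. (if z \<in> S (map (\<lambda>i. Y i w) [0..<n]) (F w) then ennreal (disc (fst z) * f (fst (X (Inl (claim_rank (map (\<lambda>i. Y i w) [0..<n]) (F w) z)) (c w)))) else 0) \<partial>count_space (F w))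
      \<in> borel_measurable W"
  proof (rule measurable_campbell[OF F])
    let ?W = "W \<Otimes>\<^sub>M intensity T"
    note m = measurable_compose[OF measurable_fst Y] measurable_compose[OF measurable_fst F]
      measurable_compose[OF measurable_snd measurable_id_intensity] measurable_compose[OF measurable_fst c]
    have [measurable]: "Measurable.pred ?W (\<lambda>u. snd u \<in> S (map (\<lambda>i. Y i (fst u)) [0..<n]) (F (fst u)))"
      by (rule measurable_accepted_points) (use m in auto)
    have "(\<lambda>u. claim_rank (map (\<lambda>i. Y i (fst u)) [0..<n]) (F (fst u)) (snd u)) \<in> ?W \<rightarrow>\<^sub>M count_space UNIV"
      by (rule measurable_claim_rank) (use m in auto)
    from measurable_claim_label[OF this m(4)]
    have "(\<lambda>u. X (Inl (claim_rank (map (\<lambda>i. Y i (fst u)) [0..<n]) (F (fst u)) (snd u))) (c (fst u))) \<in> ?W \<rightarrow>\<^sub>M borel \<Otimes>\<^sub>M borel"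
      by (simp add: borel_prod)
    from measurable_compose[OF measurable_compose[OF this measurable_fst] f_measurable]
    have [measurable]: "(\<lambda>u. f (fst (X (Inl (claim_rank (map (\<lambda>i. Y i (fst u)) [0..<n]) (F (fst u)) (snd u))) (c (fst u))))) \<in> borel_measurable ?W" .
    have "(\<lambda>u. if snd u \<in> S (map (\<lambda>i. Y i (fst u)) [0..<n]) (F (fst u)) then ennreal (disc (fst (snd u)) *
        f (fst (X (Inl (claim_rank (map (\<lambda>i. Y i (fst u)) [0..<n]) (F (fst u)) (snd u))) (c (fst u))))) else 0) \<in> borel_measurable ?W"
      by measurable
    then show "(\<lambda>(w, z). if z \<in> S (map (\<lambda>i. Y i w) [0..<n]) (F w) then ennreal (disc (fst z) * f (fst (X (Inl (claim_rank (map (\<lambda>i. Y i w) [0..<n]) (F w) z)) (c w)))) else 0)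
      \<in> borel_measurable ?W" by (simp add: split_beta')
  qed
  then show ?thesis unfolding random_part_def by measurable
qed

lemma measurable_shift_term:
  assumes "v \<in> borel_measurable W" and c: "c \<in> W \<rightarrow>\<^sub>M C"
  shows "(\<lambda>w. disc (v w) * f (fst (X k (c w)))) \<in> borel_measurable W"
proof -
  have "(\<lambda>w. X k (c w)) \<in> W \<rightarrow>\<^sub>M borel \<Otimes>\<^sub>M borel"
    using measurable_compose[OF c X_measurable] by (simp add: borel_prod)
  from measurable_compose[OF measurable_compose[OF this measurable_fst] f_measurable]
  show ?thesis using assms(1) by measurable
qed

lemma measurable_loss:
  assumes Y: "\<And>i. i < n \<Longrightarrow> Y i \<in> borel_measurable W" and F: "F \<in> W \<rightarrow>\<^sub>M P" and c: "c \<in> W \<rightarrow>\<^sub>M C"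
  shows "(\<lambda>w. loss (map (\<lambda>i. Y i w) [0..<n]) (F w) (c w)) \<in> borel_measurable W"
proof -
  have "(\<lambda>w. \<Sum>k<n. disc (Y k w) * f (fst (X (Inr (Suc k)) (c w)))) \<in> borel_measurable W"
    by (rule borel_measurable_sum) (use Y measurable_shift_term[OF _ c] in auto)
  then show ?thesis
    unfolding loss_def using measurable_random_part[OF assms] by simp
qed

lemma measurable_loss_mean:
  assumes Y: "\<And>i. i < n \<Longrightarrow> Y i \<in> borel_measurable W" and F: "F \<in> W \<rightarrow>\<^sub>M P"
  shows "(\<lambda>w. loss_mean (map (\<lambda>i. Y i w) [0..<n]) (F w)) \<in> borel_measurable W"
  unfolding loss_mean_def
proof (rule C.borel_measurable_nn_integral)
  have "(\<lambda>u. loss (map (\<lambda>i. Y i (fst u)) [0..<n]) (F (fst u)) (snd u)) \<in> borel_measurable (W \<Otimes>\<^sub>M C)"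
    by (rule measurable_loss) (use measurable_compose[OF measurable_fst Y] measurable_compose[OF measurable_fst F] in auto)
  then have "(\<lambda>u. g (X (Inr 1) (snd u)) * h (loss (map (\<lambda>i. Y i (fst u)) [0..<n]) (F (fst u)) (snd u))) \<in> borel_measurable (W \<Otimes>\<^sub>M C)"
    by measurable
  then show "(\<lambda>(w, c). g (X (Inr 1) c) * h (loss (map (\<lambda>i. Y i w) [0..<n]) (F w) c)) \<in> borel_measurable (W \<Otimes>\<^sub>M C)"
    by (simp add: split_beta')
qed

lemma measurable_loss_mean_const:
  "(\<lambda>\<omega>. loss_mean vs \<omega>) \<in> borel_measurable P"
  using measurable_loss_mean[of "length vs" "\<lambda>i w. vs ! i" P "\<lambda>\<omega>. \<omega>"] by (simp add: map_nth)

lemma measurable_loss_mean_snoc: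
  "(\<lambda>(\<omega>, s). loss_mean (vs @ [s]) \<omega>) \<in> borel_measurable (P \<Otimes>\<^sub>M borel)"
proof -
  have "map (\<lambda>i. (vs @ [s]) ! i) [0..<Suc (length vs)] = vs @ [s]" for s
    using map_nth[of "vs @ [s]"] by simp
  moreover have "(\<lambda>w. loss_mean (map (\<lambda>i. (vs @ [snd w]) ! i) [0..<Suc (length vs)]) (fst w)) \<in> borel_measurable (P \<Otimes>\<^sub>M borel)"
  proof (rule measurable_loss_mean)
    fix i
    show "(\<lambda>w. (vs @ [snd w]) ! i) \<in> borel_measurable (P \<Otimes>\<^sub>M borel)" if "i < Suc (length vs)"
      using that by (cases "i < length vs") (auto simp: nth_append)
  qed simp
  ultimately show ?thesis by (simp only: split_beta')
qed

lemma loss_mean_le: "loss_mean vs \<omega> \<le> ennreal gb * ennreal hb"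
proof -
  have "loss_mean vs \<omega> \<le> (\<integral>\<^sup>+c. ennreal gb * ennreal hb \<partial>C)"
    unfolding loss_mean_def by (intro nn_integral_mono mult_mono g_le h_le) auto
  then show ?thesis by (simp add: C.emeasure_space_1)
qed

text \<open>In the lists that occur the times decrease, so \<open>last vs\<close> is the earliest
  shift. This mean still contains the random intensity at that time, which is to be expanded
  further; \<open>shift_mean\<close> is what appears once that intensity is replaced by a
  constant.\<close>

definition rate_mean :: "real list \<Rightarrow> ennreal" where
  "rate_mean vs = (\<integral>\<^sup>+\<omega>. \<Lambda>' vs \<omega> (last vs) * loss_mean vs \<omega> \<partial>P)"

definition shift_mean :: "real list \<Rightarrow> ennreal" where
  "shift_mean vs = (\<integral>\<^sup>+\<omega>. loss_mean vs \<omega> \<partial>P)"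

lemma shift_mean_le: "shift_mean vs \<le> ennreal gb * ennreal hb"
proof -
  have "shift_mean vs \<le> (\<integral>\<^sup>+\<omega>. ennreal gb * ennreal hb \<partial>P)"
    unfolding shift_mean_def by (intro nn_integral_mono loss_mean_le)
  then show ?thesis using emeasure_space_1 by simp
qed

text \<open>Up to the earliest shift time no shift has acted, so the intensity there is that of the
  unshifted process. The bound is thus the one for the empty list and does not grow with the number
  of shifts.\<close>

lemma rate_mean_le:
  assumes "\<And>v. v \<in> set vs \<Longrightarrow> last vs \<le> v"
  shows "rate_mean vs \<le> rate_bound [] * (ennreal gb * ennreal hb)"
proof -
  have "rate_mean vs \<le> (\<integral>\<^sup>+\<omega>. \<Lambda>' [] \<omega> (last vs) * (ennreal gb * ennreal hb) \<partial>P)"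
    unfolding rate_mean_def
    by (intro nn_integral_mono mult_mono loss_mean_le) (simp_all add: rate_limit_before_shifts[OF assms])
  also have "\<dots> = (\<integral>\<^sup>+\<omega>. \<Lambda>' [] \<omega> (last vs) \<partial>P) * (ennreal gb * ennreal hb)"
    by (rule nn_integral_multc) (rule measurable_rate_limit_at)
  also have "\<dots> \<le> rate_bound [] * (ennreal gb * ennreal hb)"
    by (intro mult_right_mono expectation_rate_limit_le) simp
  finally show ?thesis .
qed

text \<open>The last shift time carries the intensity \<open>\<mu> + \<integral> \<Phi> dH\<close>; the constant part gives a term
  of the series, and the thinning formula turns the integral into one further shift.\<close>

lemma rate_mean_recursion:
  assumes vs: "vs \<noteq> []" and last: "\<And>v. v \<in> set vs \<Longrightarrow> last vs \<le> v"
  shows "rate_mean vs = m * shift_mean vs + (\<integral>\<^sup>+s\<in>{0..T}. (if s < last vs then \<phi> (last vs - s) else 0) * rate_mean (vs @ [s]) \<partial>lborel)"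
proof -
  let ?t = "last vs"
  let ?k = "\<lambda>s. if s < ?t then \<phi> (?t - s) else 0"
  let ?G = "\<lambda>\<omega> s. ?k s * loss_mean (vs @ [s]) \<omega>"
  have k [measurable]: "?k \<in> borel_measurable borel" by measurable
  have G: "(\<lambda>(\<omega>, s). ?G \<omega> s) \<in> borel_measurable (P \<Otimes>\<^sub>M borel)"
    using measurable_loss_mean_snoc[of vs] by (simp add: split_beta')
  \<comment> \<open>No shift lies strictly before the earliest one, so the intensity consists of the
    constant and the sum over accepted points.\<close>
  have sum0: "(\<Sum>v\<leftarrow>vs. if v < ?t then \<phi> (?t - v) else 0) = 0"
  proof -
    have "map (\<lambda>v. if v < ?t then \<phi> (?t - v) else 0) vs = map (\<lambda>_. 0) vs"
      by (intro map_cong refl) (simp add: leD[OF last])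
    then show ?thesis by (simp only:) simp
  qed
  let ?U = "\<lambda>\<omega>. \<integral>\<^sup>+z. (if fst z < ?t \<and> z \<in> S vs \<omega> then \<phi> (?t - fst z) else 0) \<partial>count_space \<omega>"
  have split: "\<Lambda>' vs \<omega> ?t * loss_mean vs \<omega> = m * loss_mean vs \<omega> + ?U \<omega> * loss_mean vs \<omega>" for \<omega>
    unfolding rate_limit_eq sum0 by (simp add: distrib_right)
  have U: "?U \<in> borel_measurable P"
  proof (rule measurable_campbell)
    have "Measurable.pred (P \<Otimes>\<^sub>M intensity T) (\<lambda>w. snd w \<in> S (map (\<lambda>i. vs ! i) [0..<length vs]) (fst w))"
      using measurable_compose[OF measurable_snd measurable_id_intensity]
      by (intro measurable_accepted_points[where X = "\<lambda>i w. vs ! i"]) simp_all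
    then have [measurable]: "Measurable.pred (P \<Otimes>\<^sub>M intensity T) (\<lambda>w. snd w \<in> S vs (fst w))"
      unfolding map_nth .
    have "(\<lambda>w. if fst (snd w) < ?t \<and> snd w \<in> S vs (fst w) then \<phi> (?t - fst (snd w)) else 0) \<in> borel_measurable (P \<Otimes>\<^sub>M intensity T)"
      by measurable
    then show "(\<lambda>(\<omega>, z). if fst z < ?t \<and> z \<in> S vs \<omega> then \<phi> (?t - fst z) else 0) \<in> borel_measurable (P \<Otimes>\<^sub>M intensity T)"
      by (simp add: split_beta')
  qed simp
  have "rate_mean vs = (\<integral>\<^sup>+\<omega>. m * loss_mean vs \<omega> + ?U \<omega> * loss_mean vs \<omega> \<partial>P)"
    unfolding rate_mean_def split ..
  also have "\<dots> = m * shift_mean vs + (\<integral>\<^sup>+\<omega>. ?U \<omega> * loss_mean vs \<omega> \<partial>P)"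
    unfolding shift_mean_def using U measurable_loss_mean_const[of vs] by (simp add: nn_integral_add nn_integral_cmult)
  also have "(\<integral>\<^sup>+\<omega>. ?U \<omega> * loss_mean vs \<omega> \<partial>P) =
      (\<integral>\<^sup>+\<omega>. (\<integral>\<^sup>+z. (if z \<in> S vs \<omega> then ?G (\<omega> - {z}) (fst z) else 0) \<partial>count_space \<omega>) \<partial>P)"
  proof (rule nn_integral_cong_AE)
    show "AE \<omega> in P. ?U \<omega> * loss_mean vs \<omega> = (\<integral>\<^sup>+z. (if z \<in> S vs \<omega> then ?G (\<omega> - {z}) (fst z) else 0) \<partial>count_space \<omega>)"
      using AE_regular[of vs]
    proof eventually_elim
      case (elim \<omega>)
      have "?U \<omega> * loss_mean vs \<omega> = (\<integral>\<^sup>+z. (if fst z < ?t \<and> z \<in> S vs \<omega> then \<phi> (?t - fst z) else 0) * loss_mean vs \<omega> \<partial>count_space \<omega>)"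
        by (rule nn_integral_multc[symmetric]) simp
      also have "\<dots> = (\<integral>\<^sup>+z. (if z \<in> S vs \<omega> then ?G (\<omega> - {z}) (fst z) else 0) \<partial>count_space \<omega>)"
        using loss_mean_exchange[OF elim _ vs] by (intro nn_integral_cong) auto
      finally show ?case .
    qed
  qed
  also have "\<dots> = (\<integral>\<^sup>+s\<in>{0..T}. (\<integral>\<^sup>+\<omega>. \<Lambda>' vs \<omega> s * ?G \<omega> s \<partial>P) \<partial>lborel)"
    by (rule thinning_formula[OF G])
  also have "\<dots> = (\<integral>\<^sup>+s\<in>{0..T}. ?k s * rate_mean (vs @ [s]) \<partial>lborel)"
  proof (intro nn_integral_cong arg_cong2[where f = "(*)"] refl)
    fix s
    \<comment> \<open>By predictability a shift at \<open>s\<close> does not change the intensity at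
      \<open>s\<close>. The factor left by the thinning formula is therefore the intensity that
      belongs to the longer list.\<close>
    have "(\<integral>\<^sup>+\<omega>. \<Lambda>' vs \<omega> s * ?G \<omega> s \<partial>P) = (\<integral>\<^sup>+\<omega>. ?k s * (\<Lambda>' (vs @ [s]) \<omega> s * loss_mean (vs @ [s]) \<omega>) \<partial>P)"
      by (simp add: rate_limit_append_shift ac_simps)
    also have "\<dots> = ?k s * rate_mean (vs @ [s])"
      unfolding rate_mean_def last_snoc using measurable_rate_limit_at[of "vs @ [s]" s] measurable_loss_mean_const[of "vs @ [s]"]
      by (intro nn_integral_cmult) measurable
    finally show "(\<integral>\<^sup>+\<omega>. \<Lambda>' vs \<omega> s * ?G \<omega> s \<partial>P) = ?k s * rate_mean (vs @ [s])" .
  qed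
  finally show ?thesis .
qed

definition claims_K :: "(real \<times> real) set \<Rightarrow> 'c \<Rightarrow> ennreal" where
  "claims_K \<omega> c = (\<integral>\<^sup>+z. (if z \<in> S [] \<omega> then ennreal (disc (fst z)) * g (X (Inl (claim_rank [] \<omega> z)) c) else 0) \<partial>count_space \<omega>)"

text \<open>The start of the recursion. Every accepted point contributes its own discounted claim,
  and its removal turns that claim into the first barred one; from then on the marked claim stays
  with the first shift.\<close>

lemma expectation_claims:
  "(\<integral>\<^sup>+\<omega>. (\<integral>\<^sup>+c. claims_K \<omega> c * h (loss [] \<omega> c) \<partial>C) \<partial>P) =
    (\<integral>\<^sup>+s\<in>{0..T}. ennreal (disc s) * rate_mean [s] \<partial>lborel)"
proof -
  let ?G = "\<lambda>\<omega> s. ennreal (disc s) * loss_mean [s] \<omega>"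
  have G: "(\<lambda>(\<omega>, s). ?G \<omega> s) \<in> borel_measurable (P \<Otimes>\<^sub>M borel)"
    using measurable_loss_mean_snoc[of "[]"] by (simp add: split_beta')
  have ml: "(\<lambda>c. loss [] \<omega> c) \<in> borel_measurable C" if "\<omega> \<in> space P" for \<omega>
    using measurable_loss[of 0 "\<lambda>i w. 0" C "\<lambda>_. \<omega>" "\<lambda>c. c"] that by simp
  have "(\<integral>\<^sup>+\<omega>. (\<integral>\<^sup>+c. claims_K \<omega> c * h (loss [] \<omega> c) \<partial>C) \<partial>P) =
      (\<integral>\<^sup>+\<omega>. (\<integral>\<^sup>+z. (if z \<in> S [] \<omega> then ?G (\<omega> - {z}) (fst z) else 0) \<partial>count_space \<omega>) \<partial>P)"
  proof (rule nn_integral_cong_AE)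
    show "AE \<omega> in P. (\<integral>\<^sup>+c. claims_K \<omega> c * h (loss [] \<omega> c) \<partial>C) =
        (\<integral>\<^sup>+z. (if z \<in> S [] \<omega> then ?G (\<omega> - {z}) (fst z) else 0) \<partial>count_space \<omega>)"
      using AE_regular[of "[]"] AE_space
    proof eventually_elim
      case (elim \<omega>)
      have fin: "finite (S [] \<omega>)" using elim by (simp add: regular_def)
      note ml[OF elim(2), measurable]
      have "(\<integral>\<^sup>+c. claims_K \<omega> c * h (loss [] \<omega> c) \<partial>C) =
          (\<integral>\<^sup>+c. (\<Sum>z\<in>S [] \<omega>. ennreal (disc (fst z)) * (g (X (Inl (claim_rank [] \<omega> z)) c) * h (loss [] \<omega> c))) \<partial>C)"
        unfolding claims_K_def nn_integral_accepted_points[OF fin] sum_distrib_right mult.assoc ..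
      also have "\<dots> = (\<Sum>z\<in>S [] \<omega>. \<integral>\<^sup>+c. ennreal (disc (fst z)) * (g (X (Inl (claim_rank [] \<omega> z)) c) * h (loss [] \<omega> c)) \<partial>C)"
        by (rule nn_integral_sum) measurable
      also have "\<dots> = (\<Sum>z\<in>S [] \<omega>. ennreal (disc (fst z)) * (\<integral>\<^sup>+c. g (X (Inl (claim_rank [] \<omega> z)) c) * h (loss [] \<omega> c) \<partial>C))"
        by (intro sum.cong refl nn_integral_cmult) measurable
      also have "\<dots> = (\<Sum>z\<in>S [] \<omega>. ?G (\<omega> - {z}) (fst z))"
        using exchange[OF elim(1)] by (intro sum.cong refl) (simp add: loss_mean_def claim_label_def)
      also have "\<dots> = (\<integral>\<^sup>+z. (if z \<in> S [] \<omega> then ?G (\<omega> - {z}) (fst z) else 0) \<partial>count_space \<omega>)"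
        by (rule nn_integral_accepted_points[OF fin, symmetric])
      finally show ?case .
    qed
  qed
  also have "\<dots> = (\<integral>\<^sup>+s\<in>{0..T}. (\<integral>\<^sup>+\<omega>. \<Lambda>' [] \<omega> s * ?G \<omega> s \<partial>P) \<partial>lborel)"
    by (rule thinning_formula[OF G])
  also have "\<dots> = (\<integral>\<^sup>+s\<in>{0..T}. ennreal (disc s) * rate_mean [s] \<partial>lborel)"
  proof (intro nn_integral_cong arg_cong2[where f = "(*)"] refl)
    fix s
    have "\<Lambda>' [] \<omega> s = \<Lambda>' [s] \<omega> s" for \<omega> using rate_limit_append_shift[of s s \<phi> m "[]" \<omega>] by simp
    then have "(\<integral>\<^sup>+\<omega>. \<Lambda>' [] \<omega> s * ?G \<omega> s \<partial>P) = (\<integral>\<^sup>+\<omega>. ennreal (disc s) * (\<Lambda>' [s] \<omega> s * loss_mean [s] \<omega>) \<partial>P)"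
      by (simp add: ac_simps)
    also have "\<dots> = ennreal (disc s) * rate_mean [s]"
      unfolding rate_mean_def last.simps using measurable_rate_limit_at[of "[s]" s] measurable_loss_mean_const[of "[s]"]
      by (subst nn_integral_cmult) auto
    finally show "(\<integral>\<^sup>+\<omega>. \<Lambda>' [] \<omega> s * ?G \<omega> s \<partial>P) = ennreal (disc s) * rate_mean [s]" .
  qed
  finally show ?thesis .
qed

lemma measurable_shift_mean: "(\<lambda>x. shift_mean (map x [0..<n])) \<in> borel_measurable vecs"
  and measurable_rate_mean: "0 < n \<Longrightarrow> (\<lambda>x. rate_mean (map x [0..<n])) \<in> borel_measurable vecs"
proof -
  have c: "(\<lambda>w. fst w i) \<in> borel_measurable (vecs \<Otimes>\<^sub>M P)" for i
    by (rule measurable_compose[OF measurable_fst]) (rule measurable_component_singleton, simp)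
  have 1: "(\<lambda>w. loss_mean (map (fst w) [0..<n]) (snd w)) \<in> borel_measurable (vecs \<Otimes>\<^sub>M P)"
    by (rule measurable_loss_mean) (use c in auto)
  then show "(\<lambda>x. shift_mean (map x [0..<n])) \<in> borel_measurable vecs"
    unfolding shift_mean_def by (intro borel_measurable_nn_integral) (simp add: split_beta')
  assume n: "0 < n"
  have "(\<lambda>w. \<Lambda>' (map (fst w) [0..<n]) (snd w) (fst w (n - 1))) \<in> borel_measurable (vecs \<Otimes>\<^sub>M P)"
    by (rule measurable_rate_limit) (use c in auto)
  moreover have "last (map x [0..<n]) = x (n - 1)" for x :: "nat \<Rightarrow> real"
    using n by (simp add: last_map)
  ultimately show "(\<lambda>x. rate_mean (map x [0..<n])) \<in> borel_measurable vecs"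
    unfolding rate_mean_def using 1 by (intro borel_measurable_nn_integral) (simp add: split_beta')
qed

section \<open>Conditioning on the first barred claim\<close>

definition rest :: "real list \<Rightarrow> (real \<times> real) set \<Rightarrow> 'c \<Rightarrow> real" where
  "rest vs \<omega> c = (\<Sum>k\<in>{1..<length vs}. disc (vs ! k) * f (fst (X (Inr (Suc k)) c))) + random_part vs \<omega> c"

text \<open>A version of the conditional mean of \<open>h\<close> of the loss, given that the first
  component of the first barred claim equals \<open>y\<close>. That claim enters the loss only
  through \<open>f y\<close>, so the version is a function of one real variable.\<close>

definition cond_loss :: "real list \<Rightarrow> real \<Rightarrow> ennreal" where
  "cond_loss vs y = (\<integral>\<^sup>+\<omega>. (\<integral>\<^sup>+c. h (disc (vs ! 0) * f y + rest vs \<omega> c) \<partial>C) \<partial>P)"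

lemma loss_split:
  assumes "vs \<noteq> []"
  shows "loss vs \<omega> c = disc (vs ! 0) * f (fst (X (Inr 1) c)) + rest vs \<omega> c"
proof -
  have "{..<length vs} = insert 0 {1..<length vs}" using assms by auto
  then show ?thesis by (simp add: loss_def rest_def)
qed

lemma measurable_rest: "(\<lambda>w. rest vs (fst w) (snd w)) \<in> borel_measurable (P \<Otimes>\<^sub>M C)"
proof -
  have "(\<lambda>w. random_part (map (\<lambda>i. vs ! i) [0..<length vs]) (fst w) (snd w)) \<in> borel_measurable (P \<Otimes>\<^sub>M C)"
    by (rule measurable_random_part) auto
  then have "(\<lambda>w. random_part vs (fst w) (snd w)) \<in> borel_measurable (P \<Otimes>\<^sub>M C)" by (simp only: map_nth)
  moreover have "(\<lambda>w. \<Sum>k\<in>{1..<length vs}. disc (vs ! k) * f (fst (X (Inr (Suc k)) (snd w)))) \<in> borel_measurable (P \<Otimes>\<^sub>M C)"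
    by (intro borel_measurable_sum measurable_shift_term) auto
  ultimately show ?thesis unfolding rest_def by measurable
qed

lemma measurable_cond_inner:
  "(\<lambda>u. \<integral>\<^sup>+c. h (disc (vs ! 0) * f (fst u) + rest vs (snd u) c) \<partial>C) \<in> borel_measurable (borel \<Otimes>\<^sub>M P)"
proof (rule C.borel_measurable_nn_integral)
  have "(\<lambda>u. (snd (fst u), snd u)) \<in> (borel \<Otimes>\<^sub>M P) \<Otimes>\<^sub>M C \<rightarrow>\<^sub>M P \<Otimes>\<^sub>M C" by measurable
  from measurable_compose[OF this measurable_rest[of vs]]
  have [measurable]: "(\<lambda>u. rest vs (snd (fst u)) (snd u)) \<in> borel_measurable ((borel \<Otimes>\<^sub>M P) \<Otimes>\<^sub>M C)" by simp
  have "(\<lambda>u. h (disc (vs ! 0) * f (fst (fst u)) + rest vs (snd (fst u)) (snd u))) \<in> borel_measurable ((borel \<Otimes>\<^sub>M P) \<Otimes>\<^sub>M C)"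
    by measurable
  then show "(\<lambda>(u, c). h (disc (vs ! 0) * f (fst u) + rest vs (snd u) c)) \<in> borel_measurable ((borel \<Otimes>\<^sub>M P) \<Otimes>\<^sub>M C)"
    by (simp add: split_beta')
qed

lemma measurable_cond_loss [measurable]: "cond_loss vs \<in> borel_measurable borel"
  unfolding cond_loss_def
  by (rule borel_measurable_nn_integral) (use measurable_cond_inner[of vs] in \<open>simp add: split_beta'\<close>)

lemma cond_loss_le: "cond_loss vs y \<le> ennreal hb"
proof -
  have "cond_loss vs y \<le> (\<integral>\<^sup>+\<omega>. (\<integral>\<^sup>+c. ennreal hb \<partial>C) \<partial>P)"
    unfolding cond_loss_def by (intro nn_integral_mono h_le)
  then show ?thesis using emeasure_space_1 C.emeasure_space_1 by simp
qed

text \<open>Given \<open>\<eta>'\<^sub>1\<close>, the other ingredients of the loss are independent of \<open>(\<eta>'\<^sub>1, \<vartheta>'\<^sub>1)\<close>.\<close>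

lemma expectation_cond_loss:
  assumes vs: "vs \<noteq> []" and k [measurable]: "k \<in> borel_measurable borel"
  shows "(\<integral>\<^sup>+\<omega>. (\<integral>\<^sup>+c. k (X (Inr 1) c) * h (loss vs \<omega> c) \<partial>C) \<partial>P) =
    (\<integral>\<^sup>+c. k (X (Inr 1) c) * cond_loss vs (fst (X (Inr 1) c)) \<partial>C)"
proof -
  interpret \<nu>: prob_space \<nu> by (rule prob_\<nu>)
  let ?n = "length vs"
  let ?u = "\<lambda>y \<omega>. \<integral>\<^sup>+c. h (disc (vs ! 0) * f y + rest vs \<omega> c) \<partial>C"
  have fst_meas: "fst \<in> borel_measurable (borel :: (real \<times> real) measure)"
    using measurable_fst[of "borel :: real measure" "borel :: real measure"] by (simp add: borel_prod)
  have inner: "(\<integral>\<^sup>+c. k (X (Inr 1) c) * h (loss vs \<omega> c) \<partial>C) = (\<integral>\<^sup>+x. k x * ?u (fst x) \<omega> \<partial>\<nu>)"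
    if reg: "regular vs \<omega>" for \<omega>
  proof -
    let ?J = "{1..<?n} <+> S vs \<omega>" and ?j0 = "Inl 0 :: nat + real \<times> real"
    have fin: "finite (S vs \<omega>)" using reg by (simp add: regular_def)
    have I: "insert ?j0 ?J = {..<?n} <+> S vs \<omega>" using vs by auto
    have rest: "rest vs \<omega> c = (\<Sum>j\<in>?J. disc (event_time vs j) * f (fst (X (claim_label vs \<omega> j) c)))" for c
      unfolding rest_def random_part_eq[OF fin] using fin
      by (subst sum.Plus) (simp_all add: claim_label_def event_time_def)
    have "(\<integral>\<^sup>+c. k (X (claim_label vs \<omega> ?j0) c) * h (disc (vs ! 0) * f (fst (X (claim_label vs \<omega> ?j0) c)) +
          (\<Sum>j\<in>?J. disc (event_time vs j) * f (fst (X (claim_label vs \<omega> j) c)))) \<partial>C) =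
        (\<integral>\<^sup>+x. k x * (\<integral>\<^sup>+c. h (disc (vs ! 0) * f (fst x) +
          (\<Sum>j\<in>?J. disc (event_time vs j) * f (fst (X (claim_label vs \<omega> j) c)))) \<partial>C) \<partial>\<nu>)"
    proof (rule factor_claim)
      show "inj_on (claim_label vs \<omega>) (insert ?j0 ?J)" "claim_label vs \<omega> ` insert ?j0 ?J \<subseteq> claim_indices"
        unfolding I by (rule claim_label_inj[OF reg])+
    qed (use fin in auto)
    moreover have "claim_label vs \<omega> ?j0 = Inr 1" by (simp add: claim_label_def)
    ultimately show ?thesis by (simp only: loss_split[OF vs] rest)
  qed
  have ku: "(\<lambda>(\<omega>, x). k x * ?u (fst x) \<omega>) \<in> borel_measurable (P \<Otimes>\<^sub>M \<nu>)"
  proof -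
    have "(\<lambda>w. (fst (snd w), fst w)) \<in> P \<Otimes>\<^sub>M (borel :: (real \<times> real) measure) \<rightarrow>\<^sub>M borel \<Otimes>\<^sub>M P"
      by (rule measurable_Pair[OF measurable_compose[OF measurable_snd fst_meas] measurable_fst])
    from measurable_compose[OF this measurable_cond_inner[of vs]]
    have [measurable]: "(\<lambda>w. ?u (fst (snd w)) (fst w)) \<in> borel_measurable (P \<Otimes>\<^sub>M (borel :: (real \<times> real) measure))" by simp
    have "(\<lambda>w. k (snd w) * ?u (fst (snd w)) (fst w)) \<in> borel_measurable (P \<Otimes>\<^sub>M (borel :: (real \<times> real) measure))"
      by measurable
    also have "borel_measurable (P \<Otimes>\<^sub>M (borel :: (real \<times> real) measure)) = borel_measurable (P \<Otimes>\<^sub>M \<nu>)"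
      by (rule measurable_cong_sets) (auto intro!: sets_pair_measure_cong)
    finally show ?thesis by (simp add: split_beta')
  qed
  have mu: "?u y \<in> borel_measurable P" for y
    using measurable_Pair2[OF measurable_cond_inner[of vs], of y] by simp
  have "(\<integral>\<^sup>+\<omega>. (\<integral>\<^sup>+c. k (X (Inr 1) c) * h (loss vs \<omega> c) \<partial>C) \<partial>P) = (\<integral>\<^sup>+\<omega>. (\<integral>\<^sup>+x. k x * ?u (fst x) \<omega> \<partial>\<nu>) \<partial>P)"
  proof (rule nn_integral_cong_AE)
    show "AE \<omega> in P. (\<integral>\<^sup>+c. k (X (Inr 1) c) * h (loss vs \<omega> c) \<partial>C) = (\<integral>\<^sup>+x. k x * ?u (fst x) \<omega> \<partial>\<nu>)"
      using AE_regular[of vs] by eventually_elim (rule inner)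
  qed
  also have "\<dots> = (\<integral>\<^sup>+x. (\<integral>\<^sup>+\<omega>. k x * ?u (fst x) \<omega> \<partial>P) \<partial>\<nu>)"
    by (rule pair_sigma_finite.Fubini'[symmetric, OF pair_sigma_finite.intro[OF sigma_finite_measure_axioms \<nu>.sigma_finite_measure_axioms] ku])
  also have "\<dots> = (\<integral>\<^sup>+x. k x * cond_loss vs (fst x) \<partial>\<nu>)"
    unfolding cond_loss_def by (intro nn_integral_cong nn_integral_cmult mu)
  also have "\<nu> = distr C borel (X (Inr 1))" using X_law[of "Inr 1"] by simp
  also have "(\<integral>\<^sup>+x. k x * cond_loss vs (fst x) \<partial>distr C borel (X (Inr 1))) =
      (\<integral>\<^sup>+c. k (X (Inr 1) c) * cond_loss vs (fst (X (Inr 1) c)) \<partial>C)"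
    using measurable_compose[OF fst_meas measurable_cond_loss[of vs]]
    by (intro nn_integral_distr) auto
  finally show ?thesis .
qed

end

section \<open>Pathwise uniqueness\<close>

lemma finite_gap_left:
  fixes A :: "real set" assumes "finite A" shows "\<forall>\<^sub>F u in at_left t. \<forall>a\<in>A. a \<le> u \<longleftrightarrow> a < t"
proof (rule eventually_ball_finite[OF assms], rule ballI)
  fix a
  show "\<forall>\<^sub>F u in at_left t. a \<le> u \<longleftrightarrow> a < t"
  proof (cases "a < t")
    case True
    then have "\<forall>\<^sub>F u in at_left t. u \<in> {a<..<t}" by (rule eventually_at_left_real)
    then show ?thesis by eventually_elim (use True in auto)
  next
    case False
    have "\<forall>\<^sub>F u in at_left t. u < t" by (simp add: eventually_at_filter)
    then show ?thesis by eventually_elim (use False in auto)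
  qed
qed

lemma finite_gap_right:
  fixes A :: "real set" assumes "finite A" shows "\<forall>\<^sub>F u in at_right t. \<forall>a\<in>A. a \<le> u \<longleftrightarrow> a \<le> t"
proof (rule eventually_ball_finite[OF assms], rule ballI)
  fix a
  show "\<forall>\<^sub>F u in at_right t. a \<le> u \<longleftrightarrow> a \<le> t"
  proof (cases "t < a")
    case True
    then have "\<forall>\<^sub>F u in at_right t. u \<in> {t<..<a}" by (rule eventually_at_right_real)
    then show ?thesis by eventually_elim (use True in auto)
  next
    case False
    have "\<forall>\<^sub>F u in at_right t. t < u" by (simp add: eventually_at_filter)
    then show ?thesis by eventually_elim (use False in auto)
  qed
qed

text \<open>Both measures give \<open>{x<..y}\<close> its number of jumps, and the half-lines
  \<open>{x<..}\<close> are increasing unions of such intervals. Measures that are finite and equal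
  on half-lines coincide.\<close>

lemma interval_measure_counting:
  fixes A :: "real set"
  assumes A: "finite A"
  shows "interval_measure (\<lambda>u. real (card {a\<in>A. a \<le> u})) = distr (count_space A) borel (\<lambda>a. a)"
proof (rule measure_eqI_lessThan)
  let ?F = "\<lambda>u. real (card {a\<in>A. a \<le> u})"
  let ?D = "distr (count_space A) borel (\<lambda>a. a)"
  have id: "(\<lambda>a. a) \<in> count_space A \<rightarrow>\<^sub>M borel" by simp
  have D: "emeasure ?D B = of_nat (card (B \<inter> A))" if "B \<in> sets borel" for B
    using A that by (subst emeasure_distr[OF id]) (auto simp: emeasure_count_space_finite)
  have mono: "?F x \<le> ?F y" if "x \<le> y" for x y
    using A that by (intro of_nat_mono card_mono) auto
  have cont: "continuous (at_right a) ?F" for a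
    unfolding continuous_within
  proof (rule tendsto_eventually)
    show "\<forall>\<^sub>F u in at_right a. ?F u = ?F a"
      using finite_gap_right[OF A, of a] by eventually_elim (metis (mono_tags, lifting) Collect_cong)
  qed
  have Ioc: "emeasure (interval_measure ?F) {x<..y} = ennreal (?F y - ?F x)" if "x \<le> y" for x y
    by (rule emeasure_interval_measure_Ioc[OF that mono cont])
  have IocD: "emeasure ?D {x<..y} = ennreal (?F y - ?F x)" if "x \<le> y" for x y
  proof -
    have "{a\<in>A. a \<le> y} = {a\<in>A. a \<le> x} \<union> ({x<..y} \<inter> A)" using that by auto
    then have "card {a\<in>A. a \<le> y} = card {a\<in>A. a \<le> x} + card ({x<..y} \<inter> A)"
      using A by (simp only:) (intro card_Un_disjoint, auto)
    then show ?thesis by (simp add: D ennreal_of_nat_eq_real_of_nat)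
  qed
  have UN: "{x<..} = (\<Union>n::nat. {x<..x + real n})" for x :: real
  proof (intro equalityI subsetI)
    fix y assume y: "y \<in> {x<..}"
    obtain n :: nat where n: "y - x \<le> real n" using real_arch_simple[of "y - x"] by (elim exE)
    show "y \<in> (\<Union>n::nat. {x<..x + real n})" by (rule UN_I[of n]) (use y n in simp_all)
  qed auto
  have lim: "emeasure M {x<..} = (SUP n::nat. emeasure M {x<..x + real n})" if "sets M = sets borel" for M :: "real measure" and x
  proof -
    have "emeasure M {x<..} = emeasure M (\<Union>n::nat. {x<..x + real n})" by (subst UN) (rule refl)
    also have "\<dots> = (SUP n::nat. emeasure M {x<..x + real n})"
    proof (rule SUP_emeasure_incseq[symmetric])
      show "range (\<lambda>n. {x<..x + real n}) \<subseteq> sets M" unfolding that by auto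
      show "incseq (\<lambda>n. {x<..x + real n})" by (rule incseq_SucI) auto
    qed
    finally show ?thesis .
  qed
  show "sets (interval_measure ?F) = sets borel" "sets ?D = sets borel" by simp_all
  show eq: "emeasure (interval_measure ?F) {x<..} = emeasure ?D {x<..}" for x
    by (simp add: lim Ioc IocD)
  show "emeasure (interval_measure ?F) {x<..} < \<infinity>" for x
    unfolding eq by (simp add: D of_nat_less_top)
qed

text \<open>If \<open>F\<close> is not a distribution function then \<open>interval_measure F\<close> is the null measure or an extension
  of the truncated increments; either way it is finite, so an intensity driven by any path at all is
  bounded and a shifted path cannot explode.\<close>

lemma emeasure_interval_measure_finite:
  fixes F :: "real \<Rightarrow> real"
  assumes lo: "\<And>u. u \<le> a \<Longrightarrow> F u = F a" and hi: "\<And>u. b \<le> u \<Longrightarrow> F u = F b"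
  shows "emeasure (interval_measure F) UNIV < \<infinity>"
\<comment> \<open>This existence statement is the test in the definition of
  \<open>extend_measure\<close>; when it fails, the null measure is taken.\<close>
proof (cases "\<exists>\<mu>'. (\<forall>i\<in>{(a, b). a \<le> b}. \<mu>' ((\<lambda>(a, b). {a<..b}) i) = (\<lambda>(a, b). ennreal (F b - F a)) i) \<and>
    measure_space UNIV (sigma_sets UNIV ((\<lambda>(a, b). {a<..b}) ` {(a, b). a \<le> b})) \<mu>'")
  case True
  then obtain \<mu>' where \<mu>': "\<forall>i\<in>{(a, b). a \<le> b}. \<mu>' ((\<lambda>(a, b). {a<..b}) i) = (\<lambda>(a, b). ennreal (F b - F a)) i"
    and ms: "measure_space UNIV (sigma_sets UNIV ((\<lambda>(a, b). {a<..b}) ` {(a, b). a \<le> b})) \<mu>'" by blast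
  have sets: "sets (interval_measure F) = sigma_sets UNIV ((\<lambda>(a, b). {a<..b}) ` {(a, b). a \<le> b})"
    unfolding interval_measure_def by (rule sets_extend_measure) simp
  have Ioc: "emeasure (interval_measure F) {x<..y} = ennreal (F y - F x)" if "x \<le> y" for x y
    using emeasure_extend_measure[OF interval_measure_def[of F], where \<mu>' = \<mu>' and i = "(x, y)"] \<mu>' ms that
    unfolding sets measure_space_def by auto
  have "UNIV = (\<Union>n::nat. {- real n<..real n})"
  proof (intro equalityI subsetI)
    fix y :: real
    obtain n :: nat where "\<bar>y\<bar> < real n" using reals_Archimedean2 by blast
    then have "y \<in> {- real n<..real n}" by auto
    then show "y \<in> (\<Union>n::nat. {- real n<..real n})" by blast
  qed simp
  then have "emeasure (interval_measure F) UNIV = emeasure (interval_measure F) (\<Union>n::nat. {- real n<..real n})"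
    by (rule arg_cong)
  also have "\<dots> = (SUP n::nat. emeasure (interval_measure F) {- real n<..real n})"
    by (rule SUP_emeasure_incseq[symmetric]) (auto simp: incseq_def)
  also have "\<dots> \<le> ennreal (F b - F a)"
  proof (rule SUP_least)
    fix n :: nat
    \<comment> \<open>The function is constant beyond \<open>a\<close> and \<open>b\<close>, so over
      an interval that reaches past both of them its increment is \<open>F b - F a\<close>.\<close>
    obtain k :: nat where k: "max (real n) (max \<bar>a\<bar> \<bar>b\<bar>) \<le> real k" using real_arch_simple by blast
    have "emeasure (interval_measure F) {- real n<..real n} \<le> emeasure (interval_measure F) {- real k<..real k}"
      using k by (intro emeasure_mono) auto
    also have "\<dots> = ennreal (F (real k) - F (- real k))" by (rule Ioc) simp
    also have "\<dots> = ennreal (F b - F a)" using lo[of "- real k"] hi[of "real k"] k by auto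
    finally show "emeasure (interval_measure F) {- real n<..real n} \<le> ennreal (F b - F a)" .
  qed
  also have "\<dots> < \<infinity>" by simp
  finally show ?thesis .
next
  case False
  then have "interval_measure F = measure_of UNIV ((\<lambda>(a, b). {a<..b}) ` {(a, b). a \<le> b}) (\<lambda>_. 0)"
    unfolding interval_measure_def extend_measure_def by (subst if_not_P) simp_all
  then show ?thesis by (simp add: emeasure_measure_of_conv)
qed

lemma emeasure_path_measure_finite:
  assumes "0 < T" shows "emeasure (path_measure T x) UNIV < \<infinity>"
  unfolding path_measure_def
  by (rule emeasure_interval_measure_finite[where a = 0 and b = T]) (use assms in \<open>auto simp: min_def max_def\<close>)

lemma sets_path_measure [simp]: "sets (path_measure T x) = sets borel" "space (path_measure T x) = UNIV"
  by (simp_all add: path_measure_def)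

text \<open>This estimate is available before anything is known about the path: its measure is
  finite in any case, and a non-integrable integrand has Bochner integral zero.\<close>

lemma path_integral_bound:
  assumes T: "0 < T" and G: "\<And>u. u \<in> B \<Longrightarrow> \<bar>G u\<bar> \<le> b" and b: "0 \<le> b"
  shows "\<bar>LINT u:B|path_measure T x. G u\<bar> \<le> b * measure (path_measure T x) UNIV"
proof -
  interpret finite_measure "path_measure T x"
    using emeasure_path_measure_finite[OF T, of x] by (intro finite_measureI) simp
  let ?H = "\<lambda>u. indicator B u *\<^sub>R G u"
  have H: "norm (?H u) \<le> b" for u using G b by (auto split: split_indicator)
  have "norm (\<integral>u. ?H u \<partial>path_measure T x) \<le> b * measure (path_measure T x) UNIV"
  proof (cases "integrable (path_measure T x) ?H")
    case True
    have "norm (\<integral>u. ?H u \<partial>path_measure T x) \<le> (\<integral>u. b \<partial>path_measure T x)"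
      by (rule Bochner_Integration.integral_norm_bound_integral[OF True]) (use H in simp_all)
    then show ?thesis by (simp add: mult.commute)
  next
    case False
    then show ?thesis using b by (simp add: not_integrable_integral_eq)
  qed
  then show ?thesis by (simp add: set_lebesgue_integral_def)
qed

definition counting_path :: "real \<Rightarrow> real set \<Rightarrow> (real \<Rightarrow> nat) \<Rightarrow> bool" where
  "counting_path T A y \<longleftrightarrow> finite A \<and> A \<subseteq> {0<..T} \<and> (\<forall>t\<in>{0..T}. y t = card {a\<in>A. a \<le> t})"

lemma path_measure_counting:
  assumes y: "counting_path T A y" and T: "0 < T"
  shows "path_measure T y = distr (count_space A) borel (\<lambda>a. a)"
proof -
  have A: "finite A" "A \<subseteq> {0<..T}" using y by (auto simp: counting_path_def)
  have "real (y (max 0 (min T u))) = real (card {a\<in>A. a \<le> u})" for u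
  proof -
    have "max 0 (min T u) \<in> {0..T}" using T by auto
    then have "y (max 0 (min T u)) = card {a\<in>A. a \<le> max 0 (min T u)}" using y by (simp add: counting_path_def)
    moreover have "{a\<in>A. a \<le> max 0 (min T u)} = {a\<in>A. a \<le> u}"
      using A(2) by (auto simp: max_def min_def split: if_splits)
    ultimately show ?thesis by simp
  qed
  then show ?thesis unfolding path_measure_def by (simp only: interval_measure_counting[OF A(1)])
qed

lemma path_integral_counting:
  fixes G :: "real \<Rightarrow> real"
  assumes y: "counting_path T A y" and T: "0 < T" and G: "(\<lambda>u. indicator B u * G u) \<in> borel_measurable borel"
  shows "(LINT u:B|path_measure T y. G u) = (\<Sum>a\<in>A \<inter> B. G a)"
proof -
  have A: "finite A" using y by (auto simp: counting_path_def)
  have "(LINT u:B|path_measure T y. G u) = (\<integral>u. indicator B u * G u \<partial>distr (count_space A) borel (\<lambda>a. a))"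
    unfolding path_measure_counting[OF y T] set_lebesgue_integral_def by simp
  also have "\<dots> = (\<integral>u. indicator B u * G u \<partial>count_space A)" by (rule integral_distr[OF _ G]) simp
  also have "\<dots> = (\<Sum>a\<in>A. indicator B a * G a)" by (rule lebesgue_integral_count_space_finite[OF A])
  also have "\<dots> = (\<Sum>a\<in>A \<inter> B. G a)"
    using A by (intro sum.mono_neutral_cong_right) (auto split: split_indicator)
  finally show ?thesis .
qed

lemma left_limit_counting:
  assumes A: "finite A" and t: "0 < t" and y: "\<And>u. 0 \<le> u \<Longrightarrow> u < t \<Longrightarrow> y u = card {a\<in>A. a \<le> u}"
  shows "left_limit y t = card {a\<in>A. a < t}"
proof -
  have "\<forall>\<^sub>F u in at_left t. u \<in> {0<..<t}" using t by (rule eventually_at_left_real)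
  with finite_gap_left[OF A, of t] have "\<forall>\<^sub>F u in at_left t. y u = card {a\<in>A. a < t}"
  proof eventually_elim
    case (elim u)
    have "{a\<in>A. a \<le> u} = {a\<in>A. a < t}" using elim(1) by blast
    then show ?case using y[of u] elim(2) by simp
  qed
  then have "(y \<longlongrightarrow> card {a\<in>A. a < t}) (at_left t)" by (rule tendsto_eventually)
  then show ?thesis unfolding left_limit_def by (intro tendsto_Lim) simp
qed

lemma jumps_counting:
  assumes y: "counting_path T A y"
  shows "jumps T y = A"
proof -
  have A: "finite A" "A \<subseteq> {0<..T}" using y by (auto simp: counting_path_def)
  have "left_limit y t \<noteq> y t \<longleftrightarrow> t \<in> A" if t: "t \<in> {0<..T}" for t
  proof -
    have l: "left_limit y t = card {a\<in>A. a < t}"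
      by (rule left_limit_counting[OF A(1)]) (use t y in \<open>auto simp: counting_path_def\<close>)
    have r: "y t = card {a\<in>A. a \<le> t}" using t y by (auto simp: counting_path_def)
    show ?thesis
    proof (cases "t \<in> A")
      case True
      then have "{a\<in>A. a \<le> t} = insert t {a\<in>A. a < t}" by auto
      then have "y t = Suc (card {a\<in>A. a < t})" using A(1) by (simp add: r)
      then show ?thesis using True l by simp
    next
      case False
      then have "{a\<in>A. a \<le> t} = {a\<in>A. a < t}" by (auto simp: less_le)
      then show ?thesis using False l r by simp
    qed
  qed
  then show ?thesis using A(2) unfolding jumps_def by blast
qed

text \<open>In the increasing enumeration the element at position \<open>j\<close>, counted from
  zero, has rank \<open>Suc j\<close>. This converts sums over enumerated jump times into sums over
  points that carry their rank.\<close>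

lemma sum_sorted_list_rank:
  fixes F :: "real \<Rightarrow> nat \<Rightarrow> real"
  assumes R: "finite R" "inj_on fst R"
  shows "(\<Sum>i=1..card R. F (sorted_list_of_set (fst ` R) ! (i - 1)) i) =
    (\<Sum>z\<in>R. F (fst z) (card {x\<in>R. fst x \<le> fst z}))"
proof -
  let ?A = "fst ` R" let ?l = "sorted_list_of_set ?A"
  have A: "finite ?A" "card ?A = card R" using R by (simp_all add: card_image)
  have len: "length ?l = card R" using A by simp
  have nth: "card {a\<in>?A. a \<le> ?l ! j} = Suc j" if "j < card R" for j
  proof -
    have "{a\<in>?A. a \<le> ?l ! j} = (\<lambda>i. ?l ! i) ` {..j}"
    proof (intro equalityI subsetI)
      fix a assume a: "a \<in> {a\<in>?A. a \<le> ?l ! j}"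
      then have "a \<in> set ?l" using A(1) by (simp only: set_sorted_list_of_set) simp
      then obtain i where i: "i < card R" "?l ! i = a" unfolding in_set_conv_nth len by blast
      have "\<not> j < i"
      proof
        assume "j < i"
        have "?l ! j \<le> ?l ! i" using \<open>j < i\<close> i len by (intro sorted_nth_mono) simp_all
        moreover have "?l ! j \<noteq> ?l ! i"
          using \<open>j < i\<close> i len nth_eq_iff_index_eq[OF distinct_sorted_list_of_set[of ?A], of j i] by simp
        ultimately show False using a i by simp
      qed
      then show "a \<in> (\<lambda>i. ?l ! i) ` {..j}" using i(2) by (intro image_eqI[of _ _ i]) auto
    next
      fix a assume "a \<in> (\<lambda>i. ?l ! i) ` {..j}"
      then obtain i where i: "i \<le> j" "a = ?l ! i" by auto
      then have "a \<in> set ?l" using that len by simp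
      moreover have "a \<le> ?l ! j"
        using i that len by (auto intro!: sorted_nth_mono)
      ultimately show "a \<in> {a\<in>?A. a \<le> ?l ! j}" using A(1) by simp
    qed
    moreover have "inj_on (\<lambda>i. ?l ! i) {..j}"
      using that len by (intro inj_on_nth) auto
    ultimately show ?thesis by (simp add: card_image)
  qed
  have "(\<Sum>i=1..card R. F (?l ! (i - 1)) i) = (\<Sum>j<card R. F (?l ! j) (Suc j))"
    by (rule sum.reindex_bij_witness[of _ Suc "\<lambda>i. i - 1"]) auto
  also have "\<dots> = (\<Sum>j<card R. F (?l ! j) (card {a\<in>?A. a \<le> ?l ! j}))"
    by (intro sum.cong refl) (simp add: nth)
  also have "\<dots> = (\<Sum>a\<in>?A. F a (card {b\<in>?A. b \<le> a}))"
  proof (rule sum.reindex_bij_betw[of "\<lambda>j. ?l ! j" "{..<card R}" ?A "\<lambda>a. F a (card {b\<in>?A. b \<le> a})"])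
    show "bij_betw (\<lambda>j. ?l ! j) {..<card R} ?A"
      using bij_betw_nth[of ?l "{..<card R}" ?A] A len by simp
  qed
  also have "\<dots> = (\<Sum>z\<in>R. F (fst z) (card {b\<in>?A. b \<le> fst z}))"
    by (subst sum.reindex[OF R(2)]) simp
  also have "\<dots> = (\<Sum>z\<in>R. F (fst z) (card {x\<in>R. fst x \<le> fst z}))"
  proof (intro sum.cong refl)
    fix z
    have "{b\<in>?A. b \<le> fst z} = fst ` {x\<in>R. fst x \<le> fst z}" by auto
    moreover have "inj_on fst {x\<in>R. fst x \<le> fst z}" using R(2) by (rule inj_on_subset) auto
    ultimately show "F (fst z) (card {b\<in>?A. b \<le> fst z}) = F (fst z) (card {x\<in>R. fst x \<le> fst z})"
      by (simp add: card_image)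
  qed
  finally show ?thesis .
qed

text \<open>The path \<open>l\<close> is an arbitrary function, so the acceptance region may fail to
  be measurable. The canonical process is however carried by the countable set \<omega>, and the
  region can be replaced by its intersection with \<omega>, which is countable and hence
  Borel.\<close>

lemma thinned_count_eq:
  assumes \<omega>: "\<omega> \<in> configurations T"
  shows "thinned_count T \<omega> l a t = emeasure (count_space \<omega>) {z\<in>\<omega>. fst z \<in> {a<..t} \<and> snd z \<le> l (fst z)}"
proof -
  let ?Q = "{(s, \<theta>). s \<in> {a<..t} \<and> \<theta> \<le> l s}"
  have sub: "\<omega> \<subseteq> space (intensity T)" using configurations_subset[OF \<omega>] by (simp add: space_intensity)
  have countable_sets: "B \<in> sets (intensity T)" if "B \<subseteq> \<omega>" for B
  proof (rule sets_intensityI)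
    show "B \<in> sets borel"
      by (rule sets.countable[OF _ countable_subset[OF that configurations_countable[OF \<omega>]]]) simp
    show "B \<subseteq> {0..T} \<times> {0..}" using that sub by (simp add: space_intensity)
  qed
  have "AE z in canonical_process T \<omega>. z \<in> \<omega>"
  proof (rule AE_I)
    show "{z\<in>space (canonical_process T \<omega>). z \<notin> \<omega>} \<subseteq> space (intensity T) - \<omega>" by auto
    have m: "space (intensity T) - \<omega> \<in> sets (intensity T)" using countable_sets[of \<omega>] by auto
    then show "space (intensity T) - \<omega> \<in> sets (canonical_process T \<omega>)" by simp
    show "emeasure (canonical_process T \<omega>) (space (intensity T) - \<omega>) = 0"
    proof -
      have "(space (intensity T) - \<omega>) \<inter> \<omega> = {}" by auto
      then show ?thesis unfolding emeasure_canonical_process[OF \<omega> m] by (simp only:) simp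
    qed
  qed
  then have "thinned_count T \<omega> l a t = (\<integral>\<^sup>+z. indicator (?Q \<inter> \<omega>) z \<partial>canonical_process T \<omega>)"
    unfolding thinned_count_def
    by (intro nn_integral_cong_AE) (auto elim!: eventually_mono split: split_indicator)
  also have "\<dots> = emeasure (canonical_process T \<omega>) (?Q \<inter> \<omega>)"
    by (rule nn_integral_indicator) (simp add: countable_sets)
  also have "\<dots> = emeasure (count_space \<omega>) (?Q \<inter> \<omega>)"
    by (subst emeasure_canonical_process[OF \<omega>]) (simp_all add: countable_sets Int_assoc)
  also have "?Q \<inter> \<omega> = {z\<in>\<omega>. fst z \<in> {a<..t} \<and> snd z \<le> l (fst z)}" by auto
  finally show ?thesis .
qed

text \<open>The iterates start at zero and the operator is monotone, so they stay below the solution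
  \<open>l\<close>, which gives one inclusion. For the other, a point of \<open>R\<close> depends
  only on the finitely many earlier points of \<open>R\<close>. Each of these is accepted at some
  finite stage, by induction on the number of predecessors, and one stage beyond the largest of
  these stages accepts the point itself.\<close>

lemma accepted_points_unique:
  fixes l :: "real \<Rightarrow> real" and \<Phi> :: "real \<Rightarrow> real"
  assumes fin: "finite R" and R: "R = {z\<in>\<omega>. snd z \<le> l (fst z)}"
    and \<omega>: "\<And>z. z \<in> \<omega> \<Longrightarrow> 0 < fst z \<and> fst z \<le> T \<and> 0 \<le> snd z"
    and vs: "\<And>v. v \<in> set vs \<Longrightarrow> 0 < v \<and> v < T"
    and \<Phi>: "\<And>s. 0 \<le> s \<Longrightarrow> s \<le> T \<Longrightarrow> 0 \<le> \<Phi> s \<and> \<phi> s = ennreal (\<Phi> s)" and \<mu>: "0 \<le> \<mu>"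
    and l: "\<And>t. 0 < t \<Longrightarrow> t \<le> T \<Longrightarrow>
      l t = \<mu> + (\<Sum>v\<leftarrow>vs. if v < t then \<Phi> (t - v) else 0) + (\<Sum>z\<in>R. if fst z < t then \<Phi> (t - fst z) else 0)"
  shows "accepted_points \<phi> (ennreal \<mu>) vs \<omega> = R"
proof -
  have R\<omega>: "R \<subseteq> \<omega>" using R by auto
  have terms: "0 \<le> (if s < t then \<Phi> (t - s) else 0)"
    "ennreal (if s < t then \<Phi> (t - s) else 0) = (if s < t then \<phi> (t - s) else 0)"
    if "0 < s" "t \<le> T" for s t using \<Phi>[of "t - s"] that by auto
  have shifts: "0 \<le> (\<Sum>v\<leftarrow>us. if v < t then \<Phi> (t - v) else 0) \<and>
    ennreal (\<Sum>v\<leftarrow>us. if v < t then \<Phi> (t - v) else 0) = (\<Sum>v\<leftarrow>us. if v < t then \<phi> (t - v) else 0)"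
    if "t \<le> T" "set us \<subseteq> set vs" for us t
    using that(2)
  proof (induction us)
    case (Cons u us)
    have "0 < u" using Cons.prems vs by auto
    from terms[OF this that(1)] Cons show ?case by (simp add: ennreal_plus del: if_split_asm)
  qed simp
  have l_ennreal: "ennreal (l t) = ennreal \<mu> + (\<Sum>v\<leftarrow>vs. if v < t then \<phi> (t - v) else 0) +
      (\<integral>\<^sup>+z. (if fst z < t \<and> z \<in> R then \<phi> (t - fst z) else 0) \<partial>count_space \<omega>)"
    and l_nonneg: "0 \<le> l t" if t: "0 < t" "t \<le> T" for t
  proof -
    have nn: "0 \<le> (if fst z < t then \<Phi> (t - fst z) else 0)" if "z \<in> R" for z
      using \<omega>[of z] that R\<omega> t by (intro terms) auto
    have "(\<integral>\<^sup>+z. (if fst z < t \<and> z \<in> R then \<phi> (t - fst z) else 0) \<partial>count_space \<omega>) =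
        (\<Sum>z\<in>R. if fst z < t \<and> z \<in> R then \<phi> (t - fst z) else 0)"
      by (rule nn_integral_count_space'[OF fin]) (use R\<omega> in auto)
    also have "\<dots> = (\<Sum>z\<in>R. ennreal (if fst z < t then \<Phi> (t - fst z) else 0))"
      using \<omega> R\<omega> t by (intro sum.cong refl) (subst terms(2); auto)
    also have "\<dots> = ennreal (\<Sum>z\<in>R. if fst z < t then \<Phi> (t - fst z) else 0)"
      by (rule sum_ennreal[OF nn])
    finally have I: "(\<integral>\<^sup>+z. (if fst z < t \<and> z \<in> R then \<phi> (t - fst z) else 0) \<partial>count_space \<omega>) =
      ennreal (\<Sum>z\<in>R. if fst z < t then \<Phi> (t - fst z) else 0)" .
    have s: "0 \<le> (\<Sum>z\<in>R. if fst z < t then \<Phi> (t - fst z) else 0)" by (rule sum_nonneg[OF nn])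
    note sh = shifts[OF t(2) order_refl]
    show "ennreal (l t) = ennreal \<mu> + (\<Sum>v\<leftarrow>vs. if v < t then \<phi> (t - v) else 0) +
      (\<integral>\<^sup>+z. (if fst z < t \<and> z \<in> R then \<phi> (t - fst z) else 0) \<partial>count_space \<omega>)"
      unfolding I l[OF t] using sh s \<mu> by (simp add: ennreal_plus)
    show "0 \<le> l t" unfolding l[OF t] using sh s \<mu> by simp
  qed
  have le: "rate_approx \<phi> (ennreal \<mu>) k vs \<omega> t \<le> ennreal (l t)" if "0 < t" "t \<le> T" for k t
    using that
  proof (induction k arbitrary: t)
    case (Suc k)
    show ?case
      unfolding l_ennreal[OF Suc.prems] rate_approx.simps(2)
    proof (intro add_left_mono nn_integral_mono)
      fix z assume "z \<in> space (count_space \<omega>)"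
      then have z: "z \<in> \<omega>" "0 < fst z" "fst z \<le> T" using \<omega> by auto
      have "z \<in> R" if "ennreal (snd z) \<le> rate_approx \<phi> (ennreal \<mu>) k vs \<omega> (fst z)"
      proof -
        have "ennreal (snd z) \<le> ennreal (l (fst z))" using that Suc.IH[OF z(2,3)] by (rule order_trans)
        then have "snd z \<le> l (fst z)" using l_nonneg[OF z(2,3)] by (simp add: ennreal_le_iff)
        then show ?thesis using z R by auto
      qed
      then show "(if fst z < t \<and> ennreal (snd z) \<le> rate_approx \<phi> (ennreal \<mu>) k vs \<omega> (fst z) then \<phi> (t - fst z) else 0)
          \<le> (if fst z < t \<and> z \<in> R then \<phi> (t - fst z) else 0)" by auto
    qed
  qed simp
  show ?thesis
  proof (intro equalityI subsetI)
    fix z assume "z \<in> accepted_points \<phi> (ennreal \<mu>) vs \<omega>"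
    then obtain k where z: "z \<in> \<omega>" and k: "ennreal (snd z) \<le> rate_approx \<phi> (ennreal \<mu>) k vs \<omega> (fst z)"
      by (auto simp: accepted_points_def)
    have t: "0 < fst z" "fst z \<le> T" using \<omega>[OF z] by auto
    have "ennreal (snd z) \<le> ennreal (l (fst z))" using k le[OF t] by (rule order_trans)
    then show "z \<in> R" using z R l_nonneg[OF t] by (simp add: ennreal_le_iff)
  next
    fix z assume "z \<in> R"
    then show "z \<in> accepted_points \<phi> (ennreal \<mu>) vs \<omega>"
    proof (induction "card {x\<in>R. fst x < fst z}" arbitrary: z rule: less_induct)
      case less
      let ?E = "{x\<in>R. fst x < fst z}"
      have finE: "finite ?E" using fin by simp
      have "x \<in> accepted_points \<phi> (ennreal \<mu>) vs \<omega>" if x: "x \<in> ?E" for x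
      proof (rule less.hyps)
        have "{y\<in>R. fst y < fst x} \<subset> ?E" using x by auto
        then show "card {y\<in>R. fst y < fst x} < card ?E" by (rule psubset_card_mono[OF finE])
        show "x \<in> R" using x by simp
      qed
      then have "\<exists>k. ennreal (snd x) \<le> rate_approx \<phi> (ennreal \<mu>) k vs \<omega> (fst x)" if "x \<in> ?E" for x
        using that by (auto simp: accepted_points_def)
      then obtain k where k: "\<And>x. x \<in> ?E \<Longrightarrow> ennreal (snd x) \<le> rate_approx \<phi> (ennreal \<mu>) (k x) vs \<omega> (fst x)" by metis
      \<comment> \<open>A common stage for all earlier points; inserting \<open>0\<close> covers the
        case that there are none.\<close>
      define K where "K = Max (insert 0 (k ` ?E))"
      have K: "ennreal (snd x) \<le> rate_approx \<phi> (ennreal \<mu>) K vs \<omega> (fst x)" if "x \<in> ?E" for x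
      proof -
        have "k x \<le> K" unfolding K_def using finE that by (intro Max_ge) auto
        then show ?thesis using k[OF that] rate_approx_mono order_trans by blast
      qed
      have z\<omega>: "z \<in> \<omega>" using less.prems R\<omega> by auto
      have t: "0 < fst z" "fst z \<le> T" using \<omega>[OF z\<omega>] by auto
      have "ennreal (snd z) \<le> ennreal (l (fst z))" using less.prems R by (auto intro: ennreal_leI)
      also have "\<dots> \<le> rate_approx \<phi> (ennreal \<mu>) (Suc K) vs \<omega> (fst z)"
        unfolding l_ennreal[OF t] rate_approx.simps(2)
        by (intro add_left_mono nn_integral_mono) (use K in auto)
      finally show ?case using z\<omega> by (auto simp: accepted_points_def simp del: rate_approx.simps)
    qed
  qed
qed

lemma indicator_mult_zero: "t \<notin> A \<Longrightarrow> indicator A t * c = (0 :: 'a :: semiring_1)"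
  by simp

section \<open>Hawkes equations along one configuration\<close>

locale hawkes_path =
  fixes T \<mu> b :: real and \<Phi> :: "real \<Rightarrow> real" and \<omega> :: "(real \<times> real) set" and x :: "real \<Rightarrow> nat" and l :: "real \<Rightarrow> real"
  assumes T: "0 < T" and \<omega>: "\<omega> \<in> configurations T" and distinct_times: "inj_on fst \<omega>" and no_zero: "0 \<notin> fst ` \<omega>"
    and \<Phi>_meas: "\<Phi> \<in> borel_measurable (restrict_space borel {0..T})"
    and \<Phi>_range: "\<And>s. s \<in> {0..T} \<Longrightarrow> 0 \<le> \<Phi> s \<and> \<Phi> s \<le> b"
    and hawkes: "hawkes_equations T \<mu> \<Phi> \<omega> x l"
begin

lemma b_nonneg: "0 \<le> b" using \<Phi>_range[of 0] T by auto

lemma point_range: "z \<in> \<omega> \<Longrightarrow> 0 < fst z \<and> fst z \<le> T \<and> 0 \<le> snd z"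
  using configurations_subset[OF \<omega>] no_zero by (force simp: less_le)

text \<open>Measurability of \<open>\<Phi>\<close> is given on \<open>{0..T}\<close>. The indicator
  of \<open>B\<close> keeps \<open>t - u\<close> in that interval, so extending
  \<open>\<Phi>\<close> by zero does not change the product.\<close>

lemma \<Phi>_shift_measurable:
  assumes "B \<in> sets borel" "B \<subseteq> {0..t}" "t \<le> T"
  shows "(\<lambda>u. indicator B u * \<Phi> (t - u)) \<in> borel_measurable borel"
proof -
  have "(\<lambda>s. indicator {0..T} s * \<Phi> s) \<in> borel_measurable borel"
    using \<Phi>_meas by (subst (asm) borel_measurable_restrict_space_iff) simp_all
  then have [measurable]: "(\<lambda>u. indicator {0..T} (t - u) * \<Phi> (t - u)) \<in> borel_measurable borel"
    by (rule measurable_compose[rotated]) measurable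
  have "(\<lambda>u. indicator B u * (indicator {0..T} (t - u) * \<Phi> (t - u))) \<in> borel_measurable borel"
    using assms(1) by measurable
  also have "(\<lambda>u. indicator B u * (indicator {0..T} (t - u) * \<Phi> (t - u))) = (\<lambda>u. indicator B u * \<Phi> (t - u))"
    using assms(2,3) by (auto simp: fun_eq_iff split: split_indicator)
  finally show ?thesis .
qed

definition accepted :: "(real \<Rightarrow> real) \<Rightarrow> (real \<times> real) set" where
  "accepted m = {z\<in>\<omega>. snd z \<le> m (fst z)}"

lemma accepted_subset: "accepted m \<subseteq> \<omega>"
  by (auto simp: accepted_def)

lemma sum_times:
  assumes "finite R" "R \<subseteq> \<omega>"
  shows "(\<Sum>a\<in>fst ` R \<inter> {0<..<t}. \<Phi> (t - a)) = (\<Sum>z\<in>R. if fst z < t then \<Phi> (t - fst z) else 0)"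
proof -
  have "inj_on fst R" using distinct_times assms(2) by (rule inj_on_subset)
  then have inj: "inj_on fst {z\<in>R. fst z < t}" by (rule inj_on_subset) auto
  have "fst ` R \<inter> {0<..<t} = fst ` {z\<in>R. fst z < t}"
    using point_range assms(2) by auto
  then have "(\<Sum>a\<in>fst ` R \<inter> {0<..<t}. \<Phi> (t - a)) = (\<Sum>z\<in>{z\<in>R. fst z < t}. \<Phi> (t - fst z))"
    by (simp add: sum.reindex[OF inj])
  also have "\<dots> = (\<Sum>z\<in>R. if fst z < t then \<Phi> (t - fst z) else 0)"
    using assms(1) by (intro sum.mono_neutral_cong_left) auto
  finally show ?thesis .
qed

lemma card_times:
  assumes "R \<subseteq> \<omega>"
  shows "card {a\<in>fst ` R. a \<le> t} = card {z\<in>R. fst z \<le> t}"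
proof -
  have "{a\<in>fst ` R. a \<le> t} = fst ` {z\<in>R. fst z \<le> t}" by auto
  moreover have "inj_on fst {z\<in>R. fst z \<le> t}"
    using distinct_times assms by (auto intro: inj_on_subset)
  ultimately show ?thesis by (simp add: card_image)
qed

lemma thinned_count_accepted:
  assumes "finite (accepted m)"
  shows "thinned_count T \<omega> m a t = of_nat (card {z\<in>accepted m. a < fst z \<and> fst z \<le> t})"
proof -
  have "{z\<in>\<omega>. fst z \<in> {a<..t} \<and> snd z \<le> m (fst z)} = {z\<in>accepted m. a < fst z \<and> fst z \<le> t}"
    by (auto simp: accepted_def)
  moreover have "finite {z\<in>accepted m. a < fst z \<and> fst z \<le> t}" using assms by simp
  moreover have "{z\<in>accepted m. a < fst z \<and> fst z \<le> t} \<subseteq> \<omega>" using accepted_subset by auto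
  ultimately show ?thesis by (simp add: thinned_count_eq[OF \<omega>] emeasure_count_space_finite)
qed

text \<open>\<open>x T\<close> is a natural number, so the equation at time \<open>T\<close> already
  excludes explosion. All points have positive times, so that equation counts every accepted
  point.\<close>

lemma finite_accepted: "finite (accepted l)"
proof -
  have "thinned_count T \<omega> l 0 T = of_nat (x T)"
    using hawkes T by (auto simp: hawkes_equations_def)
  then have "emeasure (count_space \<omega>) {z\<in>\<omega>. fst z \<in> {0<..T} \<and> snd z \<le> l (fst z)} < \<top>"
    by (simp add: thinned_count_eq[OF \<omega>] of_nat_less_top)
  moreover have "{z\<in>\<omega>. fst z \<in> {0<..T} \<and> snd z \<le> l (fst z)} = accepted l"
    using point_range by (auto simp: accepted_def)
  ultimately show ?thesis
    using accepted_subset by (auto simp: emeasure_count_space split: if_splits)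
qed

lemma path_eq: "t \<in> {0..T} \<Longrightarrow> x t = card {z\<in>accepted l. fst z \<le> t}"
proof -
  assume t: "t \<in> {0..T}"
  have "of_nat (x t) = thinned_count T \<omega> l 0 t" using hawkes t by (auto simp: hawkes_equations_def)
  also have "\<dots> = of_nat (card {z\<in>accepted l. 0 < fst z \<and> fst z \<le> t})"
    by (rule thinned_count_accepted[OF finite_accepted])
  also have "{z\<in>accepted l. 0 < fst z \<and> fst z \<le> t} = {z\<in>accepted l. fst z \<le> t}"
    using point_range accepted_subset by blast
  finally show ?thesis by (simp only: of_nat_eq_iff)
qed

lemma counting: "counting_path T (fst ` accepted l) x"
  unfolding counting_path_def
proof (intro conjI ballI)
  show "finite (fst ` accepted l)" using finite_accepted by simp
  show "fst ` accepted l \<subseteq> {0<..T}" using point_range accepted_subset by force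
  show "x t = card {a\<in>fst ` accepted l. a \<le> t}" if "t \<in> {0..T}" for t
    unfolding path_eq[OF that] by (rule card_times[OF accepted_subset, symmetric])
qed

lemma intensity_eq:
  assumes t: "t \<in> {0..T}"
  shows "l t = \<mu> + (\<Sum>z\<in>accepted l. if fst z < t then \<Phi> (t - fst z) else 0)"
proof -
  have "l t = \<mu> + (LINT u:{0<..<t}|path_measure T x. \<Phi> (t - u))"
    using hawkes t by (auto simp: hawkes_equations_def)
  also have "(LINT u:{0<..<t}|path_measure T x. \<Phi> (t - u)) = (\<Sum>a\<in>fst ` accepted l \<inter> {0<..<t}. \<Phi> (t - a))"
    by (rule path_integral_counting[OF counting T \<Phi>_shift_measurable]) (use t in auto)
  also have "\<dots> = (\<Sum>z\<in>accepted l. if fst z < t then \<Phi> (t - fst z) else 0)"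
    by (rule sum_times[OF finite_accepted accepted_subset])
  finally show ?thesis .
qed

end

section \<open>Shifted equations along one configuration\<close>

locale shifted_path = hawkes_path +
  fixes vs :: "real list" and y :: "real \<Rightarrow> nat" and m :: "real \<Rightarrow> real"
  assumes shifts: "shift_times T vs" and no_shift: "fst ` \<omega> \<inter> set vs = {}"
    and shifted: "shifted_hawkes_equations T \<mu> \<Phi> vs \<omega> x l y m"
begin

abbreviation "n \<equiv> length vs"

definition v :: "nat \<Rightarrow> real" where "v i = (T # vs) ! i"

abbreviation block :: "nat \<Rightarrow> real set" where
  "block i \<equiv> if i = 1 then {v 1..T} else {v i..<v (i - 1)}"

lemma v_0: "v 0 = T" and v_Suc: "v (Suc i) = vs ! i"
  by (simp_all add: v_def)

lemma n_pos: "0 < n" using shifts by (simp add: shift_times_def)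

lemma v_decreasing: "i < j \<Longrightarrow> j \<le> n \<Longrightarrow> v j < v i"
proof -
  assume ij: "i < j" "j \<le> n"
  have "sorted_wrt (>) (T # vs)" using shifts by (auto simp: shift_times_def)
  from sorted_wrt_nth_less[OF this ij(1)] ij(2) show ?thesis by (simp add: v_def)
qed

lemma v_antimono: "i \<le> j \<Longrightarrow> j \<le> n \<Longrightarrow> v j \<le> v i"
  using v_decreasing[of i j] by (cases "i = j") auto

lemma v_range: "1 \<le> i \<Longrightarrow> i \<le> n \<Longrightarrow> v i \<in> {0<..<T}"
proof -
  assume i: "1 \<le> i" "i \<le> n"
  then have "v i \<in> set vs" by (cases i) (auto simp: v_Suc)
  then show ?thesis using shifts by (auto simp: shift_times_def)
qed

lemma distinct_vs: "distinct vs"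
proof -
  have "sorted_wrt (>) vs" using shifts by (simp add: shift_times_def)
  then show ?thesis by (induction vs) auto
qed

lemma set_vs: "set vs = v ` {1..n}"
proof (intro equalityI subsetI)
  fix w assume "w \<in> set vs"
  then obtain j where "j < n" "vs ! j = w" by (auto simp: in_set_conv_nth)
  then show "w \<in> v ` {1..n}" by (intro image_eqI[of _ _ "Suc j"]) (auto simp: v_Suc)
next
  fix w assume "w \<in> v ` {1..n}"
  then obtain i where "w = v i" "1 \<le> i" "i \<le> n" by auto
  then show "w \<in> set vs" by (cases i) (auto simp: v_Suc)
qed

lemma y_eq: "t \<in> {0..T} \<Longrightarrow> (of_nat (y t) :: ennreal) = indicator {0..<v n} t * of_nat (x t) +
    (\<Sum>i=1..n. indicator (block i) t * (of_nat (left_limit y (v i)) + 1 + thinned_count T \<omega> m (v i) t))"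
  and m_eq: "t \<in> {0..T} \<Longrightarrow> m t = indicator {0<..v n} t * l t +
    (\<Sum>i=1..n. indicator {v i<..v (i - 1)} t *
      (\<mu> + (LINT u:{0<..v i}|path_measure T y. \<Phi> (t - u)) + (LINT u:{v i<..<t}|path_measure T y. \<Phi> (t - u))))"
  using shifted unfolding shifted_hawkes_equations_def Let_def v_def by blast+

lemma y_initial: "t \<in> {0..<v n} \<Longrightarrow> y t = x t"
proof -
  assume t: "t \<in> {0..<v n}"
  have vn: "v n \<le> T" using v_antimono[of 0 n] by (simp add: v_0)
  have "(\<Sum>i=1..n. indicator (block i) t * (of_nat (left_limit y (v i)) + 1 + thinned_count T \<omega> m (v i) t)) = (0 :: ennreal)"
  proof (rule sum.neutral, rule ballI)
    fix i assume "i \<in> {1..n}"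
    then have "t \<notin> block i" using v_antimono[of i n] t by auto
    then show "indicator (block i) t * (of_nat (left_limit y (v i)) + 1 + thinned_count T \<omega> m (v i) t) = (0 :: ennreal)"
      by (rule indicator_mult_zero)
  qed
  then have "(of_nat (y t) :: ennreal) = of_nat (x t)" using y_eq[of t] t vn by simp
  then show ?thesis by simp
qed

lemma y_block:
  assumes i: "i \<in> {1..n}" and t: "t \<in> block i"
  shows "(of_nat (y t) :: ennreal) = of_nat (left_limit y (v i)) + 1 + thinned_count T \<omega> m (v i) t"
proof -
  have vi: "0 < v i" "v i \<le> t" using v_range[of i] i t by (auto split: if_splits)
  have "i - 1 \<le> n" using i by auto
  then have "v (i - 1) \<le> T" using v_antimono[of 0 "i - 1"] unfolding v_0 by simp
  then have tT: "t \<in> {0..T}" using vi t by (auto split: if_splits)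
  have "t \<notin> block j" if j: "j \<in> {1..n}" "j \<noteq> i" for j
  proof (cases "j < i")
    case True
    then have "v (i - 1) \<le> v j" using v_antimono[of j "i - 1"] i by auto
    then show ?thesis using t True by (auto split: if_splits simp: not_le)
  next
    case False
    then have ij: "i < j" using j by auto
    then have "v (j - 1) \<le> v i" using v_antimono[of i "j - 1"] j by auto
    then show ?thesis using vi ij i by auto
  qed
  note notin = this
  have "(\<Sum>j=1..n. indicator (block j) t * (of_nat (left_limit y (v j)) + 1 + thinned_count T \<omega> m (v j) t)) =
     (\<Sum>j\<in>{i}. indicator (block j) t * (of_nat (left_limit y (v j)) + 1 + thinned_count T \<omega> m (v j) t) :: ennreal)"
    using i by (intro sum.mono_neutral_right ballI indicator_mult_zero notin) simp_all
  also have "\<dots> = of_nat (left_limit y (v i)) + 1 + thinned_count T \<omega> m (v i) t"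
    using t by (subst sum.insert[OF finite.emptyI]) (simp_all only: indicator_simps empty_iff not_False_eq_True sum.empty add_0_right mult_1_left)
  finally show ?thesis
    using y_eq[OF tT] vi v_antimono[of i n] i by simp
qed

lemma m_initial: "t \<in> {0<..v n} \<Longrightarrow> m t = l t"
proof -
  assume t: "t \<in> {0<..v n}"
  have vn: "v n \<le> T" using v_antimono[of 0 n] by (simp add: v_0)
  have "(\<Sum>i=1..n. indicator {v i<..v (i - 1)} t *
      (\<mu> + (LINT u:{0<..v i}|path_measure T y. \<Phi> (t - u)) + (LINT u:{v i<..<t}|path_measure T y. \<Phi> (t - u)))) = 0"
  proof (rule sum.neutral, rule ballI)
    fix i assume "i \<in> {1..n}"
    then have "t \<notin> {v i<..v (i - 1)}" using v_antimono[of i n] t by auto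
    then show "indicator {v i<..v (i - 1)} t * (\<mu> + (LINT u:{0<..v i}|path_measure T y. \<Phi> (t - u)) +
        (LINT u:{v i<..<t}|path_measure T y. \<Phi> (t - u))) = 0"
      by (rule indicator_mult_zero)
  qed
  then show ?thesis using m_eq[of t] t vn by simp
qed

lemma m_block:
  assumes i: "i \<in> {1..n}" and t: "t \<in> {v i<..v (i - 1)}"
  shows "m t = \<mu> + (LINT u:{0<..v i}|path_measure T y. \<Phi> (t - u)) + (LINT u:{v i<..<t}|path_measure T y. \<Phi> (t - u))"
proof -
  let ?c = "\<lambda>j. \<mu> + (LINT u:{0<..v j}|path_measure T y. \<Phi> (t - u)) + (LINT u:{v j<..<t}|path_measure T y. \<Phi> (t - u))"
  have vi: "0 < v i" "v i < t" using v_range[of i] i t by auto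
  have "i - 1 \<le> n" using i by auto
  then have "v (i - 1) \<le> T" using v_antimono[of 0 "i - 1"] unfolding v_0 by simp
  then have tT: "t \<in> {0..T}" using vi t by auto
  have "t \<notin> {v j<..v (j - 1)}" if j: "j \<in> {1..n}" "j \<noteq> i" for j
  proof (cases "j < i")
    case True
    then have "v (i - 1) \<le> v j" using v_antimono[of j "i - 1"] i by auto
    then show ?thesis using t by auto
  next
    case False
    then have "v (j - 1) \<le> v i" using v_antimono[of i "j - 1"] j by auto
    then show ?thesis using vi by auto
  qed
  note notin = this
  have "(\<Sum>j=1..n. indicator {v j<..v (j - 1)} t * ?c j) = (\<Sum>j\<in>{i}. indicator {v j<..v (j - 1)} t * ?c j)"
    using i by (intro sum.mono_neutral_right ballI indicator_mult_zero notin) simp_all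
  also have "\<dots> = ?c i"
    using t by (subst sum.insert[OF finite.emptyI]) (simp_all only: indicator_simps empty_iff not_False_eq_True sum.empty add_0_right mult_1_left)
  finally show ?thesis
    using m_eq[OF tT] vi v_antimono[of i n] i by simp
qed

text \<open>The times \<open>v i\<close> decrease with the index, so the least index with
  \<open>v i < t\<close> belongs to the latest shift before \<open>t\<close>.\<close>

lemma block_cases:
  assumes "t \<in> {0<..T}"
  obtains "t \<le> v n" | i where "i \<in> {1..n}" "t \<in> {v i<..v (i - 1)}"
proof (cases "t \<le> v n")
  case False
  define i where "i = (LEAST i. v i < t)"
  have ex: "v n < t" using False by simp
  have 1: "v i < t" unfolding i_def by (rule LeastI[of "\<lambda>i. v i < t", OF ex])
  have 2: "i \<le> n" unfolding i_def by (rule Least_le[of "\<lambda>i. v i < t", OF ex])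
  have "i \<noteq> 0" using 1 assms by (cases i) (auto simp: v_0)
  moreover have "\<not> v (i - 1) < t" using not_less_Least[of "i - 1" "\<lambda>i. v i < t"] \<open>i \<noteq> 0\<close> by (simp add: i_def)
  ultimately show ?thesis using 1 2 that(2)[of i] by auto
qed (use that in auto)

text \<open>Finiteness is needed before \<open>y\<close> can be recognised as a counting path, so
  the intensity is bounded without that knowledge. Up to the earliest shift it equals
  \<open>l\<close>, which is bounded since its own accepted set is finite; later it is given by
  integrals against the finite measure of \<open>y\<close>. Accepted marks thus lie in a strip,
  where the configuration is finite.\<close>

lemma finite_accepted_m: "finite (accepted m)"
proof -
  let ?M = "measure (path_measure T y) UNIV"
  \<comment> \<open>The two equal summands come from the integrals over the past up to the current
    shift and after it.\<close>
  let ?B = "\<mu> + b * ?M + b * ?M"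
  let ?L = "\<mu> + b * real (card (accepted l))"
  have l_le: "l t \<le> ?L" if "t \<in> {0..T}" for t
  proof -
    have "(\<Sum>z\<in>accepted l. if fst z < t then \<Phi> (t - fst z) else 0) \<le> (\<Sum>z\<in>accepted l. b)"
    proof (rule sum_mono)
      fix z assume "z \<in> accepted l"
      then have "0 < fst z" using point_range accepted_subset by blast
      then show "(if fst z < t then \<Phi> (t - fst z) else 0) \<le> b"
        using \<Phi>_range[of "t - fst z"] that b_nonneg by auto
    qed
    then show ?thesis unfolding intensity_eq[OF that] by (simp add: mult.commute)
  qed
  have bound: "\<bar>LINT u:B|path_measure T y. \<Phi> (t - u)\<bar> \<le> b * ?M" if "B \<subseteq> {0..t}" "t \<le> T" for B t
    by (rule path_integral_bound[OF T _ b_nonneg]) (use \<Phi>_range that in force)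
  have "m t \<le> max ?L ?B" if t: "t \<in> {0<..T}" for t
    using t
  proof (rule block_cases)
    assume "t \<le> v n"
    then have "m t = l t" using t by (intro m_initial) auto
    then show ?thesis using l_le[of t] t by auto
  next
    fix i assume i: "i \<in> {1..n}" "t \<in> {v i<..v (i - 1)}"
    have "0 < v i" using v_range[of i] i by auto
    then have "{0<..v i} \<subseteq> {0..t}" "{v i<..<t} \<subseteq> {0..t}" using i by auto
    from bound[OF this(1)] bound[OF this(2)] t
    have "m t \<le> ?B" unfolding m_block[OF i] by (auto simp: abs_le_iff)
    then show ?thesis by simp
  qed
  then have "accepted m \<subseteq> \<omega> \<inter> strip T (max ?L ?B)"
    using point_range configurations_subset[OF \<omega>] by (force simp: accepted_def)
  then show ?thesis by (rule finite_subset[OF _ finite_strip[OF \<omega>]])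
qed

definition total_count :: "real \<Rightarrow> nat" where
  "total_count t = card {w\<in>set vs. w \<le> t} + card {z\<in>accepted m. fst z \<le> t}"

lemma total_count_eq: "total_count t = card {a\<in>set vs \<union> fst ` accepted m. a \<le> t}"
proof -
  have "{a\<in>set vs \<union> fst ` accepted m. a \<le> t} = {w\<in>set vs. w \<le> t} \<union> {a\<in>fst ` accepted m. a \<le> t}" by auto
  moreover have "{w\<in>set vs. w \<le> t} \<inter> {a\<in>fst ` accepted m. a \<le> t} = {}"
    using no_shift accepted_subset by blast
  ultimately show ?thesis
    using finite_accepted_m card_times[OF accepted_subset, of m t]
    by (simp add: total_count_def card_Un_disjoint)
qed

text \<open>Downward induction on the index, that is, forward in time starting before the earliest
  shift. The value on a block refers to the left limit at the start of the block, which is known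
  once the path before it has been determined. Index \<open>0\<close> stands for the whole interval,
  including \<open>T\<close>.\<close>

lemma y_total_upto:
  "i \<le> n \<Longrightarrow> t \<in> {0..T} \<Longrightarrow> t < v i \<or> i = 0 \<Longrightarrow> y t = total_count t"
proof (induction i arbitrary: t rule: inc_induct)
  case base
  then have t: "t \<in> {0..<v n}" using n_pos by auto
  have "{w\<in>set vs. w \<le> t} = {}"
    unfolding set_vs using t v_antimono[of _ n] by (fastforce simp: not_le)
  moreover have "{z\<in>accepted m. fst z \<le> t} = {z\<in>accepted l. fst z \<le> t}"
  proof -
    have "m (fst z) = l (fst z)" if "z \<in> \<omega>" "fst z \<le> t" for z
      using that t point_range[of z] by (intro m_initial) auto
    then show ?thesis by (auto simp: accepted_def)
  qed
  ultimately show ?case using y_initial[OF t] path_eq[of t] base by (simp add: total_count_def)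
next
  case (step i)
  let ?i = "Suc i"
  have i: "?i \<in> {1..n}" using step.hyps by auto
  show ?case
  proof (cases "t < v ?i")
    case True
    then show ?thesis using step by auto
  next
    case False
    have t: "t \<in> block ?i" using False step.prems by auto
    have vi: "0 < v ?i" "v ?i < T" using v_range[of ?i] i by auto
    let ?A = "set vs \<union> fst ` accepted m"
    have "left_limit y (v ?i) = card {a\<in>?A. a < v ?i}"
    proof (rule left_limit_counting)
      show "finite ?A" using finite_accepted_m by simp
      show "y u = card {a\<in>?A. a \<le> u}" if "0 \<le> u" "u < v ?i" for u
        using step.IH[of u] that vi by (simp add: total_count_eq)
    qed (rule vi)
    moreover have "thinned_count T \<omega> m (v ?i) t = of_nat (card {z\<in>accepted m. v ?i < fst z \<and> fst z \<le> t})"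
      by (rule thinned_count_accepted[OF finite_accepted_m])
    ultimately have "(of_nat (y t) :: ennreal) = of_nat (card {a\<in>?A. a < v ?i} + 1 + card {z\<in>accepted m. v ?i < fst z \<and> fst z \<le> t})"
      using y_block[OF i t] by simp
    then have y: "y t = card {a\<in>?A. a < v ?i} + 1 + card {z\<in>accepted m. v ?i < fst z \<and> fst z \<le> t}"
      by (simp only: of_nat_eq_iff)
    have "card {z\<in>accepted m. v ?i < fst z \<and> fst z \<le> t} = card {a\<in>fst ` accepted m. v ?i < a \<and> a \<le> t}"
    proof -
      have "{a\<in>fst ` accepted m. v ?i < a \<and> a \<le> t} = fst ` {z\<in>accepted m. v ?i < fst z \<and> fst z \<le> t}" by auto
      moreover have "inj_on fst {z\<in>accepted m. v ?i < fst z \<and> fst z \<le> t}"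
        using distinct_times accepted_subset[of m] by (auto intro: inj_on_subset)
      ultimately show ?thesis by (simp add: card_image)
    qed
    \<comment> \<open>The jumps up to \<open>t\<close> are those before the shift, the shift itself,
      which is the \<open>+ 1\<close> of the equation, and the accepted points after it.\<close>
    moreover have "{a\<in>?A. a \<le> t} = insert (v ?i) ({a\<in>?A. a < v ?i} \<union> {a\<in>fst ` accepted m. v ?i < a \<and> a \<le> t})"
    proof -
      have "w \<le> v ?i" if "w \<in> set vs" "w \<le> t" for w
      proof -
        have "w \<in> v ` {1..n}" using that(1) by (simp only: set_vs)
        then obtain j where j: "w = v j" "j \<in> {1..n}" by (rule imageE)
        have "\<not> j \<le> i"
        proof
          assume "j \<le> i"
          then have "v i \<le> v j" using v_antimono[of j i] step.hyps by auto
          moreover have "1 \<le> i" using \<open>j \<le> i\<close> j by auto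
          ultimately show False using that(2) j(1) t step.prems by auto
        qed
        then show ?thesis using v_antimono[of ?i j] j by auto
      qed
      moreover have "v ?i \<in> ?A" using set_vs i by auto
      moreover have "v ?i \<le> t" using False by simp
      ultimately show ?thesis by force
    qed
    moreover have "card (insert (v ?i) ({a\<in>?A. a < v ?i} \<union> {a\<in>fst ` accepted m. v ?i < a \<and> a \<le> t})) =
        Suc (card {a\<in>?A. a < v ?i} + card {a\<in>fst ` accepted m. v ?i < a \<and> a \<le> t})"
      using finite_accepted_m by (subst card_insert_disjoint) (auto simp: card_Un_disjoint disjoint_iff)
    ultimately show ?thesis using y by (simp only: total_count_eq)
  qed
qed

lemma counting_shifted: "counting_path T (set vs \<union> fst ` accepted m) y"
  unfolding counting_path_def
proof (intro conjI ballI)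
  show "finite (set vs \<union> fst ` accepted m)" using finite_accepted_m by simp
  show "set vs \<union> fst ` accepted m \<subseteq> {0<..T}"
    using shifts point_range accepted_subset[of m] by (force simp: shift_times_def)
  show "y t = card {a\<in>set vs \<union> fst ` accepted m. a \<le> t}" if "t \<in> {0..T}" for t
    using y_total_upto[of 0 t] that by (simp add: total_count_eq)
qed

text \<open>On a block the two integrals join into one sum over all jumps before \<open>t\<close>,
  shifts and accepted points alike; the shift that opens the block is counted by the first interval.
  Up to the earliest shift the unshifted equation applies. The result is the single equation that
  pathwise uniqueness asks for.\<close>

lemma intensity_shifted_eq:
  assumes t: "t \<in> {0<..T}"
  shows "m t = \<mu> + (\<Sum>w\<leftarrow>vs. if w < t then \<Phi> (t - w) else 0) +
    (\<Sum>z\<in>accepted m. if fst z < t then \<Phi> (t - fst z) else 0)"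
  using t
proof (rule block_cases)
  assume tn: "t \<le> v n"
  have le: "t \<le> w" if "w \<in> set vs" for w
    using that tn v_antimono[of _ n] unfolding set_vs by fastforce
  have "map (\<lambda>w. if w < t then \<Phi> (t - w) else 0) vs = map (\<lambda>_. 0) vs"
    by (intro map_cong refl) (simp add: leD[OF le])
  then have 0: "(\<Sum>w\<leftarrow>vs. if w < t then \<Phi> (t - w) else 0) = 0" by (simp only:) simp
  have eq: "m (fst z) = l (fst z)" if "z \<in> \<omega>" "fst z < t" for z
    using that tn point_range[of z] by (intro m_initial) auto
  have R: "{z\<in>accepted l. fst z < t} = {z\<in>accepted m. fst z < t}"
    using eq by (auto simp: accepted_def)
  have "m t = l t" using t tn by (intro m_initial) auto
  also have "\<dots> = \<mu> + (\<Sum>z\<in>accepted l. if fst z < t then \<Phi> (t - fst z) else 0)"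
    using t by (intro intensity_eq) auto
  also have "(\<Sum>z\<in>accepted l. if fst z < t then \<Phi> (t - fst z) else 0) = (\<Sum>z\<in>{z\<in>accepted l. fst z < t}. \<Phi> (t - fst z))"
    using finite_accepted by (intro sum.mono_neutral_cong_right) auto
  also have "\<dots> = (\<Sum>z\<in>accepted m. if fst z < t then \<Phi> (t - fst z) else 0)"
    unfolding R using finite_accepted_m by (intro sum.mono_neutral_cong_left) auto
  finally show ?thesis unfolding 0 by simp
next
  fix i assume i: "i \<in> {1..n}" "t \<in> {v i<..v (i - 1)}"
  let ?A = "set vs \<union> fst ` accepted m"
  have vi: "0 < v i" using v_range[of i] i by auto
  have fin: "finite ?A" using finite_accepted_m by simp
  have "m t = \<mu> + (\<Sum>a\<in>?A \<inter> {0<..v i}. \<Phi> (t - a)) + (\<Sum>a\<in>?A \<inter> {v i<..<t}. \<Phi> (t - a))"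
    unfolding m_block[OF i] using t i vi
    by (subst (1 2) path_integral_counting[OF counting_shifted T \<Phi>_shift_measurable]) auto
  also have "\<dots> = \<mu> + (\<Sum>a\<in>?A \<inter> {0<..<t}. \<Phi> (t - a))"
  proof -
    have "?A \<inter> {0<..<t} = ?A \<inter> {0<..v i} \<union> ?A \<inter> {v i<..<t}" using i vi by auto
    then show ?thesis using fin by (simp only:) (subst sum.union_disjoint, auto)
  qed
  also have "(\<Sum>a\<in>?A \<inter> {0<..<t}. \<Phi> (t - a)) = (\<Sum>a\<in>set vs \<inter> {0<..<t}. \<Phi> (t - a)) + (\<Sum>a\<in>fst ` accepted m \<inter> {0<..<t}. \<Phi> (t - a))"
    unfolding Int_Un_distrib2 using finite_accepted_m no_shift accepted_subset[of m]
    by (intro sum.union_disjoint) auto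
  also have "(\<Sum>a\<in>fst ` accepted m \<inter> {0<..<t}. \<Phi> (t - a)) = (\<Sum>z\<in>accepted m. if fst z < t then \<Phi> (t - fst z) else 0)"
    by (rule sum_times[OF finite_accepted_m accepted_subset])
  also have "(\<Sum>a\<in>set vs \<inter> {0<..<t}. \<Phi> (t - a)) = (\<Sum>w\<in>set vs. if w < t then \<Phi> (t - w) else 0)"
    using shifts by (intro sum.mono_neutral_cong_left) (auto simp: shift_times_def)
  also have "\<dots> = (\<Sum>w\<leftarrow>vs. if w < t then \<Phi> (t - w) else 0)"
    using distinct_vs by (rule sum_list_distinct_conv_sum_set[symmetric])
  finally show ?thesis by simp
qed

end

section \<open>Expansion into a series\<close>

text \<open>The counterpart of \<open>iterated_integral\<close> in \<open>ennreal\<close>. Over open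
  intervals the lists that occur are strictly decreasing with positive entries, so below
  \<open>T\<close> the nonempty ones are admissible lists of shift times.\<close>

primrec nn_iterated :: "nat \<Rightarrow> real \<Rightarrow> (real list \<Rightarrow> ennreal) \<Rightarrow> ennreal" where
  "nn_iterated 0 b F = F []"
| "nn_iterated (Suc n) b F = (\<integral>\<^sup>+v\<in>{0<..<b}. nn_iterated n v (\<lambda>vs. F (v # vs)) \<partial>lborel)"

definition decreasing_below :: "real \<Rightarrow> real list \<Rightarrow> bool" where
  "decreasing_below b vs \<longleftrightarrow> sorted_wrt (>) (b # vs) \<and> set vs \<subseteq> {0<..}"

lemma decreasing_below_Nil [simp]: "decreasing_below b []"
  by (simp add: decreasing_below_def)

lemma decreasing_below_Cons [simp]: "decreasing_below b (v # vs) \<longleftrightarrow> 0 < v \<and> v < b \<and> decreasing_below v vs"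
  by (auto simp: decreasing_below_def)

lemma nn_iterated_mono:
  "(\<And>vs. length vs = n \<Longrightarrow> decreasing_below b vs \<Longrightarrow> F vs \<le> G vs) \<Longrightarrow> nn_iterated n b F \<le> nn_iterated n b G"
proof (induction n arbitrary: b F G)
  case (Suc n)
  have "nn_iterated n v (\<lambda>vs. F (v # vs)) \<le> nn_iterated n v (\<lambda>vs. G (v # vs))" if "v \<in> {0<..<b}" for v
    by (rule Suc.IH) (use that Suc.prems in auto)
  then show ?case by (auto intro!: nn_integral_mono split: split_indicator)
qed simp

lemma nn_iterated_cong:
  "(\<And>vs. length vs = n \<Longrightarrow> decreasing_below b vs \<Longrightarrow> F vs = G vs) \<Longrightarrow> nn_iterated n b F = nn_iterated n b G"
  by (intro antisym nn_iterated_mono) simp_all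

lemma nn_iterated_bound:
  "0 \<le> b \<Longrightarrow> (\<And>vs. length vs = n \<Longrightarrow> decreasing_below b vs \<Longrightarrow> F vs \<le> c) \<Longrightarrow> nn_iterated n b F \<le> c * ennreal (b ^ n)"
proof (induction n arbitrary: b F)
  case (Suc n)
  have "nn_iterated (Suc n) b F \<le> (\<integral>\<^sup>+v\<in>{0<..<b}. c * ennreal (b ^ n) \<partial>lborel)"
    unfolding nn_iterated.simps
  proof (rule nn_integral_mono)
    fix v
    show "nn_iterated n v (\<lambda>vs. F (v # vs)) * indicator {0<..<b} v \<le> c * ennreal (b ^ n) * indicator {0<..<b} v"
    proof (cases "v \<in> {0<..<b}")
      case True
      then have "nn_iterated n v (\<lambda>vs. F (v # vs)) \<le> c * ennreal (v ^ n)"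
        by (intro Suc.IH Suc.prems) auto
      also have "\<dots> \<le> c * ennreal (b ^ n)"
        using True by (intro mult_left_mono ennreal_leI power_mono) auto
      finally show ?thesis using True by simp
    qed simp
  qed
  also have "\<dots> = c * ennreal (b ^ n) * ennreal b"
    using Suc.prems(1) by (simp add: nn_integral_cmult_indicator)
  also have "\<dots> = c * ennreal (b ^ Suc n)"
  proof -
    have "ennreal (b ^ Suc n) = ennreal b * ennreal (b ^ n)" using Suc.prems(1) by (simp add: ennreal_mult)
    then show ?thesis by (simp only: ac_simps)
  qed
  finally show ?case .
qed simp

text \<open>The recursion appends a new shift at the end of the list, that is, in the innermost
  integral, whereas the definition peels off the outermost one. Writing \<open>last (b # vs)\<close>
  gives the correct upper limit for the empty list as well.\<close>

lemma nn_iterated_snoc: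
  "nn_iterated (Suc n) b F = nn_iterated n b (\<lambda>vs. \<integral>\<^sup>+u\<in>{0<..<last (b # vs)}. F (vs @ [u]) \<partial>lborel)"
proof (induction n arbitrary: b F)
  case (Suc n)
  have l: "last (b # v # vs) = last (v # vs)" for v :: real and vs by simp
  have "nn_iterated (Suc (Suc n)) b F = (\<integral>\<^sup>+v\<in>{0<..<b}. nn_iterated (Suc n) v (\<lambda>vs. F (v # vs)) \<partial>lborel)"
    by (rule nn_iterated.simps(2))
  also have "\<dots> = nn_iterated (Suc n) b (\<lambda>vs. \<integral>\<^sup>+u\<in>{0<..<last (b # vs)}. F (vs @ [u]) \<partial>lborel)"
    unfolding nn_iterated.simps(2)[of n b] l append_Cons by (subst Suc.IH) (rule refl)
  finally show ?case .
qed simp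

text \<open>Lists of length \<open>n\<close> are parametrised by the first \<open>n\<close> coordinates of a sequence.\<close>

definition list_measurable :: "(real list \<Rightarrow> ennreal) \<Rightarrow> bool" where
  "list_measurable F \<longleftrightarrow> (\<forall>n. (\<lambda>x. F (map x [0..<n])) \<in> borel_measurable vecs)"

lemma list_measurableD: "list_measurable F \<Longrightarrow> (\<lambda>x. F (map x [0..<n])) \<in> borel_measurable vecs"
  by (simp add: list_measurable_def)

lemma vecs_component: "(\<lambda>x. x i) \<in> borel_measurable vecs"
  by (rule measurable_component_singleton) simp

lemma vecs_update: "(\<lambda>w. (fst w)(k := snd w)) \<in> vecs \<Otimes>\<^sub>M borel \<rightarrow>\<^sub>M vecs"
proof (rule measurable_PiM_single')
  fix i
  show "(\<lambda>w. ((fst w)(k := snd w)) i) \<in> borel_measurable (vecs \<Otimes>\<^sub>M borel)"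
    using measurable_compose[OF measurable_fst vecs_component[of i]] by (cases "i = k") auto
qed simp

lemma map_update: "map (x(k := v)) [0..<Suc k] = map x [0..<k] @ [v]"
  by simp

text \<open>Prefix and upper limit are general because one integration step changes both: the new
  coordinate extends the prefix and is the upper limit of the next integral.\<close>

lemma list_measurable_append:
  assumes F: "list_measurable F" and \<beta>: "\<beta> \<in> borel_measurable vecs"
  shows "(\<lambda>x. nn_iterated n (\<beta> x) (\<lambda>vs. F (map x [0..<k] @ vs))) \<in> borel_measurable vecs"
  using \<beta>
proof (induction n arbitrary: k \<beta>)
  case 0
  then show ?case using list_measurableD[OF F] by simp
next
  case (Suc n)
  note Suc.prems[measurable]
  have "(\<lambda>y. nn_iterated n (y k) (\<lambda>vs. F (map y [0..<Suc k] @ vs))) \<in> borel_measurable vecs"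
    by (rule Suc.IH) (rule vecs_component)
  from measurable_compose[OF vecs_update[of k] this]
  have [measurable]: "(\<lambda>w. nn_iterated n (snd w) (\<lambda>vs. F (map (fst w) [0..<k] @ snd w # vs))) \<in> borel_measurable (vecs \<Otimes>\<^sub>M borel)"
    unfolding map_update by simp
  have "(\<lambda>w. nn_iterated n (snd w) (\<lambda>vs. F (map (fst w) [0..<k] @ snd w # vs)) * indicator {0<..<\<beta> (fst w)} (snd w))
      \<in> borel_measurable (vecs \<Otimes>\<^sub>M lborel)"
    unfolding indicator_def greaterThanLessThan_iff by measurable
  then show ?case unfolding nn_iterated.simps
    by (intro lborel.borel_measurable_nn_integral) (simp add: split_beta')
qed

lemma list_measurable_Cons:
  assumes F: "list_measurable F"
  shows "list_measurable (\<lambda>vs. F (v # vs))"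
  unfolding list_measurable_def
proof
  fix n
  have "(\<lambda>x. case_nat v x) \<in> vecs \<rightarrow>\<^sub>M vecs"
  proof (rule measurable_PiM_single')
    fix i show "(\<lambda>x. case_nat v x i) \<in> borel_measurable vecs"
      using vecs_component by (cases i) simp_all
  qed simp
  from measurable_compose[OF this list_measurableD[OF F, of "Suc n"]]
  have "(\<lambda>x. F (map (case_nat v x) [0..<Suc n])) \<in> borel_measurable vecs" .
  moreover have "map (case_nat v x) [0..<Suc n] = v # map x [0..<n]" for x :: "nat \<Rightarrow> real"
    by (subst upt_conv_Cons, simp, subst map_Suc_upt[symmetric], simp add: comp_def)
  ultimately show "(\<lambda>x. F (v # map x [0..<n])) \<in> borel_measurable vecs" by simp
qed

lemma measurable_nn_iterated_Cons:
  assumes F: "list_measurable F"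
  shows "(\<lambda>v. nn_iterated n v (\<lambda>vs. F (v # vs))) \<in> borel_measurable borel"
proof -
  have 1: "(\<lambda>x. nn_iterated n (x 0) (\<lambda>vs. F (map x [0..<1] @ vs))) \<in> borel_measurable vecs"
    by (rule list_measurable_append[OF F vecs_component])
  have "(\<lambda>v i. v) \<in> borel \<rightarrow>\<^sub>M vecs" by (rule measurable_PiM_single') auto
  from measurable_compose[OF this 1] show ?thesis by simp
qed

lemma nn_iterated_add:
  "list_measurable F \<Longrightarrow> list_measurable G \<Longrightarrow>
    nn_iterated n b (\<lambda>vs. F vs + G vs) = nn_iterated n b F + nn_iterated n b G"
proof (induction n arbitrary: b F G)
  case (Suc n)
  note [measurable] = measurable_nn_iterated_Cons[OF Suc.prems(1), of n] measurable_nn_iterated_Cons[OF Suc.prems(2), of n]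
  show ?case
    by (simp add: Suc.IH list_measurable_Cons Suc.prems distrib_right) (rule nn_integral_add; measurable)
qed simp

lemma nn_iterated_cmult:
  "list_measurable F \<Longrightarrow> nn_iterated n b (\<lambda>vs. c * F vs) = c * nn_iterated n b F"
proof (induction n arbitrary: b F)
  case (Suc n)
  note [measurable] = measurable_nn_iterated_Cons[OF Suc.prems(1), of n]
  show ?case
    by (simp add: Suc.IH list_measurable_Cons Suc.prems mult.assoc) (rule nn_integral_cmult; measurable)
qed simp

lemma list_measurable_last_integral:
  assumes F: "list_measurable F"
  shows "list_measurable (\<lambda>vs. \<integral>\<^sup>+u\<in>{0<..<last (b # vs)}. F (vs @ [u]) \<partial>lborel)"
  unfolding list_measurable_def
proof
  fix n
  have \<beta>: "(\<lambda>x. last (b # map x [0..<n])) \<in> borel_measurable vecs"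
    using vecs_component by (cases n) (simp_all add: last_map)
  have "(\<lambda>x. nn_iterated 1 (last (b # map x [0..<n])) (\<lambda>vs. F (map x [0..<n] @ vs))) \<in> borel_measurable vecs"
    by (rule list_measurable_append[OF F \<beta>])
  then show "(\<lambda>x. \<integral>\<^sup>+u\<in>{0<..<last (b # map x [0..<n])}. F (map x [0..<n] @ [u]) \<partial>lborel) \<in> borel_measurable vecs"
    by simp
qed

lemma interval_integral_0:
  fixes b :: real and G :: "real \<Rightarrow> real"
  shows "0 \<le> b \<Longrightarrow> (LBINT v=0..b. G v) = (\<integral>v. indicator {0<..<b} v * G v \<partial>lborel)"
  by (simp add: interval_lebesgue_integral_def set_lebesgue_integral_def zero_ereal_def)

text \<open>On decreasing lists \<open>F\<close> coincides with \<open>F'\<close>, which carries the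
  measurability. The constant \<open>c\<close> keeps every inner integral finite, so
  \<open>enn2real\<close> loses nothing at any level.\<close>

lemma iterated_integral_eq_nn_iterated:
  assumes "0 \<le> b" "list_measurable F'"
    and "\<And>vs. length vs = n \<Longrightarrow> decreasing_below b vs \<Longrightarrow> 0 \<le> F vs \<and> F' vs = ennreal (F vs) \<and> F vs \<le> c"
  shows "iterated_integral n b F = enn2real (nn_iterated n b F')"
  using assms
proof (induction n arbitrary: b F F')
  case (Suc n)
  have m: "(\<lambda>v. nn_iterated n v (\<lambda>vs. F' (v # vs))) \<in> borel_measurable borel"
    by (rule measurable_nn_iterated_Cons[OF Suc.prems(2)])
  have IH: "iterated_integral n v (\<lambda>vs. F (v # vs)) = enn2real (nn_iterated n v (\<lambda>vs. F' (v # vs)))"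
    "nn_iterated n v (\<lambda>vs. F' (v # vs)) < \<top>" if v: "v \<in> {0<..<b}" for v
  proof -
    show "iterated_integral n v (\<lambda>vs. F (v # vs)) = enn2real (nn_iterated n v (\<lambda>vs. F' (v # vs)))"
      by (rule Suc.IH) (use v Suc.prems list_measurable_Cons in auto)
    have "nn_iterated n v (\<lambda>vs. F' (v # vs)) \<le> ennreal c * ennreal (v ^ n)"
    proof (rule nn_iterated_bound)
      fix vs :: "real list" assume "length vs = n" "decreasing_below v vs"
      then have "F' (v # vs) = ennreal (F (v # vs))" "F (v # vs) \<le> c"
        using Suc.prems(3)[of "v # vs"] v by auto
      then show "F' (v # vs) \<le> ennreal c" by (simp add: ennreal_leI)
    qed (use v in auto)
    also have "\<dots> < \<top>" by (simp add: ennreal_mult_less_top)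
    finally show "nn_iterated n v (\<lambda>vs. F' (v # vs)) < \<top>" .
  qed
  have "iterated_integral (Suc n) b F = (\<integral>v. indicator {0<..<b} v * iterated_integral n v (\<lambda>vs. F (v # vs)) \<partial>lborel)"
    using Suc.prems(1) by (simp add: interval_integral_0)
  also have "\<dots> = (\<integral>v. indicator {0<..<b} v * enn2real (nn_iterated n v (\<lambda>vs. F' (v # vs))) \<partial>lborel)"
    by (intro Bochner_Integration.integral_cong refl) (auto simp: IH split: split_indicator)
  also have "\<dots> = enn2real (\<integral>\<^sup>+v. ennreal (indicator {0<..<b} v * enn2real (nn_iterated n v (\<lambda>vs. F' (v # vs)))) \<partial>lborel)"
    using m by (intro integral_eq_nn_integral) auto
  also have "(\<integral>\<^sup>+v. ennreal (indicator {0<..<b} v * enn2real (nn_iterated n v (\<lambda>vs. F' (v # vs)))) \<partial>lborel) = nn_iterated (Suc n) b F'"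
    unfolding nn_iterated.simps using IH(2) by (intro nn_integral_cong) (auto split: split_indicator)
  finally show ?case .
qed simp

fun nn_kernel :: "(real \<Rightarrow> ennreal) \<Rightarrow> real list \<Rightarrow> ennreal" where
  "nn_kernel \<phi> (v # u # vs) = \<phi> (v - u) * nn_kernel \<phi> (u # vs)"
| "nn_kernel \<phi> _ = 1"

lemma nn_kernel_snoc: "vs \<noteq> [] \<Longrightarrow> nn_kernel \<phi> (vs @ [u]) = nn_kernel \<phi> vs * \<phi> (last vs - u)"
  by (induction \<phi> vs rule: nn_kernel.induct) (simp_all add: mult.assoc)

lemma kernel_product_Cons:
  "kernel_product \<Phi> (v # u # vs) = \<Phi> (v - u) * kernel_product \<Phi> (u # vs)"
proof -
  let ?n = "length vs"
  have "kernel_product \<Phi> (v # u # vs) = (\<Prod>i=Suc 1..Suc (Suc ?n). \<Phi> ((v # u # vs) ! (i - 2) - (v # u # vs) ! (i - 1)))"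
    by (simp add: kernel_product_def numeral_2_eq_2)
  also have "\<dots> = (\<Prod>i=1..Suc ?n. \<Phi> ((v # u # vs) ! (i - 1) - (v # u # vs) ! i))"
    by (subst prod.atLeast_Suc_atMost_Suc_shift) (simp add: comp_def)
  also have "\<dots> = \<Phi> (v - u) * (\<Prod>i=Suc 1..Suc ?n. \<Phi> ((v # u # vs) ! (i - 1) - (v # u # vs) ! i))"
    by (subst prod.atLeast_Suc_atMost) simp_all
  also have "(\<Prod>i=Suc 1..Suc ?n. \<Phi> ((v # u # vs) ! (i - 1) - (v # u # vs) ! i)) = kernel_product \<Phi> (u # vs)"
    unfolding kernel_product_def by (intro prod.cong) (auto simp: numeral_2_eq_2 nth_Cons' )
  finally show ?thesis .
qed

text \<open>A nonempty list has one factor fewer than entries, and the empty product is one; a power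
  of \<open>max 1 b\<close> covers both. The bound serves to keep the iterated integrals
  finite.\<close>

lemma kernel_product_eq:
  assumes "\<And>s. 0 \<le> s \<Longrightarrow> s \<le> T \<Longrightarrow> 0 \<le> \<Phi> s \<and> \<Phi> s \<le> b \<and> \<phi> s = ennreal (\<Phi> s)" "decreasing_below T vs" "0 \<le> b"
  shows "0 \<le> kernel_product \<Phi> vs \<and> nn_kernel \<phi> vs = ennreal (kernel_product \<Phi> vs) \<and> kernel_product \<Phi> vs \<le> (max 1 b) ^ length vs"
  using assms(2)
proof (induction \<phi>\<equiv>\<phi> vs rule: nn_kernel.induct)
  case (1 v u vs)
  have s: "0 \<le> v - u" "v - u \<le> T" "decreasing_below T (u # vs)" using "1.prems" by auto
  note IH = "1.hyps"[OF s(3)] and \<Phi> = assms(1)[OF s(1,2)]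
  have "kernel_product \<Phi> (v # u # vs) \<le> max 1 b * (max 1 b) ^ length (u # vs)"
    unfolding kernel_product_Cons using IH \<Phi> assms(3) by (intro mult_mono) auto
  then show ?case using IH \<Phi> by (simp add: kernel_product_Cons ennreal_mult)
qed (simp_all add: kernel_product_def)

lemma list_measurable_nn_kernel:
  assumes [measurable]: "\<phi> \<in> borel_measurable borel"
  shows "list_measurable (nn_kernel \<phi>)"
  unfolding list_measurable_def
proof
  fix n show "(\<lambda>x. nn_kernel \<phi> (map x [0..<n])) \<in> borel_measurable vecs"
  proof (induction n)
    case (Suc n)
    show ?case
    proof (cases n)
      case 0
      then show ?thesis by simp
    next
      case (Suc k)
      have [measurable]: "(\<lambda>x. nn_kernel \<phi> (map x [0..<n])) \<in> borel_measurable vecs" by fact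
      note vecs_component[measurable]
      have "nn_kernel \<phi> (map x [0..<Suc n]) = nn_kernel \<phi> (map x [0..<n]) * \<phi> (x k - x n)" for x
        using nn_kernel_snoc[of "map x [0..<n]" \<phi> "x n"] Suc by (simp add: last_map)
      then show ?thesis by simp
    qed
  qed simp
qed

section \<open>Geometric remainder and telescoping\<close>

context claims_model
begin

text \<open>With the first time \<open>v\<close> held fixed, integrating over each gap between
  consecutive times costs at most a factor \<open>q\<close>, the bound on the total mass of the
  kernel.\<close>

lemma nn_iterated_kernel_le: "nn_iterated n v (\<lambda>vs. nn_kernel \<phi> (v # vs)) \<le> ennreal (q ^ n)"
proof (induction n arbitrary: v)
  case (Suc n)
  have lm: "list_measurable (\<lambda>vs. nn_kernel \<phi> (u # vs))" for u
    by (intro list_measurable_Cons list_measurable_nn_kernel) simp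
  have "nn_iterated (Suc n) v (\<lambda>vs. nn_kernel \<phi> (v # vs)) =
      (\<integral>\<^sup>+u\<in>{0<..<v}. \<phi> (v - u) * nn_iterated n u (\<lambda>vs. nn_kernel \<phi> (u # vs)) \<partial>lborel)"
    by (simp add: nn_iterated_cmult[OF lm])
  also have "\<dots> \<le> (\<integral>\<^sup>+u. ennreal (q ^ n) * \<phi> (v - u) \<partial>lborel)"
  proof (rule nn_integral_mono)
    fix u
    have "\<phi> (v - u) * nn_iterated n u (\<lambda>vs. nn_kernel \<phi> (u # vs)) \<le> \<phi> (v - u) * ennreal (q ^ n)"
      by (intro mult_left_mono Suc.IH) simp
    then show "\<phi> (v - u) * nn_iterated n u (\<lambda>vs. nn_kernel \<phi> (u # vs)) * indicator {0<..<v} u \<le> ennreal (q ^ n) * \<phi> (v - u)"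
      by (auto simp: mult.commute split: split_indicator)
  qed
  also have "\<dots> = ennreal (q ^ n) * (\<integral>\<^sup>+u. \<phi> (v - u) \<partial>lborel)" by (rule nn_integral_cmult) measurable
  also have "\<dots> \<le> ennreal (q ^ n) * ennreal q" by (intro mult_left_mono nn_integral_\<phi>_shift) simp
  also have "\<dots> = ennreal (q ^ Suc n)" using q by (simp add: ennreal_mult[symmetric] mult.commute)
  finally show ?case .
qed simp

text \<open>The deterministic factor under the iterated integrals. Appending \<open>T\<close> makes
  \<open>hd\<close> meaningful for every list and gives the empty list the weight one.\<close>

definition weight :: "real list \<Rightarrow> ennreal" where
  "weight vs = ennreal (disc (hd (vs @ [T]))) * nn_kernel \<phi> vs"

lemma list_measurable_weight: "list_measurable weight"
  unfolding list_measurable_def weight_def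
proof
  fix n
  have [measurable]: "(\<lambda>x. hd (map x [0..<n] @ [T])) \<in> borel_measurable vecs"
    using vecs_component by (cases n) (simp_all add: upt_conv_Cons del: upt_Suc)
  have [measurable]: "(\<lambda>x. nn_kernel \<phi> (map x [0..<n])) \<in> borel_measurable vecs"
    by (intro list_measurableD list_measurable_nn_kernel) simp
  show "(\<lambda>x. ennreal (disc (hd (map x [0..<n] @ [T]))) * nn_kernel \<phi> (map x [0..<n])) \<in> borel_measurable vecs"
    by measurable
qed

lemma weight_snoc: "vs \<noteq> [] \<Longrightarrow> weight (vs @ [u]) = weight vs * \<phi> (last vs - u)"
  by (cases vs) (simp_all add: weight_def nn_kernel_snoc[of "_ # _", simplified] mult.assoc)

text \<open>What is left after \<open>n - 1\<close> expansions, when \<open>n\<close> shifts have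
  been placed and the intensity at the earliest of them is still present. Thus
  \<open>remainder 1\<close> is the full expectation, and \<open>summand n\<close> is the term split
  off next, without its constant factor.\<close>

definition remainder :: "nat \<Rightarrow> ennreal" where
  "remainder n = nn_iterated n T (\<lambda>vs. weight vs * rate_mean vs)"

definition summand :: "nat \<Rightarrow> ennreal" where
  "summand n = nn_iterated n T (\<lambda>vs. weight vs * shift_mean vs)"

lemma list_measurable_weight_shift_mean: "list_measurable (\<lambda>vs. weight vs * shift_mean vs)"
  using list_measurableD[OF list_measurable_weight] measurable_shift_mean
  unfolding list_measurable_def by (intro allI borel_measurable_times_ennreal) auto

lemma list_measurable_weight_rate_mean: "list_measurable (\<lambda>vs. weight vs * rate_mean vs)"
  unfolding list_measurable_def
proof
  fix n
  show "(\<lambda>x. weight (map x [0..<n]) * rate_mean (map x [0..<n])) \<in> borel_measurable vecs"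
    using list_measurableD[OF list_measurable_weight, of n] measurable_rate_mean[of n]
    by (cases n) (auto intro: borel_measurable_times_ennreal)
qed

lemma decreasing_below_last: "decreasing_below c vs \<Longrightarrow> vs \<noteq> [] \<Longrightarrow> 0 < last vs \<and> last vs < c \<and> (\<forall>v\<in>set vs. last vs \<le> v)"
proof (induction vs arbitrary: c)
  case (Cons v vs)
  then show ?case by (cases "vs = []") force+
qed simp

text \<open>The recursion for \<open>rate_mean\<close> is multiplied by the weight and integrated
  over the first \<open>n\<close> shift times. The constant part of the intensity gives the summand;
  in the other part the new kernel factor completes the weight of the longer list, and the new shift
  is the innermost variable.\<close>

lemma remainder_recursion:
  assumes n: "0 < n"
  shows "remainder n = m * summand n + remainder (Suc n)"
proof -
  have "remainder n = nn_iterated n T (\<lambda>vs. m * (weight vs * shift_mean vs) + (\<integral>\<^sup>+u\<in>{0<..<last (T # vs)}. weight (vs @ [u]) * rate_mean (vs @ [u]) \<partial>lborel))"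
    unfolding remainder_def
  proof (rule nn_iterated_cong)
    fix vs :: "real list" assume len: "length vs = n" and vs: "decreasing_below T vs"
    have ne: "vs \<noteq> []" using len n by auto
    have last: "0 < last vs" "last vs < T" "\<And>v. v \<in> set vs \<Longrightarrow> last vs \<le> v"
      using decreasing_below_last[OF vs ne] by auto
    let ?k = "\<lambda>s. if s < last vs then \<phi> (last vs - s) else 0"
    have [measurable]: "(\<lambda>s. rate_mean (vs @ [s])) \<in> borel_measurable borel"
    proof -
      have "(\<lambda>s i. (vs @ [s]) ! i) \<in> borel \<rightarrow>\<^sub>M vecs"
      proof (rule measurable_PiM_single')
        fix i show "(\<lambda>s. (vs @ [s]) ! i) \<in> borel_measurable borel"
          by (cases "i < length vs"; cases "i = length vs") (auto simp: nth_append)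
      qed simp
      from measurable_compose[OF this measurable_rate_mean[of "Suc (length vs)"]]
      have "(\<lambda>s. rate_mean (map (\<lambda>i. (vs @ [s]) ! i) [0..<Suc (length vs)])) \<in> borel_measurable borel" by simp
      moreover have "map (\<lambda>i. (vs @ [s]) ! i) [0..<Suc (length vs)] = vs @ [s]" for s
        using map_nth[of "vs @ [s]"] by simp
      ultimately show ?thesis by (simp only:)
    qed
    \<comment> \<open>The kernel already restricts \<open>s\<close> to times before
      \<open>last vs\<close>, and the endpoint zero is a null set.\<close>
    have "(\<integral>\<^sup>+s\<in>{0..T}. ?k s * rate_mean (vs @ [s]) \<partial>lborel) = (\<integral>\<^sup>+s\<in>{0<..<last vs}. \<phi> (last vs - s) * rate_mean (vs @ [s]) \<partial>lborel)"
    proof (rule nn_integral_cong_AE)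
      have "AE s in lborel. s \<noteq> (0 :: real)" by (rule AE_lborel_singleton)
      then show "AE s in lborel. ?k s * rate_mean (vs @ [s]) * indicator {0..T} s = \<phi> (last vs - s) * rate_mean (vs @ [s]) * indicator {0<..<last vs} s"
        by eventually_elim (use last in \<open>auto split: split_indicator\<close>)
    qed
    then have r: "rate_mean vs = m * shift_mean vs + (\<integral>\<^sup>+s\<in>{0<..<last vs}. \<phi> (last vs - s) * rate_mean (vs @ [s]) \<partial>lborel)"
      by (subst rate_mean_recursion[OF ne last(3)]) (simp_all only:)
    have "weight vs * rate_mean vs = weight vs * (m * shift_mean vs) + weight vs * (\<integral>\<^sup>+s\<in>{0<..<last vs}. \<phi> (last vs - s) * rate_mean (vs @ [s]) \<partial>lborel)"
      by (subst r) (rule distrib_left)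
    also have "weight vs * (\<integral>\<^sup>+s\<in>{0<..<last vs}. \<phi> (last vs - s) * rate_mean (vs @ [s]) \<partial>lborel) =
        (\<integral>\<^sup>+s. weight vs * (\<phi> (last vs - s) * rate_mean (vs @ [s]) * indicator {0<..<last vs} s) \<partial>lborel)"
      by (intro nn_integral_cmult[symmetric]) measurable
    also have "\<dots> = (\<integral>\<^sup>+u\<in>{0<..<last (T # vs)}. weight (vs @ [u]) * rate_mean (vs @ [u]) \<partial>lborel)"
      using ne by (simp add: weight_snoc mult.assoc)
    finally show "weight vs * rate_mean vs = m * (weight vs * shift_mean vs) + (\<integral>\<^sup>+u\<in>{0<..<last (T # vs)}. weight (vs @ [u]) * rate_mean (vs @ [u]) \<partial>lborel)"
      by (simp add: ac_simps)
  qed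
  also have "\<dots> = nn_iterated n T (\<lambda>vs. m * (weight vs * shift_mean vs)) +
      nn_iterated n T (\<lambda>vs. \<integral>\<^sup>+u\<in>{0<..<last (T # vs)}. weight (vs @ [u]) * rate_mean (vs @ [u]) \<partial>lborel)"
  proof (rule nn_iterated_add)
    show "list_measurable (\<lambda>vs. m * (weight vs * shift_mean vs))"
      using list_measurableD[OF list_measurable_weight_shift_mean]
      unfolding list_measurable_def by (intro allI borel_measurable_times_ennreal[OF borel_measurable_const]) auto
    show "list_measurable (\<lambda>vs. \<integral>\<^sup>+u\<in>{0<..<last (T # vs)}. weight (vs @ [u]) * rate_mean (vs @ [u]) \<partial>lborel)"
      by (rule list_measurable_last_integral[OF list_measurable_weight_rate_mean])
  qed
  also have "\<dots> = m * summand n + remainder (Suc n)"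
    unfolding remainder_def summand_def nn_iterated_snoc by (simp add: nn_iterated_cmult[OF list_measurable_weight_shift_mean])
  finally show ?thesis .
qed

lemma weight_le:
  assumes "0 \<le> \<kappa>" "decreasing_below T vs"
  shows "weight vs \<le> nn_kernel \<phi> vs"
proof -
  have "hd (vs @ [T]) \<le> T" using assms(2) by (cases vs) auto
  then have "disc (hd (vs @ [T])) \<le> 1" unfolding disc_def using assms(1) by (simp add: mult_nonneg_nonneg)
  then have "ennreal (disc (hd (vs @ [T]))) \<le> 1" by (simp add: ennreal_le_1)
  from mult_right_mono[OF this, of "nn_kernel \<phi> vs"] show ?thesis by (simp add: weight_def)
qed

text \<open>Of the \<open>n + 1\<close> integrations the outermost yields \<open>T\<close> and each
  of the others at most \<open>q\<close>. The discount factor is at most one since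
  \<open>\<kappa>\<close> is nonnegative.\<close>

lemma weighted_term_le:
  assumes \<kappa>: "0 \<le> \<kappa>" and D: "\<And>vs. decreasing_below T vs \<Longrightarrow> vs \<noteq> [] \<Longrightarrow> D vs \<le> d"
  shows "nn_iterated (Suc n) T (\<lambda>vs. weight vs * D vs) \<le> d * ennreal (T * q ^ n)"
proof -
  have lm: "list_measurable (nn_kernel \<phi>)" by (intro list_measurable_nn_kernel) simp
  have "nn_iterated (Suc n) T (\<lambda>vs. weight vs * D vs) \<le> nn_iterated (Suc n) T (\<lambda>vs. d * nn_kernel \<phi> vs)"
  proof (rule nn_iterated_mono)
    fix vs :: "real list" assume "length vs = Suc n" "decreasing_below T vs"
    then have "weight vs * D vs \<le> nn_kernel \<phi> vs * d"
      by (intro mult_mono weight_le[OF \<kappa>] D) auto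
    then show "weight vs * D vs \<le> d * nn_kernel \<phi> vs" by (simp add: mult.commute)
  qed
  also have "\<dots> = d * nn_iterated (Suc n) T (nn_kernel \<phi>)" by (rule nn_iterated_cmult[OF lm])
  also have "nn_iterated (Suc n) T (nn_kernel \<phi>) \<le> (\<integral>\<^sup>+v\<in>{0<..<T}. ennreal (q ^ n) \<partial>lborel)"
    unfolding nn_iterated.simps by (intro nn_integral_mono mult_right_mono nn_iterated_kernel_le) simp
  also have "\<dots> = ennreal (T * q ^ n)"
    using T_pos q by (simp add: nn_integral_cmult_indicator ennreal_mult[symmetric] mult.commute)
  finally show ?thesis by (simp add: mult_left_mono)
qed

lemma decreasing_rate_mean_le: "decreasing_below T vs \<Longrightarrow> vs \<noteq> [] \<Longrightarrow> rate_mean vs \<le> rate_bound [] * (ennreal gb * ennreal hb)"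
  by (rule rate_mean_le) (use decreasing_below_last in blast)

text \<open>All quantities are finite, so in the reals the recursion reads
  \<open>\<mu> * rb n = ra n - ra (Suc n)\<close>. The sum telescopes, and the geometric bound sends
  \<open>ra\<close> to zero.\<close>

lemma expansion:
  assumes \<kappa>: "0 \<le> \<kappa>" and m: "m = ennreal \<mu>" "0 < \<mu>"
  shows "(\<lambda>n. enn2real (summand (Suc n))) sums (enn2real (remainder 1) / \<mu>)"
    and "remainder 1 < \<top>" and "summand (Suc n) < \<top>"
proof -
  let ?d = "rate_bound [] * (ennreal gb * ennreal hb)"
  have d: "?d < \<top>" using rate_bound_finite by (simp add: ennreal_mult_less_top)
  have A: "remainder (Suc n) \<le> ?d * ennreal (T * q ^ n)" for n
    unfolding remainder_def by (rule weighted_term_le[OF \<kappa> decreasing_rate_mean_le])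
  have finA: "remainder (Suc n) < \<top>" for n
    using A[of n] d by (auto simp: ennreal_mult_less_top intro: le_less_trans)
  then show "remainder 1 < \<top>" using finA[of 0] by simp
  have "summand (Suc n) \<le> (ennreal gb * ennreal hb) * ennreal (T * q ^ n)" for n
    unfolding summand_def by (rule weighted_term_le[OF \<kappa> shift_mean_le])
  moreover have "(ennreal gb * ennreal hb) * ennreal (T * q ^ n) < \<top>" for n by (simp add: ennreal_mult_less_top)
  ultimately have finB: "summand (Suc n) < \<top>" for n by (rule le_less_trans)
  then show "summand (Suc n) < \<top>" .
  define ra where "ra n = enn2real (remainder (Suc n))" for n
  define rb where "rb n = enn2real (summand (Suc n))" for n
  have rec: "\<mu> * rb n = ra n - ra (Suc n)" for n
  proof -
    have "remainder (Suc n) = m * summand (Suc n) + remainder (Suc (Suc n))" by (rule remainder_recursion) simp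
    then have "ra n = enn2real (m * summand (Suc n)) + ra (Suc n)"
      unfolding ra_def using finA[of "Suc n"] finB[of n] m by (simp add: enn2real_plus ennreal_mult_less_top)
    also have "enn2real (m * summand (Suc n)) = \<mu> * rb n" using m by (simp add: rb_def enn2real_mult)
    finally show ?thesis by simp
  qed
  have lim: "ra \<longlonglongrightarrow> 0"
  proof (rule tendsto_sandwich)
    have "ra n \<le> enn2real ?d * (T * q ^ n)" for n
    proof -
      have "ra n \<le> enn2real (?d * ennreal (T * q ^ n))"
        unfolding ra_def using A[of n] d by (intro enn2real_mono) (auto simp: ennreal_mult_less_top)
      then show ?thesis using T_pos q by (simp add: enn2real_mult)
    qed
    then show "\<forall>\<^sub>F n in sequentially. ra n \<le> enn2real ?d * (T * q ^ n)" by simp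
    show "\<forall>\<^sub>F n in sequentially. 0 \<le> ra n" by (simp add: ra_def)
    have "(\<lambda>n. q ^ n) \<longlonglongrightarrow> 0" using q by (intro LIMSEQ_power_zero) simp
    then have "(\<lambda>n. enn2real ?d * (T * q ^ n)) \<longlonglongrightarrow> enn2real ?d * (T * 0)"
      by (intro tendsto_mult tendsto_const)
    then show "(\<lambda>n. enn2real ?d * (T * q ^ n)) \<longlonglongrightarrow> 0" by simp
  qed simp
  have "(\<lambda>n. ra n - ra (Suc n)) sums (ra 0 - 0)" by (rule telescope_sums'[OF lim])
  then have "(\<lambda>n. \<mu> * rb n) sums ra 0" by (simp add: rec)
  then have "(\<lambda>n. \<mu> * rb n / \<mu>) sums (ra 0 / \<mu>)" by (rule sums_divide)
  then show "(\<lambda>n. enn2real (summand (Suc n))) sums (enn2real (remainder 1) / \<mu>)"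
    using m(2) by (simp add: ra_def rb_def)
qed

lemma expectation_claims_eq_remainder: "(\<integral>\<^sup>+\<omega>. (\<integral>\<^sup>+c. claims_K \<omega> c * h (loss [] \<omega> c) \<partial>C) \<partial>P) = remainder 1"
proof -
  have "(\<integral>\<^sup>+s\<in>{0..T}. ennreal (disc s) * rate_mean [s] \<partial>lborel) = (\<integral>\<^sup>+s\<in>{0<..<T}. ennreal (disc s) * rate_mean [s] \<partial>lborel)"
  proof (rule nn_integral_cong_AE)
    have "AE s in lborel. s \<noteq> (0 :: real)" "AE s in lborel. s \<noteq> T" by (rule AE_lborel_singleton)+
    then show "AE s in lborel. ennreal (disc s) * rate_mean [s] * indicator {0..T} s = ennreal (disc s) * rate_mean [s] * indicator {0<..<T} s"
      by eventually_elim (auto split: split_indicator)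
  qed
  then show ?thesis unfolding expectation_claims by (simp add: remainder_def weight_def)
qed

end

section \<open>Identification with the Hawkes loss processes\<close>

lemma bounded_nonneg_measurable_bound:
  assumes "bounded_nonneg_measurable A f" "x \<in> A"
  shows "0 \<le> f x" "f x \<le> Sup (f ` A)"
  using assms by (auto simp: bounded_nonneg_measurable_def intro!: cSup_upper bounded_imp_bdd_above)

lemma bounded_nonneg_measurable_extend:
  assumes f: "bounded_nonneg_measurable A f" and A: "A \<in> sets borel"
  shows "(\<lambda>x. if x \<in> A then f x else 0) \<in> borel_measurable borel"
proof -
  have "f \<in> borel_measurable (restrict_space borel A)" using f by (simp add: bounded_nonneg_measurable_def)
  then have "(\<lambda>x. indicator A x *\<^sub>R f x) \<in> borel_measurable borel"
    using A by (subst (asm) borel_measurable_restrict_space_iff) simp_all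
  also have "(\<lambda>x. indicator A x *\<^sub>R f x) = (\<lambda>x. if x \<in> A then f x else 0)" by (auto simp: fun_eq_iff)
  finally show ?thesis .
qed

lemma completion_measurable_AE:
  fixes F G :: "'a \<Rightarrow> real"
  assumes G: "G \<in> borel_measurable M" and AE: "AE x in M. F x = G x"
  shows "F \<in> borel_measurable (completion M)"
proof (rule measurableI)
  fix B :: "real set" assume B: "B \<in> sets borel"
  show "F -` B \<inter> space (completion M) \<in> sets (completion M)"
  proof (rule completion.in_sets_AE)
    show "G -` B \<inter> space M \<in> sets (completion M)" using measurable_sets[OF G B] by simp
    have "AE x in completion M. F x = G x" using AE by (rule AE_completion)
    then show "AE x in completion M. (x \<in> G -` B \<inter> space M) = (x \<in> F -` B \<inter> space (completion M))"
      by eventually_elim auto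
  qed simp
qed simp

text \<open>Integrands built from the given processes are known only almost everywhere, which the
  completion turns into measurability. The representative \<open>G\<close> lives in
  \<open>ennreal\<close>, and finiteness of its integral yields integrability.\<close>

lemma completion_integral_AE:
  fixes F :: "'a \<Rightarrow> real" and G :: "'a \<Rightarrow> ennreal"
  assumes G: "G \<in> borel_measurable M"
    and AE: "AE x in completion M. F x = enn2real (G x)" and fin: "(\<integral>\<^sup>+x. G x \<partial>M) < \<top>"
  shows "integrable (completion M) F" "(\<integral>x. F x \<partial>completion M) = enn2real (\<integral>\<^sup>+x. G x \<partial>M)"
proof -
  have F: "F \<in> borel_measurable (completion M)"
    using completion_measurable_AE[OF _ AE[unfolded AE_completion_iff]] G by simp
  have m: "(\<lambda>x. enn2real (G x)) \<in> borel_measurable M" using G by measurable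
  have "AE x in M. G x \<noteq> \<infinity>" using fin by (intro nn_integral_PInf_AE[OF G]) simp
  then have "AE x in M. ennreal (enn2real (G x)) = G x" by eventually_elim (simp add: less_top)
  then have nn: "(\<integral>\<^sup>+x. ennreal (enn2real (G x)) \<partial>M) = (\<integral>\<^sup>+x. G x \<partial>M)" by (rule nn_integral_cong_AE)
  have int: "integrable M (\<lambda>x. enn2real (G x))"
    using m nn fin by (intro integrableI_nonneg) auto
  have AEc: "AE x in completion M. enn2real (G x) = F x" using AE by eventually_elim simp
  have "integrable (completion M) (\<lambda>x. enn2real (G x))"
    using int by (simp add: integrable_completion[OF m])
  then show "integrable (completion M) F"
    by (rule integrable_cong_AE_imp) (use F AEc in auto)
  have "(\<integral>x. F x \<partial>completion M) = (\<integral>x. enn2real (G x) \<partial>completion M)"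
    by (rule integral_cong_AE[OF F measurable_completion[OF m] AE])
  also have "\<dots> = (\<integral>x. enn2real (G x) \<partial>M)" by (rule integral_completion[OF m])
  also have "\<dots> = enn2real (\<integral>\<^sup>+x. G x \<partial>M)"
    using m nn by (subst integral_eq_nn_integral) auto
  finally show "(\<integral>x. F x \<partial>completion M) = enn2real (\<integral>\<^sup>+x. G x \<partial>M)" .
qed

section \<open>The given processes and their canonical versions\<close>

locale loss_model =
  fixes T \<mu> \<kappa> :: real
    and \<Phi> f h :: "real \<Rightarrow> real"
    and g :: "real \<times> real \<Rightarrow> real"
    and PN :: "(real \<times> real) set measure"
    and PC :: "'c measure"
    and H :: "real \<Rightarrow> (real \<times> real) set \<Rightarrow> nat"
    and \<Lambda>H :: "real \<Rightarrow> (real \<times> real) set \<Rightarrow> real"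
    and Hs :: "real list \<Rightarrow> real \<Rightarrow> (real \<times> real) set \<Rightarrow> nat"
    and \<Lambda>s :: "real list \<Rightarrow> real \<Rightarrow> (real \<times> real) set \<Rightarrow> real"
    and \<eta> \<theta> \<eta>' \<theta>' :: "nat \<Rightarrow> 'c \<Rightarrow> real"
  assumes T: "T > 0" and \<mu>: "\<mu> > 0" and \<kappa>: "\<kappa> \<ge> 0"
    and \<Phi>: "bounded_nonneg_measurable {0..T} \<Phi>"
    and \<Phi>_norm: "(LBINT s=0..T. \<Phi> s) < 1"
    and PN: "canonical_poisson_space T PN"
    and hawkes: "hawkes_process T \<mu> \<Phi> PN H \<Lambda>H"
    and shifted: "\<And>vs. shift_times T vs \<Longrightarrow> shifted_hawkes_process T \<mu> \<Phi> PN H \<Lambda>H vs (Hs vs) (\<Lambda>s vs)"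
    and PC: "prob_space PC"
    and claims: "iid_claims PC \<eta> \<theta> \<eta>' \<theta>'"
    and f: "bounded_nonneg_measurable {0..} f"
    and g: "bounded_nonneg_measurable ({0..} \<times> {0..}) g"
    and h: "bounded_nonneg_measurable {0..} h"
begin

definition raw_claim :: "nat + nat \<Rightarrow> 'c \<Rightarrow> real \<times> real" where
  "raw_claim k c = (case k of Inl i \<Rightarrow> (\<eta> i c, \<theta> i c) | Inr i \<Rightarrow> (\<eta>' i c, \<theta>' i c))"

text \<open>\<open>iid_claims\<close> speaks of indices from one on. At index zero a constant is
  substituted, so that every \<open>claim k\<close> is measurable.\<close>

definition claim :: "nat + nat \<Rightarrow> 'c \<Rightarrow> real \<times> real" where
  "claim k = (if k \<in> claim_indices then raw_claim k else (\<lambda>_. (0, 0)))"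

text \<open>Here and in \<open>f0\<close>, \<open>g0\<close> and \<open>h0\<close> the data, given
  on \<open>{0..T}\<close>, the half-line or the quadrant, are extended by zero, which keeps
  measurability and bounds. The values that matter are unchanged, since gaps between times in
  \<open>{0..T}\<close> stay there and claims and losses are nonnegative.\<close>

definition \<phi> :: "real \<Rightarrow> ennreal" where "\<phi> t = ennreal (if t \<in> {0..T} then \<Phi> t else 0)"
definition f0 :: "real \<Rightarrow> real" where "f0 x = (if x \<in> {0..} then f x else 0)"
definition g0 :: "real \<times> real \<Rightarrow> ennreal" where "g0 p = ennreal (if p \<in> {0..} \<times> {0..} then g p else 0)"
definition h0 :: "real \<Rightarrow> ennreal" where "h0 x = ennreal (if x \<in> {0..} then h x else 0)"

abbreviation "\<Phi>b \<equiv> Sup (\<Phi> ` {0..T})"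
abbreviation "gb \<equiv> Sup (g ` ({0..} \<times> {0..}))"
abbreviation "hb \<equiv> Sup (h ` {0..})"

lemma \<Phi>_range: "s \<in> {0..T} \<Longrightarrow> 0 \<le> \<Phi> s \<and> \<Phi> s \<le> \<Phi>b"
  using bounded_nonneg_measurable_bound[OF \<Phi>] by simp

lemma \<Phi>b_nonneg: "0 \<le> \<Phi>b"
  using \<Phi>_range[of 0] T by auto

lemma iid: "prob_space.indep_vars PC (\<lambda>_. borel) raw_claim claim_indices"
  "\<And>k. k \<in> claim_indices \<Longrightarrow> distr PC borel (raw_claim k) = distr PC borel (raw_claim (Inl 1))"
  "\<And>k c. k \<in> claim_indices \<Longrightarrow> c \<in> space PC \<Longrightarrow> raw_claim k c \<in> {0..} \<times> {0..}"
proof -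
  have *: "raw_claim = (\<lambda>k c. case k of Inl i \<Rightarrow> (\<eta> i c, \<theta> i c) | Inr i \<Rightarrow> (\<eta>' i c, \<theta>' i c))"
    by (auto simp: fun_eq_iff raw_claim_def)
  show "prob_space.indep_vars PC (\<lambda>_. borel) raw_claim claim_indices"
    "\<And>k. k \<in> claim_indices \<Longrightarrow> distr PC borel (raw_claim k) = distr PC borel (raw_claim (Inl 1))"
    "\<And>k c. k \<in> claim_indices \<Longrightarrow> c \<in> space PC \<Longrightarrow> raw_claim k c \<in> {0..} \<times> {0..}"
    using claims unfolding iid_claims_def Let_def claim_indices_def * by blast+
qed

lemma \<phi>_measurable: "\<phi> \<in> borel_measurable borel"
  unfolding \<phi>_def using bounded_nonneg_measurable_extend[OF \<Phi>] by measurable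

text \<open>The interval integral is a Bochner integral over the open interval. It agrees with the
  integral in \<open>ennreal\<close> because \<open>\<Phi>\<close> is bounded on a bounded interval
  and the endpoints are null sets.\<close>

lemma \<phi>_norm: "(\<integral>\<^sup>+s. \<phi> s \<partial>lborel) = ennreal (LBINT s=0..T. \<Phi> s)" "0 \<le> (LBINT s=0..T. \<Phi> s)"
proof -
  have "AE s in lborel. s \<noteq> (0 :: real)" "AE s in lborel. s \<noteq> T" by (rule AE_lborel_singleton)+
  then have "AE s in lborel. \<phi> s = ennreal (indicator {0<..<T} s * \<Phi> s)"
    by eventually_elim (auto simp: \<phi>_def split: split_indicator)
  then have 1: "(\<integral>\<^sup>+s. \<phi> s \<partial>lborel) = (\<integral>\<^sup>+s. ennreal (indicator {0<..<T} s * \<Phi> s) \<partial>lborel)"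
    by (rule nn_integral_cong_AE)
  have [measurable]: "(\<lambda>s. if s \<in> {0..T} then \<Phi> s else 0) \<in> borel_measurable borel"
    by (rule bounded_nonneg_measurable_extend[OF \<Phi>]) simp
  have "(\<lambda>s. indicator {0<..<T} s * (if s \<in> {0..T} then \<Phi> s else 0)) \<in> borel_measurable lborel" by measurable
  also have "(\<lambda>s. indicator {0<..<T} s * (if s \<in> {0..T} then \<Phi> s else 0)) = (\<lambda>s. indicator {0<..<T} s * \<Phi> s)"
    by (auto simp: fun_eq_iff split: split_indicator)
  finally have m: "(\<lambda>s. indicator {0<..<T} s * \<Phi> s) \<in> borel_measurable lborel" .
  have nonneg: "0 \<le> indicator {0<..<T} s * \<Phi> s" for s
    using \<Phi>_range[of s] by (auto split: split_indicator)
  have int: "(LBINT s=0..T. \<Phi> s) = (\<integral>s. indicator {0<..<T} s * \<Phi> s \<partial>lborel)"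
    using T by (simp add: interval_integral_0)
  show "0 \<le> (LBINT s=0..T. \<Phi> s)" unfolding int by (rule Bochner_Integration.integral_nonneg) (rule nonneg)
  have "(\<integral>\<^sup>+s. ennreal (indicator {0<..<T} s * \<Phi> s) \<partial>lborel) \<le> (\<integral>\<^sup>+s\<in>{0<..<T}. ennreal \<Phi>b \<partial>lborel)"
    using \<Phi>_range by (intro nn_integral_mono) (auto intro!: ennreal_leI split: split_indicator)
  also have "\<dots> < \<top>" using T by (simp add: nn_integral_cmult_indicator ennreal_mult_less_top)
  finally have fin: "(\<integral>\<^sup>+s. ennreal (indicator {0<..<T} s * \<Phi> s) \<partial>lborel) < \<top>" .
  have "(\<integral>s. indicator {0<..<T} s * \<Phi> s \<partial>lborel) = enn2real (\<integral>\<^sup>+s. ennreal (indicator {0<..<T} s * \<Phi> s) \<partial>lborel)"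
    by (rule integral_eq_nn_integral[OF m]) (simp add: nonneg)
  then show "(\<integral>\<^sup>+s. \<phi> s \<partial>lborel) = ennreal (LBINT s=0..T. \<Phi> s)"
    unfolding 1 int using fin by simp
qed

sublocale CM: claims_model T PN \<phi> "ennreal \<mu>" "LBINT s=0..T. \<Phi> s" \<Phi>b PC claim "distr PC borel (raw_claim (Inl 1))"
  \<kappa> f0 g0 h0 gb hb
proof (unfold_locales)
  interpret C: prob_space PC by (rule PC)
  show "T > 0" "canonical_poisson_space T PN" by (rule T, rule PN)
  show "\<phi> \<in> borel_measurable borel" by (rule \<phi>_measurable)
  show "\<phi> t \<le> ennreal \<Phi>b" for t
    unfolding \<phi>_def using \<Phi>_range[of t] \<Phi>b_nonneg by (intro ennreal_leI) auto
  show "(\<integral>\<^sup>+s. \<phi> s \<partial>lborel) \<le> ennreal (LBINT s=0..T. \<Phi> s)" by (simp add: \<phi>_norm)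
  show "0 \<le> (LBINT s=0..T. \<Phi> s)" "(LBINT s=0..T. \<Phi> s) < 1" by (rule \<phi>_norm, rule \<Phi>_norm)
  show "ennreal \<mu> < \<top>" by simp
  show "\<exists>A. countable A \<and> A \<subseteq> sets PC \<and> \<Union> A = space PC \<and> (\<forall>a\<in>A. emeasure PC a \<noteq> \<infinity>)"
    by (rule C.sigma_finite_countable)
  show "emeasure PC (space PC) = 1" "emeasure PC (space PC) \<noteq> \<top>" by (simp_all add: C.emeasure_space_1)
  have "raw_claim k \<in> borel_measurable PC" if "k \<in> claim_indices" for k
    using iid(1) that by (simp add: C.indep_vars_def2)
  then show "claim k \<in> borel_measurable PC" for k by (simp add: claim_def)
  show "C.indep_vars (\<lambda>_. borel) claim claim_indices"
    using iid(1) by (subst C.indep_vars_cong[of claim_indices claim_indices claim raw_claim]) (simp_all add: claim_def)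
  show "distr PC borel (claim k) = distr PC borel (raw_claim (Inl 1))" if "k \<in> claim_indices" for k
    using iid(2)[OF that] that by (simp add: claim_def)
  show "f0 \<in> borel_measurable borel"
    unfolding f0_def by (rule bounded_nonneg_measurable_extend[OF f]) simp
  have "({0..} \<times> {0..} :: (real \<times> real) set) \<in> sets borel" by (intro borel_Times) auto
  from bounded_nonneg_measurable_extend[OF g this]
  show "g0 \<in> borel_measurable borel" unfolding g0_def by measurable
  show "h0 \<in> borel_measurable borel"
    unfolding h0_def using bounded_nonneg_measurable_extend[OF h] by measurable
  show "0 \<le> f0 x" for x using bounded_nonneg_measurable_bound(1)[OF f, of x] by (simp add: f0_def)
  show "g0 x \<le> ennreal gb" for x
    unfolding g0_def using bounded_nonneg_measurable_bound[OF g, of x] bounded_nonneg_measurable_bound[OF g, of "(0, 0)"]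
    by (intro ennreal_leI) auto
  show "h0 x \<le> ennreal hb" for x
    unfolding h0_def using bounded_nonneg_measurable_bound[OF h, of x] bounded_nonneg_measurable_bound[OF h, of 0]
    by (intro ennreal_leI) auto
qed

abbreviation "S \<equiv> accepted_points \<phi> (ennreal \<mu>)"

text \<open>The configurations on which the pathwise analysis works for one list. The exceptional
  null set depends on \<open>vs\<close>, and this suffices because under the iterated integrals each
  expectation concerns a single fixed list. The empty list stands for the unshifted process.\<close>

definition good :: "real list \<Rightarrow> (real \<times> real) set \<Rightarrow> bool" where
  "good vs \<omega> \<longleftrightarrow> \<omega> \<in> configurations T \<and> inj_on fst \<omega> \<and> 0 \<notin> fst ` \<omega> \<and> fst ` \<omega> \<inter> set vs = {} \<and>
     hawkes_equations T \<mu> \<Phi> \<omega> (\<lambda>t. H t \<omega>) (\<lambda>t. \<Lambda>H t \<omega>) \<and>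
     (vs \<noteq> [] \<longrightarrow> shifted_hawkes_equations T \<mu> \<Phi> vs \<omega> (\<lambda>t. H t \<omega>) (\<lambda>t. \<Lambda>H t \<omega>) (\<lambda>t. Hs vs t \<omega>) (\<lambda>t. \<Lambda>s vs t \<omega>))"

lemma AE_good:
  assumes "vs \<noteq> [] \<Longrightarrow> shift_times T vs"
  shows "AE \<omega> in PN. good vs \<omega>"
proof -
  have 1: "AE \<omega> in PN. \<omega> \<in> configurations T" using AE_space[of PN] by simp
  have 2: "AE \<omega> in PN. \<forall>v\<in>set vs. v \<notin> fst ` \<omega>"
    by (rule AE_finite_allI) (simp_all add: CM.AE_no_point_at)
  have 3: "AE \<omega> in PN. hawkes_equations T \<mu> \<Phi> \<omega> (\<lambda>t. H t \<omega>) (\<lambda>t. \<Lambda>H t \<omega>)"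
    using hawkes by (simp add: hawkes_process_def)
  have 4: "AE \<omega> in PN. vs \<noteq> [] \<longrightarrow> shifted_hawkes_equations T \<mu> \<Phi> vs \<omega> (\<lambda>t. H t \<omega>) (\<lambda>t. \<Lambda>H t \<omega>) (\<lambda>t. Hs vs t \<omega>) (\<lambda>t. \<Lambda>s vs t \<omega>)"
    using shifted[OF assms] by (cases "vs = []") (auto simp: shifted_hawkes_process_def)
  show ?thesis
    using 1 2 3 4 CM.AE_distinct_times CM.AE_no_point_at[of 0]
    by eventually_elim (unfold good_def, blast)
qed

lemma good_hawkes_path: "good vs \<omega> \<Longrightarrow> hawkes_path T \<mu> \<Phi>b \<Phi> \<omega> (\<lambda>t. H t \<omega>) (\<lambda>t. \<Lambda>H t \<omega>)"
  unfolding hawkes_path_def good_def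
  using T \<Phi>_range \<Phi> by (simp add: bounded_nonneg_measurable_def)

lemma good_shifted_path:
  "good vs \<omega> \<Longrightarrow> shift_times T vs \<Longrightarrow>
    shifted_path T \<mu> \<Phi>b \<Phi> \<omega> (\<lambda>t. H t \<omega>) (\<lambda>t. \<Lambda>H t \<omega>) vs (\<lambda>t. Hs vs t \<omega>) (\<lambda>t. \<Lambda>s vs t \<omega>)"
  unfolding shifted_path_def shifted_path_axioms_def
  using good_hawkes_path[of vs \<omega>] by (auto simp: good_def shift_times_def)

lemma \<phi>_eq: "0 \<le> s \<Longrightarrow> s \<le> T \<Longrightarrow> 0 \<le> \<Phi> s \<and> \<phi> s = ennreal (\<Phi> s)"
  using \<Phi>_range[of s] by (simp add: \<phi>_def)

text \<open>Pathwise uniqueness identifies the given solution with the canonical one, so the times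
  of the accepted points are its jump times.\<close>

lemma hawkes_jumps:
  assumes "good [] \<omega>"
  shows "finite (S [] \<omega>)" "counting_path T (fst ` S [] \<omega>) (\<lambda>t. H t \<omega>)"
proof -
  interpret hawkes_path T \<mu> \<Phi>b \<Phi> \<omega> "\<lambda>t. H t \<omega>" "\<lambda>t. \<Lambda>H t \<omega>" using assms by (rule good_hawkes_path)
  have "S [] \<omega> = accepted (\<lambda>t. \<Lambda>H t \<omega>)"
    by (rule accepted_points_unique[where T = T and l = "\<lambda>t. \<Lambda>H t \<omega>" and \<Phi> = \<Phi>])
       (use finite_accepted accepted_def point_range \<phi>_eq \<mu> intensity_eq in auto)
  then show "finite (S [] \<omega>)" "counting_path T (fst ` S [] \<omega>) (\<lambda>t. H t \<omega>)"
    using finite_accepted counting by simp_all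
qed

lemma shifted_jumps:
  assumes "good vs \<omega>" "shift_times T vs"
  shows "finite (S vs \<omega>)" "counting_path T (set vs \<union> fst ` S vs \<omega>) (\<lambda>t. Hs vs t \<omega>)" "distinct vs"
proof -
  interpret shifted_path T \<mu> \<Phi>b \<Phi> \<omega> "\<lambda>t. H t \<omega>" "\<lambda>t. \<Lambda>H t \<omega>" vs "\<lambda>t. Hs vs t \<omega>" "\<lambda>t. \<Lambda>s vs t \<omega>"
    using assms by (rule good_shifted_path)
  have "S vs \<omega> = accepted (\<lambda>t. \<Lambda>s vs t \<omega>)"
    by (rule accepted_points_unique[where T = T and l = "\<lambda>t. \<Lambda>s vs t \<omega>" and \<Phi> = \<Phi>])
       (use finite_accepted_m accepted_def point_range \<phi>_eq \<mu> intensity_shifted_eq shifts in \<open>auto simp: shift_times_def\<close>)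
  then show "finite (S vs \<omega>)" "counting_path T (set vs \<union> fst ` S vs \<omega>) (\<lambda>t. Hs vs t \<omega>)" "distinct vs"
    using finite_accepted_m counting_shifted distinct_vs by simp_all
qed

lemma good_regular:
  "good vs \<omega> \<Longrightarrow> finite (S vs \<omega>) \<Longrightarrow> inj_on fst (S vs \<omega>)"
  by (rule inj_on_subset[of fst \<omega>]) (simp_all add: good_def accepted_points_subset)

text \<open>Once the times in \<open>V\<close> are discarded, the jump times enumerate the points of
  \<open>R\<close> in increasing order, and there are \<open>y T - card V\<close> of them. With
  \<open>V\<close> empty this covers the unshifted process.\<close>

lemma sum_jump_times:
  fixes F :: "real \<Rightarrow> nat \<Rightarrow> real"
  assumes y: "counting_path T (V \<union> fst ` R) y" and V: "V \<inter> fst ` R = {}" "finite V" and R: "finite R" "inj_on fst R"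
  shows "(\<Sum>i=1..y T - card V. F (jump_time T y V i) i) = (\<Sum>z\<in>R. F (fst z) (card {x\<in>R. fst x \<le> fst z}))"
proof -
  have A: "finite (V \<union> fst ` R)" "V \<union> fst ` R \<subseteq> {0<..T}" using y by (auto simp: counting_path_def)
  have "y T = card {a\<in>V \<union> fst ` R. a \<le> T}" using y T by (simp add: counting_path_def)
  also have "{a\<in>V \<union> fst ` R. a \<le> T} = V \<union> fst ` R" using A(2) by auto
  also have "card (V \<union> fst ` R) = card V + card R"
    using V R by (simp add: card_Un_disjoint card_image)
  finally have yT: "y T - card V = card R" by simp
  have "jumps T y - V = fst ` R" unfolding jumps_counting[OF y] using V by auto
  then show ?thesis
    unfolding jump_time_def yT using sum_sorted_list_rank[OF R, of F] by simp
qed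

lemma raw_claim_nonneg:
  assumes "c \<in> space PC" "0 < i"
  shows "fst (claim (Inl i) c) = \<eta> i c" "fst (claim (Inr i) c) = \<eta>' i c" "0 \<le> \<eta> i c" "0 \<le> \<eta>' i c"
    "claim (Inl i) c = (\<eta> i c, \<theta> i c)" "claim (Inr i) c = (\<eta>' i c, \<theta>' i c)" "0 \<le> \<theta> i c" "0 \<le> \<theta>' i c"
  using iid(3)[OF _ assms(1), of "Inl i"] iid(3)[OF _ assms(1), of "Inr i"] assms(2)
  by (simp_all add: claim_def raw_claim_def)

lemma random_part_eq_jumps:
  assumes good: "good vs \<omega>" and fin: "finite (S vs \<omega>)" and y: "counting_path T (set vs \<union> fst ` S vs \<omega>) y"
    and d: "distinct vs" and c: "c \<in> space PC"
  shows "(\<Sum>i=1..y T - length vs. exp (- \<kappa> * (T - jump_time T y (set vs) i)) * f (\<eta> i c)) = CM.random_part vs \<omega> c"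
proof -
  have V: "set vs \<inter> fst ` S vs \<omega> = {}" using good accepted_points_subset[of \<phi> "ennreal \<mu>" vs \<omega>] by (auto simp: good_def)
  have "(\<Sum>i=1..y T - card (set vs). exp (- \<kappa> * (T - jump_time T y (set vs) i)) * f (\<eta> i c)) =
      (\<Sum>z\<in>S vs \<omega>. exp (- \<kappa> * (T - fst z)) * f (\<eta> (card {x\<in>S vs \<omega>. fst x \<le> fst z}) c))"
    by (rule sum_jump_times[OF y V _ fin good_regular[OF good fin]]) simp
  also have "\<dots> = CM.random_part vs \<omega> c"
    unfolding CM.random_part_eq[OF fin]
  proof (intro sum.cong refl)
    fix z assume z: "z \<in> S vs \<omega>"
    have "0 < CM.claim_rank vs \<omega> z" using CM.claim_rank_pos[OF fin z] by simp
    from raw_claim_nonneg[OF c this]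
    show "exp (- \<kappa> * (T - fst z)) * f (\<eta> (card {x\<in>S vs \<omega>. fst x \<le> fst z}) c) =
        CM.disc (fst z) * f0 (fst (claim (Inl (CM.claim_rank vs \<omega> z)) c))"
      unfolding CM.claim_rank_eq[OF fin, symmetric] by (simp add: CM.disc_def f0_def)
  qed
  finally show ?thesis by (simp add: distinct_card[OF d])
qed

lemma shifted_loss_eq:
  assumes good: "good vs \<omega>" and vs: "shift_times T vs" and c: "c \<in> space PC"
  shows "shifted_loss T \<kappa> f \<eta> \<eta>' vs (Hs vs) (\<omega>, c) = CM.loss vs \<omega> c"
proof -
  note j = shifted_jumps[OF good vs]
  have "(\<Sum>k=1..length vs. exp (- \<kappa> * (T - (T # vs) ! k)) * f (\<eta>' k c)) =
      (\<Sum>k<length vs. CM.disc (vs ! k) * f0 (fst (claim (Inr (Suc k)) c)))"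
  proof (rule sum.reindex_bij_witness[of _ Suc "\<lambda>k. k - 1"])
    fix k assume k: "k \<in> {1..length vs}"
    then have "0 < k" by auto
    from raw_claim_nonneg[OF c this] k
    show "CM.disc (vs ! (k - 1)) * f0 (fst (claim (Inr (Suc (k - 1))) c)) = exp (- \<kappa> * (T - (T # vs) ! k)) * f (\<eta>' k c)"
      by (cases k) (simp_all add: CM.disc_def f0_def)
  qed auto
  then show ?thesis
    unfolding shifted_loss_def CM.loss_def prod.case random_part_eq_jumps[OF good j(1,2,3) c] by simp
qed

lemma h0_eq: "0 \<le> x \<Longrightarrow> h0 x = ennreal (h x) \<and> 0 \<le> h x"
  using bounded_nonneg_measurable_bound(1)[OF h, of x] by (simp add: h0_def)

lemma loss_L_eq:
  assumes good: "good [] \<omega>" and c: "c \<in> space PC"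
  shows "loss_L T \<kappa> f H \<eta> T (\<omega>, c) = CM.loss [] \<omega> c"
  using random_part_eq_jumps[OF good hawkes_jumps(1)[OF good] _ _ c, of "\<lambda>t. H t \<omega>"] hawkes_jumps(2)[OF good]
  by (simp add: loss_L_def CM.loss_def)

lemma loss_K_eq:
  assumes good: "good [] \<omega>" and c: "c \<in> space PC"
  shows "0 \<le> loss_K T \<kappa> g H \<eta> \<theta> T (\<omega>, c)" "ennreal (loss_K T \<kappa> g H \<eta> \<theta> T (\<omega>, c)) = CM.claims_K \<omega> c"
proof -
  note j = hawkes_jumps[OF good]
  let ?R = "S [] \<omega>"
  have y: "counting_path T ({} \<union> fst ` ?R) (\<lambda>t. H t \<omega>)" using j(2) by simp
  have claim_rank: "0 < CM.claim_rank [] \<omega> z" if "z \<in> ?R" for z using CM.claim_rank_pos[OF j(1) that] by simp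
  have K: "loss_K T \<kappa> g H \<eta> \<theta> T (\<omega>, c) = (\<Sum>z\<in>?R. CM.disc (fst z) * g (claim (Inl (CM.claim_rank [] \<omega> z)) c))"
  proof -
    have "loss_K T \<kappa> g H \<eta> \<theta> T (\<omega>, c) =
        (\<Sum>z\<in>?R. exp (- \<kappa> * (T - fst z)) * g (\<eta> (card {x\<in>?R. fst x \<le> fst z}) c, \<theta> (card {x\<in>?R. fst x \<le> fst z}) c))"
      using sum_jump_times[OF y _ _ j(1) good_regular[OF good j(1)],
          of "\<lambda>t i. exp (- \<kappa> * (T - t)) * g (\<eta> i c, \<theta> i c)"]
      by (simp add: loss_K_def)
    also have "\<dots> = (\<Sum>z\<in>?R. CM.disc (fst z) * g (claim (Inl (CM.claim_rank [] \<omega> z)) c))"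
      by (intro sum.cong refl) (simp add: CM.claim_rank_eq[OF j(1), symmetric] CM.disc_def raw_claim_nonneg[OF c claim_rank])
    finally show ?thesis .
  qed
  have pos: "claim (Inl (CM.claim_rank [] \<omega> z)) c \<in> {0..} \<times> {0..}" if "z \<in> ?R" for z
    using raw_claim_nonneg[OF c claim_rank[OF that]] by simp
  have nn: "0 \<le> CM.disc (fst z) * g (claim (Inl (CM.claim_rank [] \<omega> z)) c)" if "z \<in> ?R" for z
    using bounded_nonneg_measurable_bound(1)[OF g pos[OF that]] CM.disc_pos[of "fst z"] by simp
  show "0 \<le> loss_K T \<kappa> g H \<eta> \<theta> T (\<omega>, c)" unfolding K by (rule sum_nonneg) (rule nn)
  have "ennreal (loss_K T \<kappa> g H \<eta> \<theta> T (\<omega>, c)) = (\<Sum>z\<in>?R. ennreal (CM.disc (fst z) * g (claim (Inl (CM.claim_rank [] \<omega> z)) c)))"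
    unfolding K by (rule sum_ennreal[symmetric]) (rule nn)
  also have "\<dots> = (\<Sum>z\<in>?R. ennreal (CM.disc (fst z)) * g0 (claim (Inl (CM.claim_rank [] \<omega> z)) c))"
    using pos by (intro sum.cong refl) (simp add: g0_def ennreal_mult' less_imp_le[OF CM.disc_pos] ennreal_mult'')
  also have "\<dots> = CM.claims_K \<omega> c"
    unfolding CM.claims_K_def CM.nn_integral_accepted_points[OF j(1)] ..
  finally show "ennreal (loss_K T \<kappa> g H \<eta> \<theta> T (\<omega>, c)) = CM.claims_K \<omega> c" .
qed

abbreviation "M0 \<equiv> PN \<Otimes>\<^sub>M PC"
abbreviation "M \<equiv> joint_space PN PC"

lemma AE_pair:
  assumes "AE \<omega> in PN. Q \<omega>"
  shows "AE z in M. Q (fst z) \<and> snd z \<in> space PC"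
proof -
  interpret C: prob_space PC by (rule PC)
  obtain N where N: "{\<omega>\<in>space PN. \<not> Q \<omega>} \<subseteq> N" "emeasure PN N = 0" "N \<in> sets PN" using assms by (rule AE_E)
  have "AE z in M0. Q (fst z) \<and> snd z \<in> space PC"
  proof (rule AE_I)
    show "{z\<in>space M0. \<not> (Q (fst z) \<and> snd z \<in> space PC)} \<subseteq> N \<times> space PC"
      using N(1) by (auto simp: space_pair_measure simp del: CM.space_P)
    show "emeasure M0 (N \<times> space PC) = 0" using N by (simp add: C.emeasure_pair_measure_Times)
    show "N \<times> space PC \<in> sets M0" using N(3) by simp
  qed
  then show ?thesis unfolding joint_space_def by (rule AE_completion)
qed

lemma measurable_claims_K: "(\<lambda>w. CM.claims_K (fst w) (snd w)) \<in> borel_measurable M0"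
  unfolding CM.claims_K_def
proof (rule CM.measurable_campbell)
  let ?W = "M0 \<Otimes>\<^sub>M intensity T"
  note m = measurable_compose[OF measurable_fst measurable_fst] measurable_compose[OF measurable_fst measurable_snd]
      measurable_compose[OF measurable_snd measurable_id_intensity]
  have "Measurable.pred ?W (\<lambda>u. snd u \<in> S (map (\<lambda>i. (0::real)) [0..<0]) (fst (fst u)))"
    by (rule CM.measurable_accepted_points) (use m in auto)
  then have [measurable]: "Measurable.pred ?W (\<lambda>u. snd u \<in> S [] (fst (fst u)))" by simp
  have "(\<lambda>u. CM.claim_rank (map (\<lambda>i. (0::real)) [0..<0]) (fst (fst u)) (snd u)) \<in> ?W \<rightarrow>\<^sub>M count_space UNIV"
    by (rule CM.measurable_claim_rank) (use m in auto)
  from CM.measurable_claim_label[OF this m(2)]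
  have [measurable]: "(\<lambda>u. claim (Inl (CM.claim_rank [] (fst (fst u)) (snd u))) (snd (fst u))) \<in> borel_measurable ?W" by simp
  have "(\<lambda>u. if snd u \<in> S [] (fst (fst u)) then ennreal (CM.disc (fst (snd u))) * g0 (claim (Inl (CM.claim_rank [] (fst (fst u)) (snd u))) (snd (fst u))) else 0) \<in> borel_measurable ?W"
    by measurable
  then show "(\<lambda>(w, z). if z \<in> S [] (fst w) then ennreal (CM.disc (fst z)) * g0 (claim (Inl (CM.claim_rank [] (fst w) z)) (snd w)) else 0) \<in> borel_measurable ?W"
    by (simp add: split_beta')
qed simp

lemma measurable_loss_pair: "(\<lambda>w. CM.loss vs (fst w) (snd w)) \<in> borel_measurable M0"
proof -
  have "(\<lambda>w. CM.loss (map (\<lambda>i. vs ! i) [0..<length vs]) (fst w) (snd w)) \<in> borel_measurable M0"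
    by (rule CM.measurable_loss) auto
  then show ?thesis by (simp only: map_nth)
qed

lemma nn_integral_M0:
  assumes "(\<lambda>w. F (fst w) (snd w)) \<in> borel_measurable M0"
  shows "(\<integral>\<^sup>+w. F (fst w) (snd w) \<partial>M0) = (\<integral>\<^sup>+\<omega>. (\<integral>\<^sup>+c. F \<omega> c \<partial>PC) \<partial>PN)"
proof -
  interpret C: prob_space PC by (rule PC)
  show ?thesis using C.nn_integral_fst[OF assms] by simp
qed

lemma claim_measurable [measurable]: "claim k \<in> borel_measurable PC"
  by (rule CM.X_measurable)

lemma h0_measurable [measurable]: "h0 \<in> borel_measurable borel" by (rule CM.h_measurable)
lemma g0_measurable [measurable]: "g0 \<in> borel_measurable borel" by (rule CM.g_measurable)

text \<open>Almost everywhere the integrand is the functional of the canonical version, whose mean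
  is the remainder before any expansion; finiteness of that remainder gives integrability.\<close>

lemma expectation_loss:
  "integrable M (\<lambda>z. loss_K T \<kappa> g H \<eta> \<theta> T z * h (loss_L T \<kappa> f H \<eta> T z))"
  "(\<integral>z. loss_K T \<kappa> g H \<eta> \<theta> T z * h (loss_L T \<kappa> f H \<eta> T z) \<partial>M) = enn2real (CM.remainder 1)"
proof -
  let ?G = "\<lambda>w. CM.claims_K (fst w) (snd w) * h0 (CM.loss [] (fst w) (snd w))"
  note measurable_claims_K[measurable] measurable_loss_pair[measurable]
  have G: "?G \<in> borel_measurable M0" by measurable
  have nn: "(\<integral>\<^sup>+w. ?G w \<partial>M0) = CM.remainder 1"
    using nn_integral_M0[of "\<lambda>\<omega> c. CM.claims_K \<omega> c * h0 (CM.loss [] \<omega> c)"] G CM.expectation_claims_eq_remainder by simp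
  have fin: "(\<integral>\<^sup>+w. ?G w \<partial>M0) < \<top>" unfolding nn using CM.expansion(2)[OF \<kappa> refl \<mu>] .
  have AE: "AE z in completion M0. loss_K T \<kappa> g H \<eta> \<theta> T z * h (loss_L T \<kappa> f H \<eta> T z) = enn2real (?G z)"
    using AE_pair[OF AE_good[of "[]", simplified]] unfolding joint_space_def
  proof eventually_elim
    case (elim z)
    obtain \<omega> c where z: "z = (\<omega>, c)" by (cases z)
    have good: "good [] \<omega>" and c: "c \<in> space PC" using elim by (auto simp: z)
    have "enn2real (?G z) = enn2real (CM.claims_K \<omega> c) * enn2real (h0 (CM.loss [] \<omega> c))"
      by (simp add: z enn2real_mult)
    also have "enn2real (h0 (CM.loss [] \<omega> c)) = h (CM.loss [] \<omega> c)"
      using h0_eq[OF CM.loss_nonneg, of "[]" \<omega> c] by simp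
    also have "enn2real (CM.claims_K \<omega> c) = loss_K T \<kappa> g H \<eta> \<theta> T (\<omega>, c)"
      using loss_K_eq[OF good c] by (metis enn2real_ennreal)
    finally show ?case by (simp add: z loss_L_eq[OF good c])
  qed
  show "integrable M (\<lambda>z. loss_K T \<kappa> g H \<eta> \<theta> T z * h (loss_L T \<kappa> f H \<eta> T z))"
    "(\<integral>z. loss_K T \<kappa> g H \<eta> \<theta> T z * h (loss_L T \<kappa> f H \<eta> T z) \<partial>M) = enn2real (CM.remainder 1)"
    using completion_integral_AE[OF G AE fin] unfolding nn joint_space_def by simp_all
qed

section \<open>The conditional expectation in the series\<close>

definition cond_expectation :: "real list \<Rightarrow> real" where
  "cond_expectation vs = (\<integral>z. g (\<eta>' 1 (snd z), \<theta>' 1 (snd z)) *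
     real_cond_exp M (vimage_algebra (space M) (\<lambda>(\<omega>, c). \<eta>' 1 c) borel)
       (\<lambda>z. h (shifted_loss T \<kappa> f \<eta> \<eta>' vs (Hs vs) z)) z \<partial>M)"

text \<open>The candidate \<open>?D\<close> is \<open>cond_loss\<close> at the first barred \<eta>.
  The identity \<open>cond\<close> serves twice: with an indicator as \<open>k\<close> it verifies
  the characterising property of the conditional expectation, and with \<open>g0\<close> as
  \<open>k\<close> it puts the loss back in place of its conditional mean. The second use goes
  beyond that property, because \<open>g0\<close> also depends on the second component of the
  claim.\<close>

lemma cond_expectation_eq:
  assumes vs: "shift_times T vs"
  shows "cond_expectation vs = enn2real (CM.shift_mean vs)"
proof -
  interpret C: prob_space PC by (rule PC)
  interpret pair: pair_prob_space PN PC ..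
  interpret M: prob_space M unfolding joint_space_def by (rule pair.prob_space_completion)
  have ne: "vs \<noteq> []" using vs by (simp add: shift_times_def)
  let ?u = "\<lambda>(\<omega> :: (real \<times> real) set, c). \<eta>' 1 c"
  let ?G = "vimage_algebra (space M) ?u borel"
  let ?hs = "\<lambda>z. h (shifted_loss T \<kappa> f \<eta> \<eta>' vs (Hs vs) z)"
  let ?D = "\<lambda>z. enn2real (CM.cond_loss vs (?u z))"
  have claim1: "claim (Inr 1) c = (\<eta>' 1 c, \<theta>' 1 c)" for c
    by (simp add: claim_def raw_claim_def)
  have eta [measurable]: "\<eta>' 1 \<in> borel_measurable PC"
  proof -
    have "claim (Inr 1) \<in> PC \<rightarrow>\<^sub>M borel \<Otimes>\<^sub>M borel" using claim_measurable by (simp add: borel_prod)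
    from measurable_compose[OF this measurable_fst] show ?thesis by (simp only: claim1 fst_conv)
  qed
  have u0: "?u \<in> borel_measurable M0" by measurable
  have u: "?u \<in> borel_measurable M" unfolding joint_space_def by (rule measurable_completion[OF u0])
  have sub: "subalgebra M ?G"
    unfolding subalgebra_def using sets_image_in_sets[OF refl u] by simp
  interpret sub: finite_measure_subalgebra M ?G
    by (unfold_locales) (rule sub)
  have uG: "?u \<in> borel_measurable ?G" by (rule measurable_vimage_algebra1) simp
  have DG: "?D \<in> borel_measurable ?G"
    using measurable_compose[OF uG CM.measurable_cond_loss[of vs]] by measurable
  note measurable_loss_pair[of vs, measurable]
  have good: "AE z in M. good vs (fst z) \<and> snd z \<in> space PC"
    by (rule AE_pair) (rule AE_good[OF vs])
  have hs: "AE z in M. ?hs z = enn2real (h0 (CM.loss vs (fst z) (snd z)))"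
    using good
  proof eventually_elim
    case (elim z)
    then have "shifted_loss T \<kappa> f \<eta> \<eta>' vs (Hs vs) z = CM.loss vs (fst z) (snd z)"
      using shifted_loss_eq[OF _ vs, of "fst z" "snd z"] by simp
    then show ?case using h0_eq[OF CM.loss_nonneg, of vs "fst z" "snd z"] by simp
  qed
  have cond: "(\<integral>\<^sup>+w. k (claim (Inr 1) (snd w)) * h0 (CM.loss vs (fst w) (snd w)) \<partial>M0) =
      (\<integral>\<^sup>+w. k (claim (Inr 1) (snd w)) * CM.cond_loss vs (\<eta>' 1 (snd w)) \<partial>M0)"
    if [measurable]: "k \<in> borel_measurable borel" for k
  proof -
    have "(\<integral>\<^sup>+w. k (claim (Inr 1) (snd w)) * h0 (CM.loss vs (fst w) (snd w)) \<partial>M0) =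
        (\<integral>\<^sup>+\<omega>. (\<integral>\<^sup>+c. k (claim (Inr 1) c) * h0 (CM.loss vs \<omega> c) \<partial>PC) \<partial>PN)"
      by (rule nn_integral_M0) measurable
    also have "\<dots> = (\<integral>\<^sup>+c. k (claim (Inr 1) c) * CM.cond_loss vs (fst (claim (Inr 1) c)) \<partial>PC)"
      by (rule CM.expectation_cond_loss[OF ne that])
    also have "\<dots> = (\<integral>\<^sup>+\<omega>. (\<integral>\<^sup>+c. k (claim (Inr 1) c) * CM.cond_loss vs (\<eta>' 1 c) \<partial>PC) \<partial>PN)"
      using CM.emeasure_space_1 by (simp only: claim1 fst_conv nn_integral_const mult_1_right)
    also have "\<dots> = (\<integral>\<^sup>+w. k (claim (Inr 1) (snd w)) * CM.cond_loss vs (\<eta>' 1 (snd w)) \<partial>M0)"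
      by (rule nn_integral_M0[symmetric]) measurable
    finally show ?thesis .
  qed
  have fin: "(\<integral>\<^sup>+w. k (claim (Inr 1) (snd w)) * CM.cond_loss vs (\<eta>' 1 (snd w)) \<partial>M0) < \<top>"
    if "\<And>p. k p \<le> ennreal K" for k K
  proof -
    have "(\<integral>\<^sup>+w. k (claim (Inr 1) (snd w)) * CM.cond_loss vs (\<eta>' 1 (snd w)) \<partial>M0) \<le> (\<integral>\<^sup>+w. ennreal K * ennreal hb \<partial>M0)"
      by (intro nn_integral_mono mult_mono that CM.cond_loss_le) simp_all
    also have "\<dots> < \<top>" using pair.emeasure_space_1 by (simp add: ennreal_mult_less_top)
    finally show ?thesis .
  qed
  have "AE z in M. real_cond_exp M ?G ?hs z = ?D z"
  proof (rule sub.real_cond_exp_charact)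
    have int_hs: "(\<integral>z. indicator B (?u z) * ?hs z \<partial>M) = enn2real (\<integral>\<^sup>+w. indicator B (fst (claim (Inr 1) (snd w))) * CM.cond_loss vs (\<eta>' 1 (snd w)) \<partial>M0)"
      "integrable M (\<lambda>z. indicator B (?u z) * ?hs z)"
      "(\<integral>z. indicator B (?u z) * ?D z \<partial>M) = enn2real (\<integral>\<^sup>+w. indicator B (fst (claim (Inr 1) (snd w))) * CM.cond_loss vs (\<eta>' 1 (snd w)) \<partial>M0)"
      "integrable M (\<lambda>z. indicator B (?u z) * ?D z)"
      if B[measurable]: "B \<in> sets borel" for B :: "real set"
    proof -
      have "fst \<in> borel_measurable (borel :: (real \<times> real) measure)"
        using measurable_fst[of "borel :: real measure" "borel :: real measure"] by (simp add: borel_prod)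
      then have k: "(\<lambda>p. indicator B (fst p) :: ennreal) \<in> borel_measurable (borel :: (real \<times> real) measure)" by measurable
      have kle: "indicator B (fst p) \<le> ennreal 1" for p :: "real \<times> real" by (simp split: split_indicator)
      note c = cond[OF k] and fn = fin[of "\<lambda>p. indicator B (fst p)" 1, OF kle]
      have G1: "(\<lambda>w. indicator B (fst (claim (Inr 1) (snd w))) * h0 (CM.loss vs (fst w) (snd w))) \<in> borel_measurable M0"
        unfolding claim1 fst_conv by measurable
      have G2: "(\<lambda>w. indicator B (fst (claim (Inr 1) (snd w))) * CM.cond_loss vs (\<eta>' 1 (snd w))) \<in> borel_measurable M0"
        unfolding claim1 fst_conv by measurable
      have A1: "AE z in completion M0. indicator B (?u z) * ?hs z = enn2real (indicator B (fst (claim (Inr 1) (snd z))) * h0 (CM.loss vs (fst z) (snd z)))"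
        using hs unfolding joint_space_def by eventually_elim (auto simp: claim1[unfolded One_nat_def] enn2real_mult split: split_indicator)
      have A2: "AE z in completion M0. indicator B (?u z) * ?D z = enn2real (indicator B (fst (claim (Inr 1) (snd z))) * CM.cond_loss vs (\<eta>' 1 (snd z)))"
        by (intro AE_I2) (auto simp: claim1[unfolded One_nat_def] enn2real_mult split: split_indicator)
      from completion_integral_AE[OF G1 A1] completion_integral_AE[OF G2 A2]
      show "(\<integral>z. indicator B (?u z) * ?hs z \<partial>M) = enn2real (\<integral>\<^sup>+w. indicator B (fst (claim (Inr 1) (snd w))) * CM.cond_loss vs (\<eta>' 1 (snd w)) \<partial>M0)"
        "integrable M (\<lambda>z. indicator B (?u z) * ?hs z)"
        "(\<integral>z. indicator B (?u z) * ?D z \<partial>M) = enn2real (\<integral>\<^sup>+w. indicator B (fst (claim (Inr 1) (snd w))) * CM.cond_loss vs (\<eta>' 1 (snd w)) \<partial>M0)"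
        "integrable M (\<lambda>z. indicator B (?u z) * ?D z)"
        unfolding c joint_space_def using fn by simp_all
    qed
    show "integrable M ?hs" "integrable M ?D" using int_hs(2,4)[of UNIV] by simp_all
    show "?D \<in> borel_measurable ?G" by (rule DG)
    \<comment> \<open>The sub-algebra is generated by the first barred \<eta>, so its sets are
      preimages of Borel sets, and the integrals over them are those with the indicator of
      \<open>B\<close>.\<close>
    fix A assume "A \<in> sets ?G"
    then obtain B where B: "B \<in> sets borel" and A: "A = ?u -` B \<inter> space M"
      by (subst (asm) sets_vimage_algebra2) auto
    have "(LINT z:A|M. F z) = (\<integral>z. indicator B (?u z) * F z \<partial>M)" for F :: "_ \<Rightarrow> real"
      unfolding set_lebesgue_integral_def
      by (intro Bochner_Integration.integral_cong refl) (auto simp: A split: split_indicator)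
    then show "(LINT z:A|M. ?hs z) = (LINT z:A|M. ?D z)" by (simp only: int_hs[OF B])
  qed
  then have AE: "AE z in completion M0. g (\<eta>' 1 (snd z), \<theta>' 1 (snd z)) * real_cond_exp M ?G ?hs z =
      enn2real (g0 (claim (Inr 1) (snd z)) * CM.cond_loss vs (\<eta>' 1 (snd z)))"
    using good unfolding joint_space_def
  proof eventually_elim
    case (elim z)
    have c: "snd z \<in> space PC" using elim by simp
    have p: "(\<eta>' 1 (snd z), \<theta>' 1 (snd z)) \<in> {0..} \<times> {0..}" using raw_claim_nonneg[OF c, of 1] by simp
    have "enn2real (g0 (claim (Inr 1) (snd z))) = g (\<eta>' 1 (snd z), \<theta>' 1 (snd z))"
      using p bounded_nonneg_measurable_bound(1)[OF g p] by (simp add: g0_def claim1[unfolded One_nat_def])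
    then show ?case using elim(1) by (simp add: enn2real_mult split_beta')
  qed
  have G: "(\<lambda>w. g0 (claim (Inr 1) (snd w)) * CM.cond_loss vs (\<eta>' 1 (snd w))) \<in> borel_measurable M0" by measurable
  have "cond_expectation vs = enn2real (\<integral>\<^sup>+w. g0 (claim (Inr 1) (snd w)) * CM.cond_loss vs (\<eta>' 1 (snd w)) \<partial>M0)"
    unfolding cond_expectation_def
    using completion_integral_AE(2)[OF G AE fin[of g0 gb, OF CM.g_le]] unfolding joint_space_def .
  also have "(\<integral>\<^sup>+w. g0 (claim (Inr 1) (snd w)) * CM.cond_loss vs (\<eta>' 1 (snd w)) \<partial>M0) =
      (\<integral>\<^sup>+w. g0 (claim (Inr 1) (snd w)) * h0 (CM.loss vs (fst w) (snd w)) \<partial>M0)"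
    by (rule cond[symmetric]) measurable
  also have "\<dots> = CM.shift_mean vs"
    unfolding CM.shift_mean_def CM.loss_mean_def by (rule nn_integral_M0) measurable
  finally show ?thesis .
qed

section \<open>The terms of the series\<close>

definition series_term :: "nat \<Rightarrow> real" where
  "series_term n = iterated_integral n T (\<lambda>vs. exp (- \<kappa> * (T - vs ! 0)) * kernel_product \<Phi> vs * cond_expectation vs)"

text \<open>The values \<open>cond_expectation vs\<close> come from separately given processes
  \<open>Hs vs\<close>, with no relation between different lists. On lists of shift times they equal
  \<open>shift_mean\<close>, which is measurable in the list, and this allows the iterated real
  integral to be evaluated in \<open>ennreal\<close>.\<close>

lemma series_term_eq: "series_term (Suc n) = enn2real (CM.summand (Suc n))"
  unfolding series_term_def CM.summand_def
proof (rule iterated_integral_eq_nn_iterated[OF _ CM.list_measurable_weight_shift_mean])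
  show "0 \<le> T" using T by simp
  fix vs :: "real list" assume len: "length vs = Suc n" and dec: "decreasing_below T vs"
  have "sorted_wrt (>) vs" "set vs \<subseteq> {0<..<T}" "vs \<noteq> []"
    using dec len by (auto simp: decreasing_below_def)
  then have shift: "shift_times T vs" by (simp add: shift_times_def)
  obtain v us where vs: "vs = v # us" using len by (cases vs) auto
  have v: "v \<le> T" using dec by (simp add: vs)
  have disc: "CM.disc v \<le> 1" unfolding CM.disc_def using \<kappa> v by (simp add: mult_nonneg_nonneg)
  have ker: "0 \<le> kernel_product \<Phi> vs" "nn_kernel \<phi> vs = ennreal (kernel_product \<Phi> vs)" "kernel_product \<Phi> vs \<le> (max 1 \<Phi>b) ^ Suc n"
    using kernel_product_eq[of T \<Phi> \<Phi>b \<phi> vs, OF _ dec \<Phi>b_nonneg] \<Phi>_range \<phi>_eq len by auto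
  have shift_mean: "ennreal (cond_expectation vs) = CM.shift_mean vs" "0 \<le> cond_expectation vs"
    unfolding cond_expectation_eq[OF shift] using CM.shift_mean_le[of vs]
    by (auto simp: ennreal_mult_less_top le_less_trans[of _ "ennreal gb * ennreal hb" "\<top>"])
  have "ennreal (cond_expectation vs) \<le> ennreal \<bar>gb * hb\<bar>"
  proof -
    have "ennreal gb * ennreal hb \<le> ennreal \<bar>gb\<bar> * ennreal \<bar>hb\<bar>" by (intro mult_mono ennreal_leI) auto
    then show ?thesis using CM.shift_mean_le[of vs] shift_mean by (simp add: abs_mult ennreal_mult)
  qed
  then have "cond_expectation vs \<le> \<bar>gb * hb\<bar>" by (simp add: ennreal_le_iff)
  then have le: "exp (- \<kappa> * (T - vs ! 0)) * kernel_product \<Phi> vs * cond_expectation vs \<le> 1 * (max 1 \<Phi>b) ^ Suc n * \<bar>gb * hb\<bar>"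
    using disc ker shift_mean(2) by (intro mult_mono) (auto simp: vs CM.disc_def)
  have eq: "CM.weight vs * CM.shift_mean vs = ennreal (exp (- \<kappa> * (T - vs ! 0)) * kernel_product \<Phi> vs * cond_expectation vs)"
    unfolding CM.weight_def ker(2) shift_mean(1)[symmetric] using ker(1) shift_mean(2) by (simp add: vs CM.disc_def ennreal_mult)
  show "0 \<le> exp (- \<kappa> * (T - vs ! 0)) * kernel_product \<Phi> vs * cond_expectation vs \<and>
      CM.weight vs * CM.shift_mean vs = ennreal (exp (- \<kappa> * (T - vs ! 0)) * kernel_product \<Phi> vs * cond_expectation vs) \<and>
      exp (- \<kappa> * (T - vs ! 0)) * kernel_product \<Phi> vs * cond_expectation vs \<le> 1 * (max 1 \<Phi>b) ^ Suc n * \<bar>gb * hb\<bar>"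
    using ker(1) shift_mean(2) by (intro conjI eq le mult_nonneg_nonneg) auto
qed

lemma loss_expansion:
  "summable (\<lambda>n. series_term (n + 2))"
  "(\<integral>z. loss_K T \<kappa> g H \<eta> \<theta> T z * h (loss_L T \<kappa> f H \<eta> T z) \<partial>M) =
    \<mu> * (LBINT v=0..T. exp (- \<kappa> * (T - v)) * cond_expectation [v]) + \<mu> * (\<Sum>n. series_term (n + 2))"
proof -
  let ?E = "enn2real (CM.remainder 1)"
  have sums: "(\<lambda>n. series_term (Suc n)) sums (?E / \<mu>)"
    unfolding series_term_eq by (rule CM.expansion(1)[OF \<kappa> refl \<mu>])
  then have "summable (\<lambda>n. series_term (Suc n))" by (rule sums_summable)
  then have summ: "summable (\<lambda>n. series_term (Suc (Suc n)))" by (subst (asm) summable_Suc_iff[symmetric])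
  then show "summable (\<lambda>n. series_term (n + 2))" by (simp add: numeral_2_eq_2)
  \<comment> \<open>The expansion starts with one shift and the series in the theorem with two, so
    the first term is split off.\<close>
  have "(\<lambda>n. series_term (Suc n)) sums ((\<Sum>n. series_term (Suc (Suc n))) + series_term (Suc 0))"
    using summable_sums[OF summ] by (rule sums_Suc)
  with sums have "?E / \<mu> = (\<Sum>n. series_term (Suc (Suc n))) + series_term (Suc 0)" by (rule sums_unique2)
  then have "?E = \<mu> * series_term (Suc 0) + \<mu> * (\<Sum>n. series_term (Suc (Suc n)))"
    using \<mu> by (simp add: field_simps)
  moreover have "series_term (Suc 0) = (LBINT v=0..T. exp (- \<kappa> * (T - v)) * cond_expectation [v])"
    by (simp add: series_term_def kernel_product_def)
  ultimately show "(\<integral>z. loss_K T \<kappa> g H \<eta> \<theta> T z * h (loss_L T \<kappa> f H \<eta> T z) \<partial>M) =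
    \<mu> * (LBINT v=0..T. exp (- \<kappa> * (T - v)) * cond_expectation [v]) + \<mu> * (\<Sum>n. series_term (n + 2))"
    unfolding expectation_loss(2) by (simp add: numeral_2_eq_2)
qed

end

theorem theorem4p3:
  fixes T \<mu> \<kappa> :: real
    and \<Phi> f h :: "real \<Rightarrow> real"
    and g :: "real \<times> real \<Rightarrow> real"
    and PN :: "(real \<times> real) set measure"
    and PC :: "'c measure"
    and H :: "real \<Rightarrow> (real \<times> real) set \<Rightarrow> nat"
    and \<Lambda> :: "real \<Rightarrow> (real \<times> real) set \<Rightarrow> real"
    and Hs :: "real list \<Rightarrow> real \<Rightarrow> (real \<times> real) set \<Rightarrow> nat"
    and \<Lambda>s :: "real list \<Rightarrow> real \<Rightarrow> (real \<times> real) set \<Rightarrow> real"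
    and \<eta> \<theta> \<eta>' \<theta>' :: "nat \<Rightarrow> 'c \<Rightarrow> real"
  assumes "T > 0" and "\<mu> > 0" and "\<kappa> \<ge> 0"
    and "bounded_nonneg_measurable {0..T} \<Phi>"
    and "(LBINT s=0..T. \<Phi> s) < 1"
    and "canonical_poisson_space T PN"
    and "hawkes_process T \<mu> \<Phi> PN H \<Lambda>"
    and "\<And>vs. shift_times T vs \<Longrightarrow>
           shifted_hawkes_process T \<mu> \<Phi> PN H \<Lambda> vs (Hs vs) (\<Lambda>s vs)"
    and "prob_space PC"
    and "iid_claims PC \<eta> \<theta> \<eta>' \<theta>'"
    and "bounded_nonneg_measurable {0..} f"
    and "bounded_nonneg_measurable ({0..} \<times> {0..}) g"
    and "bounded_nonneg_measurable {0..} h"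
    and "m_simplex T \<Phi> \<longlonglongrightarrow> 0"
  shows
    "let M = joint_space PN PC;
         G = vimage_algebra (space M) (\<lambda>(\<omega>, c). \<eta>' 1 c) borel;
         E = (\<lambda>vs. \<integral>z. g (\<eta>' 1 (snd z), \<theta>' 1 (snd z)) *
                real_cond_exp M G (\<lambda>z. h (shifted_loss T \<kappa> f \<eta> \<eta>' vs (Hs vs) z)) z \<partial>M);
         J = (\<lambda>n. iterated_integral n T (\<lambda>vs.
                exp (- \<kappa> * (T - vs ! 0)) * kernel_product \<Phi> vs * E vs));
         X = (\<lambda>z. loss_K T \<kappa> g H \<eta> \<theta> T z * h (loss_L T \<kappa> f H \<eta> T z))
     in integrable M X \<and> summable (\<lambda>n. J (n + 2)) \<and>
        (\<integral>z. X z \<partial>M) =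
          \<mu> * (LBINT v=0..T. exp (- \<kappa> * (T - v)) * E [v]) + \<mu> * (\<Sum>n. J (n + 2))"
proof -
  interpret L: loss_model T \<mu> \<kappa> \<Phi> f h g PN PC H \<Lambda> Hs \<Lambda>s \<eta> \<theta> \<eta>' \<theta>'
    by (rule loss_model.intro) (use assms in blast)+
  show ?thesis
    unfolding Let_def
    using L.expectation_loss(1) L.loss_expansion
    unfolding L.series_term_def L.cond_expectation_def
    by blast
qed

end
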